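(* Let $G$ be a finitely presented group and let $G'\leq N\leq G$ be a subgroup of co-rank $2$. Then there is a finitely presented normal $N$-fibre product in $G\times G$ if and only if $G=\langle t\rangle\ltimes K$ where $\langle t\rangle$ is infinite cyclic, $K$ is a finitely generated normal subgroup of $G$ and $N\leq K$.
   Context: $G'$ denotes the commutator subgroup of $G$. A subgroup $N$ with $G'\leq N\leq G$ has co-rank equal to the torsion-free rank of the finitely generated abelian group $G/N$. An $N$-fibre product in $G\times G$ is a subgroup of the form $H_\mu=\{(g_1,g_2)\in G\times G\mid \mu(g_1N)=g_2N\}$ where $\mu:G/N\to G/N$ is an automorphism; it is normal in $G\times G$ because $G'\leq N$. *)

theory Defs
  imports "HOL-Algebra.Algebra" "HOL-Library.Extended_Nat"
begin

text \<open>
  A letter \<open>(x, True)\<close> stands for the generator \<open>x\<close> and \<open>(x, False)\<close> for its formal inverse.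
  The free group on \<open>B\<close> is realised on the reduced words over \<open>B\<close>.
\<close>

type_synonym 'x letter = "'x \<times> bool"

definition inv_letter :: "'x letter \<Rightarrow> 'x letter" where
  "inv_letter a = (fst a, \<not> snd a)"

fun reduced :: "'x letter list \<Rightarrow> bool" where
  "reduced (a # b # w) \<longleftrightarrow> b \<noteq> inv_letter a \<and> reduced (b # w)"
| "reduced _ \<longleftrightarrow> True"

fun push_letter :: "'x letter \<Rightarrow> 'x letter list \<Rightarrow> 'x letter list" where
  "push_letter a [] = [a]"
| "push_letter a (b # w) = (if b = inv_letter a then w else a # b # w)"

definition free_group :: "'x set \<Rightarrow> 'x letter list monoid" where
  "free_group B =
    \<lparr>carrier = {w. w \<in> lists (B \<times> UNIV) \<and> reduced w},
     monoid.mult = (\<lambda>u v. foldr push_letter u v),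
     one = []\<rparr>"

definition normal_closure :: "('a, 'b) monoid_scheme \<Rightarrow> 'a set \<Rightarrow> 'a set" where
  "normal_closure G R = \<Inter> {M. M \<lhd> G \<and> R \<subseteq> M}"

definition finitely_presented :: "('a, 'b) monoid_scheme \<Rightarrow> bool" where
  "finitely_presented G \<longleftrightarrow> group G \<and>
    (\<exists>(n::nat) R. finite R \<and> R \<subseteq> carrier (free_group {..<n}) \<and>
       G \<cong> free_group {..<n} Mod normal_closure (free_group {..<n}) R)"

definition finitely_generated :: "('a, 'b) monoid_scheme \<Rightarrow> bool" where
  "finitely_generated G \<longleftrightarrow> group G \<and>
    (\<exists>S. finite S \<and> S \<subseteq> carrier G \<and> generate G S = carrier G)"

definition int_independent :: "('a, 'b) monoid_scheme \<Rightarrow> 'a set \<Rightarrow> bool" where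
  "int_independent A S \<longleftrightarrow> S \<subseteq> carrier A \<and> finite S \<and>
    (\<forall>k :: 'a \<Rightarrow> int. (\<Otimes>\<^bsub>A\<^esub>x\<in>S. x [^]\<^bsub>A\<^esub> k x) = \<one>\<^bsub>A\<^esub> \<longrightarrow> (\<forall>x\<in>S. k x = 0))"

text \<open>
  The torsion-free rank of an abelian group (written multiplicatively) is the largest number of
  elements that are linearly independent over the integers.
\<close>

definition torsion_free_rank :: "('a, 'b) monoid_scheme \<Rightarrow> enat" where
  "torsion_free_rank A = (SUP S \<in> {S. int_independent A S}. enat (card S))"

definition co_rank :: "('a, 'b) monoid_scheme \<Rightarrow> 'a set \<Rightarrow> enat" where
  "co_rank G N = torsion_free_rank (G Mod N)"

text \<open>
  \<open>N\<close> contains the commutator subgroup, hence is normal, so the right cosets used by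
  \<open>G Mod N\<close> are the left cosets as well.
\<close>

definition fibre_product ::
    "('a, 'b) monoid_scheme \<Rightarrow> 'a set \<Rightarrow> ('a set \<Rightarrow> 'a set) \<Rightarrow> ('a \<times> 'a) set" where
  "fibre_product G N \<mu> =
    {(g1, g2) \<in> carrier G \<times> carrier G. \<mu> (N #>\<^bsub>G\<^esub> g1) = N #>\<^bsub>G\<^esub> g2}"

definition is_fibre_product ::
    "('a, 'b) monoid_scheme \<Rightarrow> 'a set \<Rightarrow> ('a \<times> 'a) set \<Rightarrow> bool" where
  "is_fibre_product G N H \<longleftrightarrow> (\<exists>\<mu> \<in> iso (G Mod N) (G Mod N). H = fibre_product G N \<mu>)"

definition internal_semidirect :: "('a, 'b) monoid_scheme \<Rightarrow> 'a set \<Rightarrow> 'a set \<Rightarrow> bool" where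
  "internal_semidirect G Q K \<longleftrightarrow>
    subgroup Q G \<and> K \<lhd> G \<and> Q \<inter> K = {\<one>\<^bsub>G\<^esub>} \<and> Q <#>\<^bsub>G\<^esub> K = carrier G"

end

theory Submission
  imports Defs
begin

text \<open>
  A character \<open>\<chi>\<close> of \<open>G\<close> vanishing on \<open>N\<close> lies in the Bieri--Neumann--Strebel invariant if \<open>N\<close> is
  contained in one component of the half-space \<open>\<chi> \<ge> 0\<close> of a Cayley graph of \<open>G\<close>. This is an open
  condition, and an integral character has finitely generated kernel if \<open>\<chi>\<close> and \<open>- \<chi>\<close> satisfy it.
  In a finitely presented fibre product \<open>H\<close> the commuting subgroups \<open>N \<times> 1\<close> and \<open>1 \<times> N\<close> cannot both
  be disconnected, on the side \<open>\<chi> \<ge> 0\<close> and on the side \<open>\<chi> \<le> 0\<close>; hence for every \<open>\<chi>\<close> one of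
  \<open>\<chi>\<close> and \<open>- \<chi> \<circ> \<mu>\<inverse>\<close> lies in the invariant. As co-rank 2 makes the sphere of characters a circle,
  which is connected, there is \<open>\<chi>\<close> such that \<open>\<chi>\<close> and \<open>- \<chi>\<close> both lie in it, and by
  openness \<open>\<chi>\<close> can be taken integral.

  Conversely, let \<open>G = \<langle>t\<rangle> \<ltimes> K\<close> and let \<open>s \<in> K\<close> generate \<open>K\<close> modulo a subgroup \<open>L\<close> that contains \<open>N\<close>
  with finite index. For large \<open>m\<close> the automorphism of \<open>G / L\<close> that fixes \<open>s\<close> and maps \<open>t\<close> to
  \<open>t s\<^sup>m\<close> has a finitely presented fibre product: the only infinite set of relations is that
  the \<open>s\<close>-conjugates of generators of \<open>L \<times> 1\<close> and \<open>1 \<times> L\<close> commute, and conjugation by \<open>(t, t s\<^sup>m)\<close>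
  shifts the second family by \<open>m\<close> steps relative to the first while spreading each by a bounded
  amount, so those at large distance follow by induction from finitely many. The corresponding
  \<open>N\<close>-fibre product has finite index in this one.
\<close>

section \<open>Words and presentations\<close>

text \<open>Finite presentability of a given group is exploited mainly in one form: a word that is
  trivial in the group acts trivially on every set on which the relators act trivially. In the
  forward direction the action is built from a cocycle that counts crossings between components;
  that there are only finitely many relators gives one constant by which two half-spaces must
  overlap for every relator loop to fit into one of them.

  In the converse direction the difficulty is that a group \<open>P\<close> satisfying the finitely
  many relations contains no evident image of \<open>G\<close>: conjugation by \<open>\<tau>\<close>
  changes \<open>\<sigma>\<close> by elements of both families. Once the families are known to
  commute at all distances, the part belonging to the other family centralises the subgroup
  \<open>M\<close> generated by the conjugates of one family and can be discarded. This makes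
  \<open>G\<close> act on pairs of an element of \<open>M\<close> and an exponent of
  \<open>\<sigma>\<close>, and following the base point yields a homomorphism from \<open>L\<close>
  to \<open>M\<close>, although \<open>L\<close> itself need not be finitely generated.\<close>

definition letter_val :: "('a, 'b) monoid_scheme \<Rightarrow> ('x \<Rightarrow> 'a) \<Rightarrow> 'x letter \<Rightarrow> 'a" where
  "letter_val G g l = (if snd l then g (fst l) else inv\<^bsub>G\<^esub> g (fst l))"

fun eval_word :: "('a, 'b) monoid_scheme \<Rightarrow> ('x \<Rightarrow> 'a) \<Rightarrow> 'x letter list \<Rightarrow> 'a" where
  "eval_word G g [] = \<one>\<^bsub>G\<^esub>"
| "eval_word G g (l # w) = letter_val G g l \<otimes>\<^bsub>G\<^esub> eval_word G g w"

definition words :: "'x set \<Rightarrow> 'x letter list set" where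
  "words B = lists (B \<times> UNIV)"

lemma words_Nil [simp]: "[] \<in> words B"
  by (simp add: words_def)

lemma words_Cons [simp]: "l # w \<in> words B \<longleftrightarrow> fst l \<in> B \<and> w \<in> words B"
  by (cases l) (auto simp: words_def)

lemma words_append [simp]: "u @ v \<in> words B \<longleftrightarrow> u \<in> words B \<and> v \<in> words B"
  by (auto simp: words_def)

definition inv_word :: "'x letter list \<Rightarrow> 'x letter list" where
  "inv_word w = rev (map inv_letter w)"

definition reduce_word :: "'x letter list \<Rightarrow> 'x letter list" where
  "reduce_word w = foldr push_letter w []"

section \<open>Free groups on reduced words\<close>

lemma inv_letter_inv_letter [simp]: "inv_letter (inv_letter a) = a"
  by (simp add: inv_letter_def)

lemma inv_letter_simps [simp]:
  "fst (inv_letter a) = fst a" "snd (inv_letter a) \<longleftrightarrow> \<not> snd a"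
  by (simp_all add: inv_letter_def)

lemma inv_letter_neq [simp]: "a \<noteq> inv_letter a"
  by (auto simp: inv_letter_def prod_eq_iff)

lemma reduced_Cons: "reduced (a # w) \<longleftrightarrow> reduced w \<and> (w = [] \<or> hd w \<noteq> inv_letter a)"
  by (cases w) auto

lemma reduced_push_letter: "reduced w \<Longrightarrow> reduced (push_letter a w)"
  by (cases w) (auto simp: reduced_Cons)

lemma push_letter_cancel: "reduced w \<Longrightarrow> push_letter a (push_letter (inv_letter a) w) = w"
proof (cases w)
  case (Cons b w')
  assume "reduced w"
  then show ?thesis using Cons by (cases w') auto
qed simp

lemma push_letter_in_words: "fst a \<in> B \<Longrightarrow> w \<in> words B \<Longrightarrow> push_letter a w \<in> words B"
  by (cases w) auto

lemma push_letter_reduced: "reduced (a # w) \<Longrightarrow> push_letter a w = a # w"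
  by (cases w) (auto simp del: reduced.simps simp: reduced_Cons)

lemma reduced_foldr_push: "reduced v \<Longrightarrow> reduced (foldr push_letter u v)"
  by (induction u) (auto intro: reduced_push_letter)

lemma foldr_push_in_words:
  "u \<in> words B \<Longrightarrow> v \<in> words B \<Longrightarrow> foldr push_letter u v \<in> words B"
proof (induction u)
  case (Cons a u)
  then show ?case using push_letter_in_words[of a B "foldr push_letter u v"] by simp
qed simp

text \<open>Associativity of the product comes down to pushing a single letter. The only case of
  substance is cancellation at the head of the left word, and it needs the right word to be
  reduced.\<close>

lemma foldr_push_push:
  assumes "reduced w"
  shows "foldr push_letter (push_letter a u) w = push_letter a (foldr push_letter u w)"
proof (cases u)
  case (Cons b u')
  then show ?thesis
    using assms push_letter_cancel[OF reduced_foldr_push[OF assms], of a u'] by auto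
qed simp

lemma foldr_push_assoc:
  assumes "reduced w"
  shows "foldr push_letter (foldr push_letter u v) w = foldr push_letter u (foldr push_letter v w)"
  by (induction u) (simp_all add: foldr_push_push assms)

lemma foldr_push_Nil: "reduced w \<Longrightarrow> foldr push_letter w [] = w"
  by (induction w) (auto simp: push_letter_reduced reduced_Cons)

lemma foldr_push_inv_word:
  "reduced v \<Longrightarrow> foldr push_letter (inv_word u) (foldr push_letter u v) = v"
proof (induction u arbitrary: v)
  case (Cons a u)
  have "push_letter (inv_letter a) (push_letter a (foldr push_letter u v)) = foldr push_letter u v"
    using push_letter_cancel[of "foldr push_letter u v" "inv_letter a"] reduced_foldr_push[OF Cons.prems]
    by simp
  then show ?case using Cons by (simp add: inv_word_def)
qed (simp add: inv_word_def)

lemma inv_word_in_words: "w \<in> words B \<Longrightarrow> inv_word w \<in> words B"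
  by (induction w) (auto simp: inv_word_def)

lemma free_group_carrier: "w \<in> carrier (free_group B) \<longleftrightarrow> w \<in> words B \<and> reduced w"
  by (simp add: free_group_def words_def)

lemma reduce_word_in: "w \<in> words B \<Longrightarrow> reduce_word w \<in> carrier (free_group B)"
  unfolding reduce_word_def free_group_carrier
  using foldr_push_in_words[of w B "[]"] reduced_foldr_push[of "[]" w] by simp

lemma free_group_mult [simp]: "u \<otimes>\<^bsub>free_group B\<^esub> v = foldr push_letter u v"
  by (simp add: free_group_def)

lemma free_group_one [simp]: "\<one>\<^bsub>free_group B\<^esub> = []"
  by (simp add: free_group_def)

lemma group_free_group: "group (free_group B)"
proof (rule groupI)
  fix u v w
  assume u: "u \<in> carrier (free_group B)" and v: "v \<in> carrier (free_group B)"
  show "u \<otimes>\<^bsub>free_group B\<^esub> v \<in> carrier (free_group B)"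
    using u v foldr_push_in_words[of u B v] reduced_foldr_push[of v u] by (simp add: free_group_carrier)
  assume w: "w \<in> carrier (free_group B)"
  show "u \<otimes>\<^bsub>free_group B\<^esub> v \<otimes>\<^bsub>free_group B\<^esub> w = u \<otimes>\<^bsub>free_group B\<^esub> (v \<otimes>\<^bsub>free_group B\<^esub> w)"
    using w by (simp add: free_group_carrier foldr_push_assoc)
next
  show "\<one>\<^bsub>free_group B\<^esub> \<in> carrier (free_group B)" by (simp add: free_group_carrier)
next
  fix u assume u: "u \<in> carrier (free_group B)"
  show "\<one>\<^bsub>free_group B\<^esub> \<otimes>\<^bsub>free_group B\<^esub> u = u" by (simp add: free_group_carrier)
  have "reduce_word (inv_word u) \<otimes>\<^bsub>free_group B\<^esub> u = \<one>\<^bsub>free_group B\<^esub>"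
    using u foldr_push_inv_word[of "[]" u] foldr_push_Nil[of u]
    by (simp add: free_group_carrier reduce_word_def foldr_push_assoc)
  moreover have "reduce_word (inv_word u) \<in> carrier (free_group B)"
    using u by (intro reduce_word_in inv_word_in_words) (simp add: free_group_carrier)
  ultimately show "\<exists>y\<in>carrier (free_group B). y \<otimes>\<^bsub>free_group B\<^esub> u = \<one>\<^bsub>free_group B\<^esub>"
    by blast
qed

section \<open>Evaluation of words in a group\<close>

context group
begin

lemma inv_mult_eq_one: "a \<in> carrier G \<Longrightarrow> b \<in> carrier G \<Longrightarrow> inv a \<otimes> b = \<one> \<Longrightarrow> b = a"
  using inv_comm inv_equality[of b "inv a"] by auto

lemma letter_val_closed [simp]: "(\<And>x. g x \<in> carrier G) \<Longrightarrow> letter_val G g l \<in> carrier G"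
  by (simp add: letter_val_def)

lemma eval_word_closed [simp]: "(\<And>x. g x \<in> carrier G) \<Longrightarrow> eval_word G g w \<in> carrier G"
  by (induction w) auto

lemma letter_val_inv:
  "(\<And>x. g x \<in> carrier G) \<Longrightarrow> letter_val G g (inv_letter l) = inv letter_val G g l"
  by (simp add: letter_val_def)

lemma eval_word_append:
  assumes g: "\<And>x. g x \<in> carrier G"
  shows "eval_word G g (u @ v) = eval_word G g u \<otimes> eval_word G g v"
  by (induction u) (simp_all add: g m_assoc)

lemma eval_word_inv_word:
  assumes g: "\<And>x. g x \<in> carrier G"
  shows "eval_word G g (inv_word w) = inv eval_word G g w"
  by (induction w) (simp_all add: inv_word_def eval_word_append g letter_val_inv inv_mult_group)

lemma eval_word_push_letter:
  assumes g: "\<And>x. g x \<in> carrier G"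
  shows "eval_word G g (push_letter a w) = letter_val G g a \<otimes> eval_word G g w"
proof (cases w)
  case (Cons b w')
  then show ?thesis
    by (auto simp: letter_val_inv g m_assoc[symmetric])
qed simp

lemma eval_word_foldr_push:
  assumes g: "\<And>x. g x \<in> carrier G"
  shows "eval_word G g (foldr push_letter u v) = eval_word G g u \<otimes> eval_word G g v"
  by (induction u) (simp_all add: eval_word_push_letter g m_assoc)

lemma eval_word_reduce_word:
  assumes g: "\<And>x. g x \<in> carrier G"
  shows "eval_word G g (reduce_word w) = eval_word G g w"
  by (simp add: reduce_word_def eval_word_foldr_push g)

lemma eval_word_hom:
  assumes g: "\<And>x. g x \<in> carrier G"
  shows "eval_word G g \<in> hom (free_group B) G"
  by (auto simp: hom_def eval_word_foldr_push g)

lemma eval_word_in_subgroup: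
  assumes "subgroup H G" "\<And>x. x \<in> B \<Longrightarrow> g x \<in> H" "w \<in> words B"
  shows "eval_word G g w \<in> H"
  using assms(3)
proof (induction w)
  case (Cons l w)
  then show ?case using assms(1,2)
    by (auto simp: letter_val_def subgroup.m_closed subgroup.m_inv_closed)
qed (simp add: subgroup.one_closed[OF assms(1)])

lemma generate_eval_word:
  assumes g: "\<And>x. g x \<in> carrier G" and a: "a \<in> generate G (g ` B)"
  shows "\<exists>w\<in>carrier (free_group B). eval_word G g w = a"
proof -
  have "\<exists>w\<in>words B. eval_word G g w = a"
    using a
  proof (induction rule: generate.induct)
    case one
    then show ?case by (intro bexI[of _ "[]"]) auto
  next
    case (incl h)
    then obtain x where "x \<in> B" "h = g x" by auto
    then show ?case by (intro bexI[of _ "[(x, True)]"]) (auto simp: letter_val_def g)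
  next
    case (inv h)
    then obtain x where "x \<in> B" "h = g x" by auto
    then show ?case by (intro bexI[of _ "[(x, False)]"]) (auto simp: letter_val_def g)
  next
    case (eng h1 h2)
    then obtain u v where "u \<in> words B" "eval_word G g u = h1" "v \<in> words B" "eval_word G g v = h2"
      by auto
    then show ?case by (intro bexI[of _ "u @ v"]) (auto simp: eval_word_append g)
  qed
  then obtain w where "w \<in> words B" "eval_word G g w = a" by auto
  then show ?thesis
    using reduce_word_in[of w B] eval_word_reduce_word[of g w] g
    by (intro bexI[of _ "reduce_word w"]) auto
qed

lemma normal_closure_normal:
  assumes "R \<subseteq> carrier G"
  shows "normal_closure G R \<lhd> G"
proof -
  let ?A = "{M. M \<lhd> G \<and> R \<subseteq> M}"
  have ne: "carrier G \<in> ?A"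
    using assms normal_inv_iff subgroup_self by auto
  have sub: "subgroup (\<Inter>?A) G"
    using ne by (intro subgroups_Inter) (auto dest: normal_imp_subgroup)
  show ?thesis
    unfolding normal_closure_def
  proof (rule normal_invI[OF sub])
    fix x h assume "x \<in> carrier G" "h \<in> \<Inter>?A"
    then show "x \<otimes> h \<otimes> inv x \<in> \<Inter>?A"
      by (auto intro: normal.inv_op_closed2)
  qed
qed

end

lemma subset_normal_closure: "R \<subseteq> normal_closure G R"
  by (auto simp: normal_closure_def)

lemma normal_closure_subset: "M \<lhd> G \<Longrightarrow> R \<subseteq> M \<Longrightarrow> normal_closure G R \<subseteq> M"
  by (auto simp: normal_closure_def)

section \<open>Substitution in words, and finite presentations\<close>

lemma eval_word_map:
  "eval_word G g (map (\<lambda>l. (f (fst l), snd l)) w) = eval_word G (g \<circ> f) w"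
  by (induction w) (auto simp: letter_val_def)

definition subst_letter :: "('x \<Rightarrow> 'y letter list) \<Rightarrow> 'x letter \<Rightarrow> 'y letter list" where
  "subst_letter f l = (if snd l then f (fst l) else inv_word (f (fst l)))"

definition subst_word :: "('x \<Rightarrow> 'y letter list) \<Rightarrow> 'x letter list \<Rightarrow> 'y letter list" where
  "subst_word f w = concat (map (subst_letter f) w)"

lemma (in group) eval_subst_word:
  assumes g: "\<And>x. g x \<in> carrier G"
  shows "eval_word G g (subst_word f w) = eval_word G (\<lambda>x. eval_word G g (f x)) w"
  by (induction w)
     (simp_all add: subst_word_def subst_letter_def letter_val_def eval_word_append
       eval_word_inv_word g)

lemma subst_word_in_words:
  assumes "\<And>x. x \<in> B \<Longrightarrow> f x \<in> words Y" "w \<in> words B"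
  shows "subst_word f w \<in> words Y"
  using assms(2)
proof (induction w)
  case (Cons l w)
  then show ?case using assms(1) inv_word_in_words
    by (auto simp: subst_word_def subst_letter_def)
qed (simp add: subst_word_def)

lemma (in group_hom) eval_word_hom_image:
  assumes "\<And>x. g x \<in> carrier G"
  shows "h (eval_word G g w) = eval_word H (h \<circ> g) w"
  by (induction w) (simp_all add: assms letter_val_def)

lemma eval_word_cong:
  assumes "\<And>x. x \<in> B \<Longrightarrow> g x = g' x" "w \<in> words B"
  shows "eval_word G g w = eval_word G g' w"
  using assms(2) by (induction w) (auto simp: letter_val_def assms(1))

text \<open>A presentation with named generators and relators. The map \<open>g\<close> takes values
  in the group on the whole type, so that words can be evaluated without side conditions. The last
  conjunct says that the relators suffice: the kernel of evaluation is no larger than their normal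
  closure.\<close>

definition presents ::
    "('a, 'b) monoid_scheme \<Rightarrow> 'x set \<Rightarrow> ('x \<Rightarrow> 'a) \<Rightarrow> 'x letter list set \<Rightarrow> bool" where
  "presents G B g R \<longleftrightarrow> group G \<and> finite B \<and> (\<forall>x. g x \<in> carrier G) \<and>
     generate G (g ` B) = carrier G \<and> finite R \<and> R \<subseteq> carrier (free_group B) \<and>
     (\<forall>r\<in>R. eval_word G g r = \<one>\<^bsub>G\<^esub>) \<and>
     (\<forall>w\<in>carrier (free_group B). eval_word G g w = \<one>\<^bsub>G\<^esub> \<longrightarrow> w \<in> normal_closure (free_group B) R)"

text \<open>Von Dyck: the kernel of evaluation in \<open>P\<close> is normal and contains the
  relators, hence contains their normal closure.\<close>

lemma presents_imp_trivial:
  assumes pres: "presents G B g R" and P: "group P" and p: "\<And>x. p x \<in> carrier P"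
    and R: "\<And>r. r \<in> R \<Longrightarrow> eval_word P p r = \<one>\<^bsub>P\<^esub>"
    and w: "w \<in> words B" "eval_word G g w = \<one>\<^bsub>G\<^esub>"
  shows "eval_word P p w = \<one>\<^bsub>P\<^esub>"
proof -
  interpret G: group G using pres by (simp add: presents_def)
  interpret P: group P by fact
  interpret F: group "free_group B" by (rule group_free_group)
  interpret h: group_hom "free_group B" P "eval_word P p"
    using P.eval_word_hom[OF p] by unfold_locales auto
  let ?v = "reduce_word w"
  have g: "\<And>x. g x \<in> carrier G" and RX: "R \<subseteq> carrier (free_group B)"
    using pres by (auto simp: presents_def)
  have v: "?v \<in> carrier (free_group B)" using w reduce_word_in by auto
  have "eval_word G g ?v = \<one>\<^bsub>G\<^esub>" using w g G.eval_word_reduce_word[of g] by simp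
  then have "?v \<in> normal_closure (free_group B) R" using pres v by (simp add: presents_def)
  also have "\<dots> \<subseteq> kernel (free_group B) P (eval_word P p)"
    using h.normal_kernel R RX by (intro normal_closure_subset) (auto simp: kernel_def)
  finally show ?thesis using p P.eval_word_reduce_word[of p] by (simp add: kernel_def)
qed

text \<open>Send an element to the value in \<open>P\<close> of any word for it. Two words for the
  same element differ by a trivial word, to which \<open>presents_imp_trivial\<close>
  applies.\<close>

lemma presents_hom:
  assumes pres: "presents G B g R" and P: "group P" and p: "\<And>x. p x \<in> carrier P"
    and R: "\<And>r. r \<in> R \<Longrightarrow> eval_word P p r = \<one>\<^bsub>P\<^esub>"
  shows "\<exists>\<theta>\<in>hom G P. \<forall>x\<in>B. \<theta> (g x) = p x"
proof -
  interpret G: group G using pres by (simp add: presents_def)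
  interpret P: group P by fact
  have g: "\<And>x. g x \<in> carrier G" and gen: "generate G (g ` B) = carrier G"
    using pres by (auto simp: presents_def)
  define wd where "wd a = (SOME w. w \<in> words B \<and> eval_word G g w = a)" for a
  have wd: "wd a \<in> words B \<and> eval_word G g (wd a) = a" if "a \<in> carrier G" for a
    unfolding wd_def
  proof (rule someI_ex)
    show "\<exists>w. w \<in> words B \<and> eval_word G g w = a"
      using G.generate_eval_word[of g a B] g that gen by (auto simp: free_group_carrier)
  qed
  have wd_eq: "eval_word P p (wd a) = eval_word P p u"
    if "u \<in> words B" "eval_word G g u = a" for u a
  proof -
    have a: "a \<in> carrier G" using that g G.eval_word_closed by blast
    have "eval_word P p (inv_word u @ wd a) = \<one>\<^bsub>P\<^esub>"
    proof (rule presents_imp_trivial[OF pres P p R])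
      show "inv_word u @ wd a \<in> words B" using that wd[OF a] inv_word_in_words by auto
      show "eval_word G g (inv_word u @ wd a) = \<one>\<^bsub>G\<^esub>"
        using that wd[OF a] a by (simp add: G.eval_word_append g G.eval_word_inv_word)
    qed
    then have "inv\<^bsub>P\<^esub> eval_word P p u \<otimes>\<^bsub>P\<^esub> eval_word P p (wd a) = \<one>\<^bsub>P\<^esub>"
      by (simp add: P.eval_word_append p P.eval_word_inv_word)
    then show ?thesis by (rule P.inv_mult_eq_one[rotated 2]) (simp_all add: p)
  qed
  have "(\<lambda>a. eval_word P p (wd a)) \<in> hom G P"
  proof (rule homI)
    fix a b assume a: "a \<in> carrier G" and b: "b \<in> carrier G"
    have "eval_word P p (wd (a \<otimes>\<^bsub>G\<^esub> b)) = eval_word P p (wd a @ wd b)"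
      using wd[OF a] wd[OF b] by (intro wd_eq) (auto simp: G.eval_word_append g)
    then show "eval_word P p (wd (a \<otimes>\<^bsub>G\<^esub> b)) = eval_word P p (wd a) \<otimes>\<^bsub>P\<^esub> eval_word P p (wd b)"
      by (simp add: P.eval_word_append p)
  qed (simp add: p)
  moreover have "eval_word P p (wd (g x)) = p x" if "x \<in> B" for x
    using wd_eq[of "[(x, True)]" "g x"] that by (simp add: letter_val_def g p)
  ultimately show ?thesis by (intro bexI[of _ "\<lambda>a. eval_word P p (wd a)"]) auto
qed

text \<open>
  It suffices to check the universal property of a presentation on one group, the quotient of
  the free group; this is why the type of \<open>P\<close> is fixed here.
\<close>

lemma presentsI:
  fixes B :: "'x set"
  assumes H: "group H" and B: "finite B" and g: "\<And>x. g x \<in> carrier H"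
    and gen: "generate H (g ` B) = carrier H"
    and R: "finite R" "R \<subseteq> words B" "\<And>r. r \<in> R \<Longrightarrow> eval_word H g r = \<one>\<^bsub>H\<^esub>"
    and univ: "\<And>(P :: 'x letter list set monoid) p. group P \<Longrightarrow> (\<And>x. p x \<in> carrier P) \<Longrightarrow>
      (\<And>x. x \<notin> B \<Longrightarrow> p x = \<one>\<^bsub>P\<^esub>) \<Longrightarrow> (\<And>r. r \<in> R \<Longrightarrow> eval_word P p r = \<one>\<^bsub>P\<^esub>) \<Longrightarrow>
      (\<exists>\<theta>. \<theta> \<one>\<^bsub>H\<^esub> = \<one>\<^bsub>P\<^esub> \<and> (\<forall>x\<in>B. \<forall>h\<in>carrier H. \<theta> (g x \<otimes>\<^bsub>H\<^esub> h) = p x \<otimes>\<^bsub>P\<^esub> \<theta> h) \<and>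
          (\<forall>h\<in>carrier H. \<theta> h \<in> carrier P))"
  shows "presents H B g (reduce_word ` R)"
proof -
  interpret H: group H by fact
  interpret F: group "free_group B" by (rule group_free_group)
  let ?F = "free_group B" and ?R = "reduce_word ` R"
  let ?K = "normal_closure ?F ?R"
  let ?P = "?F Mod ?K"
  have RF: "?R \<subseteq> carrier ?F" using R(2) reduce_word_in by auto
  interpret N: normal ?K ?F by (rule F.normal_closure_normal[OF RF])
  interpret P: group ?P by (rule N.factorgroup_is_group)
  interpret q: group_hom ?F ?P "\<lambda>a. ?K #>\<^bsub>?F\<^esub> a"
    using N.r_coset_hom_Mod by unfold_locales auto
  \<comment> \<open>The property is tested on the quotient of the free group by the relators.
    Outside \<open>B\<close> the value must be the unit, since \<open>univ\<close> speaks of such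
    maps only.\<close>
  define p where "p x = (if x \<in> B then ?K #>\<^bsub>?F\<^esub> [(x, True)] else \<one>\<^bsub>?P\<^esub>)" for x
  have sing: "[(x, b)] \<in> carrier ?F" if "x \<in> B" for x b
    using that by (auto simp: free_group_carrier)
  have p: "p x \<in> carrier ?P" for x
    using sing q.hom_closed P.one_closed by (auto simp: p_def simp del: one_FactGroup)
  have p1: "p x = \<one>\<^bsub>?P\<^esub>" if "x \<notin> B" for x using that by (simp add: p_def)
  have inv_sing: "inv\<^bsub>?F\<^esub> [(x, True)] = [(x, False)]" if "x \<in> B" for x
    using sing[OF that] by (intro F.inv_equality) (auto simp: inv_letter_def)
  have lv: "letter_val ?P p l = ?K #>\<^bsub>?F\<^esub> [l]" if "fst l \<in> B" for l
    using that sing inv_sing q.hom_inv[of "[(fst l, True)]"]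
    by (cases l; cases "snd l") (auto simp: letter_val_def p_def simp del: q.hom_inv)
  have ev: "eval_word ?P p w = ?K #>\<^bsub>?F\<^esub> reduce_word w" if "w \<in> words B" for w
    using that
  proof (induction w)
    case Nil
    have "?K #>\<^bsub>?F\<^esub> \<one>\<^bsub>?F\<^esub> = \<one>\<^bsub>?P\<^esub>" by (rule q.hom_one)
    then show ?case by (simp add: reduce_word_def)
  next
    case (Cons l w)
    have "?K #>\<^bsub>?F\<^esub> ([l] \<otimes>\<^bsub>?F\<^esub> reduce_word w) =
        (?K #>\<^bsub>?F\<^esub> [l]) \<otimes>\<^bsub>?P\<^esub> (?K #>\<^bsub>?F\<^esub> reduce_word w)"
      using Cons sing[of "fst l" "snd l"] reduce_word_in[of w B] by (intro q.hom_mult) auto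
    then show ?case using Cons lv[of l] by (simp add: reduce_word_def)
  qed
  have Rp: "eval_word ?P p r = \<one>\<^bsub>?P\<^esub>" if "r \<in> R" for r
  proof -
    have "reduce_word r \<in> ?K" using that subset_normal_closure[of ?R ?F] by auto
    then have "?K #>\<^bsub>?F\<^esub> reduce_word r = ?K"
      using N.is_subgroup RF that by (intro F.coset_join2) auto
    then show ?thesis using ev that R(2) by (auto simp: FactGroup_def)
  qed
  obtain \<theta> where \<theta>: "\<theta> \<one>\<^bsub>H\<^esub> = \<one>\<^bsub>?P\<^esub>"
    "\<And>x h. x \<in> B \<Longrightarrow> h \<in> carrier H \<Longrightarrow> \<theta> (g x \<otimes>\<^bsub>H\<^esub> h) = p x \<otimes>\<^bsub>?P\<^esub> \<theta> h"
    "\<And>h. h \<in> carrier H \<Longrightarrow> \<theta> h \<in> carrier ?P"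
    using univ[of ?P p, OF P.group_axioms p p1 Rp] by blast
  \<comment> \<open>\<open>univ\<close> provides compatibility with left multiplication by
    generators, not a homomorphism. Along a word this is enough; for an inverse letter it is applied
    to \<open>inv (g x)\<close> times the rest, and \<open>p x\<close> is then cancelled.\<close>
  have \<theta>_eval: "\<theta> (eval_word H g w) = eval_word ?P p w" if "w \<in> words B" for w
    using that
  proof (induction w)
    case (Cons l w)
    obtain x b where l: "l = (x, b)" by (cases l)
    have x: "x \<in> B" using Cons l by auto
    let ?e = "eval_word H g w"
    have e: "?e \<in> carrier H" using g by simp
    have IH: "\<theta> ?e = eval_word ?P p w" using Cons by auto
    show ?case
    proof (cases b)
      case True
      then show ?thesis using \<theta>(2)[OF x e] IH l by (simp add: letter_val_def)
    next
      case False
      have "\<theta> ?e = p x \<otimes>\<^bsub>?P\<^esub> \<theta> (inv\<^bsub>H\<^esub> g x \<otimes>\<^bsub>H\<^esub> ?e)"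
        using \<theta>(2)[OF x, of "inv\<^bsub>H\<^esub> g x \<otimes>\<^bsub>H\<^esub> ?e"] g e by (simp add: H.m_assoc[symmetric])
      then have "inv\<^bsub>?P\<^esub> p x \<otimes>\<^bsub>?P\<^esub> \<theta> ?e = \<theta> (inv\<^bsub>H\<^esub> g x \<otimes>\<^bsub>H\<^esub> ?e)"
        using \<theta>(3)[of "inv\<^bsub>H\<^esub> g x \<otimes>\<^bsub>H\<^esub> ?e"] p g e
        by (simp add: P.m_assoc[symmetric] del: mult_FactGroup one_FactGroup)
      then show ?thesis using False IH l by (simp add: letter_val_def)
    qed
  qed (simp add: \<theta>(1))
  \<comment> \<open>As \<open>w\<close> is reduced, its value in the quotient is its own coset, and
    \<open>\<theta>\<close> shows that this coset is trivial.\<close>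
  have "w \<in> ?K" if w: "w \<in> carrier ?F" "eval_word H g w = \<one>\<^bsub>H\<^esub>" for w
  proof -
    have "?K #>\<^bsub>?F\<^esub> w = \<one>\<^bsub>?P\<^esub>"
      using \<theta>_eval[of w] w ev[of w] \<theta>(1) foldr_push_Nil[of w]
      by (simp add: free_group_carrier reduce_word_def)
    then show ?thesis
      using F.rcos_self[OF w(1) N.is_subgroup] by (simp add: FactGroup_def)
  qed
  then show ?thesis
    using H B g gen R RF by (auto simp: presents_def H.eval_word_reduce_word)
qed

text \<open>A Tietze transformation. With \<open>u x\<close> a word in the new generators for an old
  one and \<open>v y\<close> a word in the old generators for a new one, the old relators are
  rewritten through \<open>u\<close>, and each new generator is equated with \<open>v y\<close>
  rewritten through \<open>u\<close>.\<close>

lemma presents_change_generators: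
  fixes Y :: "'y set"
  assumes pres: "presents G B g R" and Y: "finite Y" and h: "\<And>y. h y \<in> carrier G"
    and gen: "generate G (h ` Y) = carrier G"
  shows "\<exists>R'. presents G Y h R'"
proof -
  interpret G: group G using pres by (simp add: presents_def)
  have g: "\<And>x. g x \<in> carrier G" and genX: "generate G (g ` B) = carrier G"
    and RX: "R \<subseteq> words B" "\<And>r. r \<in> R \<Longrightarrow> eval_word G g r = \<one>\<^bsub>G\<^esub>" "finite R"
    using pres by (auto simp: presents_def free_group_carrier)
  have "\<exists>u. u \<in> words Y \<and> eval_word G h u = g x" for x
    using G.generate_eval_word[of h "g x" Y] h gen g by (auto simp: free_group_carrier)
  then obtain u where u: "\<And>x. u x \<in> words Y" "\<And>x. eval_word G h (u x) = g x" by metis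
  have "\<exists>v. v \<in> words B \<and> eval_word G g v = h y" for y
    using G.generate_eval_word[of g "h y" B] g genX h by (auto simp: free_group_carrier)
  then obtain v where v: "\<And>y. v y \<in> words B" "\<And>y. eval_word G g (v y) = h y" by metis
  let ?R = "subst_word u ` R \<union> (\<lambda>y. (y, False) # subst_word u (v y)) ` Y"
  have "presents G Y h (reduce_word ` ?R)"
  proof (rule presentsI[OF G.group_axioms Y h gen])
    show "finite ?R" using RX Y by auto
    show "?R \<subseteq> words Y"
      using u v RX subst_word_in_words[of B u] by auto
    fix r assume "r \<in> ?R"
    then show "eval_word G h r = \<one>\<^bsub>G\<^esub>"
      using RX by (auto simp: G.eval_subst_word h u v letter_val_def)
  next
    fix P :: "'y letter list set monoid" and p
    assume P: "group P" and p: "\<And>x. p x \<in> carrier P"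
      and rel: "\<And>r. r \<in> ?R \<Longrightarrow> eval_word P p r = \<one>\<^bsub>P\<^esub>"
    interpret P: group P by fact
    let ?p = "\<lambda>x. eval_word P p (u x)"
    have "\<exists>\<theta>\<in>hom G P. \<forall>x\<in>B. \<theta> (g x) = ?p x"
    proof (rule presents_hom[OF pres P])
      show "?p x \<in> carrier P" for x using p by simp
      show "eval_word P ?p r = \<one>\<^bsub>P\<^esub>" if "r \<in> R" for r
        using rel[of "subst_word u r"] that by (simp add: P.eval_subst_word p)
    qed
    then obtain \<theta> where \<theta>: "\<theta> \<in> hom G P" "\<And>x. x \<in> B \<Longrightarrow> \<theta> (g x) = ?p x" by auto
    interpret \<theta>: group_hom G P \<theta> using \<theta> by unfold_locales auto
    have "\<theta> (h y) = p y" if "y \<in> Y" for y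
    proof -
      have "\<theta> (h y) = eval_word P (\<theta> \<circ> g) (v y)"
        using \<theta>.eval_word_hom_image[of g "v y"] g v by simp
      also have "\<dots> = eval_word P ?p (v y)"
        using \<theta>(2) v by (intro eval_word_cong[of B]) auto
      finally have 1: "\<theta> (h y) = eval_word P p (subst_word u (v y))"
        by (simp add: P.eval_subst_word p)
      have "inv\<^bsub>P\<^esub> p y \<otimes>\<^bsub>P\<^esub> eval_word P p (subst_word u (v y)) = \<one>\<^bsub>P\<^esub>"
        using rel[of "(y, False) # subst_word u (v y)"] that by (simp add: letter_val_def)
      then show ?thesis unfolding 1 by (rule P.inv_mult_eq_one[rotated 2]) (simp_all add: p)
    qed
    then show "\<exists>\<theta>. \<theta> \<one>\<^bsub>G\<^esub> = \<one>\<^bsub>P\<^esub> \<and>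
         (\<forall>x\<in>Y. \<forall>a\<in>carrier G. \<theta> (h x \<otimes>\<^bsub>G\<^esub> a) = p x \<otimes>\<^bsub>P\<^esub> \<theta> a) \<and> (\<forall>h\<in>carrier G. \<theta> h \<in> carrier P)"
      using h by (intro exI[of _ \<theta>]) auto
  qed
  then show ?thesis by blast
qed

text \<open>\<open>finitely_presented\<close> asks for generators numbered by an initial segment of
  the naturals, so they are renumbered first. The isomorphism is then the one induced by
  evaluation.\<close>

lemma presents_imp_finitely_presented:
  assumes "presents G B g R"
  shows "finitely_presented G"
proof -
  interpret G: group G using assms by (simp add: presents_def)
  have g: "\<And>x. g x \<in> carrier G" and gen: "generate G (g ` B) = carrier G" and "finite B"
    using assms by (auto simp: presents_def)
  then obtain n and b :: "nat \<Rightarrow> _" where b: "bij_betw b {..<n} B"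
    by (metis bij_betw_from_nat_into_finite)
  let ?h = "\<lambda>i. g (b i)"
  have "?h ` {..<n} = g ` B" using b by (auto simp: bij_betw_def)
  then obtain R' where pres: "presents G {..<n} ?h R'"
    using presents_change_generators[OF assms, of "{..<n}" ?h] g gen by auto
  let ?F = "free_group {..<n}"
  interpret F: group ?F by (rule group_free_group)
  interpret e: group_hom ?F G "eval_word G ?h"
    using G.eval_word_hom[OF g] by unfold_locales auto
  have R': "finite R'" "R' \<subseteq> carrier ?F" using pres by (auto simp: presents_def)
  have "kernel ?F G (eval_word G ?h) = normal_closure ?F R'"
  proof
    show "kernel ?F G (eval_word G ?h) \<subseteq> normal_closure ?F R'"
      using pres by (auto simp: presents_def kernel_def)
    show "normal_closure ?F R' \<subseteq> kernel ?F G (eval_word G ?h)"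
      using pres e.normal_kernel by (intro normal_closure_subset) (auto simp: presents_def kernel_def)
  qed
  moreover have "eval_word G ?h ` carrier ?F = carrier G"
    using G.generate_eval_word[of ?h _ "{..<n}"] pres g by (auto simp: presents_def)
  ultimately have "?F Mod normal_closure ?F R' \<cong> G" using e.FactGroup_iso by simp
  then have "G \<cong> ?F Mod normal_closure ?F R'"
    using F.normal_closure_normal[OF R'(2)] group.iso_sym normal.factorgroup_is_group by blast
  then show ?thesis using R' G.group_axioms by (auto simp: finitely_presented_def)
qed

text \<open>The generators are the images of the one-letter words under the given isomorphism, with
  the unit as value outside the range.\<close>

lemma finitely_presented_imp_presents:
  assumes "finitely_presented G"
  shows "\<exists>(n::nat) g R. presents G {..<n} g R"
proof -
  interpret G: group G using assms by (simp add: finitely_presented_def)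
  obtain n :: nat and R where R: "finite R" "R \<subseteq> carrier (free_group {..<n})"
    and "G \<cong> free_group {..<n} Mod normal_closure (free_group {..<n}) R"
    using assms by (auto simp: finitely_presented_def)
  let ?F = "free_group {..<n}"
  let ?K = "normal_closure ?F R"
  let ?P = "?F Mod ?K"
  interpret F: group ?F by (rule group_free_group)
  interpret N: normal ?K ?F by (rule F.normal_closure_normal[OF R(2)])
  interpret P: group ?P by (rule N.factorgroup_is_group)
  have "?P \<cong> G" using \<open>G \<cong> ?P\<close> by (rule G.iso_sym)
  then obtain \<phi> where \<phi>: "\<phi> \<in> iso ?P G" by (auto simp: is_iso_def)
  interpret \<phi>: group_hom ?P G \<phi> using \<phi> by unfold_locales (auto simp: iso_def)
  interpret q: group_hom ?F ?P "\<lambda>a. ?K #>\<^bsub>?F\<^esub> a"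
    using N.r_coset_hom_Mod by unfold_locales auto
  define g where "g x = (if x < n then \<phi> (?K #>\<^bsub>?F\<^esub> [(x, True)]) else \<one>\<^bsub>G\<^esub>)" for x
  have sing: "[(x, b)] \<in> carrier ?F" if "x < n" for x b
    using that by (auto simp: free_group_carrier)
  have g: "g x \<in> carrier G" for x
    using sing by (auto simp: g_def)
  have inv_sing: "inv\<^bsub>?F\<^esub> [(x, True)] = [(x, False)]" if "x < n" for x
    using sing[OF that] by (intro F.inv_equality) (auto simp: inv_letter_def)
  have lv: "letter_val G g l = \<phi> (?K #>\<^bsub>?F\<^esub> [l])" if "fst l < n" for l
    using that sing inv_sing q.hom_inv[of "[(fst l, True)]"]
      \<phi>.hom_inv[of "?K #>\<^bsub>?F\<^esub> [(fst l, True)]"] q.hom_closed[of "[(fst l, True)]"]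
    by (cases l; cases "snd l") (auto simp: letter_val_def g_def simp del: q.hom_inv \<phi>.hom_inv)
  have ev: "eval_word G g w = \<phi> (?K #>\<^bsub>?F\<^esub> reduce_word w)" if "w \<in> words {..<n}" for w
    using that
  proof (induction w)
    case Nil
    have "?K #>\<^bsub>?F\<^esub> \<one>\<^bsub>?F\<^esub> = \<one>\<^bsub>?P\<^esub>" by (rule q.hom_one)
    then show ?case using \<phi>.hom_one by (simp add: reduce_word_def)
  next
    case (Cons l w)
    have c: "[l] \<in> carrier ?F" "reduce_word w \<in> carrier ?F"
      using Cons sing[of "fst l" "snd l"] reduce_word_in[of w "{..<n}"] by auto
    have "?K #>\<^bsub>?F\<^esub> ([l] \<otimes>\<^bsub>?F\<^esub> reduce_word w) =
        (?K #>\<^bsub>?F\<^esub> [l]) \<otimes>\<^bsub>?P\<^esub> (?K #>\<^bsub>?F\<^esub> reduce_word w)"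
      using c by (intro q.hom_mult)
    then show ?case using Cons lv[of l] \<phi>.hom_mult[OF q.hom_closed[OF c(1)] q.hom_closed[OF c(2)]]
      by (simp add: reduce_word_def)
  qed
  have ev': "eval_word G g w = \<phi> (?K #>\<^bsub>?F\<^esub> w)" if "w \<in> carrier ?F" for w
    using that ev[of w] foldr_push_Nil[of w] by (simp add: free_group_carrier reduce_word_def)
  have inj: "inj_on \<phi> (carrier ?P)" and surj: "\<phi> ` carrier ?P = carrier G"
    using \<phi> by (auto simp: iso_def bij_betw_def)
  have K_iff: "eval_word G g w = \<one>\<^bsub>G\<^esub> \<longleftrightarrow> w \<in> ?K" if w: "w \<in> carrier ?F" for w
  proof -
    have "eval_word G g w = \<one>\<^bsub>G\<^esub> \<longleftrightarrow> ?K #>\<^bsub>?F\<^esub> w = \<one>\<^bsub>?P\<^esub>"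
      using ev'[OF w] inj q.hom_closed[OF w] \<phi>.hom_one P.one_closed
      by (metis inj_onD)
    also have "\<dots> \<longleftrightarrow> ?K #>\<^bsub>?F\<^esub> w = ?K" by (simp add: FactGroup_def)
    also have "\<dots> \<longleftrightarrow> w \<in> ?K"
      using w N.is_subgroup F.rcos_self F.coset_join2[OF w] by auto
    finally show ?thesis .
  qed
  have "generate G (g ` {..<n}) = carrier G"
  proof
    show "generate G (g ` {..<n}) \<subseteq> carrier G"
      using g by (intro G.generate_incl) auto
    show "carrier G \<subseteq> generate G (g ` {..<n})"
    proof
      fix a assume "a \<in> carrier G"
      then obtain c where "c \<in> carrier ?P" "a = \<phi> c" using surj by auto
      then obtain w where w: "w \<in> carrier ?F" "a = \<phi> (?K #>\<^bsub>?F\<^esub> w)"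
        by (auto simp: FactGroup_def RCOSETS_def)
      have "eval_word G g w \<in> generate G (g ` {..<n})"
        using w g by (intro G.eval_word_in_subgroup[of _ "{..<n}"] G.generate_is_subgroup)
          (auto simp: free_group_carrier intro: generate.incl)
      then show "a \<in> generate G (g ` {..<n})" using ev' w by simp
    qed
  qed
  then have "presents G {..<n} g R"
    using G.group_axioms g R K_iff subset_normal_closure[of R ?F]
    by (auto simp: presents_def)
  then show ?thesis by blast
qed

section \<open>Kernels of homomorphisms with finite image\<close>

text \<open>\<open>f'\<close> plays the role of the inverse of \<open>f\<close>. The head of the
  word acts last, so concatenation of words becomes composition of maps.\<close>

fun word_act :: "('x \<Rightarrow> 's \<Rightarrow> 's) \<Rightarrow> ('x \<Rightarrow> 's \<Rightarrow> 's) \<Rightarrow> 'x letter list \<Rightarrow> 's \<Rightarrow> 's" where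
  "word_act f f' [] s = s"
| "word_act f f' (l # w) s = (if snd l then f else f') (fst l) (word_act f f' w s)"

lemma BijGroup_mult_apply:
  "\<lbrakk>f \<in> Bij S; f' \<in> Bij S; s \<in> S\<rbrakk> \<Longrightarrow> (f \<otimes>\<^bsub>BijGroup S\<^esub> f') s = f (f' s)"
  by (simp add: BijGroup_def compose_def)

text \<open>The bijections of \<open>S\<close> form a group, and von Dyck's theorem is applied to
  it. Afterwards relators have to be checked pointwise only.\<close>

lemma presents_word_act_trivial:
  assumes pres: "presents G B g R"
    and f: "\<And>x s. s \<in> S \<Longrightarrow> f x s \<in> S" "\<And>x s. s \<in> S \<Longrightarrow> f' x s \<in> S"
    and inv: "\<And>x s. s \<in> S \<Longrightarrow> f' x (f x s) = s" "\<And>x s. s \<in> S \<Longrightarrow> f x (f' x s) = s"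
    and R: "\<And>r s. r \<in> R \<Longrightarrow> s \<in> S \<Longrightarrow> word_act f f' r s = s"
    and w: "w \<in> words B" "eval_word G g w = \<one>\<^bsub>G\<^esub>" and s: "s \<in> S"
  shows "word_act f f' w s = s"
proof -
  interpret P: group "BijGroup S" by (rule group_BijGroup)
  define p where "p x = restrict (f x) S" for x
  have bij: "bij_betw (f x) S S" for x
    by (rule bij_betw_byWitness[where f' = "f' x"]) (auto simp: f inv)
  have p: "p x \<in> Bij S" for x
    using bij by (simp add: p_def Bij_def)
  then have pc: "p x \<in> carrier (BijGroup S)" for x
    by (simp add: BijGroup_def)
  have act_in: "word_act f f' w s \<in> S" if "s \<in> S" for w s
    using that by (induction w) (auto simp: f)
  have p_apply: "p x s = f x s" if "s \<in> S" for x s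
    using that by (simp add: p_def)
  have inv_p: "(inv\<^bsub>BijGroup S\<^esub> p x) s = f' x s" if "s \<in> S" for x s
  proof -
    have "inv_into S (p x) s = f' x s"
      using p that f inv by (intro inv_into_f_eq) (auto simp: p_def Bij_def bij_betw_def)
    then show ?thesis using inv_BijGroup[OF p] that by simp
  qed
  have ev: "eval_word (BijGroup S) p w s = word_act f f' w s" if "s \<in> S" for w s
    using that
  proof (induction w)
    case (Cons l w)
    have c: "letter_val (BijGroup S) p l \<in> Bij S" "eval_word (BijGroup S) p w \<in> Bij S"
      using P.letter_val_closed[of p, OF pc] P.eval_word_closed[of p, OF pc] by (auto simp: BijGroup_def)
    have "eval_word (BijGroup S) p (l # w) s =
        letter_val (BijGroup S) p l (eval_word (BijGroup S) p w s)"
      using c Cons.prems by (simp add: BijGroup_mult_apply)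
    then show ?case
      using Cons act_in[of s w] by (auto simp: letter_val_def inv_p p_apply)
  qed (simp add: BijGroup_def)
  have ext: "eval_word (BijGroup S) p w \<in> extensional S" for w
    using P.eval_word_closed[of p, OF pc] by (auto simp: BijGroup_def Bij_def)
  have one: "\<one>\<^bsub>BijGroup S\<^esub> = (\<lambda>s\<in>S. s)" by (simp add: BijGroup_def)
  have "eval_word (BijGroup S) p w = \<one>\<^bsub>BijGroup S\<^esub>"
  proof (rule presents_imp_trivial[OF pres P.group_axioms pc _ w])
    fix r assume "r \<in> R"
    show "eval_word (BijGroup S) p r = \<one>\<^bsub>BijGroup S\<^esub>"
      unfolding one
      using ext by (rule extensionalityI) (auto simp: ev R \<open>r \<in> R\<close>)
  qed
  then show ?thesis using ev[OF s, of w] s by (simp add: one)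
qed

text \<open>The label \<open>p q x\<close> sits on the edge from \<open>q\<close> to
  \<open>q t x\<close>. The word is read as a path starting at \<open>q\<close>, and the labels are
  multiplied along it, inverted on edges that are run backwards.\<close>

fun word_cocycle ::
    "('q, 'c) monoid_scheme \<Rightarrow> ('p, 'd) monoid_scheme \<Rightarrow> ('x \<Rightarrow> 'q) \<Rightarrow> ('q \<Rightarrow> 'x \<Rightarrow> 'p) \<Rightarrow>
      'q \<Rightarrow> 'x letter list \<Rightarrow> 'p" where
  "word_cocycle T P t p q [] = \<one>\<^bsub>P\<^esub>"
| "word_cocycle T P t p q (l # w) =
    (if snd l then p q (fst l) \<otimes>\<^bsub>P\<^esub> word_cocycle T P t p (q \<otimes>\<^bsub>T\<^esub> t (fst l)) w
     else inv\<^bsub>P\<^esub> p (q \<otimes>\<^bsub>T\<^esub> inv\<^bsub>T\<^esub> t (fst l)) (fst l) \<otimes>\<^bsub>P\<^esub>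
       word_cocycle T P t p (q \<otimes>\<^bsub>T\<^esub> inv\<^bsub>T\<^esub> t (fst l)) w)"

section \<open>Cocycles along words\<close>

locale cocycle_data =
  T: group T + P: group P
  for T :: "('q, 'c) monoid_scheme" and P :: "('p, 'd) monoid_scheme" +
  fixes t :: "'x \<Rightarrow> 'q" and p :: "'q \<Rightarrow> 'x \<Rightarrow> 'p"
  assumes t_closed [simp]: "t x \<in> carrier T"
    and p_closed [simp]: "q \<in> carrier T \<Longrightarrow> p q x \<in> carrier P"
begin

abbreviation "coc \<equiv> word_cocycle T P t p"

lemma coc_closed [simp]: "q \<in> carrier T \<Longrightarrow> coc q w \<in> carrier P"
  by (induction w arbitrary: q) auto

lemma coc_append:
  "q \<in> carrier T \<Longrightarrow> coc q (u @ v) = coc q u \<otimes>\<^bsub>P\<^esub> coc (q \<otimes>\<^bsub>T\<^esub> eval_word T t u) v"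
  by (induction u arbitrary: q) (auto simp: P.m_assoc T.m_assoc letter_val_def)

lemma coc_inv_word:
  "q \<in> carrier T \<Longrightarrow> coc (q \<otimes>\<^bsub>T\<^esub> eval_word T t u) (inv_word u) = inv\<^bsub>P\<^esub> coc q u"
proof (induction u arbitrary: q)
  case Nil
  then show ?case by (simp add: inv_word_def)
next
  case (Cons l u)
  let ?l = "letter_val T t l" and ?e = "eval_word T t u"
  have iw: "inv_word (l # u) = inv_word u @ [inv_letter l]" by (simp add: inv_word_def)
  have l: "?l \<in> carrier T" and e: "?e \<in> carrier T" by auto
  have q': "q \<otimes>\<^bsub>T\<^esub> ?l \<in> carrier T" using Cons.prems l by simp
  have "coc (q \<otimes>\<^bsub>T\<^esub> eval_word T t (l # u)) (inv_word (l # u)) =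
     coc (q \<otimes>\<^bsub>T\<^esub> ?l \<otimes>\<^bsub>T\<^esub> ?e) (inv_word u) \<otimes>\<^bsub>P\<^esub> coc (q \<otimes>\<^bsub>T\<^esub> ?l) [inv_letter l]"
    using Cons.prems l e by (simp add: iw coc_append T.m_assoc T.eval_word_inv_word)
  also have "\<dots> = inv\<^bsub>P\<^esub> coc (q \<otimes>\<^bsub>T\<^esub> ?l) u \<otimes>\<^bsub>P\<^esub> coc (q \<otimes>\<^bsub>T\<^esub> ?l) [inv_letter l]"
    using Cons.IH[OF q'] by simp
  also have "\<dots> = inv\<^bsub>P\<^esub> coc q (l # u)"
    using Cons.prems by (auto simp: letter_val_def P.inv_mult_group T.m_assoc)
  finally show ?case .
qed

text \<open>The cocycle as an action on pairs of a vertex and a value. The last letter acts first,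
  so letters move the vertex backwards: after the whole word it is the start of the path that reads
  the word and ends in \<open>q\<close>, and the value has changed by the cocycle of this
  path.\<close>

lemma word_act_cocycle:
  assumes "q \<in> carrier T" "b \<in> carrier P"
  shows "word_act (\<lambda>x (q, b). (q \<otimes>\<^bsub>T\<^esub> inv\<^bsub>T\<^esub> t x, p (q \<otimes>\<^bsub>T\<^esub> inv\<^bsub>T\<^esub> t x) x \<otimes>\<^bsub>P\<^esub> b))
     (\<lambda>x (q, b). (q \<otimes>\<^bsub>T\<^esub> t x, inv\<^bsub>P\<^esub> p q x \<otimes>\<^bsub>P\<^esub> b)) w (q, b) =
     (q \<otimes>\<^bsub>T\<^esub> inv\<^bsub>T\<^esub> eval_word T t w, coc (q \<otimes>\<^bsub>T\<^esub> inv\<^bsub>T\<^esub> eval_word T t w) w \<otimes>\<^bsub>P\<^esub> b)"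
  using assms
  by (induction w) (auto simp: letter_val_def T.inv_mult_group T.m_assoc P.m_assoc)

text \<open>By \<open>trivT\<close> a trivial word fixes the vertex, so all that is left of its
  action is multiplication by the cocycle. Hence triviality at all vertices passes from the relators
  to all trivial words.\<close>

lemma coc_trivial:
  assumes pres: "presents G B g R"
    and trivT: "\<And>w. w \<in> words B \<Longrightarrow> eval_word G g w = \<one>\<^bsub>G\<^esub> \<Longrightarrow> eval_word T t w = \<one>\<^bsub>T\<^esub>"
    and R: "\<And>r q. r \<in> R \<Longrightarrow> q \<in> carrier T \<Longrightarrow> coc q r = \<one>\<^bsub>P\<^esub>"
    and w: "w \<in> words B" "eval_word G g w = \<one>\<^bsub>G\<^esub>" and q: "q \<in> carrier T"
  shows "coc q w = \<one>\<^bsub>P\<^esub>"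
proof -
  let ?f = "\<lambda>x (q, b). (q \<otimes>\<^bsub>T\<^esub> inv\<^bsub>T\<^esub> t x, p (q \<otimes>\<^bsub>T\<^esub> inv\<^bsub>T\<^esub> t x) x \<otimes>\<^bsub>P\<^esub> b)"
  let ?f' = "\<lambda>x (q, b). (q \<otimes>\<^bsub>T\<^esub> t x, inv\<^bsub>P\<^esub> p q x \<otimes>\<^bsub>P\<^esub> b)"
  let ?S = "carrier T \<times> carrier P"
  have Rw: "r \<in> words B" "eval_word G g r = \<one>\<^bsub>G\<^esub>" if "r \<in> R" for r
    using pres that by (auto simp: presents_def free_group_carrier)
  have "word_act ?f ?f' w (q, \<one>\<^bsub>P\<^esub>) = (q, \<one>\<^bsub>P\<^esub>)"
  proof (rule presents_word_act_trivial[OF pres, where S = ?S])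
    fix r s assume "r \<in> R" "s \<in> ?S"
    then show "word_act ?f ?f' r s = s"
      using Rw[of r] trivT[of r] R[of r "fst s"] by (auto simp: word_act_cocycle)
  qed (use w q in \<open>auto simp: T.m_assoc P.m_assoc[symmetric]\<close>)
  then show ?thesis
    using w q by (simp add: word_act_cocycle trivT)
qed

end

text \<open>The letter \<open>(q, x)\<close> names the edge from \<open>q\<close> to
  \<open>q t x\<close>; these letters will stand for the Schreier generators of a kernel.\<close>

fun rewrite_word :: "('q, 'c) monoid_scheme \<Rightarrow> ('x \<Rightarrow> 'q) \<Rightarrow> 'q \<Rightarrow> 'x letter list \<Rightarrow> ('q \<times> 'x) letter list" where
  "rewrite_word T t q [] = []"
| "rewrite_word T t q (l # w) =
    (if snd l then ((q, fst l), True) # rewrite_word T t (q \<otimes>\<^bsub>T\<^esub> t (fst l)) w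
     else ((q \<otimes>\<^bsub>T\<^esub> inv\<^bsub>T\<^esub> t (fst l), fst l), False) # rewrite_word T t (q \<otimes>\<^bsub>T\<^esub> inv\<^bsub>T\<^esub> t (fst l)) w)"

lemma eval_rewrite_word:
  "eval_word P p (rewrite_word T t q w) = word_cocycle T P t (\<lambda>q x. p (q, x)) q w"
  by (induction w arbitrary: q) (auto simp: letter_val_def)

lemma rewrite_word_in_words:
  assumes "group T" "subgroup Q T" "\<And>x. t x \<in> Q" "q \<in> Q" "w \<in> words B"
  shows "rewrite_word T t q w \<in> words (Q \<times> B)"
  using assms(4,5)
  by (induction w arbitrary: q)
     (auto simp: assms(3) subgroup.m_closed[OF assms(2)] subgroup.m_inv_closed[OF assms(2)])

lemma (in group) eval_word_subgroup:
  assumes "subgroup H G" "\<And>x. g x \<in> H"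
  shows "eval_word (G\<lparr>carrier := H\<rparr>) g w = eval_word G g w"
  by (induction w) (auto simp: letter_val_def m_inv_consistent[OF assms(1)] assms(2))

text \<open>Reidemeister--Schreier rewriting.\<close>

lemma finitely_presented_finite_index_kernel:
  fixes G :: "('a, 'b) monoid_scheme" and T :: "('q, 'c) monoid_scheme"
  assumes fp: "finitely_presented G" and \<phi>: "group_hom G T \<phi>" and fin: "finite (\<phi> ` carrier G)"
  shows "finitely_presented (G\<lparr>carrier := kernel G T \<phi>\<rparr>)"
proof -
  interpret \<phi>: group_hom G T \<phi> by fact
  obtain n :: nat and g R where pres: "presents G {..<n} g R"
    using finitely_presented_imp_presents[OF fp] by blast
  let ?B = "{..<n}"
  have g: "\<And>x. g x \<in> carrier G" and gen: "generate G (g ` ?B) = carrier G" and finR: "finite R"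
    and R: "R \<subseteq> words ?B" "\<And>r. r \<in> R \<Longrightarrow> eval_word G g r = \<one>\<^bsub>G\<^esub>"
    using pres by (auto simp: presents_def free_group_carrier)
  define Q where "Q = \<phi> ` carrier G"
  have Q: "subgroup Q T" unfolding Q_def by (rule \<phi>.img_is_subgroup)
  have QT: "q \<in> carrier T" if "q \<in> Q" for q using that by (auto simp: Q_def)
  let ?t = "\<phi> \<circ> g"
  have t: "?t x \<in> Q" for x using g by (auto simp: Q_def)
  have ev_t: "eval_word T ?t w = \<phi> (eval_word G g w)" for w
    using \<phi>.eval_word_hom_image[of g w] g by simp
  \<comment> \<open>A transversal given by words. The trivial coset receives the empty word, so that
    its representative is the unit.\<close>
  define u where "u q = (if q = \<one>\<^bsub>T\<^esub> then [] else SOME w. w \<in> words ?B \<and> eval_word T ?t w = q)" for q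
  have u: "u q \<in> words ?B \<and> eval_word T ?t (u q) = q" if "q \<in> Q" for q
  proof (cases "q = \<one>\<^bsub>T\<^esub>")
    case False
    obtain a where a: "a \<in> carrier G" "q = \<phi> a" using \<open>q \<in> Q\<close> by (auto simp: Q_def)
    then obtain w where "w \<in> words ?B" "eval_word G g w = a"
      using \<phi>.G.generate_eval_word[of g a ?B] g gen by (auto simp: free_group_carrier)
    then have "\<exists>w. w \<in> words ?B \<and> eval_word T ?t w = q" using a ev_t by auto
    then have "(SOME w. w \<in> words ?B \<and> eval_word T ?t w = q) \<in> words ?B \<and>
        eval_word T ?t (SOME w. w \<in> words ?B \<and> eval_word T ?t w = q) = q"
      by (rule someI_ex)
    then show ?thesis using False by (simp add: u_def)
  qed (simp add: u_def)
  define \<sigma> where "\<sigma> q = eval_word G g (u q)" for q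
  have \<sigma>: "\<sigma> q \<in> carrier G" for q using g by (simp add: \<sigma>_def)
  have \<phi>\<sigma>: "\<phi> (\<sigma> q) = q" if "q \<in> Q" for q using u[OF that] ev_t by (simp add: \<sigma>_def)
  have \<sigma>1: "\<sigma> \<one>\<^bsub>T\<^esub> = \<one>\<^bsub>G\<^esub>" by (simp add: \<sigma>_def u_def)
  let ?K = "kernel G T \<phi>"
  let ?H = "G\<lparr>carrier := ?K\<rparr>"
  have K: "subgroup ?K G" by (rule \<phi>.subgroup_kernel)
  interpret H: group ?H by (rule \<phi>.G.subgroup_imp_group[OF K])
  \<comment> \<open>The Schreier generators; the value outside \<open>Q\<close> only makes
    \<open>s\<close> total.\<close>
  define s where "s = (\<lambda>(q, x). if q \<in> Q
    then \<sigma> q \<otimes>\<^bsub>G\<^esub> g x \<otimes>\<^bsub>G\<^esub> inv\<^bsub>G\<^esub> \<sigma> (q \<otimes>\<^bsub>T\<^esub> ?t x) else \<one>\<^bsub>G\<^esub>)"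
  have s: "s y \<in> ?K" for y
  proof (cases y)
    case (Pair q x)
    have "q \<in> Q \<Longrightarrow> q \<otimes>\<^bsub>T\<^esub> \<phi> (g x) \<in> Q"
      using t[of x] by (auto intro: subgroup.m_closed[OF Q])
    then show ?thesis using Pair \<sigma> \<phi>\<sigma> g QT by (auto simp: s_def kernel_def)
  qed
  have sG: "s y \<in> carrier G" for y using s by (auto simp: kernel_def)
  interpret c0: cocycle_data T G ?t "\<lambda>q x. s (q, x)"
    using g by unfold_locales (auto simp: sG)
  have ev_s: "eval_word G s (rewrite_word T ?t q w) =
      \<sigma> q \<otimes>\<^bsub>G\<^esub> eval_word G g w \<otimes>\<^bsub>G\<^esub> inv\<^bsub>G\<^esub> \<sigma> (q \<otimes>\<^bsub>T\<^esub> eval_word T ?t w)"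
    if "q \<in> Q" for q w
    using that
  proof (induction w arbitrary: q)
    case (Cons l w)
    obtain x b where l: "l = (x, b)" by (cases l)
    have qt: "q \<otimes>\<^bsub>T\<^esub> \<phi> (g x) \<in> Q" "q \<otimes>\<^bsub>T\<^esub> inv\<^bsub>T\<^esub> \<phi> (g x) \<in> Q"
      using t[of x] Cons.prems
      by (auto intro: subgroup.m_closed[OF Q] subgroup.m_inv_closed[OF Q])
    have c: "q \<in> carrier T" using Cons.prems QT by auto
    have e: "eval_word G g w \<in> carrier G" "eval_word T ?t w \<in> carrier T"
      using g by (auto simp: ev_t)
    show ?case
      using Cons.IH[OF qt(1)] Cons.IH[OF qt(2)] Cons.prems \<sigma> g l c qt e
      by (simp add: letter_val_def s_def \<phi>.G.m_assoc \<phi>.H.m_assoc \<phi>.G.inv_mult_group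
          \<phi>.G.inv_solve_left')
  qed (use \<sigma> QT in simp)
  \<comment> \<open>The transversal is not assumed closed under prefixes, so no Schreier generator
    is trivial by construction. Instead the transversal words, read from the trivial coset, are
    added to the relators read from every coset.\<close>
  let ?R = "(\<lambda>(q, r). rewrite_word T ?t q r) ` (Q \<times> R) \<union> (\<lambda>q. rewrite_word T ?t \<one>\<^bsub>T\<^esub> (u q)) ` Q"
  have oneQ: "\<one>\<^bsub>T\<^esub> \<in> Q" by (rule subgroup.one_closed[OF Q])
  have finQ: "finite Q" using fin by (simp add: Q_def)
  have wordK: "\<exists>w\<in>words ?B. eval_word G g w = h" if "h \<in> carrier G" for h
    using \<phi>.G.generate_eval_word[of g h ?B] g gen that by (auto simp: free_group_carrier)
  have "presents ?H (Q \<times> ?B) s (reduce_word ` ?R)"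
  proof (rule presentsI)
    show "group ?H" by (rule H.group_axioms)
    show "finite (Q \<times> ?B)" using finQ by simp
    show "s y \<in> carrier ?H" for y using s by simp
    show "generate ?H (s ` (Q \<times> ?B)) = carrier ?H"
    proof
      show "generate ?H (s ` (Q \<times> ?B)) \<subseteq> carrier ?H"
        using s by (intro H.generate_incl) auto
      show "carrier ?H \<subseteq> generate ?H (s ` (Q \<times> ?B))"
      proof
        fix h assume "h \<in> carrier ?H"
        then have h: "h \<in> carrier G" "\<phi> h = \<one>\<^bsub>T\<^esub>" by (auto simp: kernel_def)
        obtain w where w: "w \<in> words ?B" "eval_word G g w = h" using wordK[OF h(1)] by auto
        have "eval_word ?H s (rewrite_word T ?t \<one>\<^bsub>T\<^esub> w) \<in> generate ?H (s ` (Q \<times> ?B))"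
        proof (rule H.eval_word_in_subgroup[where B = "Q \<times> ?B"])
          show "subgroup (generate ?H (s ` (Q \<times> ?B))) ?H"
            using s by (intro H.generate_is_subgroup) auto
          show "rewrite_word T ?t \<one>\<^bsub>T\<^esub> w \<in> words (Q \<times> ?B)"
            using w t oneQ by (intro rewrite_word_in_words[OF \<phi>.H.group_axioms Q])
        qed (auto intro: generate.incl)
        moreover have "eval_word ?H s (rewrite_word T ?t \<one>\<^bsub>T\<^esub> w) = h"
          using ev_s[OF oneQ, of w] w h ev_t[of w] \<sigma>1
          by (simp add: \<phi>.G.eval_word_subgroup[OF K s])
        ultimately show "h \<in> generate ?H (s ` (Q \<times> ?B))" by simp
      qed
    qed
    show "finite ?R" using finQ finR by simp
    show "?R \<subseteq> words (Q \<times> ?B)"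
      using R(1) u oneQ by (auto intro!: rewrite_word_in_words[OF \<phi>.H.group_axioms Q t])
    show "eval_word ?H s r = \<one>\<^bsub>?H\<^esub>" if r: "r \<in> ?R" for r
    proof -
      consider q r' where "q \<in> Q" "r' \<in> R" "r = rewrite_word T ?t q r'"
        | q where "q \<in> Q" "r = rewrite_word T ?t \<one>\<^bsub>T\<^esub> (u q)"
        using r by auto
      then show ?thesis
      proof cases
        case 1
        then show ?thesis using R(2)[of r'] ev_s[of q r'] ev_t[of r'] \<sigma> QT
          by (simp add: \<phi>.G.eval_word_subgroup[OF K s])
      next
        case 2
        then show ?thesis using ev_s[OF oneQ, of "u q"] u[of q] \<sigma>1 \<sigma>[of q] QT[of q]
          by (simp add: \<phi>.G.eval_word_subgroup[OF K s] \<sigma>_def[symmetric])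
      qed
    qed
  next
    fix P :: "('q \<times> nat) letter list set monoid" and p
    assume P: "group P" and p: "\<And>x. p x \<in> carrier P"
      and rel: "\<And>r. r \<in> ?R \<Longrightarrow> eval_word P p r = \<one>\<^bsub>P\<^esub>"
    \<comment> \<open>Relations in \<open>P\<close> are available for vertices in the image
      \<open>Q\<close> only, so the cocycle argument runs over the group \<open>Q\<close> instead of
      \<open>T\<close>.\<close>
    interpret TQ: group "T\<lparr>carrier := Q\<rparr>" by (rule \<phi>.H.subgroup_imp_group[OF Q])
    interpret c: cocycle_data "T\<lparr>carrier := Q\<rparr>" P ?t "\<lambda>q x. p (q, x)"
      using t p by (intro cocycle_data.intro cocycle_data_axioms.intro TQ.group_axioms P) auto
    have invQ: "inv\<^bsub>T\<lparr>carrier := Q\<rparr>\<^esub> ?t x = inv\<^bsub>T\<^esub> ?t x" for x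
      by (rule \<phi>.H.m_inv_consistent[OF Q t])
    have coc_eq: "c.coc q w = word_cocycle T P ?t (\<lambda>q x. p (q, x)) q w" for q w
      using invQ by (induction w arbitrary: q) auto
    have ev_tQ: "eval_word (T\<lparr>carrier := Q\<rparr>) ?t w = eval_word T ?t w" for w
      by (rule \<phi>.H.eval_word_subgroup[OF Q t])
    have triv: "c.coc q w = \<one>\<^bsub>P\<^esub>" if "w \<in> words ?B" "eval_word G g w = \<one>\<^bsub>G\<^esub>" "q \<in> Q" for w q
    proof (rule c.coc_trivial[OF pres])
      show "c.coc q r = \<one>\<^bsub>P\<^esub>" if "r \<in> R" "q \<in> carrier (T\<lparr>carrier := Q\<rparr>)" for r q
        using rel[of "rewrite_word T ?t q r"] that by (auto simp: eval_rewrite_word coc_eq)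
      show "eval_word (T\<lparr>carrier := Q\<rparr>) ?t w = \<one>\<^bsub>T\<lparr>carrier := Q\<rparr>\<^esub>"
        if "eval_word G g w = \<one>\<^bsub>G\<^esub>" for w
        using that by (simp add: ev_tQ ev_t)
    qed (use that in auto)
    have coc_u: "c.coc \<one>\<^bsub>T\<^esub> (u q) = \<one>\<^bsub>P\<^esub>" if "q \<in> Q" for q
      using rel[of "rewrite_word T ?t \<one>\<^bsub>T\<^esub> (u q)"] that by (auto simp: eval_rewrite_word coc_eq)
    define wd where "wd h = (SOME w. w \<in> words ?B \<and> eval_word G g w = h)" for h
    have wd: "wd h \<in> words ?B \<and> eval_word G g (wd h) = h" if "h \<in> carrier G" for h
      unfolding wd_def by (rule someI_ex) (use wordK[OF that] in auto)
    have coc_wd: "c.coc \<one>\<^bsub>T\<^esub> (wd h) = c.coc \<one>\<^bsub>T\<^esub> w" if "w \<in> words ?B" "eval_word G g w = h" for w h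
    proof -
      have h: "h \<in> carrier G" using that g by auto
      have 1: "c.coc \<one>\<^bsub>T\<^esub> (wd h @ inv_word w) = \<one>\<^bsub>P\<^esub>"
        using wd[OF h] that h oneQ g
        by (intro triv) (auto simp: inv_word_in_words \<phi>.G.eval_word_append \<phi>.G.eval_word_inv_word)
      have 2: "eval_word T ?t (wd h) = eval_word T ?t w"
        using wd[OF h] that by (simp add: ev_t)
      have "c.coc \<one>\<^bsub>T\<^esub> (wd h) \<otimes>\<^bsub>P\<^esub> inv\<^bsub>P\<^esub> c.coc \<one>\<^bsub>T\<^esub> w = \<one>\<^bsub>P\<^esub>"
        using 1 c.coc_append[of "\<one>\<^bsub>T\<^esub>" "wd h" "inv_word w"] c.coc_inv_word[of "\<one>\<^bsub>T\<^esub>" w] oneQ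
        by (simp add: ev_tQ 2)
      then show ?thesis
        using oneQ c.P.inv_equality[of "c.coc \<one>\<^bsub>T\<^esub> (wd h)" "inv\<^bsub>P\<^esub> c.coc \<one>\<^bsub>T\<^esub> w"] by simp
    qed
    \<comment> \<open>The cocycle of any word for \<open>h\<close>, read from the trivial coset; by
      \<open>coc_wd\<close> the choice of the word is immaterial.\<close>
    let ?\<theta> = "\<lambda>h. c.coc \<one>\<^bsub>T\<^esub> (wd h)"
    have "?\<theta> (s (q, x) \<otimes>\<^bsub>?H\<^esub> h) = p (q, x) \<otimes>\<^bsub>P\<^esub> ?\<theta> h"
      if q: "q \<in> Q" and x: "x \<in> ?B" and h: "h \<in> ?K" for q x h
    proof -
      let ?q = "q \<otimes>\<^bsub>T\<^esub> ?t x"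
      have q': "?q \<in> Q" by (rule subgroup.m_closed[OF Q q t])
      have hG: "h \<in> carrier G" "\<phi> h = \<one>\<^bsub>T\<^esub>" using h by (auto simp: kernel_def)
      \<comment> \<open>A word for \<open>s (q, x)\<close> times \<open>h\<close>: along the
        transversal to \<open>q\<close>, over the edge \<open>x\<close>, back along the transversal,
        then \<open>h\<close>. The two transversal parts have trivial cocycle by the additional
        relators.\<close>
      let ?v = "inv_word (u ?q) @ wd h"
      let ?w = "u q @ (x, True) # ?v"
      have W: "?w \<in> words ?B" using u[OF q] u[OF q'] x wd[OF hG(1)] inv_word_in_words by auto
      have "eval_word G g ?w = s (q, x) \<otimes>\<^bsub>G\<^esub> h"
        using q g \<sigma> wd[OF hG(1)] hG
        by (simp add: \<phi>.G.eval_word_append \<phi>.G.eval_word_inv_word letter_val_def s_def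
            \<sigma>_def[symmetric] \<phi>.G.m_assoc)
      then have "?\<theta> (s (q, x) \<otimes>\<^bsub>?H\<^esub> h) = c.coc \<one>\<^bsub>T\<^esub> ?w"
        using coc_wd[OF W] by simp
      also have "\<dots> = c.coc q ((x, True) # ?v)"
        using c.coc_append[of "\<one>\<^bsub>T\<^esub>" "u q" "(x, True) # ?v"] oneQ coc_u[OF q] u[OF q] q QT[OF q]
        by (simp add: ev_tQ del: word_cocycle.simps)
      also have "\<dots> = p (q, x) \<otimes>\<^bsub>P\<^esub> c.coc ?q ?v"
        by simp
      also have "c.coc ?q ?v = c.coc ?q (inv_word (u ?q)) \<otimes>\<^bsub>P\<^esub> c.coc (?q \<otimes>\<^bsub>T\<^esub> inv\<^bsub>T\<^esub> ?q) (wd h)"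
        using c.coc_append[of ?q "inv_word (u ?q)" "wd h"] q' u[OF q'] \<phi>.H.eval_word_inv_word[of ?t "u ?q"] g
        by (simp add: ev_tQ)
      also have "c.coc ?q (inv_word (u ?q)) = \<one>\<^bsub>P\<^esub>"
        using c.coc_inv_word[of "\<one>\<^bsub>T\<^esub>" "u ?q"] coc_u[OF q'] u[OF q'] oneQ QT[OF q']
        by (simp add: ev_tQ)
      finally have "?\<theta> (s (q, x) \<otimes>\<^bsub>?H\<^esub> h) =
          p (q, x) \<otimes>\<^bsub>P\<^esub> (\<one>\<^bsub>P\<^esub> \<otimes>\<^bsub>P\<^esub> c.coc (?q \<otimes>\<^bsub>T\<^esub> inv\<^bsub>T\<^esub> ?q) (wd h))" .
      moreover have "?q \<otimes>\<^bsub>T\<^esub> inv\<^bsub>T\<^esub> ?q = \<one>\<^bsub>T\<^esub>" using QT[OF q'] by (rule \<phi>.H.r_inv)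
      moreover have "?\<theta> h \<in> carrier P" using oneQ by (intro c.coc_closed) simp
      ultimately show ?thesis by (simp only: c.P.l_one)
    qed
    moreover have "?\<theta> \<one>\<^bsub>?H\<^esub> = \<one>\<^bsub>P\<^esub>"
      using coc_wd[of "[]" "\<one>\<^bsub>G\<^esub>"] by simp
    ultimately show "\<exists>\<theta>. \<theta> \<one>\<^bsub>?H\<^esub> = \<one>\<^bsub>P\<^esub> \<and>
        (\<forall>y\<in>Q \<times> ?B. \<forall>h\<in>carrier ?H. \<theta> (s y \<otimes>\<^bsub>?H\<^esub> h) = p y \<otimes>\<^bsub>P\<^esub> \<theta> h) \<and>
        (\<forall>h\<in>carrier ?H. \<theta> h \<in> carrier P)"
      using oneQ by (intro exI[of _ ?\<theta>]) auto
  qed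
  then show ?thesis by (rule presents_imp_finitely_presented)
qed

section \<open>Components of half-spaces in Cayley graphs\<close>

text \<open>The target is any abelian group: integral, rational and real characters all
  occur.\<close>

definition add_hom :: "('a, 'b) monoid_scheme \<Rightarrow> ('a \<Rightarrow> 'r::ab_group_add) \<Rightarrow> bool" where
  "add_hom G \<chi> \<longleftrightarrow> (\<forall>x\<in>carrier G. \<forall>y\<in>carrier G. \<chi> (x \<otimes>\<^bsub>G\<^esub> y) = \<chi> x + \<chi> y)"

definition letters_of :: "('a, 'b) monoid_scheme \<Rightarrow> 'a set \<Rightarrow> 'a set" where
  "letters_of G S = S \<union> m_inv G ` S"

text \<open>Letters multiply on the right, so left translations preserve edges of the Cayley
  graph.\<close>

definition edges_in :: "('a, 'b) monoid_scheme \<Rightarrow> 'a set \<Rightarrow> 'a set \<Rightarrow> ('a \<times> 'a) set" where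
  "edges_in G S D = {(h, k). h \<in> carrier G \<and> h \<in> D \<and> k \<in> D \<and> (\<exists>y\<in>letters_of G S. k = h \<otimes>\<^bsub>G\<^esub> y)}"

text \<open>Connected by a path with all vertices in \<open>D\<close>, except that the empty path is
  allowed everywhere, also outside \<open>D\<close>.\<close>

definition joined :: "('a, 'b) monoid_scheme \<Rightarrow> 'a set \<Rightarrow> 'a set \<Rightarrow> ('a \<times> 'a) set" where
  "joined G S D = (edges_in G S D)\<^sup>*"

context group
begin

lemma add_hom_mult: "add_hom G \<chi> \<Longrightarrow> x \<in> carrier G \<Longrightarrow> y \<in> carrier G \<Longrightarrow> \<chi> (x \<otimes> y) = \<chi> x + \<chi> y"
  by (simp add: add_hom_def)

lemma add_hom_one: "add_hom G \<chi> \<Longrightarrow> \<chi> \<one> = 0"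
  using add_hom_mult[of \<chi> \<one> \<one>] by simp

lemma add_hom_inv: "add_hom G \<chi> \<Longrightarrow> x \<in> carrier G \<Longrightarrow> \<chi> (inv x) = - \<chi> x"
  using add_hom_mult[of \<chi> x "inv x"] add_hom_one[of \<chi>] by (simp add: eq_neg_iff_add_eq_0 add.commute)

lemma add_hom_nat_pow:
  "add_hom G (\<chi> :: _ \<Rightarrow> 'r::ring_1) \<Longrightarrow> x \<in> carrier G \<Longrightarrow> \<chi> (x [^] (k::nat)) = of_nat k * \<chi> x"
  by (induction k) (simp_all add: add_hom_one add_hom_mult algebra_simps)

lemma add_hom_int_pow:
  "add_hom G (\<chi> :: _ \<Rightarrow> 'r::ring_1) \<Longrightarrow> x \<in> carrier G \<Longrightarrow> \<chi> (x [^] (k::int)) = of_int k * \<chi> x"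
  by (cases k rule: int_cases2) (simp_all add: int_pow_neg add_hom_inv add_hom_nat_pow int_pow_int)

lemma add_hom_eq_0_on_generate:
  assumes "add_hom G \<chi>" "S \<subseteq> carrier G" "\<And>y. y \<in> S \<Longrightarrow> \<chi> y = 0" "x \<in> generate G S"
  shows "\<chi> x = 0"
  using assms(4)
  by (induction rule: generate.induct)
     (use assms generate_in_carrier in \<open>auto simp: add_hom_one add_hom_mult add_hom_inv subset_iff\<close>)

lemma letters_of_closed: "S \<subseteq> carrier G \<Longrightarrow> y \<in> letters_of G S \<Longrightarrow> y \<in> carrier G"
  by (auto simp: letters_of_def)

lemma letters_of_inv: "S \<subseteq> carrier G \<Longrightarrow> y \<in> letters_of G S \<Longrightarrow> inv y \<in> letters_of G S"
  by (auto simp: letters_of_def subset_iff)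

lemma letters_of_mono: "S \<subseteq> S' \<Longrightarrow> letters_of G S \<subseteq> letters_of G S'"
  by (auto simp: letters_of_def)

lemma finite_letters_of: "finite S \<Longrightarrow> finite (letters_of G S)"
  by (simp add: letters_of_def)

lemma joined_refl [simp]: "(h, h) \<in> joined G S D"
  by (simp add: joined_def)

lemma joined_trans: "(h, k) \<in> joined G S D \<Longrightarrow> (k, l) \<in> joined G S D \<Longrightarrow> (h, l) \<in> joined G S D"
  unfolding joined_def by (rule rtrancl_trans)

lemma joined_edge:
  "h \<in> carrier G \<Longrightarrow> h \<in> D \<Longrightarrow> h \<otimes> y \<in> D \<Longrightarrow> y \<in> letters_of G S \<Longrightarrow> (h, h \<otimes> y) \<in> joined G S D"
  unfolding joined_def edges_in_def by (rule r_into_rtrancl) auto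

lemma joined_induct [consumes 2, case_names refl step]:
  assumes "(h, k) \<in> joined G S D" "h \<in> carrier G"
    and "P h"
    and "\<And>x y. \<lbrakk>(h, x) \<in> joined G S D; x \<in> carrier G; x \<in> D; x \<otimes> y \<in> D; y \<in> letters_of G S; P x\<rbrakk> \<Longrightarrow> P (x \<otimes> y)"
  shows "P k"
  using assms(1) unfolding joined_def
proof (induction rule: rtrancl_induct)
  case base
  show ?case by (rule assms(3))
next
  case (step x z)
  then show ?case using assms(4)[of x] by (auto simp: edges_in_def joined_def)
qed

lemma joined_sym:
  assumes "S \<subseteq> carrier G" "(h, k) \<in> joined G S D"
  shows "(k, h) \<in> joined G S D"
proof -
  have "sym (edges_in G S D)"
  proof (rule symI)
    fix x z assume "(x, z) \<in> edges_in G S D"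
    then obtain y where y: "x \<in> carrier G" "x \<in> D" "z \<in> D" "y \<in> letters_of G S" "z = x \<otimes> y"
      by (auto simp: edges_in_def)
    then have "y \<in> carrier G" "inv y \<in> letters_of G S"
      using assms letters_of_closed letters_of_inv by auto
    then show "(z, x) \<in> edges_in G S D"
      using y by (auto simp: edges_in_def m_assoc intro!: bexI[of _ "inv y"])
  qed
  then have "sym (joined G S D)" unfolding joined_def by (rule sym_rtrancl)
  then show ?thesis using assms by (meson symD)
qed

lemma joined_mono:
  assumes "(h, k) \<in> joined G S D" "S \<subseteq> S'" "D \<subseteq> D'"
  shows "(h, k) \<in> joined G S' D'"
proof -
  have "edges_in G S D \<subseteq> edges_in G S' D'"
    using assms letters_of_mono[of S S'] by (auto simp: edges_in_def)
  then show ?thesis using assms(1) rtrancl_mono unfolding joined_def by blast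
qed

lemma joined_translate:
  assumes "(h, k) \<in> joined G S D" "h \<in> carrier G" "S \<subseteq> carrier G" "a \<in> carrier G"
    and D: "\<And>x. x \<in> D \<Longrightarrow> x \<in> carrier G \<Longrightarrow> a \<otimes> x \<in> D'"
  shows "(a \<otimes> h, a \<otimes> k) \<in> joined G S D'"
  using assms(1,2)
proof (induction rule: joined_induct)
  case (step x y)
  have y: "y \<in> carrier G" using step assms letters_of_closed by auto
  have "(a \<otimes> x, a \<otimes> x \<otimes> y) \<in> joined G S D'"
    using step y D[of x] D[of "x \<otimes> y"] assms by (intro joined_edge) (auto simp: m_assoc)
  then show ?case using step y assms by (auto simp: m_assoc intro: joined_trans)
qed simp

text \<open>Follow the path to \<open>z\<close>, then the path for \<open>b\<close> translated by
  \<open>z\<close>, then return along the path to \<open>z\<close> translated by the conjugate. The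
  hypotheses on \<open>E\<close> and \<open>D\<close> keep the last two parts inside
  \<open>D\<close>.\<close>

lemma joined_conj:
  assumes S: "S \<subseteq> carrier G" and b: "b \<in> carrier G" and z: "z \<in> carrier G"
    and 1: "(\<one>, z) \<in> joined G S D" "(\<one>, b) \<in> joined G S E"
    and E: "\<And>x. x \<in> E \<Longrightarrow> x \<in> carrier G \<Longrightarrow> z \<otimes> x \<in> D"
    and D: "\<And>x. x \<in> D \<Longrightarrow> x \<in> carrier G \<Longrightarrow> z \<otimes> b \<otimes> inv z \<otimes> x \<in> D"
  shows "(\<one>, z \<otimes> b \<otimes> inv z) \<in> joined G S D"
proof -
  have "(z \<otimes> \<one>, z \<otimes> b) \<in> joined G S D"
    using 1(2) S z E by (intro joined_translate[where D = E]) auto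
  moreover have "(z \<otimes> b \<otimes> inv z \<otimes> \<one>, z \<otimes> b \<otimes> inv z \<otimes> z) \<in> joined G S D"
    using 1(1) S z b D by (intro joined_translate[where D = D]) auto
  then have "(z \<otimes> b \<otimes> inv z, z \<otimes> b) \<in> joined G S D"
    using z b by (simp add: m_assoc)
  ultimately show ?thesis using 1(1) z joined_sym[OF S] joined_trans by (metis r_one)
qed

text \<open>A path has finitely many vertices; the uniform bounds on heights below originate
  here.\<close>

lemma joined_finite:
  assumes "(h, k) \<in> joined G S D" "h \<in> carrier G"
  shows "\<exists>F. finite F \<and> (h, k) \<in> joined G S (D \<inter> F)"
  using assms
proof (induction rule: joined_induct)
  case refl
  show ?case by (auto intro!: exI[of _ "{}"])
next
  case (step x y)
  then obtain F where F: "finite F" "(h, x) \<in> joined G S (D \<inter> F)" by auto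
  let ?F = "insert x (insert (x \<otimes> y) F)"
  have "(h, x) \<in> joined G S (D \<inter> ?F)" by (rule joined_mono[OF F(2)]) auto
  moreover have "(x, x \<otimes> y) \<in> joined G S (D \<inter> ?F)"
    using step by (intro joined_edge) auto
  ultimately have "(h, x \<otimes> y) \<in> joined G S (D \<inter> ?F)" by (rule joined_trans)
  then show ?case using F by (intro exI[of _ ?F]) auto
qed

lemma joined_generated:
  assumes S: "S \<subseteq> carrier G" and gen: "generate G S = carrier G" and a: "a \<in> carrier G"
  shows "(\<one>, a) \<in> joined G S UNIV"
proof -
  have "a \<in> generate G S" using a gen by simp
  then show ?thesis
  proof (induction rule: generate.induct)
    case (incl h)
    then show ?case using joined_edge[of \<one> UNIV h S] S by (auto simp: letters_of_def)
  next
    case (inv h)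
    then show ?case using joined_edge[of \<one> UNIV "inv h" S] S by (auto simp: letters_of_def)
  next
    case (eng h1 h2)
    have c: "h1 \<in> carrier G" "h2 \<in> carrier G" using eng gen S by auto
    have "(h1 \<otimes> \<one>, h1 \<otimes> h2) \<in> joined G S UNIV"
      using eng c S by (intro joined_translate[where D = UNIV]) auto
    then show ?case using eng c by (auto intro: joined_trans)
  qed simp
qed

lemma joined_above:
  fixes \<chi> :: "'a \<Rightarrow> 'r::linordered_ab_group_add"
  assumes "S \<subseteq> carrier G" "generate G S = carrier G" "a \<in> carrier G"
  shows "\<exists>M. (\<one>, a) \<in> joined G S {x. M \<le> \<chi> x}"
proof -
  obtain F where F: "finite F" "(\<one>, a) \<in> joined G S (UNIV \<inter> F)"
    using joined_finite[OF joined_generated[OF assms]] by auto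
  have "(\<one>, a) \<in> joined G S {x. Min (insert 0 (\<chi> ` F)) \<le> \<chi> x}"
    using F(1) by (intro joined_mono[OF F(2)]) auto
  then show ?thesis by blast
qed

lemma joined_pow:
  fixes \<chi> :: "'a \<Rightarrow> 'r::linordered_idom"
  assumes "add_hom G \<chi>" "S \<subseteq> carrier G" "s \<in> letters_of G S" "0 \<le> \<chi> s"
  shows "(\<one>, s [^] (k::nat)) \<in> joined G S {x. 0 \<le> \<chi> x}"
proof (induction k)
  case (Suc k)
  have s: "s \<in> carrier G" using assms letters_of_closed by auto
  have "(s [^] k, s [^] k \<otimes> s) \<in> joined G S {x. 0 \<le> \<chi> x}"
    using assms s by (intro joined_edge) (auto simp: add_hom_nat_pow add_hom_mult)
  then show ?case using Suc by (auto intro: joined_trans)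
qed simp

end

text \<open>Like \<open>joined\<close>, but for the path read along a given word, since cocycles are
  attached to words.\<close>

fun walk_in :: "('a, 'b) monoid_scheme \<Rightarrow> ('x \<Rightarrow> 'a) \<Rightarrow> 'a set \<Rightarrow> 'a \<Rightarrow> 'x letter list \<Rightarrow> bool" where
  "walk_in G g D h [] \<longleftrightarrow> True"
| "walk_in G g D h (l # w) \<longleftrightarrow>
    h \<in> D \<and> h \<otimes>\<^bsub>G\<^esub> letter_val G g l \<in> D \<and> walk_in G g D (h \<otimes>\<^bsub>G\<^esub> letter_val G g l) w"

section \<open>Paths read along words\<close>

context group
begin

lemma walk_in_append:
  assumes "\<And>x. g x \<in> carrier G" "h \<in> carrier G"
  shows "walk_in G g D h (u @ v) \<longleftrightarrow> walk_in G g D h u \<and> walk_in G g D (h \<otimes> eval_word G g u) v"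
  using assms(2) by (induction u arbitrary: h) (auto simp: assms(1) m_assoc)

lemma walk_in_translate:
  assumes "\<And>x. g x \<in> carrier G" "h \<in> carrier G" "a \<in> carrier G"
    and "\<And>x. x \<in> D \<Longrightarrow> x \<in> carrier G \<Longrightarrow> a \<otimes> x \<in> D'" "walk_in G g D h w"
  shows "walk_in G g D' (a \<otimes> h) w"
  using assms(2,5)
  by (induction w arbitrary: h) (auto simp: assms(1,3,4) m_assoc)

lemma joined_walk:
  assumes g: "\<And>x. g x \<in> carrier G" and "(h, k) \<in> joined G (g ` B) D" "h \<in> carrier G"
  shows "\<exists>w\<in>words B. k = h \<otimes> eval_word G g w \<and> walk_in G g D h w"
  using assms(2,3)
proof (induction rule: joined_induct)
  case refl
  show ?case using \<open>h \<in> carrier G\<close> by (intro bexI[of _ "[]"]) auto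
next
  case (step x y)
  then obtain w where w: "w \<in> words B" "x = h \<otimes> eval_word G g w" "walk_in G g D h w" by auto
  obtain l where l: "fst l \<in> B" "y = letter_val G g l"
  proof -
    obtain b where "b \<in> B" "y = g b \<or> y = inv g b" using step by (auto simp: letters_of_def)
    then show ?thesis using that[of "(b, True)"] that[of "(b, False)"] by (auto simp: letter_val_def)
  qed
  have "eval_word G g (w @ [l]) = eval_word G g w \<otimes> y" using g l by (simp add: eval_word_append)
  then show ?case using w l step \<open>h \<in> carrier G\<close> g
    by (intro bexI[of _ "w @ [l]"]) (auto simp: walk_in_append m_assoc)
qed

end

text \<open>Total variation of \<open>\<chi>\<close> along the word: no path reading
  \<open>w\<close> departs further from its initial height.\<close>

definition word_size :: "('a, 'b) monoid_scheme \<Rightarrow> ('x \<Rightarrow> 'a) \<Rightarrow> ('a \<Rightarrow> real) \<Rightarrow> 'x letter list \<Rightarrow> real" where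
  "word_size G g \<chi> w = (\<Sum>l\<leftarrow>w. \<bar>\<chi> (letter_val G g l)\<bar>)"

lemma word_size_nonneg: "0 \<le> word_size G g \<chi> w"
  by (induction w) (auto simp: word_size_def)

context group
begin

lemma walk_in_below:
  assumes g: "\<And>x. g x \<in> carrier G" and \<chi>: "add_hom G \<chi>" and h: "h \<in> carrier G"
    and "\<chi> h + word_size G g \<chi> w \<le> c"
  shows "walk_in G g {x. \<chi> x \<le> c} h w"
  using h assms(4)
proof (induction w arbitrary: h)
  case (Cons l w)
  let ?l = "letter_val G g l"
  have "\<chi> (h \<otimes> ?l) + word_size G g \<chi> w \<le> \<chi> h + word_size G g \<chi> (l # w)"
    using Cons.prems g by (simp add: add_hom_mult[OF \<chi>] word_size_def)
  then show ?case
    using Cons word_size_nonneg[of G g \<chi> w] word_size_nonneg[of G g \<chi> "l # w"] g by auto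
qed simp

lemma walk_in_above:
  assumes g: "\<And>x. g x \<in> carrier G" and \<chi>: "add_hom G \<chi>" and h: "h \<in> carrier G"
    and "word_size G g \<chi> w \<le> \<chi> h"
  shows "walk_in G g {x. 0 \<le> \<chi> x} h w"
  using h assms(4)
proof (induction w arbitrary: h)
  case (Cons l w)
  let ?l = "letter_val G g l"
  have "word_size G g \<chi> w \<le> \<chi> (h \<otimes> ?l)"
    using Cons.prems g by (simp add: add_hom_mult[OF \<chi>] word_size_def)
  then show ?case
    using Cons word_size_nonneg[of G g \<chi> w] word_size_nonneg[of G g \<chi> "l # w"] g by auto
qed simp

end

text \<open>
  If neither alternative held, the edges inside the component of \<open>\<one>\<close> in \<open>\<chi> \<ge> 0\<close> that leave or
  enter the component of \<open>\<one>\<close> in \<open>\<chi> \<le> c\<close> would define a cocycle vanishing on all relators but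
  not on the commutator loop through \<open>\<one>\<close>, \<open>a\<close>, \<open>a \<otimes> b\<close>, \<open>b\<close>.
\<close>

lemma presents_commuting_joined:
  assumes pres: "presents G B g R" and \<chi>: "add_hom G (\<chi> :: _ \<Rightarrow> real)"
  shows "\<exists>c\<ge>0. \<forall>a\<in>carrier G. \<forall>b\<in>carrier G. a \<otimes>\<^bsub>G\<^esub> b = b \<otimes>\<^bsub>G\<^esub> a \<longrightarrow> \<chi> a = 0 \<longrightarrow> \<chi> b = 0 \<longrightarrow>
     (\<one>\<^bsub>G\<^esub>, a) \<in> joined G (g ` B) {x. \<chi> x \<le> c} \<longrightarrow> (\<one>\<^bsub>G\<^esub>, b) \<in> joined G (g ` B) {x. 0 \<le> \<chi> x} \<longrightarrow>
     (\<one>\<^bsub>G\<^esub>, b) \<in> joined G (g ` B) {x. \<chi> x \<le> c} \<or> (\<one>\<^bsub>G\<^esub>, a) \<in> joined G (g ` B) {x. 0 \<le> \<chi> x}"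
proof -
  interpret G: group G using pres by (simp add: presents_def)
  have g: "\<And>x. g x \<in> carrier G" and finR: "finite R"
    and R: "\<And>r. r \<in> R \<Longrightarrow> r \<in> words B \<and> eval_word G g r = \<one>\<^bsub>G\<^esub>"
    using pres by (auto simp: presents_def free_group_carrier)
  let ?S = "g ` B"
  have S: "?S \<subseteq> carrier G" using g by auto
  \<comment> \<open>A relator loop at \<open>q\<close> stays in \<open>?up\<close> if the height of
    \<open>q\<close> is at least the size of \<open>r\<close>, and otherwise it stays below twice
    that size. With this \<open>c\<close> every relator loop lies in one of the two half-spaces; the
    sum serves as an upper bound for all sizes.\<close>
  define c where "c = 2 * (\<Sum>r\<in>R. word_size G g \<chi> r)"
  have c: "2 * word_size G g \<chi> r \<le> c" if "r \<in> R" for r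
    using member_le_sum[OF that, of "word_size G g \<chi>"] finR word_size_nonneg by (auto simp: c_def)
  have c0: "0 \<le> c" by (auto simp: c_def intro!: sum_nonneg word_size_nonneg)
  let ?up = "{x. 0 \<le> \<chi> x}" and ?dn = "{x. \<chi> x \<le> c}"
  define V where "V = {h. (\<one>\<^bsub>G\<^esub>, h) \<in> joined G ?S ?up}"
  define U where "U = {h. (\<one>\<^bsub>G\<^esub>, h) \<in> joined G ?S ?dn}"
  define f :: "_ \<Rightarrow> int" where "f h = (if h \<in> U then 1 else 0)" for h
  \<comment> \<open>On edges inside \<open>V\<close> this is the difference of the indicator of
    \<open>U\<close> at the two ends. A path in \<open>?up\<close> cannot enter or leave
    \<open>V\<close>, so there the values add up to a difference at its ends. A path in
    \<open>?dn\<close> cannot enter or leave \<open>U\<close>, so there all values vanish.\<close>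
  define p where "p h x = (if h \<in> V \<and> h \<otimes>\<^bsub>G\<^esub> g x \<in> V then f (h \<otimes>\<^bsub>G\<^esub> g x) - f h else 0)" for h x
  interpret co: cocycle_data G integer_group g p
    by (intro cocycle_data.intro cocycle_data_axioms.intro G.group_axioms) (auto simp: g)
  have comp: "(\<one>\<^bsub>G\<^esub>, h) \<in> joined G ?S D \<longleftrightarrow> (\<one>\<^bsub>G\<^esub>, h \<otimes>\<^bsub>G\<^esub> letter_val G g l) \<in> joined G ?S D"
    if "h \<in> carrier G" "fst l \<in> B" "h \<in> D" "h \<otimes>\<^bsub>G\<^esub> letter_val G g l \<in> D" for h l D
  proof -
    have "letter_val G g l \<in> letters_of G ?S" using that by (auto simp: letter_val_def letters_of_def)
    then have "(h, h \<otimes>\<^bsub>G\<^esub> letter_val G g l) \<in> joined G ?S D" using that by (intro G.joined_edge)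
    then show ?thesis using G.joined_sym[OF S] G.joined_trans by meson
  qed
  have up: "co.coc h w = (if h \<in> V then f (h \<otimes>\<^bsub>G\<^esub> eval_word G g w) - f h else 0)"
    if "h \<in> carrier G" "w \<in> words B" "walk_in G g ?up h w" for h w
    using that
  proof (induction w arbitrary: h)
    case (Cons l w)
    let ?k = "h \<otimes>\<^bsub>G\<^esub> letter_val G g l"
    have k: "?k \<in> carrier G" using Cons.prems g by simp
    have "h \<in> V \<longleftrightarrow> ?k \<in> V" using comp[of h l ?up] Cons.prems by (simp add: V_def)
    moreover have "co.coc ?k w = (if ?k \<in> V then f (?k \<otimes>\<^bsub>G\<^esub> eval_word G g w) - f ?k else 0)"
      using Cons k by auto
    ultimately show ?case
      using Cons.prems g p_def[of h "fst l"] p_def[of ?k "fst l"]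
      by (auto simp: letter_val_def G.m_assoc)
  qed simp
  have dn: "co.coc h w = 0" if "h \<in> carrier G" "w \<in> words B" "walk_in G g ?dn h w" for h w
    using that
  proof (induction w arbitrary: h)
    case (Cons l w)
    let ?k = "h \<otimes>\<^bsub>G\<^esub> letter_val G g l"
    have k: "?k \<in> carrier G" using Cons.prems g by simp
    have "f h = f ?k" using comp[of h l ?dn] Cons.prems by (simp add: U_def f_def)
    moreover have "co.coc ?k w = 0" using Cons k by auto
    ultimately show ?case
      using Cons.prems g p_def[of h "fst l"] p_def[of ?k "fst l"]
      by (auto simp: letter_val_def G.m_assoc)
  qed simp
  have triv: "co.coc \<one>\<^bsub>G\<^esub> w = 0" if "w \<in> words B" "eval_word G g w = \<one>\<^bsub>G\<^esub>" for w
  proof -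
    have "co.coc \<one>\<^bsub>G\<^esub> w = \<one>\<^bsub>integer_group\<^esub>"
    proof (rule co.coc_trivial[OF pres])
      fix r q assume r: "r \<in> R" and q: "q \<in> carrier G"
      show "co.coc q r = \<one>\<^bsub>integer_group\<^esub>"
      proof (cases "word_size G g \<chi> r \<le> \<chi> q")
        case True
        then have "walk_in G g ?up q r" using g \<chi> q by (intro G.walk_in_above)
        then show ?thesis using up[OF q] R[OF r] q by simp
      next
        case False
        then have "walk_in G g ?dn q r" using g \<chi> q c[OF r] by (intro G.walk_in_below) auto
        then show ?thesis using dn[OF q] R[OF r] by simp
      qed
    qed (use that in auto)
    then show ?thesis by simp
  qed
  have "b \<in> U \<or> a \<in> V"
    if a: "a \<in> carrier G" "\<chi> a = 0" "a \<in> U" and b: "b \<in> carrier G" "\<chi> b = 0" "b \<in> V"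
      and ab: "a \<otimes>\<^bsub>G\<^esub> b = b \<otimes>\<^bsub>G\<^esub> a" for a b
  proof (rule ccontr)
    assume neg: "\<not> (b \<in> U \<or> a \<in> V)"
    obtain u where u: "u \<in> words B" "eval_word G g u = a" "walk_in G g ?dn \<one>\<^bsub>G\<^esub> u"
      using G.joined_walk[of g "\<one>\<^bsub>G\<^esub>" a B ?dn] g a by (auto simp: U_def)
    obtain v where v: "v \<in> words B" "eval_word G g v = b" "walk_in G g ?up \<one>\<^bsub>G\<^esub> v"
      using G.joined_walk[of g "\<one>\<^bsub>G\<^esub>" b B ?up] g b by (auto simp: V_def)
    have "walk_in G g ?dn (b \<otimes>\<^bsub>G\<^esub> \<one>\<^bsub>G\<^esub>) u"
      using u g b by (intro G.walk_in_translate[of g "\<one>\<^bsub>G\<^esub>" b ?dn]) (auto simp: G.add_hom_mult[OF \<chi>])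
    then have bu: "co.coc b u = 0" using dn b u by simp
    have "walk_in G g ?up (a \<otimes>\<^bsub>G\<^esub> \<one>\<^bsub>G\<^esub>) v"
      using v g a by (intro G.walk_in_translate[of g "\<one>\<^bsub>G\<^esub>" a ?up]) (auto simp: G.add_hom_mult[OF \<chi>])
    then have av: "co.coc a v = 0" using up[of a v] a v neg by simp
    have u1: "co.coc \<one>\<^bsub>G\<^esub> u = 0" using dn u by simp
    have v1: "co.coc \<one>\<^bsub>G\<^esub> v = -1"
      using up[of "\<one>\<^bsub>G\<^esub>" v] v b neg by (simp add: f_def V_def U_def)
    have iu: "co.coc (b \<otimes>\<^bsub>G\<^esub> a) (inv_word u) = - co.coc b u"
      using co.coc_inv_word[of b u] b u by simp
    have iv: "co.coc b (inv_word v) = - co.coc \<one>\<^bsub>G\<^esub> v"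
      using co.coc_inv_word[of "\<one>\<^bsub>G\<^esub>" v] b v by simp
    \<comment> \<open>The commutator loop has four sides. Both copies of \<open>u\<close> lie in
      \<open>?dn\<close> and contribute 0, and the copy of \<open>v\<close> at \<open>a\<close>
      contributes 0 because \<open>a\<close> is not in \<open>V\<close>. The copy of
      \<open>v\<close> at the unit leads out of \<open>U\<close>; it has value -1 and is run
      backwards.\<close>
    let ?w = "u @ v @ inv_word u @ inv_word v"
    have "co.coc \<one>\<^bsub>G\<^esub> ?w = co.coc \<one>\<^bsub>G\<^esub> u + (co.coc a v + (co.coc (a \<otimes>\<^bsub>G\<^esub> b) (inv_word u) +
        co.coc (a \<otimes>\<^bsub>G\<^esub> b \<otimes>\<^bsub>G\<^esub> inv\<^bsub>G\<^esub> a) (inv_word v)))"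
      using u v a b g by (simp add: co.coc_append G.eval_word_inv_word)
    also have "a \<otimes>\<^bsub>G\<^esub> b \<otimes>\<^bsub>G\<^esub> inv\<^bsub>G\<^esub> a = b" using a b by (simp add: ab G.m_assoc)
    finally have "co.coc \<one>\<^bsub>G\<^esub> ?w = 1" using u1 av bu iu iv v1 by (simp add: ab)
    moreover have "eval_word G g ?w = \<one>\<^bsub>G\<^esub>"
    proof -
      have "eval_word G g ?w = a \<otimes>\<^bsub>G\<^esub> b \<otimes>\<^bsub>G\<^esub> (inv\<^bsub>G\<^esub> a \<otimes>\<^bsub>G\<^esub> inv\<^bsub>G\<^esub> b)"
        using u v a b g by (simp add: G.eval_word_append G.eval_word_inv_word G.m_assoc)
      also have "inv\<^bsub>G\<^esub> a \<otimes>\<^bsub>G\<^esub> inv\<^bsub>G\<^esub> b = inv\<^bsub>G\<^esub> (a \<otimes>\<^bsub>G\<^esub> b)"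
        using a b by (simp add: ab G.inv_mult_group)
      finally show ?thesis using a b by simp
    qed
    moreover have "?w \<in> words B" using u v by (auto simp: inv_word_in_words)
    ultimately show False using triv by simp
  qed
  then show ?thesis using c0 by (intro exI[of _ c]) (auto simp: U_def V_def)
qed

text \<open>Conjugation by a high power \<open>z\<close> of a letter closes the gap between
  \<open>c\<close> and 0. If \<open>a0\<close> and \<open>b0\<close> violated both alternatives,
  then the conjugate of \<open>a0\<close> by the inverse of \<open>z\<close> would be joined to the
  unit below \<open>c\<close>, and the conjugate of \<open>b0\<close> by \<open>z\<close> above 0.
  Neither could be joined on the other side, since conjugating back would join \<open>a0\<close> or
  \<open>b0\<close>. This contradicts \<open>presents_commuting_joined\<close>.\<close>

lemma presents_commuting_normal_joined:
  assumes pres: "presents G B g R" and \<chi>: "add_hom G (\<chi> :: _ \<Rightarrow> real)"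
    and ne: "\<exists>x\<in>carrier G. \<chi> x \<noteq> 0"
    and N1: "N1 \<lhd> G" "\<And>x. x \<in> N1 \<Longrightarrow> \<chi> x = 0" and N2: "N2 \<lhd> G" "\<And>x. x \<in> N2 \<Longrightarrow> \<chi> x = 0"
    and comm: "\<And>x y. x \<in> N1 \<Longrightarrow> y \<in> N2 \<Longrightarrow> x \<otimes>\<^bsub>G\<^esub> y = y \<otimes>\<^bsub>G\<^esub> x"
  shows "(\<forall>a\<in>N1. (\<one>\<^bsub>G\<^esub>, a) \<in> joined G (g ` B) {x. 0 \<le> \<chi> x}) \<or>
    (\<forall>b\<in>N2. (\<one>\<^bsub>G\<^esub>, b) \<in> joined G (g ` B) {x. \<chi> x \<le> 0})"
proof (rule ccontr)
  let ?S = "g ` B"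
  assume "\<not> ?thesis"
  then obtain a0 b0 where a0: "a0 \<in> N1" "(\<one>\<^bsub>G\<^esub>, a0) \<notin> joined G ?S {x. 0 \<le> \<chi> x}"
    and b0: "b0 \<in> N2" "(\<one>\<^bsub>G\<^esub>, b0) \<notin> joined G ?S {x. \<chi> x \<le> 0}" by blast
  interpret G: group G using pres by (simp add: presents_def)
  interpret N1: normal N1 G by fact
  interpret N2: normal N2 G by fact
  have S: "?S \<subseteq> carrier G" and gen: "generate G ?S = carrier G"
    using pres by (auto simp: presents_def)
  note hm = G.add_hom_mult[OF \<chi>] and hi = G.add_hom_inv[OF \<chi>] and hp = G.add_hom_nat_pow[OF \<chi>]
  obtain c where c: "c \<ge> 0" and sep: "\<And>a b. \<lbrakk>a \<in> carrier G; b \<in> carrier G;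
      a \<otimes>\<^bsub>G\<^esub> b = b \<otimes>\<^bsub>G\<^esub> a; \<chi> a = 0; \<chi> b = 0; (\<one>\<^bsub>G\<^esub>, a) \<in> joined G ?S {x. \<chi> x \<le> c};
      (\<one>\<^bsub>G\<^esub>, b) \<in> joined G ?S {x. 0 \<le> \<chi> x}\<rbrakk> \<Longrightarrow>
      (\<one>\<^bsub>G\<^esub>, b) \<in> joined G ?S {x. \<chi> x \<le> c} \<or> (\<one>\<^bsub>G\<^esub>, a) \<in> joined G ?S {x. 0 \<le> \<chi> x}"
    using presents_commuting_joined[OF pres \<chi>] by blast
  obtain y where "y \<in> ?S" "\<chi> y \<noteq> 0"
    using ne G.add_hom_eq_0_on_generate[OF \<chi> S] gen by blast
  then obtain s where s: "s \<in> letters_of G ?S" "\<chi> s > 0"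
  proof (cases "\<chi> y > 0")
    case True
    then show ?thesis using that \<open>y \<in> ?S\<close> by (auto simp: letters_of_def)
  next
    case False
    then have "\<chi> (inv\<^bsub>G\<^esub> y) > 0" using \<open>y \<in> ?S\<close> \<open>\<chi> y \<noteq> 0\<close> S hi by auto
    then show ?thesis using that[of "inv\<^bsub>G\<^esub> y"] \<open>y \<in> ?S\<close> by (auto simp: letters_of_def)
  qed
  have sc: "s \<in> carrier G" using s S G.letters_of_closed by blast
  have sk: "(\<one>\<^bsub>G\<^esub>, s [^]\<^bsub>G\<^esub> (k::nat)) \<in> joined G ?S {x. 0 \<le> \<chi> x}" for k
    using G.joined_pow[OF \<chi> S s(1)] s(2) by simp
  have sk': "(\<one>\<^bsub>G\<^esub>, inv\<^bsub>G\<^esub> (s [^]\<^bsub>G\<^esub> (k::nat))) \<in> joined G ?S {x. \<chi> x \<le> 0}" for k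
  proof -
    have "add_hom G (\<lambda>x. - \<chi> x)" using \<chi> by (auto simp: add_hom_def)
    moreover have "inv\<^bsub>G\<^esub> s \<in> letters_of G ?S" using S s(1) by (rule G.letters_of_inv)
    ultimately have "(\<one>\<^bsub>G\<^esub>, (inv\<^bsub>G\<^esub> s) [^]\<^bsub>G\<^esub> k) \<in> joined G ?S {x. 0 \<le> - \<chi> x}"
      using s(2) S sc by (intro G.joined_pow) (auto simp: hi)
    then show ?thesis using sc by (simp add: G.nat_pow_inv)
  qed
  obtain M1 where M1: "(\<one>\<^bsub>G\<^esub>, a0) \<in> joined G ?S {x. M1 \<le> - \<chi> x}"
    using G.joined_above[OF S gen, of a0 "\<lambda>x. - \<chi> x"] a0 by auto
  obtain M2 where M2: "(\<one>\<^bsub>G\<^esub>, b0) \<in> joined G ?S {x. M2 \<le> \<chi> x}"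
    using G.joined_above[OF S gen, of b0 "\<chi>"] b0 by auto
  \<comment> \<open>Three requirements on the height of \<open>z\<close>: the path for
    \<open>a0\<close> moved down by it comes to lie at most at 0, the path for \<open>b0\<close>
    moved up at least at 0, and level \<open>c\<close> moved down at most at 0.\<close>
  obtain k :: nat where k: "- M1 \<le> real k * \<chi> s" "- M2 \<le> real k * \<chi> s" "c \<le> real k * \<chi> s"
  proof -
    obtain k :: nat where "max (max (- M1) (- M2)) c < real k * \<chi> s"
      using reals_Archimedean3[OF s(2)] by blast
    then show ?thesis by (intro that[of k]) auto
  qed
  let ?z = "s [^]\<^bsub>G\<^esub> k"
  have z: "?z \<in> carrier G" using sc by simp
  define a where "a = inv\<^bsub>G\<^esub> ?z \<otimes>\<^bsub>G\<^esub> a0 \<otimes>\<^bsub>G\<^esub> ?z"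
  define b where "b = ?z \<otimes>\<^bsub>G\<^esub> b0 \<otimes>\<^bsub>G\<^esub> inv\<^bsub>G\<^esub> ?z"
  have ac: "a \<in> N1" unfolding a_def using z a0 N1.inv_op_closed1 by simp
  have bc: "b \<in> N2" unfolding b_def using z b0 N2.inv_op_closed2 by simp
  have a0_eq: "?z \<otimes>\<^bsub>G\<^esub> a \<otimes>\<^bsub>G\<^esub> inv\<^bsub>G\<^esub> ?z = a0"
    using z a0 N1.subset by (auto simp: a_def G.m_assoc[symmetric]) (auto simp: G.m_assoc)
  have b0_eq: "inv\<^bsub>G\<^esub> ?z \<otimes>\<^bsub>G\<^esub> b \<otimes>\<^bsub>G\<^esub> ?z = b0"
    using z b0 N2.subset by (auto simp: b_def G.m_assoc[symmetric]) (auto simp: G.m_assoc)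
  have "(\<one>\<^bsub>G\<^esub>, inv\<^bsub>G\<^esub> ?z \<otimes>\<^bsub>G\<^esub> a0 \<otimes>\<^bsub>G\<^esub> inv\<^bsub>G\<^esub> (inv\<^bsub>G\<^esub> ?z)) \<in> joined G ?S {x. \<chi> x \<le> c}"
  proof (rule G.joined_conj[OF S _ _ _ M1])
    show "(\<one>\<^bsub>G\<^esub>, inv\<^bsub>G\<^esub> ?z) \<in> joined G ?S {x. \<chi> x \<le> c}"
      using sk' c by (intro G.joined_mono[OF sk']) auto
    show "inv\<^bsub>G\<^esub> ?z \<otimes>\<^bsub>G\<^esub> a0 \<otimes>\<^bsub>G\<^esub> inv\<^bsub>G\<^esub> (inv\<^bsub>G\<^esub> ?z) \<otimes>\<^bsub>G\<^esub> x \<in> {x. \<chi> x \<le> c}"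
      if "x \<in> {x. \<chi> x \<le> c}" "x \<in> carrier G" for x
      using that z a0 N1 by (simp add: hm hi)
  qed (use z a0 c k in \<open>auto simp: hm hi hp sc\<close>)
  then have a1: "(\<one>\<^bsub>G\<^esub>, a) \<in> joined G ?S {x. \<chi> x \<le> c}" using z by (simp add: a_def)
  have b1: "(\<one>\<^bsub>G\<^esub>, b) \<in> joined G ?S {x. 0 \<le> \<chi> x}"
    unfolding b_def
    by (rule G.joined_conj[OF S _ _ sk M2]) (use z b0 N2 k in \<open>auto simp: hm hi hp sc\<close>)
  have a2: "(\<one>\<^bsub>G\<^esub>, a) \<notin> joined G ?S {x. 0 \<le> \<chi> x}"
  proof
    assume *: "(\<one>\<^bsub>G\<^esub>, a) \<in> joined G ?S {x. 0 \<le> \<chi> x}"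
    have "(\<one>\<^bsub>G\<^esub>, ?z \<otimes>\<^bsub>G\<^esub> a \<otimes>\<^bsub>G\<^esub> inv\<^bsub>G\<^esub> ?z) \<in> joined G ?S {x. 0 \<le> \<chi> x}"
      by (rule G.joined_conj[OF S _ _ sk *]) (use z ac N1 s in \<open>auto simp: hm hi hp sc\<close>)
    then show False using a0 a0_eq by simp
  qed
  have b2: "(\<one>\<^bsub>G\<^esub>, b) \<notin> joined G ?S {x. \<chi> x \<le> c}"
  proof
    assume *: "(\<one>\<^bsub>G\<^esub>, b) \<in> joined G ?S {x. \<chi> x \<le> c}"
    have "(\<one>\<^bsub>G\<^esub>, inv\<^bsub>G\<^esub> ?z \<otimes>\<^bsub>G\<^esub> b \<otimes>\<^bsub>G\<^esub> inv\<^bsub>G\<^esub> (inv\<^bsub>G\<^esub> ?z)) \<in> joined G ?S {x. \<chi> x \<le> 0}"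
      by (rule G.joined_conj[OF S _ _ sk' *]) (use z bc N2 k in \<open>auto simp: hm hi hp sc\<close>)
    then show False using b0 b0_eq z by simp
  qed
  show False
    using sep[of a b] ac bc N1 N2 comm a1 a2 b1 b2 by auto
qed

section \<open>The Bieri--Neumann--Strebel invariant\<close>

text \<open>
  Membership of the character \<open>\<chi>\<close> in the Bieri--Neumann--Strebel invariant, for characters
  vanishing on a subgroup \<open>N\<close> that contains the commutator subgroup.
\<close>

definition in_BNS :: "('a, 'b) monoid_scheme \<Rightarrow> 'a set \<Rightarrow> ('a \<Rightarrow> real) \<Rightarrow> bool" where
  "in_BNS G N \<chi> \<longleftrightarrow> (\<exists>S. finite S \<and> S \<subseteq> carrier G \<and> (\<forall>n\<in>N. (\<one>\<^bsub>G\<^esub>, n) \<in> joined G S {x. 0 \<le> \<chi> x}))"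

lemma in_BNS_scale:
  assumes "c > 0" shows "in_BNS G N (\<lambda>x. c * \<chi> x) \<longleftrightarrow> in_BNS G N \<chi>"
  using assms by (simp add: in_BNS_def zero_le_mult_iff)

section \<open>Pushing paths, openness, and finitely generated kernels\<close>

context group
begin

text \<open>\<open>y t inv y\<close> is \<open>t\<close> times a commutator, which is joined to the
  unit at nonnegative height; one more letter \<open>y\<close> leads to \<open>y t\<close>. All
  larger sets \<open>S'\<close> are covered, because \<open>t\<close> and a generating set are added
  afterwards.\<close>

lemma in_BNS_push:
  assumes \<chi>: "add_hom G \<chi>" and BNS: "in_BNS G N \<chi>"
    and comm: "\<And>x y. x \<in> carrier G \<Longrightarrow> y \<in> carrier G \<Longrightarrow> x \<otimes> y \<otimes> inv x \<otimes> inv y \<in> N"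
    and t: "t \<in> carrier G"
  shows "\<exists>S. finite S \<and> S \<subseteq> carrier G \<and> (\<forall>S' y. S \<subseteq> S' \<longrightarrow> S' \<subseteq> carrier G \<longrightarrow> y \<in> letters_of G S' \<longrightarrow>
     (t, y \<otimes> t) \<in> joined G S' {x. \<chi> t + min 0 (\<chi> y) \<le> \<chi> x})"
proof -
  obtain S where S: "finite S" "S \<subseteq> carrier G" "\<And>n. n \<in> N \<Longrightarrow> (\<one>, n) \<in> joined G S {x. 0 \<le> \<chi> x}"
    using BNS by (auto simp: in_BNS_def)
  have "(t, y \<otimes> t) \<in> joined G S' {x. \<chi> t + min 0 (\<chi> y) \<le> \<chi> x}"
    if S': "S \<subseteq> S'" "S' \<subseteq> carrier G" and y: "y \<in> letters_of G S'" for S' y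
  proof -
    have yc: "y \<in> carrier G" using letters_of_closed S' y by blast
    let ?n = "inv t \<otimes> y \<otimes> inv (inv t) \<otimes> inv y"
    have n: "?n \<in> N" using comm[of "inv t" y] t yc by simp
    have "(\<one>, ?n) \<in> joined G S' {x. 0 \<le> \<chi> x}"
      using S(3)[OF n] S' by (intro joined_mono[OF S(3)[OF n]]) auto
    then have "(t \<otimes> \<one>, t \<otimes> ?n) \<in> joined G S' {x. \<chi> t + min 0 (\<chi> y) \<le> \<chi> x}"
      using S' t by (intro joined_translate[where D = "{x. 0 \<le> \<chi> x}"]) (auto simp: add_hom_mult[OF \<chi>])
    moreover have "t \<otimes> ?n = y \<otimes> t \<otimes> inv y" using t yc by (simp add: m_assoc[symmetric])
    moreover have "(y \<otimes> t \<otimes> inv y, y \<otimes> t \<otimes> inv y \<otimes> y) \<in> joined G S' {x. \<chi> t + min 0 (\<chi> y) \<le> \<chi> x}"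
      using t yc y by (intro joined_edge) (auto simp: add_hom_mult[OF \<chi>] add_hom_inv[OF \<chi>])
    ultimately show ?thesis using t yc by (auto simp: m_assoc intro: joined_trans)
  qed
  then show ?thesis using S by blast
qed

text \<open>Right multiplication by \<open>t\<close> raises a path by \<open>\<epsilon>\<close>:
  each edge with label \<open>y\<close> is replaced by a translate of the path from \<open>t\<close>
  to \<open>y t\<close>. The term \<open>min 0 (\<chi> y)\<close> allows for descending edges, whose
  lower end is at least at \<open>c\<close> as well.\<close>

lemma push_joined:
  assumes \<chi>: "add_hom G (\<chi> :: _ \<Rightarrow> real)" and S: "S \<subseteq> carrier G" and t: "t \<in> carrier G"
    and push: "\<And>y. y \<in> letters_of G S \<Longrightarrow> (t, y \<otimes> t) \<in> joined G S {x. \<epsilon> + min 0 (\<chi> y) \<le> \<chi> x}"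
    and gh: "(g, h) \<in> joined G S {x. c \<le> \<chi> x}" and g: "g \<in> carrier G"
  shows "(g \<otimes> t, h \<otimes> t) \<in> joined G S {x. c + \<epsilon> \<le> \<chi> x}"
  using gh g
proof (induction rule: joined_induct)
  case (step x y)
  have yc: "y \<in> carrier G" using letters_of_closed S step by blast
  have "(x \<otimes> t, x \<otimes> (y \<otimes> t)) \<in> joined G S {x. c + \<epsilon> \<le> \<chi> x}"
    using push[of y] step yc S t
    by (intro joined_translate[where D = "{x. \<epsilon> + min 0 (\<chi> y) \<le> \<chi> x}"])
       (auto simp: add_hom_mult[OF \<chi>])
  then show ?case using step yc t by (auto simp: m_assoc intro: joined_trans)
qed simp

text \<open>Repeated pushing lifts an arbitrary path from the unit to \<open>g\<close> above 0, with
  both ends moved by a power of \<open>t\<close>. The ends are connected to the original ones by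
  ascending along powers of \<open>t\<close>.\<close>

lemma push_joined_half_space:
  assumes \<chi>: "add_hom G (\<chi> :: _ \<Rightarrow> real)" and S: "S \<subseteq> carrier G" "generate G S = carrier G"
    and t: "t \<in> letters_of G S" "0 \<le> \<chi> t" and \<epsilon>: "\<epsilon> > 0"
    and push: "\<And>y. y \<in> letters_of G S \<Longrightarrow> (t, y \<otimes> t) \<in> joined G S {x. \<epsilon> + min 0 (\<chi> y) \<le> \<chi> x}"
    and g: "g \<in> carrier G" "0 \<le> \<chi> g"
  shows "(\<one>, g) \<in> joined G S {x. 0 \<le> \<chi> x}"
proof -
  have tc: "t \<in> carrier G" using t S letters_of_closed by blast
  obtain M where M: "(\<one>, g) \<in> joined G S {x. M \<le> \<chi> x}" using joined_above[OF S g(1)] by blast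
  obtain k :: nat where k: "- M < real k * \<epsilon>" using reals_Archimedean3[OF \<epsilon>] by blast
  have "(\<one> \<otimes> t [^] k, g \<otimes> t [^] k) \<in> joined G S {x. M + real k * \<epsilon> \<le> \<chi> x}" for k :: nat
  proof (induction k)
    case (Suc k)
    have "(\<one> \<otimes> t [^] k \<otimes> t, g \<otimes> t [^] k \<otimes> t) \<in> joined G S {x. M + real k * \<epsilon> + \<epsilon> \<le> \<chi> x}"
      by (rule push_joined[OF \<chi> S(1) tc push Suc]) (use tc in auto)
    then show ?case using tc g by (simp add: m_assoc algebra_simps)
  qed (use M g in simp)
  then have "(\<one> \<otimes> t [^] k, g \<otimes> t [^] k) \<in> joined G S {x. 0 \<le> \<chi> x}"
    by (rule joined_mono) (use k in auto)
  then have 2: "(t [^] k, g \<otimes> t [^] k) \<in> joined G S {x. 0 \<le> \<chi> x}" using tc by simp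
  have 1: "(\<one>, t [^] k) \<in> joined G S {x. 0 \<le> \<chi> x}" by (rule joined_pow[OF \<chi> S(1) t])
  have "(g \<otimes> \<one>, g \<otimes> t [^] k) \<in> joined G S {x. 0 \<le> \<chi> x}"
    using 1 S g by (intro joined_translate[where D = "{x. 0 \<le> \<chi> x}"]) (auto simp: add_hom_mult[OF \<chi>])
  then have 3: "(g \<otimes> t [^] k, g) \<in> joined G S {x. 0 \<le> \<chi> x}"
    using joined_sym[OF S(1)] g by simp
  show ?thesis using 1 2 3 joined_trans by blast
qed

text \<open>The push condition consists of finitely many finite paths with positive gain
  \<open>\<chi> t\<close>. It survives a small change of the character with a smaller gain, and
  \<open>push_joined_half_space\<close> recovers membership from it.\<close>

lemma in_BNS_open:
  assumes h1: "add_hom G \<chi>1" and h2: "add_hom G \<chi>2"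
    and BNS: "in_BNS G N (\<lambda>x. \<alpha> * \<chi>1 x + \<beta> * \<chi>2 x)"
    and ne: "\<exists>x\<in>carrier G. \<alpha> * \<chi>1 x + \<beta> * \<chi>2 x \<noteq> 0"
    and N: "N \<subseteq> carrier G" "\<And>n. n \<in> N \<Longrightarrow> \<chi>1 n = 0" "\<And>n. n \<in> N \<Longrightarrow> \<chi>2 n = 0"
    and comm: "\<And>x y. x \<in> carrier G \<Longrightarrow> y \<in> carrier G \<Longrightarrow> x \<otimes> y \<otimes> inv x \<otimes> inv y \<in> N"
    and fg: "finite S0" "S0 \<subseteq> carrier G" "generate G S0 = carrier G"
  shows "\<exists>\<delta>>0. \<forall>\<alpha>' \<beta>'. \<bar>\<alpha>' - \<alpha>\<bar> < \<delta> \<longrightarrow> \<bar>\<beta>' - \<beta>\<bar> < \<delta> \<longrightarrow> in_BNS G N (\<lambda>x. \<alpha>' * \<chi>1 x + \<beta>' * \<chi>2 x)"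
proof -
  define \<chi> where "\<chi> = (\<lambda>x. \<alpha> * \<chi>1 x + \<beta> * \<chi>2 x)"
  have hom: "add_hom G (\<lambda>x. a * \<chi>1 x + b * \<chi>2 x)" for a b
    using h1 h2 by (auto simp: add_hom_def algebra_simps)
  then have \<chi>: "add_hom G \<chi>" by (simp add: \<chi>_def)
  obtain x where x: "x \<in> carrier G" "\<chi> x \<noteq> 0" using ne by (auto simp: \<chi>_def)
  obtain t where t: "t \<in> carrier G" "\<chi> t > 0"
  proof (cases "\<chi> x > 0")
    case False
    then show ?thesis using that[of "inv x"] x by (simp add: add_hom_inv[OF \<chi>])
  qed (use that x in auto)
  obtain S1 where S1: "finite S1" "S1 \<subseteq> carrier G"
    and push1: "\<And>S' y. S1 \<subseteq> S' \<Longrightarrow> S' \<subseteq> carrier G \<Longrightarrow> y \<in> letters_of G S' \<Longrightarrow>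
      (t, y \<otimes> t) \<in> joined G S' {x. \<chi> t + min 0 (\<chi> y) \<le> \<chi> x}"
    using in_BNS_push[OF \<chi> _ comm t(1)] BNS unfolding \<chi>_def by blast
  define S where "S = insert t (S0 \<union> S1)"
  have S: "finite S" "S \<subseteq> carrier G" using S1 fg t by (auto simp: S_def)
  have genS: "generate G S = carrier G"
    using mono_generate[of S0 S] fg generate_incl[OF S(2)] by (auto simp: S_def)
  have "\<exists>F. finite F \<and> (t, y \<otimes> t) \<in> joined G S ({x. \<chi> t + min 0 (\<chi> y) \<le> \<chi> x} \<inter> F)"
    if "y \<in> letters_of G S" for y
    using joined_finite[OF push1[of S y] t(1)] that S by (auto simp: S_def)
  then obtain F where F: "\<And>y. y \<in> letters_of G S \<Longrightarrow> finite (F y)"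
    "\<And>y. y \<in> letters_of G S \<Longrightarrow> (t, y \<otimes> t) \<in> joined G S ({x. \<chi> t + min 0 (\<chi> y) \<le> \<chi> x} \<inter> F y)"
    by metis
  define A where "A = letters_of G S \<union> (\<Union>y\<in>letters_of G S. F y)"
  have finA: "finite A" using F S finite_letters_of by (auto simp: A_def)
  define M where "M = 1 + (\<Sum>x\<in>A. \<bar>\<chi>1 x\<bar> + \<bar>\<chi>2 x\<bar>)"
  have M: "\<bar>\<chi>1 x\<bar> \<le> M" "\<bar>\<chi>2 x\<bar> \<le> M" if "x \<in> A" for x
    using member_le_sum[OF that, of "\<lambda>x. \<bar>\<chi>1 x\<bar> + \<bar>\<chi>2 x\<bar>"] finA by (auto simp: M_def)
  have M0: "M \<ge> 1" by (auto simp: M_def intro: sum_nonneg)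
  \<comment> \<open>Chosen so that no height on \<open>A\<close> changes by more than a quarter of
    the gain. Two such changes, at the vertex and inside the minimum, leave half of the gain, of
    which a quarter is claimed.\<close>
  define \<delta> where "\<delta> = \<chi> t / (8 * M)"
  have \<delta>: "\<delta> > 0" "2 * M * \<delta> = \<chi> t / 4" using t M0 by (auto simp: \<delta>_def field_simps)
  have tS: "t \<in> letters_of G S" by (auto simp: S_def letters_of_def)
  have "in_BNS G N (\<lambda>x. a * \<chi>1 x + b * \<chi>2 x)" if ab: "\<bar>a - \<alpha>\<bar> < \<delta>" "\<bar>b - \<beta>\<bar> < \<delta>" for a b
  proof -
    let ?c = "\<lambda>x. a * \<chi>1 x + b * \<chi>2 x"
    have near: "\<bar>?c x - \<chi> x\<bar> \<le> \<chi> t / 4" if "x \<in> A" for x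
    proof -
      have "?c x - \<chi> x = (a - \<alpha>) * \<chi>1 x + (b - \<beta>) * \<chi>2 x" by (simp add: \<chi>_def algebra_simps)
      also have "\<bar>\<dots>\<bar> \<le> \<bar>a - \<alpha>\<bar> * \<bar>\<chi>1 x\<bar> + \<bar>b - \<beta>\<bar> * \<bar>\<chi>2 x\<bar>"
        by (metis abs_mult abs_triangle_ineq)
      also have "\<dots> \<le> \<delta> * M + \<delta> * M"
        using ab M[OF that] by (intro add_mono mult_mono) auto
      finally show ?thesis using \<delta>(2) by (simp add: algebra_simps)
    qed
    have "(\<one>, n) \<in> joined G S {x. 0 \<le> ?c x}" if n: "n \<in> N" for n
    proof (rule push_joined_half_space[OF hom S(2) genS tS, where \<epsilon> = "\<chi> t / 4"])
      have "\<bar>?c t - \<chi> t\<bar> \<le> \<chi> t / 4" using near[of t] tS by (auto simp: A_def)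
      then show "0 \<le> ?c t" using t(2) by linarith
      show "0 < \<chi> t / 4" using t by simp
      show "n \<in> carrier G" "0 \<le> ?c n" using n N by auto
      fix y assume y: "y \<in> letters_of G S"
      show "(t, y \<otimes> t) \<in> joined G S {x. \<chi> t / 4 + min 0 (?c y) \<le> ?c x}"
      proof (rule joined_mono[OF F(2)[OF y]])
        have ny: "\<bar>?c y - \<chi> y\<bar> \<le> \<chi> t / 4" using near[of y] y by (auto simp: A_def)
        show "{x. \<chi> t + min 0 (\<chi> y) \<le> \<chi> x} \<inter> F y \<subseteq> {x. \<chi> t / 4 + min 0 (?c y) \<le> ?c x}"
        proof clarify
          fix x assume x: "\<chi> t + min 0 (\<chi> y) \<le> \<chi> x" "x \<in> F y"
          have "\<bar>?c x - \<chi> x\<bar> \<le> \<chi> t / 4" using near[of x] x y by (auto simp: A_def)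
          then show "\<chi> t / 4 + min 0 (?c y) \<le> ?c x" using x(1) ny t(2) unfolding min_def abs_le_iff
            by (auto split: if_splits)
        qed
      qed simp
    qed
    then show ?thesis using S by (auto simp: in_BNS_def)
  qed
  then show ?thesis using \<delta> by blast
qed

text \<open>The top of the strip is lowered by one: a vertex on level \<open>M\<close> is replaced
  by its neighbour one level below, and an edge at such a vertex by a translate of the pushed
  path.\<close>

lemma joined_descend:
  fixes \<chi> :: "'a \<Rightarrow> int" and C M :: int
  assumes \<chi>: "add_hom G \<chi>" and S: "S \<subseteq> carrier G" and t: "t \<in> S" "\<chi> t = 1"
    and push: "\<And>y. y \<in> letters_of G S \<Longrightarrow>
      (inv t, y \<otimes> inv t) \<in> joined G S {x. - C \<le> \<chi> x \<and> \<chi> x \<le> max 0 (\<chi> y) - 1}"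
    and C: "C \<ge> 0" "\<And>y. y \<in> letters_of G S \<Longrightarrow> \<bar>\<chi> y\<bar> \<le> C" and M: "M \<ge> C + 1"
    and gh: "(g, h) \<in> joined G S {x. 0 \<le> \<chi> x \<and> \<chi> x \<le> M}" and g: "g \<in> carrier G"
  defines "d \<equiv> \<lambda>x. if \<chi> x = M then x \<otimes> inv t else x"
  shows "(d g, d h) \<in> joined G S {x. 0 \<le> \<chi> x \<and> \<chi> x \<le> M - 1}"
  using gh g
proof (induction rule: joined_induct)
  case (step x y)
  let ?D = "{x. 0 \<le> \<chi> x \<and> \<chi> x \<le> M - 1}"
  note hm = add_hom_mult[OF \<chi>] and hi = add_hom_inv[OF \<chi>]
  have tc: "t \<in> carrier G" using t S by auto
  have yc: "y \<in> carrier G" using letters_of_closed S step by blast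
  have tl: "t \<in> letters_of G S" "inv t \<in> letters_of G S" using t by (auto simp: letters_of_def)
  \<comment> \<open>Edges leaving the top level; edges arriving there are reversed. The translated
    path stays between \<open>M - C\<close> and \<open>M - 1\<close>. The remaining edge from
    \<open>x y inv t\<close> to \<open>x y\<close> may start at level \<open>M - C - 1\<close>,
    whence the bound \<open>C + 1\<close> for \<open>M\<close>.\<close>
  have key: "(x \<otimes> inv t, d (x \<otimes> y)) \<in> joined G S ?D"
    if x: "x \<in> carrier G" "\<chi> x = M" and y: "y \<in> letters_of G S" "0 \<le> M + \<chi> y" "M + \<chi> y \<le> M" for x y
  proof -
    have yc: "y \<in> carrier G" using letters_of_closed S y by blast
    have "(x \<otimes> inv t, x \<otimes> (y \<otimes> inv t)) \<in> joined G S ?D"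
      using push[OF y(1)] x y S tc M
      by (intro joined_translate[where D = "{x. - C \<le> \<chi> x \<and> \<chi> x \<le> max 0 (\<chi> y) - 1}"]) (auto simp: hm)
    moreover have "(x \<otimes> y \<otimes> inv t, d (x \<otimes> y)) \<in> joined G S ?D"
    proof (cases "\<chi> (x \<otimes> y) = M")
      case False
      have "(x \<otimes> y \<otimes> inv t, x \<otimes> y \<otimes> inv t \<otimes> t) \<in> joined G S ?D"
        using x y yc tc tl t M C(2)[OF y(1)] False by (intro joined_edge) (auto simp: hm hi)
      then show ?thesis using False x yc tc by (simp add: d_def m_assoc)
    qed (simp add: d_def)
    ultimately show ?thesis using x yc tc by (auto simp: m_assoc intro: joined_trans)
  qed
  have "(d x, d (x \<otimes> y)) \<in> joined G S ?D"
  proof (cases "\<chi> x = M")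
    case True
    then show ?thesis using key[of x y] step yc by (auto simp: d_def hm)
  next
    case False
    show ?thesis
    proof (cases "\<chi> (x \<otimes> y) = M")
      case True
      have "(x \<otimes> y \<otimes> inv t, d (x \<otimes> y \<otimes> inv y)) \<in> joined G S ?D"
        using step yc True letters_of_inv[OF S] by (intro key) (auto simp: hm hi)
      then show ?thesis using True False step yc joined_sym[OF S]
        by (auto simp: d_def m_assoc)
    next
      case False
      then show ?thesis using \<open>\<chi> x \<noteq> M\<close> step by (auto simp: d_def intro!: joined_edge)
    qed
  qed
  then show ?case using step by (auto intro: joined_trans)
qed simp

text \<open>Each edge contributes one factor \<open>t^i y t^-j\<close>, where \<open>i\<close> and
  \<open>j\<close> are the heights of its ends, and the product telescopes. For finite
  \<open>S\<close> a strip yields finitely many such factors.\<close>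

lemma joined_strip_generates:
  fixes \<chi> :: "'a \<Rightarrow> int" and L :: int
  assumes \<chi>: "add_hom G \<chi>" and S: "S \<subseteq> carrier G" and t: "t \<in> carrier G" "\<chi> t = 1"
    and g: "(\<one>, g) \<in> joined G S {x. 0 \<le> \<chi> x \<and> \<chi> x \<le> L}"
    and Z: "\<And>i j y. \<lbrakk>i \<in> {0..L}; j \<in> {0..L}; y \<in> letters_of G S; i + \<chi> y = j\<rbrakk> \<Longrightarrow>
      t [^] i \<otimes> y \<otimes> t [^] (- j) \<in> Z"
  shows "g \<otimes> t [^] (- \<chi> g) \<in> generate G Z"
  using g one_closed
proof (induction rule: joined_induct)
  case refl
  show ?case using add_hom_one[OF \<chi>] generate.one by simp
next
  case (step x y)
  have yc: "y \<in> carrier G" using letters_of_closed S step by blast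
  have hm: "\<chi> (x \<otimes> y) = \<chi> x + \<chi> y" using add_hom_mult[OF \<chi>] step yc by simp
  have "t [^] \<chi> x \<otimes> y \<otimes> t [^] (- \<chi> (x \<otimes> y)) \<in> generate G Z"
    using step by (intro generate.incl Z) (auto simp: hm)
  then have "(x \<otimes> t [^] (- \<chi> x)) \<otimes> (t [^] \<chi> x \<otimes> y \<otimes> t [^] (- \<chi> (x \<otimes> y))) \<in> generate G Z"
    using step by (intro generate.eng[of "x \<otimes> t [^] (- \<chi> x)"]) auto
  moreover have "(x \<otimes> t [^] (- \<chi> x)) \<otimes> (t [^] \<chi> x \<otimes> y \<otimes> t [^] (- \<chi> (x \<otimes> y))) =
      x \<otimes> y \<otimes> t [^] (- \<chi> (x \<otimes> y))"
    using step yc t by (simp add: m_assoc int_pow_neg inv_solve_left')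
  ultimately show ?case by simp
qed

text \<open>Membership of \<open>\<chi>\<close> lifts a path to an element of the kernel above 0.
  Membership of its negative lowers the top of this path level by level to the height
  \<open>C + 1\<close>, which does not depend on the element. The edges of this strip supply the
  generators.\<close>

lemma in_BNS_both_imp_kernel_finitely_generated:
  fixes \<chi> :: "'a \<Rightarrow> int"
  assumes \<chi>: "add_hom G \<chi>" and t: "t \<in> carrier G" "\<chi> t = 1"
    and BNS: "in_BNS G N (\<lambda>x. real_of_int (\<chi> x))" "in_BNS G N (\<lambda>x. - real_of_int (\<chi> x))"
    and comm: "\<And>x y. x \<in> carrier G \<Longrightarrow> y \<in> carrier G \<Longrightarrow> x \<otimes> y \<otimes> inv x \<otimes> inv y \<in> N"
    and fg: "finite S0" "S0 \<subseteq> carrier G" "generate G S0 = carrier G"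
  shows "\<exists>Z. finite Z \<and> Z \<subseteq> {x \<in> carrier G. \<chi> x = 0} \<and> {x \<in> carrier G. \<chi> x = 0} \<subseteq> generate G Z"
proof -
  note hm = add_hom_mult[OF \<chi>] and hi = add_hom_inv[OF \<chi>] and hp = add_hom_int_pow[OF \<chi>]
  have h1: "add_hom G (\<lambda>x. real_of_int (\<chi> x))" and h2: "add_hom G (\<lambda>x. - real_of_int (\<chi> x))"
    using \<chi> by (auto simp: add_hom_def)
  obtain S1 where S1: "finite S1" "S1 \<subseteq> carrier G"
    and push1: "\<And>S' y. S1 \<subseteq> S' \<Longrightarrow> S' \<subseteq> carrier G \<Longrightarrow> y \<in> letters_of G S' \<Longrightarrow>
      (t, y \<otimes> t) \<in> joined G S' {x. real_of_int (\<chi> t) + min 0 (real_of_int (\<chi> y)) \<le> real_of_int (\<chi> x)}"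
    using in_BNS_push[OF h1 BNS(1) comm t(1)] by blast
  obtain S2 where S2: "finite S2" "S2 \<subseteq> carrier G"
    and push2: "\<And>S' y. S2 \<subseteq> S' \<Longrightarrow> S' \<subseteq> carrier G \<Longrightarrow> y \<in> letters_of G S' \<Longrightarrow>
      (inv t, y \<otimes> inv t) \<in> joined G S'
        {x. - real_of_int (\<chi> (inv t)) + min 0 (- real_of_int (\<chi> y)) \<le> - real_of_int (\<chi> x)}"
    using in_BNS_push[OF h2 BNS(2) comm, of "inv t"] t(1) by blast
  define S where "S = insert t (S0 \<union> S1 \<union> S2)"
  have S: "finite S" "S \<subseteq> carrier G" using S1 S2 fg t by (auto simp: S_def)
  have genS: "generate G S = carrier G"
    using mono_generate[of S0 S] fg generate_incl[OF S(2)] by (auto simp: S_def)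
  have tS: "t \<in> S" by (simp add: S_def)
  have finl: "finite (letters_of G S)" using S finite_letters_of by blast
  \<comment> \<open>For integral heights with \<open>\<chi> t = 1\<close> the push for the negative
    character says that the path stays at least one level below the higher end of the edge.\<close>
  have dn: "(inv t, y \<otimes> inv t) \<in> joined G S {x. \<chi> x \<le> max 0 (\<chi> y) - 1}"
    if y: "y \<in> letters_of G S" for y
  proof (rule joined_mono[OF push2[of S y]])
    show "{x. - real_of_int (\<chi> (inv t)) + min 0 (- real_of_int (\<chi> y)) \<le> - real_of_int (\<chi> x)} \<subseteq>
      {x. \<chi> x \<le> max 0 (\<chi> y) - 1}" using t by (auto simp: hi)
  qed (use S y in \<open>auto simp: S_def\<close>)
  have "\<exists>F. finite F \<and> (inv t, y \<otimes> inv t) \<in> joined G S ({x. \<chi> x \<le> max 0 (\<chi> y) - 1} \<inter> F)"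
    if "y \<in> letters_of G S" for y
    using joined_finite[OF dn[OF that]] t by simp
  then obtain F where F: "\<And>y. y \<in> letters_of G S \<Longrightarrow> finite (F y)"
    "\<And>y. y \<in> letters_of G S \<Longrightarrow> (inv t, y \<otimes> inv t) \<in> joined G S ({x. \<chi> x \<le> max 0 (\<chi> y) - 1} \<inter> F y)"
    by metis
  define A where "A = letters_of G S \<union> (\<Union>y\<in>letters_of G S. F y)"
  have finA: "finite A" using F finl by (auto simp: A_def)
  define C where "C = (\<Sum>x\<in>A. \<bar>\<chi> x\<bar>)"
  have CA: "\<bar>\<chi> x\<bar> \<le> C" if "x \<in> A" for x
    using member_le_sum[OF that, of "\<lambda>x. \<bar>\<chi> x\<bar>"] finA by (auto simp: C_def)
  have C0: "C \<ge> 0" by (auto simp: C_def intro: sum_nonneg)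
  have dnC: "(inv t, y \<otimes> inv t) \<in> joined G S {x. - C \<le> \<chi> x \<and> \<chi> x \<le> max 0 (\<chi> y) - 1}"
    if y: "y \<in> letters_of G S" for y
  proof (rule joined_mono[OF F(2)[OF y]])
    show "{x. \<chi> x \<le> max 0 (\<chi> y) - 1} \<inter> F y \<subseteq> {x. - C \<le> \<chi> x \<and> \<chi> x \<le> max 0 (\<chi> y) - 1}"
    proof clarify
      fix x assume "x \<in> F y"
      then have "\<bar>\<chi> x\<bar> \<le> C" using CA[of x] y by (auto simp: A_def)
      then show "- C \<le> \<chi> x" by simp
    qed
  qed simp
  let ?strip = "\<lambda>M. {x. 0 \<le> \<chi> x \<and> \<chi> x \<le> M}"
  have strip: "(\<one>, g) \<in> joined G S (?strip (C + 1))" if g: "g \<in> carrier G" "\<chi> g = 0" for g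
  proof -
    have "(\<one>, g) \<in> joined G S {x. 0 \<le> real_of_int (\<chi> x)}"
    proof (rule push_joined_half_space[OF h1 S(2) genS, where t = t and \<epsilon> = 1])
      show "t \<in> letters_of G S" using tS by (simp add: letters_of_def)
      show "(t, y \<otimes> t) \<in> joined G S {x. 1 + min 0 (real_of_int (\<chi> y)) \<le> real_of_int (\<chi> x)}"
        if "y \<in> letters_of G S" for y
      proof -
        have "S1 \<subseteq> S" by (auto simp: S_def)
        then show ?thesis using push1[of S y] S that t by simp
      qed
    qed (use t g in auto)
    then obtain F' where F': "finite F'" "(\<one>, g) \<in> joined G S ({x. 0 \<le> real_of_int (\<chi> x)} \<inter> F')"
      using joined_finite by blast
    \<comment> \<open>A bound for the excess of the path over height \<open>C + 1\<close>; it is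
      removed one level at a time.\<close>
    define m where "m = nat (Max (insert 0 (\<chi> ` F')))"
    have "(\<one>, g) \<in> joined G S (?strip (C + 1 + int m))"
    proof (rule joined_mono[OF F'(2)])
      show "{x. 0 \<le> real_of_int (\<chi> x)} \<inter> F' \<subseteq> ?strip (C + 1 + int m)"
      proof clarify
        fix x assume "x \<in> F'" "0 \<le> real_of_int (\<chi> x)"
        then have "\<chi> x \<le> Max (insert 0 (\<chi> ` F'))" using F'(1) by (intro Max_ge) auto
        then show "0 \<le> \<chi> x \<and> \<chi> x \<le> C + 1 + int m" using \<open>0 \<le> real_of_int (\<chi> x)\<close> C0
          by (auto simp: m_def)
      qed
    qed simp
    then show ?thesis
    proof (induction m)
      case (Suc m)
      let ?M = "C + 1 + int (Suc m)"
      have "(if \<chi> \<one> = ?M then \<one> \<otimes> inv t else \<one>, if \<chi> g = ?M then g \<otimes> inv t else g)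
         \<in> joined G S (?strip (?M - 1))"
        using Suc.prems CA C0 dnC
        by (intro joined_descend[OF \<chi> S(2) tS t(2), where C = C]) (auto simp: A_def)
      moreover have "?M - 1 = C + 1 + int m" by simp
      ultimately have "(\<one>, g) \<in> joined G S (?strip (C + 1 + int m))"
        using g C0 add_hom_one[OF \<chi>] by (simp add: algebra_simps)
      then show ?case by (rule Suc.IH)
    qed simp
  qed
  define Z where "Z = (\<lambda>(i, j, y). t [^] i \<otimes> y \<otimes> t [^] (- j)) `
    {(i, j, y). i \<in> {0..C+1} \<and> j \<in> {0..C+1} \<and> y \<in> letters_of G S \<and> i + \<chi> y = j}"
  have "finite ({0..C+1} \<times> {0..C+1} \<times> letters_of G S)" using finl by simp
  then have finZ: "finite Z" unfolding Z_def
    by (rule finite_imageI[OF finite_subset[rotated]]) auto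
  have ZK: "Z \<subseteq> {x \<in> carrier G. \<chi> x = 0}"
    using letters_of_closed[OF S(2)] t by (auto simp: Z_def hm hp)
  have "g \<in> generate G Z" if g: "g \<in> carrier G" "\<chi> g = 0" for g
  proof -
    have "g \<otimes> t [^] (- \<chi> g) \<in> generate G Z"
    proof (rule joined_strip_generates[OF \<chi> S(2) t strip[OF g]])
      show "t [^] i \<otimes> y \<otimes> t [^] (- j) \<in> Z"
        if "i \<in> {0..C+1}" "j \<in> {0..C+1}" "y \<in> letters_of G S" "i + \<chi> y = j" for i j y
        unfolding Z_def using that by (intro image_eqI[of _ _ "(i, j, y)"]) auto
    qed
    then show ?thesis using g by simp
  qed
  then show ?thesis using finZ ZK by blast
qed

end

section \<open>Integral characters of abelian quotients\<close>

text \<open>Send \<open>b y^k\<close> to \<open>f b + k v\<close>. The hypothesis on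
  \<open>v\<close> is exactly what makes this independent of the representation.\<close>

lemma (in comm_group) extend_add_hom:
  fixes f :: "'a \<Rightarrow> rat"
  assumes B: "subgroup B G" and f: "\<And>x y. x \<in> B \<Longrightarrow> y \<in> B \<Longrightarrow> f (x \<otimes> y) = f x + f y"
    and y: "y \<in> carrier G" and v: "\<And>j::int. y [^] j \<in> B \<Longrightarrow> f (y [^] j) = of_int j * v"
  shows "\<exists>B' f'. subgroup B' G \<and> B \<subseteq> B' \<and> y \<in> B' \<and> (\<forall>x\<in>B. f' x = f x) \<and> f' y = v \<and>
    (\<forall>x\<in>B'. \<forall>z\<in>B'. f' (x \<otimes> z) = f' x + f' z)"
proof -
  interpret B: subgroup B G by fact
  define B' where "B' = {b \<otimes> y [^] (k::int) | b k. b \<in> B}"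
  define f' where "f' z = (THE r. \<exists>b\<in>B. \<exists>k::int. z = b \<otimes> y [^] k \<and> r = f b + of_int k * v)" for z
  have f'_eq: "f' (b \<otimes> y [^] k) = f b + of_int k * v" if "b \<in> B" for b and k :: int
    unfolding f'_def
  proof (rule the_equality)
    fix r assume "\<exists>b'\<in>B. \<exists>k'::int. b \<otimes> y [^] k = b' \<otimes> y [^] k' \<and> r = f b' + of_int k' * v"
    then obtain b' and k' :: int where b': "b' \<in> B" "b \<otimes> y [^] k = b' \<otimes> y [^] k'" "r = f b' + of_int k' * v"
      by blast
    have c: "b \<in> carrier G" "b' \<in> carrier G" using that b' B.mem_carrier by auto
    have eq: "y [^] (k - k') = inv b \<otimes> b'"
    proof -
      have "inv b \<otimes> (b \<otimes> y [^] k) \<otimes> y [^] (-k') = inv b \<otimes> (b' \<otimes> y [^] k') \<otimes> y [^] (-k')"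
        using b'(2) by simp
      then have "y [^] k \<otimes> y [^] (-k') = inv b \<otimes> b'"
        using c y by (simp add: m_assoc[symmetric]) (simp add: m_assoc int_pow_neg)
      then show ?thesis using y by (simp add: int_pow_diff int_pow_neg)
    qed
    then have mem: "y [^] (k - k') \<in> B" using that b' by simp
    have "f b' = f (b \<otimes> y [^] (k - k'))"
      using c y by (simp add: eq m_assoc[symmetric])
    also have "\<dots> = f b + of_int (k - k') * v"
      using f[OF that mem] v[OF mem] by simp
    finally show "r = f b + of_int k * v" using b' by (simp add: algebra_simps)
  qed (use that in blast)
  have "subgroup B' G"
  proof (rule subgroupI)
    show "B' \<subseteq> carrier G" using y B.mem_carrier by (auto simp: B'_def)
    show "B' \<noteq> {}" using B.one_closed unfolding B'_def by blast
    show "inv a \<in> B'" if a: "a \<in> B'" for a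
    proof -
      obtain b and k :: int where b: "b \<in> B" "a = b \<otimes> y [^] k" using a by (auto simp: B'_def)
      have "inv a = inv b \<otimes> y [^] (-k)"
        using b y B.mem_carrier by (simp add: inv_mult int_pow_neg)
      then show ?thesis unfolding B'_def using b by blast
    qed
    show "a \<otimes> a' \<in> B'" if a: "a \<in> B'" "a' \<in> B'" for a a'
    proof -
      obtain b k b' k' where b: "b \<in> B" "a = b \<otimes> y [^] (k::int)" "b' \<in> B" "a' = b' \<otimes> y [^] (k'::int)"
        using a by (auto simp: B'_def)
      have "a \<otimes> a' = (b \<otimes> b') \<otimes> y [^] (k + k')"
        using b y B.mem_carrier by (simp add: int_pow_mult m_ac)
      then show ?thesis unfolding B'_def using b by blast
    qed
  qed
  moreover have "B \<subseteq> B'"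
  proof
    fix b assume "b \<in> B"
    moreover have "b = b \<otimes> y [^] (0::int)" using \<open>b \<in> B\<close> B.mem_carrier by simp
    ultimately show "b \<in> B'" unfolding B'_def by blast
  qed
  moreover have "y = \<one> \<otimes> y [^] (1::int)" using y by simp
  then have "y \<in> B'" unfolding B'_def using B.one_closed by blast
  moreover have "f' x = f x" if "x \<in> B" for x
    using f'_eq[OF that, of 0] that B.mem_carrier by simp
  moreover have "f \<one> = 0" using f[of \<one> \<one>] by simp
  then have "f' y = v" using f'_eq[of \<one> 1] y by simp
  moreover have "f' (x \<otimes> z) = f' x + f' z" if xz: "x \<in> B'" "z \<in> B'" for x z
  proof -
    obtain b k b' k' where b: "b \<in> B" "x = b \<otimes> y [^] (k::int)" "b' \<in> B" "z = b' \<otimes> y [^] (k'::int)"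
      using xz by (auto simp: B'_def)
    have "x \<otimes> z = (b \<otimes> b') \<otimes> y [^] (k + k')"
      using b y B.mem_carrier by (simp add: int_pow_mult m_ac)
    then have "f' (x \<otimes> z) = f (b \<otimes> b') + of_int (k + k') * v" using f'_eq[of "b \<otimes> b'" "k + k'"] b by simp
    then show ?thesis using b f by (simp add: f'_eq algebra_simps)
  qed
  ultimately show ?thesis by (intro exI[of _ B'] exI[of _ f']) blast
qed

lemma common_denominator:
  fixes f :: "'a \<Rightarrow> rat"
  assumes "finite S"
  shows "\<exists>d::int. d > 0 \<and> (\<forall>s\<in>S. \<exists>m::int. of_int d * f s = of_int m)"
  using assms
proof (induction S)
  case empty
  show ?case by (intro exI[of _ 1]) auto
next
  case (insert s S)
  then obtain d :: int where d: "d > 0" "\<forall>s\<in>S. \<exists>m::int. of_int d * f s = of_int m" by auto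
  obtain a b where ab: "quotient_of (f s) = (a, b)" by force
  then have b: "b > 0" "f s = of_int a / of_int b"
    using quotient_of_denom_pos quotient_of_div by auto
  have "\<exists>m::int. of_int (d * b) * f s' = of_int m" if "s' \<in> insert s S" for s'
  proof (cases "s' = s")
    case True
    then have "of_int (d * b) * f s' = of_int (d * a)" using b by simp
    then show ?thesis by blast
  next
    case False
    then have "s' \<in> S" using that by simp
    then obtain m :: int where m: "of_int d * f s' = of_int m" using d(2) by metis
    then have "of_int (d * b) * f s' = of_int (b * m)" by simp
    then show ?thesis by blast
  qed
  then show ?case using d b by (intro exI[of _ "d * b"]) auto
qed

text \<open>The rationals are divisible, so the map with value 1 on \<open>e\<close> extends over
  one generator after another. A common denominator of the values on the generators makes it
  integral.\<close>

lemma (in comm_group) exists_int_hom: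
  assumes S: "finite S" "S \<subseteq> carrier G" "generate G S = carrier G"
    and e: "e \<in> carrier G" "\<And>k::int. e [^] k = \<one> \<Longrightarrow> k = 0"
  shows "\<exists>f :: 'a \<Rightarrow> int. add_hom G f \<and> f e \<noteq> 0"
proof -
  have ext: "\<exists>B f. subgroup B G \<and> T \<subseteq> B \<and> e \<in> B \<and> f e = 1 \<and>
     (\<forall>x\<in>B. \<forall>z\<in>B. (f (x \<otimes> z) :: rat) = f x + f z)" if "finite T" "T \<subseteq> carrier G" for T
    using that
  proof (induction T)
    case empty
    \<comment> \<open>Adjoin \<open>e\<close> with value 1 to the trivial subgroup; this is
      consistent because only the zeroth power of \<open>e\<close> is the unit.\<close>
    have "\<exists>B' f'. subgroup B' G \<and> {\<one>} \<subseteq> B' \<and> e \<in> B' \<and> (\<forall>x\<in>{\<one>}. f' x = (0::rat)) \<and> f' e = 1 \<and>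
      (\<forall>x\<in>B'. \<forall>z\<in>B'. f' (x \<otimes> z) = f' x + f' z)"
      using e triv_subgroup by (intro extend_add_hom) auto
    then show ?case by blast
  next
    case (insert y T)
    then obtain B f where B: "subgroup B G" "T \<subseteq> B" "e \<in> B" "f e = 1"
      and f: "\<forall>x\<in>B. \<forall>z\<in>B. (f (x \<otimes> z) :: rat) = f x + f z" by auto
    interpret B: subgroup B G by fact
    have y: "y \<in> carrier G" using insert by auto
    have fB: "add_hom (G\<lparr>carrier := B\<rparr>) f" using f by (simp add: add_hom_def)
    interpret BG: group "G\<lparr>carrier := B\<rparr>" by (rule subgroup_imp_group[OF B(1)])
    have pow: "f (b [^] (i::int)) = of_int i * f b" if "b \<in> B" for b i
      using BG.add_hom_int_pow[OF fB, of b i] that int_pow_consistent[OF B(1) that] by simp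
    \<comment> \<open>If a power of \<open>y\<close> with nonzero exponent \<open>m\<close> lies in
      \<open>B\<close>, the value is forced and is obtained by dividing by \<open>m\<close>.
      Otherwise every value is admissible, and 0 is taken.\<close>
    have "\<exists>v. \<forall>j::int. y [^] j \<in> B \<longrightarrow> f (y [^] j) = of_int j * v"
    proof (cases "\<exists>m::int. m \<noteq> 0 \<and> y [^] m \<in> B")
      case True
      then obtain m :: int where m: "m \<noteq> 0" "y [^] m \<in> B" by auto
      have "f (y [^] j) = of_int j * (f (y [^] m) / of_int m)" if "y [^] j \<in> B" for j :: int
      proof -
        have "(y [^] j) [^] m = (y [^] m) [^] j" using y by (simp add: int_pow_pow mult.commute)
        then have "of_int m * f (y [^] j) = of_int j * f (y [^] m)"
          using pow[OF that, of m] pow[OF m(2), of j] by simp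
        then show ?thesis using m by (simp add: field_simps)
      qed
      then show ?thesis by blast
    next
      case False
      have "f \<one> = 0" using f B.one_closed by (metis add_cancel_left_left l_one one_closed)
      then have "f (y [^] j) = of_int j * 0" if "y [^] j \<in> B" for j :: int
        using False that by (cases "j = 0") auto
      then show ?thesis by blast
    qed
    then obtain v where "\<And>j::int. y [^] j \<in> B \<Longrightarrow> f (y [^] j) = of_int j * v" by auto
    then obtain B' f' where "subgroup B' G" "B \<subseteq> B'" "y \<in> B'" "\<forall>x\<in>B. f' x = f x"
        "\<forall>x\<in>B'. \<forall>z\<in>B'. (f' (x \<otimes> z) :: rat) = f' x + f' z"
      using extend_add_hom[OF B(1) _ y, of f v] f by blast
    then show ?case using B by (intro exI[of _ B'] exI[of _ f']) auto
  qed
  then obtain B f where B: "subgroup B G" "S \<subseteq> B" and f: "f e = 1"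
     "\<forall>x\<in>B. \<forall>z\<in>B. (f (x \<otimes> z) :: rat) = f x + f z" using ext[OF S(1,2)] by blast
  have "carrier G \<subseteq> B" using generate_subgroup_incl[OF B(2,1)] S by simp
  then have fh: "add_hom G f" using f by (auto simp: add_hom_def)
  obtain d :: int where d: "d > 0" "\<And>s. s \<in> S \<Longrightarrow> \<exists>m::int. of_int d * f s = of_int m"
    using common_denominator[OF S(1), of f] by auto
  have int: "\<exists>m::int. of_int d * f x = of_int m" if "x \<in> carrier G" for x
  proof -
    have "x \<in> generate G S" using that S by simp
    then show ?thesis
    proof (induction rule: generate.induct)
      case one
      show ?case using add_hom_one[OF fh] by (intro exI[of _ 0]) simp
    next
      case (inv h)
      then obtain m :: int where "of_int d * f h = of_int m" using d by blast
      then show ?case using inv S by (intro exI[of _ "- m"]) (simp add: add_hom_inv[OF fh] subset_iff)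
    next
      case (eng h1 h2)
      then obtain m1 m2 :: int where "of_int d * f h1 = of_int m1" "of_int d * f h2 = of_int m2" by blast
      moreover have "h1 \<in> carrier G" "h2 \<in> carrier G" using eng S by auto
      ultimately show ?case by (intro exI[of _ "m1 + m2"]) (simp add: add_hom_mult[OF fh] distrib_left)
    qed (use d in blast)
  qed
  \<comment> \<open>On the carrier the product is an integer already; rounding only changes the
    type.\<close>
  define g where "g x = \<lfloor>of_int d * f x\<rfloor>" for x
  have g: "of_int (g x) = of_int d * f x" if "x \<in> carrier G" for x
    using int[OF that] by (auto simp: g_def)
  have "add_hom G g"
    unfolding add_hom_def
  proof (intro ballI)
    fix x y assume "x \<in> carrier G" "y \<in> carrier G"
    then have "(of_int (g (x \<otimes> y)) :: rat) = of_int (g x + g y)"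
      by (simp add: g add_hom_mult[OF fh] distrib_left)
    then show "g (x \<otimes> y) = g x + g y" by (simp only: of_int_eq_iff)
  qed
  moreover have "g e \<noteq> 0" using g[OF e(1)] f d by auto
  ultimately show ?thesis by blast
qed

section \<open>Quotients by a subgroup containing the commutators\<close>

locale coabelian = normal N G for N and G (structure) +
  assumes commutator_in: "x \<in> carrier G \<Longrightarrow> y \<in> carrier G \<Longrightarrow> x \<otimes> y \<otimes> inv x \<otimes> inv y \<in> N"
begin

abbreviation "Q \<equiv> G Mod N"

lemma coset_eq_iff: "x \<in> carrier G \<Longrightarrow> y \<in> carrier G \<Longrightarrow> N #> x = N #> y \<longleftrightarrow> x \<otimes> inv y \<in> N"
  using is_subgroup rcos_module[OF is_group, of y x] rcos_self[of x N] repr_independence[of x N y]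
  by auto

lemma coset_one_iff: "x \<in> carrier G \<Longrightarrow> N #> x = \<one>\<^bsub>Q\<^esub> \<longleftrightarrow> x \<in> N"
  using rcos_self coset_join2 is_subgroup by auto

lemma coset_closed: "x \<in> carrier G \<Longrightarrow> N #> x \<in> carrier Q"
  by (auto simp: carrier_FactGroup)

lemma coset_mult: "x \<in> carrier G \<Longrightarrow> y \<in> carrier G \<Longrightarrow> (N #> x) \<otimes>\<^bsub>Q\<^esub> (N #> y) = N #> (x \<otimes> y)"
  by (simp add: rcos_sum)

lemma comm_group_Q: "comm_group Q"
proof (rule group.group_comm_groupI[OF factorgroup_is_group])
  fix a b assume "a \<in> carrier Q" "b \<in> carrier Q"
  then obtain x y where xy: "x \<in> carrier G" "a = N #> x" "y \<in> carrier G" "b = N #> y"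
    by (auto simp: carrier_FactGroup)
  have "N #> (x \<otimes> y) = N #> (y \<otimes> x)"
    using commutator_in[of x y] xy by (subst coset_eq_iff) (auto simp: inv_mult_group m_assoc)
  then show "a \<otimes>\<^bsub>Q\<^esub> b = b \<otimes>\<^bsub>Q\<^esub> a" using xy by (simp add: coset_mult del: mult_FactGroup)
qed

lemma coset_hom: "group_hom G Q (\<lambda>x. N #> x)"
  using r_coset_hom_Mod factorgroup_is_group by (intro group_hom.intro group_hom_axioms.intro is_group)

lemma generate_Q:
  assumes "S \<subseteq> carrier G" "generate G S = carrier G"
  shows "generate Q ((\<lambda>x. N #> x) ` S) = carrier Q"
  using group_hom.generate_img[OF coset_hom assms(1)] assms(2) by (simp add: carrier_FactGroup)

lemma exists_int_hom_coset:
  assumes S: "finite S" "S \<subseteq> carrier G" "generate G S = carrier G"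
    and e: "e \<in> carrier G" "\<And>k::int. e [^] k \<in> N \<Longrightarrow> k = 0"
  shows "\<exists>\<chi> :: 'a \<Rightarrow> int. add_hom G \<chi> \<and> (\<forall>n\<in>N. \<chi> n = 0) \<and> \<chi> e \<noteq> 0"
proof -
  interpret Q: comm_group Q by (rule comm_group_Q)
  have "\<exists>f :: 'a set \<Rightarrow> int. add_hom Q f \<and> f (N #> e) \<noteq> 0"
  proof (rule Q.exists_int_hom[of "(\<lambda>x. N #> x) ` S"])
    show "k = 0" if "(N #> e) [^]\<^bsub>Q\<^esub> k = \<one>\<^bsub>Q\<^esub>" for k :: int
      using that e by (simp add: FactGroup_int_pow coset_one_iff[symmetric])
  qed (use S e generate_Q coset_closed in auto)
  then obtain f :: "'a set \<Rightarrow> int" where f: "add_hom Q f" "f (N #> e) \<noteq> 0" by blast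
  have "add_hom G (\<lambda>x. f (N #> x))"
    unfolding add_hom_def using f(1) coset_closed coset_mult by (metis Q.add_hom_mult)
  moreover have "f (N #> n) = 0" if "n \<in> N" for n
    using Q.add_hom_one[OF f(1)] coset_one_iff[of n] that mem_carrier by metis
  ultimately show ?thesis using f by blast
qed

lemma rank_ge_2:
  assumes "co_rank G N = 2"
  shows "\<exists>x\<in>carrier G. \<exists>y\<in>carrier G. \<forall>(i::int) (j::int). x [^] i \<otimes> y [^] j \<in> N \<longrightarrow> i = 0 \<and> j = 0"
proof -
  interpret Q: comm_group Q by (rule comm_group_Q)
  have "\<exists>S. int_independent Q S \<and> card S \<ge> 2"
  proof (rule ccontr)
    assume "\<not> ?thesis"
    then have "card S \<le> 1" if "int_independent Q S" for S using that by force
    then have "torsion_free_rank Q \<le> 1"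
      unfolding torsion_free_rank_def by (intro SUP_least) (auto simp: one_enat_def)
    then show False using assms by (simp add: co_rank_def)
  qed
  then obtain S where S: "int_independent Q S" "card S \<ge> 2" by blast
  then obtain a b where ab: "a \<in> S" "b \<in> S" "a \<noteq> b"
    using card_2_iff' card_le_Suc0_iff_eq[of S] by (auto simp: int_independent_def)
  have SQ: "S \<subseteq> carrier Q" "finite S" using S by (auto simp: int_independent_def)
  obtain x y where xy: "x \<in> carrier G" "a = N #> x" "y \<in> carrier G" "b = N #> y"
  proof -
    have "a \<in> carrier Q" "b \<in> carrier Q" using ab SQ by auto
    then show ?thesis using that by (auto simp: carrier_FactGroup)
  qed
  have "i = 0 \<and> j = 0" if h: "x [^] i \<otimes> y [^] j \<in> N" for i j :: int
  proof -
    \<comment> \<open>With coefficients vanishing on the rest of \<open>S\<close> the product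
      reduces to the two chosen factors.\<close>
    define k where "k = (\<lambda>z. if z = a then i else if z = b then j else 0)"
    have "(\<Otimes>\<^bsub>Q\<^esub>z\<in>S. z [^]\<^bsub>Q\<^esub> k z) = (\<Otimes>\<^bsub>Q\<^esub>z\<in>{a, b}. z [^]\<^bsub>Q\<^esub> k z)"
      using SQ ab by (intro Q.finprod_mono_neutral_cong_right) (auto simp: k_def)
    also have "\<dots> = a [^]\<^bsub>Q\<^esub> i \<otimes>\<^bsub>Q\<^esub> b [^]\<^bsub>Q\<^esub> j"
      using ab SQ by (simp add: k_def subset_iff del: mult_FactGroup one_FactGroup)
    also have "\<dots> = N #> (x [^] i \<otimes> y [^] j)"
      using xy by (simp add: FactGroup_int_pow coset_mult del: mult_FactGroup)
    also have "\<dots> = \<one>\<^bsub>Q\<^esub>" using h xy by (subst coset_one_iff) auto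
    finally have "\<forall>z\<in>S. k z = 0" using S(1) by (auto simp: int_independent_def)
    then show ?thesis using ab by (auto simp: k_def split: if_splits)
  qed
  then show ?thesis using xy by blast
qed

lemma rank_le_2:
  assumes "co_rank G N = 2" and xyz: "x \<in> carrier G" "y \<in> carrier G" "z \<in> carrier G"
  shows "\<exists>(i::int) (j::int) (k::int). x [^] i \<otimes> y [^] j \<otimes> z [^] k \<in> N \<and> (i, j, k) \<noteq> (0, 0, 0)"
proof (rule ccontr)
  assume neg: "\<not> ?thesis"
  interpret Q: comm_group Q by (rule comm_group_Q)
  have coset3: "(N #> x) [^]\<^bsub>Q\<^esub> i \<otimes>\<^bsub>Q\<^esub> ((N #> y) [^]\<^bsub>Q\<^esub> j \<otimes>\<^bsub>Q\<^esub> (N #> z) [^]\<^bsub>Q\<^esub> k) =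
      N #> (x [^] i \<otimes> y [^] j \<otimes> z [^] k)" for i j k :: int
    using xyz by (simp add: FactGroup_int_pow coset_mult m_assoc del: mult_FactGroup one_FactGroup)
  have ind: "i = 0 \<and> j = 0 \<and> k = 0"
    if "(N #> x) [^]\<^bsub>Q\<^esub> i \<otimes>\<^bsub>Q\<^esub> ((N #> y) [^]\<^bsub>Q\<^esub> j \<otimes>\<^bsub>Q\<^esub> (N #> z) [^]\<^bsub>Q\<^esub> k) = \<one>\<^bsub>Q\<^esub>" for i j k :: int
  proof -
    have "x [^] i \<otimes> y [^] j \<otimes> z [^] k \<in> N"
      using that[unfolded coset3] xyz by (subst (asm) coset_one_iff) auto
    then show ?thesis using neg by auto
  qed
  note cl = coset_closed[OF xyz(1)] coset_closed[OF xyz(2)] coset_closed[OF xyz(3)]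
  \<comment> \<open>Independence is a property of a set, so the three elements count as three only
    if their cosets differ. Equal cosets would be a relation with exponents 1 and -1.\<close>
  have d1: "N #> x \<noteq> N #> y"
  proof
    assume "N #> x = N #> y"
    then show False using ind[of 1 "-1" 0] cl by (simp add: Q.int_pow_neg del: mult_FactGroup one_FactGroup)
  qed
  have d2: "N #> x \<noteq> N #> z"
  proof
    assume "N #> x = N #> z"
    then show False using ind[of 1 0 "-1"] cl by (simp add: Q.int_pow_neg del: mult_FactGroup one_FactGroup)
  qed
  have d3: "N #> y \<noteq> N #> z"
  proof
    assume "N #> y = N #> z"
    then show False using ind[of 0 1 "-1"] cl by (simp add: Q.int_pow_neg del: mult_FactGroup one_FactGroup)
  qed
  let ?S = "{N #> x, N #> y, N #> z}"
  have "int_independent Q ?S"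
    unfolding int_independent_def
  proof (intro conjI allI impI)
    fix k :: "'a set \<Rightarrow> int"
    assume "(\<Otimes>\<^bsub>Q\<^esub>a\<in>?S. a [^]\<^bsub>Q\<^esub> k a) = \<one>\<^bsub>Q\<^esub>"
    moreover have "(\<Otimes>\<^bsub>Q\<^esub>a\<in>?S. a [^]\<^bsub>Q\<^esub> k a) = (N #> x) [^]\<^bsub>Q\<^esub> k (N #> x) \<otimes>\<^bsub>Q\<^esub>
       ((N #> y) [^]\<^bsub>Q\<^esub> k (N #> y) \<otimes>\<^bsub>Q\<^esub> (N #> z) [^]\<^bsub>Q\<^esub> k (N #> z))"
      using cl d1 d2 d3 by (simp del: mult_FactGroup one_FactGroup)
    ultimately show "\<forall>a\<in>?S. k a = 0" using ind by auto
  qed (use cl in auto)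
  then have "enat (card ?S) \<le> torsion_free_rank Q"
    unfolding torsion_free_rank_def by (intro SUP_upper) auto
  then show False using assms(1) d1 d2 d3 by (simp add: co_rank_def numeral_eq_enat)
qed

end

section \<open>Finitely presented fibre products force a splitting\<close>

declare mult_FactGroup [simp del] one_FactGroup [simp del]

lemma joined_hom:
  assumes f: "group_hom G H f" and S: "S \<subseteq> carrier G"
    and hk: "(h, k) \<in> joined G S D" and h: "h \<in> carrier G"
    and D: "\<And>x. x \<in> D \<Longrightarrow> x \<in> carrier G \<Longrightarrow> f x \<in> D'"
  shows "(f h, f k) \<in> joined H (f ` S) D'"
proof -
  interpret f: group_hom G H f by fact
  show ?thesis
    using hk h
  proof (induction rule: f.G.joined_induct)
    case (step x y)
    have y: "y \<in> carrier G" using f.G.letters_of_closed[OF S] step by blast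
    have "f y \<in> letters_of H (f ` S)"
      using step S by (auto simp: letters_of_def)
    then have "(f x, f x \<otimes>\<^bsub>H\<^esub> f y) \<in> joined H (f ` S) D'"
      using step y D[of x] D[of "x \<otimes>\<^bsub>G\<^esub> y"] by (intro f.H.joined_edge) auto
    then show ?case using step y by (auto intro: f.H.joined_trans)
  qed simp
qed

definition splits_over_cyclic :: "('a, 'b) monoid_scheme \<Rightarrow> 'a set \<Rightarrow> bool" where
  "splits_over_cyclic G N \<longleftrightarrow> (\<exists>t K. t \<in> carrier G \<and> infinite (generate G {t})
             \<and> internal_semidirect G (generate G {t}) K
             \<and> finitely_generated (G\<lparr>carrier := K\<rparr>) \<and> N \<subseteq> K)"

lemma (in group) kernel_of_surjective_int_hom:
  assumes \<chi>: "add_hom G (\<chi> :: 'a \<Rightarrow> int)" and t: "t \<in> carrier G" "\<chi> t = 1"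
  defines "K \<equiv> {x \<in> carrier G. \<chi> x = 0}"
  shows "infinite (generate G {t})" "internal_semidirect G (generate G {t}) K"
proof -
  note hm = add_hom_mult[OF \<chi>] and hi = add_hom_inv[OF \<chi>] and hp = add_hom_int_pow[OF \<chi>]
    and h1 = add_hom_one[OF \<chi>]
  have gen: "generate G {t} = {t [^] (k::int) | k. k \<in> UNIV}" using generate_pow t by simp
  have inj: "inj (\<lambda>k::int. t [^] k)"
    using t hp by (metis injI mult.right_neutral of_int_eq_id id_apply)
  have "generate G {t} = range (\<lambda>k::int. t [^] k)" by (auto simp: gen)
  then show "infinite (generate G {t})"
    using inj infinite_UNIV_int by (metis finite_imageD)
  have sub: "subgroup K G"
    by (rule subgroupI) (auto simp: K_def hm hi h1 intro!: exI[of _ \<one>])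
  have "K \<lhd> G"
    unfolding normal_inv_iff using sub by (auto simp: K_def hm hi)
  moreover have "subgroup (generate G {t}) G" using t by (intro generate_is_subgroup) simp
  moreover have "generate G {t} \<inter> K = {\<one>}"
  proof
    show "generate G {t} \<inter> K \<subseteq> {\<one>}" using t hp by (auto simp: gen K_def)
    show "{\<one>} \<subseteq> generate G {t} \<inter> K" using h1 by (auto simp: K_def generate.one)
  qed
  moreover have "generate G {t} <#> K = carrier G"
  proof
    show "generate G {t} <#> K \<subseteq> carrier G" using t by (auto simp: set_mult_def gen K_def)
    show "carrier G \<subseteq> generate G {t} <#> K"
    proof
      fix x assume x: "x \<in> carrier G"
      have "t [^] (\<chi> x) \<in> generate G {t}" by (auto simp: gen)
      moreover have "t [^] (- \<chi> x) \<otimes> x \<in> K" using x t by (simp add: K_def hm hp)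
      moreover have "x = t [^] (\<chi> x) \<otimes> (t [^] (- \<chi> x) \<otimes> x)"
        using x t by (simp add: m_assoc[symmetric] int_pow_neg)
      ultimately show "x \<in> generate G {t} <#> K" unfolding set_mult_def by blast
    qed
  qed
  ultimately show "internal_semidirect G (generate G {t}) K"
    by (simp add: internal_semidirect_def)
qed

text \<open>By division with remainder the values of \<open>\<psi>\<close> are the multiples of the
  least positive one; dividing by it gives a character that takes the value 1.\<close>

lemma (in group) int_hom_primitive:
  assumes \<psi>: "add_hom G (\<psi> :: 'a \<Rightarrow> int)" and ne: "x \<in> carrier G" "\<psi> x \<noteq> 0"
  shows "\<exists>n::int. n > 0 \<and> (\<exists>\<chi>. add_hom G \<chi> \<and> (\<exists>t\<in>carrier G. \<chi> t = 1) \<and> (\<forall>y\<in>carrier G. \<psi> y = n * \<chi> y))"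
proof -
  note hm = add_hom_mult[OF \<psi>] and hi = add_hom_inv[OF \<psi>] and hp = add_hom_int_pow[OF \<psi>]
  let ?P = "\<lambda>n::nat. n > 0 \<and> (\<exists>t\<in>carrier G. \<psi> t = int n)"
  have "\<exists>n. ?P n"
  proof (cases "\<psi> x > 0")
    case True
    then show ?thesis using ne by (intro exI[of _ "nat (\<psi> x)"]) auto
  next
    case False
    then show ?thesis using ne by (intro exI[of _ "nat (- \<psi> x)"]) (auto intro!: bexI[of _ "inv x"] simp: hi)
  qed
  define n where "n = (LEAST n. ?P n)"
  have "?P n" unfolding n_def by (rule LeastI_ex) fact
  then obtain t where n: "n > 0" and t: "t \<in> carrier G" "\<psi> t = int n" by auto
  have dvd: "int n dvd \<psi> y" if y: "y \<in> carrier G" for y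
  proof (rule ccontr)
    assume "\<not> int n dvd \<psi> y"
    then have r: "\<psi> y mod int n > 0"
      using n pos_mod_sign[of "int n" "\<psi> y"] by (fastforce simp: dvd_eq_mod_eq_0)
    have "\<psi> (y \<otimes> t [^] (- (\<psi> y div int n))) = \<psi> y mod int n"
      using y t by (simp add: hm hp minus_div_mult_eq_mod[symmetric])
    then have "?P (nat (\<psi> y mod int n))"
      using r y t by (auto intro!: bexI[of _ "y \<otimes> t [^] (- (\<psi> y div int n))"])
    then have "n \<le> nat (\<psi> y mod int n)" unfolding n_def by (rule Least_le)
    then show False using pos_mod_bound[of "int n" "\<psi> y"] n r by linarith
  qed
  define \<chi> where "\<chi> y = \<psi> y div int n" for y
  have \<psi>\<chi>: "\<psi> y = int n * \<chi> y" if "y \<in> carrier G" for y using dvd[OF that] by (simp add: \<chi>_def)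
  have \<chi>: "add_hom G \<chi>"
    unfolding add_hom_def
  proof (intro ballI)
    fix a b assume "a \<in> carrier G" "b \<in> carrier G"
    then show "\<chi> (a \<otimes> b) = \<chi> a + \<chi> b" using dvd by (simp add: \<chi>_def hm div_plus_div_distrib_dvd_left)
  qed
  have "\<chi> t = 1" using t n by (simp add: \<chi>_def)
  then show ?thesis using n t(1) \<chi> \<psi>\<chi> by (intro exI[of _ "int n"] conjI exI[of _ \<chi>]) auto
qed

section \<open>Characters in the invariant, and fibre products\<close>

context coabelian
begin

lemma int_character_splits:
  assumes \<psi>: "add_hom G (\<psi> :: 'a \<Rightarrow> int)" and N0: "\<And>n. n \<in> N \<Longrightarrow> \<psi> n = 0"
    and ne: "x \<in> carrier G" "\<psi> x \<noteq> 0"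
    and BNS: "in_BNS G N (\<lambda>x. real_of_int (\<psi> x))" "in_BNS G N (\<lambda>x. - real_of_int (\<psi> x))"
    and fg: "finite S" "S \<subseteq> carrier G" "generate G S = carrier G"
  shows "splits_over_cyclic G N"
proof -
  obtain n and \<chi> :: "'a \<Rightarrow> int" and t where n: "n > 0" and \<chi>: "add_hom G \<chi>"
    and t: "t \<in> carrier G" and \<chi>t: "\<chi> t = 1" and \<psi>\<chi>: "\<And>y. y \<in> carrier G \<Longrightarrow> \<psi> y = n * \<chi> y"
    using int_hom_primitive[OF \<psi> ne] by metis
  let ?K = "{y \<in> carrier G. \<chi> y = 0}"
  have "in_BNS G N (\<lambda>x. real_of_int (\<chi> x))" "in_BNS G N (\<lambda>x. - real_of_int (\<chi> x))"
  proof -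
    \<comment> \<open>The relation between \<open>\<psi>\<close> and \<open>\<chi>\<close> is known
      on the carrier only, so \<open>in_BNS_scale\<close> does not apply directly. Edges, however,
      involve only elements of the carrier.\<close>
    have joined_eq: "joined G S {x. 0 \<le> f x} = joined G S {x. 0 \<le> g x}"
      if S: "S \<subseteq> carrier G" and fg: "\<And>x. x \<in> carrier G \<Longrightarrow> (0 \<le> f x) = (0 \<le> g x)" for f g :: "'a \<Rightarrow> real" and S
    proof -
      have "edges_in G S {x. 0 \<le> f x} = edges_in G S {x. 0 \<le> g x}"
        using fg letters_of_closed[OF S] by (auto simp: edges_in_def)
      then show ?thesis by (simp add: joined_def)
    qed
    have BNS_eq: "in_BNS G N f" if "in_BNS G N g" "\<And>x. x \<in> carrier G \<Longrightarrow> (0 \<le> f x) = (0 \<le> g x)"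
      for f g :: "'a \<Rightarrow> real"
      using that joined_eq[of _ f g] unfolding in_BNS_def by metis
    show "in_BNS G N (\<lambda>x. real_of_int (\<chi> x))"
      by (rule BNS_eq[OF BNS(1)]) (use n in \<open>simp add: \<psi>\<chi> zero_le_mult_iff\<close>)
    show "in_BNS G N (\<lambda>x. - real_of_int (\<chi> x))"
      by (rule BNS_eq[OF BNS(2)]) (use n in \<open>simp add: \<psi>\<chi> mult_le_0_iff\<close>)
  qed
  then obtain Z where Z: "finite Z" "Z \<subseteq> ?K" "?K \<subseteq> generate G Z"
    using in_BNS_both_imp_kernel_finitely_generated[OF \<chi> t \<chi>t _ _ commutator_in fg] by blast
  have sd: "internal_semidirect G (generate G {t}) ?K" "infinite (generate G {t})"
    using kernel_of_surjective_int_hom[OF \<chi> t \<chi>t] by auto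
  have K: "subgroup ?K G" using sd(1) normal_imp_subgroup by (auto simp: internal_semidirect_def)
  have "generate G Z \<subseteq> ?K" using Z(2) K by (rule generate_subgroup_incl)
  then have "generate (G\<lparr>carrier := ?K\<rparr>) Z = ?K"
    using generate_consistent[OF Z(2) K] Z(3) by simp
  then have "finitely_generated (G\<lparr>carrier := ?K\<rparr>)"
    using Z subgroup_imp_group[OF K] by (auto simp: finitely_generated_def)
  moreover have "N \<subseteq> ?K" using N0 subset \<psi>\<chi> n by fastforce
  ultimately show ?thesis using t sd unfolding splits_over_cyclic_def by blast
qed

text \<open>Both memberships are open conditions on the coefficients, so these may be replaced by
  nearby fractions with a common denominator, which is then cleared. The elements \<open>x\<close>
  and \<open>z\<close> express independence of the two characters in triangular form: no nontrivial
  combination vanishes.\<close>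

lemma real_character_splits:
  assumes \<chi>1: "add_hom G (\<chi>1 :: 'a \<Rightarrow> int)" "\<And>n. n \<in> N \<Longrightarrow> \<chi>1 n = 0"
    and \<chi>2: "add_hom G (\<chi>2 :: 'a \<Rightarrow> int)" "\<And>n. n \<in> N \<Longrightarrow> \<chi>2 n = 0"
    and x: "x \<in> carrier G" "\<chi>1 x \<noteq> 0" and z: "z \<in> carrier G" "\<chi>1 z = 0" "\<chi>2 z \<noteq> 0"
    and \<alpha>\<beta>: "\<alpha> \<noteq> 0 \<or> \<beta> \<noteq> 0"
    and BNS: "in_BNS G N (\<lambda>x. \<alpha> * real_of_int (\<chi>1 x) + \<beta> * real_of_int (\<chi>2 x))"
      "in_BNS G N (\<lambda>x. (- \<alpha>) * real_of_int (\<chi>1 x) + (- \<beta>) * real_of_int (\<chi>2 x))"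
    and fg: "finite S" "S \<subseteq> carrier G" "generate G S = carrier G"
  shows "splits_over_cyclic G N"
proof -
  let ?c1 = "\<lambda>x. real_of_int (\<chi>1 x)" and ?c2 = "\<lambda>x. real_of_int (\<chi>2 x)"
  have h: "add_hom G ?c1" "add_hom G ?c2" using \<chi>1 \<chi>2 by (auto simp: add_hom_def)
  have ne: "\<exists>x\<in>carrier G. a * ?c1 x + b * ?c2 x \<noteq> 0" if "a \<noteq> 0 \<or> b \<noteq> 0" for a b :: real
  proof (cases "b = 0")
    case True
    then show ?thesis using that x by (intro bexI[of _ x]) auto
  next
    case False
    then show ?thesis using z by (intro bexI[of _ z]) auto
  qed
  obtain \<delta>1 where \<delta>1: "\<delta>1 > 0" "\<And>a b. \<bar>a - \<alpha>\<bar> < \<delta>1 \<Longrightarrow> \<bar>b - \<beta>\<bar> < \<delta>1 \<Longrightarrow> in_BNS G N (\<lambda>x. a * ?c1 x + b * ?c2 x)"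
    using in_BNS_open[OF h BNS(1) ne[OF \<alpha>\<beta>] subset _ _ commutator_in fg] \<chi>1 \<chi>2 by auto
  have "\<exists>\<delta>>0. \<forall>a b. \<bar>a - - \<alpha>\<bar> < \<delta> \<longrightarrow> \<bar>b - - \<beta>\<bar> < \<delta> \<longrightarrow> in_BNS G N (\<lambda>x. a * ?c1 x + b * ?c2 x)"
    using \<alpha>\<beta> \<chi>1 \<chi>2 by (intro in_BNS_open[OF h BNS(2) ne subset _ _ commutator_in fg]) auto
  then obtain \<delta>2 where \<delta>2: "\<delta>2 > 0" "\<And>a b. \<bar>a + \<alpha>\<bar> < \<delta>2 \<Longrightarrow> \<bar>b + \<beta>\<bar> < \<delta>2 \<Longrightarrow> in_BNS G N (\<lambda>x. a * ?c1 x + b * ?c2 x)"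
    by auto
  \<comment> \<open>The last bound ensures that \<open>\<alpha>\<close> and \<open>\<beta>\<close>
    are not both rounded to 0.\<close>
  define \<delta> where "\<delta> = min (min \<delta>1 \<delta>2) (max \<bar>\<alpha>\<bar> \<bar>\<beta>\<bar>)"
  have \<delta>: "\<delta> > 0" "\<delta> \<le> \<delta>1" "\<delta> \<le> \<delta>2" "\<delta> \<le> max \<bar>\<alpha>\<bar> \<bar>\<beta>\<bar>"
    using \<delta>1 \<delta>2 \<alpha>\<beta> by (auto simp: \<delta>_def)
  \<comment> \<open>Rounding to an integer costs at most 1/2, hence less than
    \<open>\<delta>\<close> after division by \<open>d\<close>.\<close>
  obtain d :: nat where d0: "1 < real d * \<delta>" using reals_Archimedean3[OF \<delta>(1)] by blast
  have d: "d > 0" using d0 by (cases d) auto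
  define p where "p = round (real d * \<alpha>)"
  define q where "q = round (real d * \<beta>)"
  have near: "\<bar>of_int (round (real d * a)) / real d - a\<bar> < \<delta>" for a
  proof -
    have "\<bar>of_int (round (real d * a)) - real d * a\<bar> \<le> 1/2" by (rule of_int_round_abs_le)
    also have "\<dots> < real d * \<delta>" using d0 by simp
    finally have "\<bar>real d * (of_int (round (real d * a)) / real d - a)\<bar> < real d * \<delta>"
      using d by (simp add: right_diff_distrib)
    then show ?thesis using d by (simp add: abs_mult)
  qed
  have pq: "p \<noteq> 0 \<or> q \<noteq> 0"
  proof (rule ccontr)
    assume "\<not> ?thesis"
    then have "\<bar>\<alpha>\<bar> < \<delta>" "\<bar>\<beta>\<bar> < \<delta>" using near[of \<alpha>] near[of \<beta>] by (auto simp: p_def q_def)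
    then show False using \<delta>(4) by auto
  qed
  let ?\<psi> = "\<lambda>x. p * \<chi>1 x + q * \<chi>2 x"
  have "in_BNS G N (\<lambda>x. of_int p / real d * ?c1 x + of_int q / real d * ?c2 x)"
    using near[of \<alpha>] near[of \<beta>] \<delta> by (intro \<delta>1) (auto simp: p_def q_def)
  then have "in_BNS G N (\<lambda>x. real d * (of_int p / real d * ?c1 x + of_int q / real d * ?c2 x))"
    using d by (subst in_BNS_scale) auto
  then have B1: "in_BNS G N (\<lambda>x. real_of_int (?\<psi> x))"
    using d by (simp add: distrib_left)
  have "\<bar>- (of_int p / real d) + \<alpha>\<bar> < \<delta>2" "\<bar>- (of_int q / real d) + \<beta>\<bar> < \<delta>2"
    using near[of \<alpha>] near[of \<beta>] \<delta> by (auto simp: p_def q_def)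
  then have "in_BNS G N (\<lambda>x. - (of_int p / real d) * ?c1 x + - (of_int q / real d) * ?c2 x)"
    by (rule \<delta>2)
  then have "in_BNS G N (\<lambda>x. real d * (- (of_int p / real d) * ?c1 x + - (of_int q / real d) * ?c2 x))"
    using d by (subst in_BNS_scale) auto
  then have B2: "in_BNS G N (\<lambda>x. - real_of_int (?\<psi> x))"
    using d by (simp add: distrib_left right_diff_distrib)
  obtain y where y: "y \<in> carrier G" "?\<psi> y \<noteq> 0"
  proof (cases "q = 0")
    case True
    then show ?thesis using that[of x] x pq by simp
  next
    case False
    then show ?thesis using that[of z] z by simp
  qed
  have hom: "add_hom G ?\<psi>" using \<chi>1 \<chi>2 by (auto simp: add_hom_def algebra_simps)
  show ?thesis
    by (rule int_character_splits[OF hom _ y B1 B2 fg]) (use \<chi>1 \<chi>2 in auto)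
qed

text \<open>\<open>\<chi>'\<close> is \<open>\<chi>\<close> composed with the inverse of
  \<open>\<mu>\<close>. It is computed on chosen preimages, and the choice is invisible because
  \<open>\<chi>\<close> vanishes on \<open>N\<close>.\<close>

lemma transport_character:
  assumes \<mu>: "\<mu> \<in> iso Q Q" and \<chi>: "add_hom G \<chi>" and N0: "\<And>n. n \<in> N \<Longrightarrow> \<chi> n = 0"
  shows "\<exists>\<chi>'. add_hom G \<chi>' \<and> (\<forall>n\<in>N. \<chi>' n = 0) \<and>
    (\<forall>a\<in>carrier G. \<forall>b\<in>carrier G. \<mu> (N #> a) = N #> b \<longrightarrow> \<chi>' b = \<chi> a)"
proof -
  interpret Q: comm_group Q by (rule comm_group_Q)
  interpret \<mu>: group_hom Q Q \<mu> using \<mu> by unfold_locales (auto simp: iso_def)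
  have inj: "inj_on \<mu> (carrier Q)" and surj: "\<mu> ` carrier Q = carrier Q"
    using \<mu> by (auto simp: iso_def bij_betw_def)
  define r where "r b = (SOME a. a \<in> carrier G \<and> \<mu> (N #> a) = N #> b)" for b
  have r: "r b \<in> carrier G \<and> \<mu> (N #> r b) = N #> b" if b: "b \<in> carrier G" for b
  proof -
    have "N #> b \<in> \<mu> ` carrier Q" using surj coset_closed[OF b] by simp
    then obtain a where "a \<in> carrier G" "N #> b = \<mu> (N #> a)" by (auto simp: carrier_FactGroup)
    then have "\<exists>a. a \<in> carrier G \<and> \<mu> (N #> a) = N #> b" by auto
    then show ?thesis unfolding r_def by (rule someI_ex)
  qed
  have eq: "\<chi> (r b) = \<chi> a" if "a \<in> carrier G" "b \<in> carrier G" "\<mu> (N #> a) = N #> b" for a b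
  proof -
    have "N #> r b = N #> a"
      by (rule inj_onD[OF inj]) (use that r[OF that(2)] coset_closed in auto)
    then have "r b \<otimes> inv a \<in> N" using coset_eq_iff r[OF that(2)] that by simp
    then have "\<chi> (r b \<otimes> inv a) = 0" by (rule N0)
    then show ?thesis using r[OF that(2)] that by (simp add: add_hom_mult[OF \<chi>] add_hom_inv[OF \<chi>])
  qed
  have "add_hom G (\<lambda>b. \<chi> (r b))"
    unfolding add_hom_def
  proof (intro ballI)
    fix b c assume bc: "b \<in> carrier G" "c \<in> carrier G"
    have "\<mu> (N #> (r b \<otimes> r c)) = N #> (b \<otimes> c)"
      using r[OF bc(1)] r[OF bc(2)] bc by (simp add: coset_mult[symmetric] coset_closed)
    then have "\<chi> (r (b \<otimes> c)) = \<chi> (r b \<otimes> r c)" by (rule eq[rotated 2]) (use r bc in auto)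
    then show "\<chi> (r (b \<otimes> c)) = \<chi> (r b) + \<chi> (r c)" using r bc by (simp add: add_hom_mult[OF \<chi>])
  qed
  moreover have "\<chi> (r n) = 0" if "n \<in> N" for n
  proof -
    have "N #> n = \<one>\<^bsub>Q\<^esub>" using that coset_one_iff by simp
    moreover have "N #> \<one> = \<one>\<^bsub>Q\<^esub>" using coset_one_iff[of \<one>] by simp
    ultimately have "\<mu> (N #> \<one>) = N #> n" by simp
    then have "\<chi> (r n) = \<chi> \<one>" by (rule eq[rotated 2]) (use that in auto)
    then show ?thesis using add_hom_one[OF \<chi>] by simp
  qed
  ultimately show ?thesis using eq by (intro exI[of _ "\<lambda>b. \<chi> (r b)"]) auto
qed

text \<open>As \<open>Q\<close> is abelian, comparing the two coordinates in \<open>Q\<close> is a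
  homomorphism. This accounts for normality, and it also allows a fibre product to be treated as a
  kernel with finite image.\<close>

lemma fibre_product_kernel:
  assumes \<mu>: "\<mu> \<in> iso Q Q"
  defines "\<phi> \<equiv> \<lambda>(g1, g2). \<mu> (N #> g1) \<otimes>\<^bsub>Q\<^esub> inv\<^bsub>Q\<^esub> (N #> g2)"
  shows "group_hom (G \<times>\<times> G) Q \<phi>" "fibre_product G N \<mu> = kernel (G \<times>\<times> G) Q \<phi>"
proof -
  interpret Q: comm_group Q by (rule comm_group_Q)
  interpret \<mu>: group_hom Q Q \<mu> using \<mu> by unfold_locales (auto simp: iso_def)
  interpret GG: group "G \<times>\<times> G" by (rule DirProd_group[OF is_group is_group])
  note cl = coset_closed
  have "\<phi> (p \<otimes>\<^bsub>G \<times>\<times> G\<^esub> q) = \<phi> p \<otimes>\<^bsub>Q\<^esub> \<phi> q" if "p \<in> carrier (G \<times>\<times> G)" "q \<in> carrier (G \<times>\<times> G)" for p q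
    using that cl by (auto simp: \<phi>_def coset_mult[symmetric] Q.inv_mult Q.m_ac)
  moreover have "\<phi> p \<in> carrier Q" if "p \<in> carrier (G \<times>\<times> G)" for p using that cl by (auto simp: \<phi>_def)
  ultimately show "group_hom (G \<times>\<times> G) Q \<phi>"
    by (intro group_hom.intro group_hom_axioms.intro GG.is_group Q.is_group homI)
  have "\<mu> (N #> g1) \<otimes>\<^bsub>Q\<^esub> inv\<^bsub>Q\<^esub> (N #> g2) = \<one>\<^bsub>Q\<^esub> \<longleftrightarrow> \<mu> (N #> g1) = N #> g2"
    if "g1 \<in> carrier G" "g2 \<in> carrier G" for g1 g2
    using that cl Q.inv_solve_right'[of "\<one>\<^bsub>Q\<^esub>" "\<mu> (N #> g1)" "N #> g2"] by auto
  then show "fibre_product G N \<mu> = kernel (G \<times>\<times> G) Q \<phi>"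
    by (auto simp: fibre_product_def kernel_def \<phi>_def)
qed

lemma fibre_product_normal: "\<mu> \<in> iso Q Q \<Longrightarrow> fibre_product G N \<mu> \<lhd> (G \<times>\<times> G)"
  using fibre_product_kernel group_hom.normal_kernel by metis

text \<open>The subgroups \<open>N \<times> {\<one>}\<close> and \<open>{\<one>} \<times> N\<close>
  are normal in the fibre product and commute, and \<open>\<chi> \<circ> fst\<close> vanishes on
  both. On the fibre product it equals \<open>\<chi>' \<circ> snd\<close>, so the second projection
  turns its lower half-space into the upper one of the negative of \<open>\<chi>'\<close>.\<close>

lemma fibre_product_BNS:
  assumes \<mu>: "\<mu> \<in> iso Q Q" and fp: "finitely_presented ((G \<times>\<times> G)\<lparr>carrier := fibre_product G N \<mu>\<rparr>)"
    and \<chi>: "add_hom G (\<chi> :: 'a \<Rightarrow> real)" "\<And>n. n \<in> N \<Longrightarrow> \<chi> n = 0" "\<exists>x\<in>carrier G. \<chi> x \<noteq> 0"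
    and \<chi>': "\<And>a b. a \<in> carrier G \<Longrightarrow> b \<in> carrier G \<Longrightarrow> \<mu> (N #> a) = N #> b \<Longrightarrow> \<chi>' b = \<chi> a"
  shows "in_BNS G N \<chi> \<or> in_BNS G N (\<lambda>x. - \<chi>' x)"
proof -
  interpret Q: comm_group Q by (rule comm_group_Q)
  interpret \<mu>: group_hom Q Q \<mu> using \<mu> by unfold_locales (auto simp: iso_def)
  let ?H = "fibre_product G N \<mu>"
  let ?HG = "(G \<times>\<times> G)\<lparr>carrier := ?H\<rparr>"
  interpret GG: group "G \<times>\<times> G" by (rule DirProd_group[OF is_group is_group])
  have Hsub: "subgroup ?H (G \<times>\<times> G)" using fibre_product_normal[OF \<mu>] normal_imp_subgroup by blast
  interpret H: group ?HG by (rule GG.subgroup_imp_group[OF Hsub])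
  have inv_H: "inv\<^bsub>?HG\<^esub> (a, b) = (inv a, inv b)" if "(a, b) \<in> ?H" for a b
    using GG.m_inv_consistent[OF Hsub that] that is_group by (auto simp: fibre_product_def)
  have one: "N #> \<one> = \<one>\<^bsub>Q\<^esub>" and Nn: "\<And>n. n \<in> N \<Longrightarrow> N #> n = \<one>\<^bsub>Q\<^esub>"
    using coset_one_iff by auto
  obtain n :: nat and g R where pres: "presents ?HG {..<n} g R"
    using finitely_presented_imp_presents[OF fp] by blast
  let ?B = "{..<n}"
  have g: "g ` ?B \<subseteq> carrier ?HG" and finB: "finite (g ` ?B)" using pres by (auto simp: presents_def)
  have fst: "group_hom ?HG G fst" and snd: "group_hom ?HG G snd"
    using H.group_axioms is_group
    by (auto simp: group_hom_def group_hom_axioms_def hom_def fibre_product_def)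
  have "(\<forall>a\<in>N \<times> {\<one>}. (\<one>\<^bsub>?HG\<^esub>, a) \<in> joined ?HG (g ` ?B) {x. 0 \<le> (\<chi> \<circ> fst) x}) \<or>
    (\<forall>b\<in>{\<one>} \<times> N. (\<one>\<^bsub>?HG\<^esub>, b) \<in> joined ?HG (g ` ?B) {x. (\<chi> \<circ> fst) x \<le> 0})"
  proof (rule presents_commuting_normal_joined[OF pres])
    show "add_hom ?HG (\<chi> \<circ> fst)"
      using \<chi>(1) by (auto simp: add_hom_def fibre_product_def)
    obtain x where x: "x \<in> carrier G" "\<chi> x \<noteq> 0" using \<chi>(3) by blast
    have "\<mu> (N #> x) \<in> carrier Q" using coset_closed[OF x(1)] by simp
    then obtain y where "y \<in> carrier G" "\<mu> (N #> x) = N #> y" by (auto simp: carrier_FactGroup)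
    then show "\<exists>x\<in>carrier ?HG. (\<chi> \<circ> fst) x \<noteq> 0"
      using x by (intro bexI[of _ "(x, y)"]) (auto simp: fibre_product_def)
    have N1: "N \<times> {\<one>} \<subseteq> ?H" "{\<one>} \<times> N \<subseteq> ?H"
      using Nn subset \<mu>.hom_one by (auto simp: fibre_product_def one_FactGroup)
    have sub1: "subgroup (N \<times> {\<one>}) ?HG" "subgroup ({\<one>} \<times> N) ?HG"
      using GG.subgroup_incl[OF _ Hsub] N1
        DirProd_subgroups[OF is_group is_subgroup is_group triv_subgroup]
        DirProd_subgroups[OF is_group triv_subgroup is_group is_subgroup] by auto
    show "N \<times> {\<one>} \<lhd> ?HG"
    proof (rule H.normal_invI[OF sub1(1)])
      fix x h assume x: "x \<in> carrier ?HG" and h: "h \<in> N \<times> {\<one>}"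
      obtain a b where ab: "x = (a, b)" "(a, b) \<in> ?H" using x by (cases x) auto
      then have "a \<in> carrier G" "b \<in> carrier G" by (auto simp: fibre_product_def)
      then show "x \<otimes>\<^bsub>?HG\<^esub> h \<otimes>\<^bsub>?HG\<^esub> inv\<^bsub>?HG\<^esub> x \<in> N \<times> {\<one>}"
        using h inv_op_closed2[of a "fst h"] ab(1) inv_H[OF ab(2)] by auto
    qed
    show "{\<one>} \<times> N \<lhd> ?HG"
    proof (rule H.normal_invI[OF sub1(2)])
      fix x h assume x: "x \<in> carrier ?HG" and h: "h \<in> {\<one>} \<times> N"
      obtain a b where ab: "x = (a, b)" "(a, b) \<in> ?H" using x by (cases x) auto
      then have "a \<in> carrier G" "b \<in> carrier G" by (auto simp: fibre_product_def)
      then show "x \<otimes>\<^bsub>?HG\<^esub> h \<otimes>\<^bsub>?HG\<^esub> inv\<^bsub>?HG\<^esub> x \<in> {\<one>} \<times> N"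
        using h inv_op_closed2[of b "snd h"] ab(1) inv_H[OF ab(2)] by auto
    qed
    show "(\<chi> \<circ> fst) x = 0" if "x \<in> N \<times> {\<one>}" for x using that \<chi>(2) by auto
    show "(\<chi> \<circ> fst) x = 0" if "x \<in> {\<one>} \<times> N" for x using that add_hom_one[OF \<chi>(1)] by auto
    show "x \<otimes>\<^bsub>?HG\<^esub> y = y \<otimes>\<^bsub>?HG\<^esub> x" if "x \<in> N \<times> {\<one>}" "y \<in> {\<one>} \<times> N" for x y
      using that by auto
  qed
  then show ?thesis
  proof (elim disjE)
    assume a: "\<forall>a\<in>N \<times> {\<one>}. (\<one>\<^bsub>?HG\<^esub>, a) \<in> joined ?HG (g ` ?B) {x. 0 \<le> (\<chi> \<circ> fst) x}"
    have "(\<one>, n) \<in> joined G (fst ` g ` ?B) {x. 0 \<le> \<chi> x}" if "n \<in> N" for n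
      using joined_hom[OF fst g, of "\<one>\<^bsub>?HG\<^esub>" "(n, \<one>)" "{x. 0 \<le> (\<chi> \<circ> fst) x}" "{x. 0 \<le> \<chi> x}"]
        a that H.one_closed by auto
    then have "in_BNS G N \<chi>"
      unfolding in_BNS_def using finB g
      by (intro exI[of _ "fst ` g ` ?B"]) (auto simp: fibre_product_def)
    then show ?thesis ..
  next
    assume b: "\<forall>b\<in>{\<one>} \<times> N. (\<one>\<^bsub>?HG\<^esub>, b) \<in> joined ?HG (g ` ?B) {x. (\<chi> \<circ> fst) x \<le> 0}"
    have "(\<one>, n) \<in> joined G (snd ` g ` ?B) {x. 0 \<le> - \<chi>' x}" if n: "n \<in> N" for n
    proof -
      have "(snd (\<one>\<^bsub>?HG\<^esub>), snd (\<one>, n)) \<in> joined G (snd ` g ` ?B) {x. 0 \<le> - \<chi>' x}"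
      proof (rule joined_hom[OF snd g])
        show "(\<one>\<^bsub>?HG\<^esub>, (\<one>, n)) \<in> joined ?HG (g ` ?B) {x. (\<chi> \<circ> fst) x \<le> 0}" using b n by blast
        show "snd x \<in> {x. 0 \<le> - \<chi>' x}" if x: "x \<in> {x. (\<chi> \<circ> fst) x \<le> 0}" "x \<in> carrier ?HG" for x
        proof -
          have "\<chi>' (snd x) = \<chi> (fst x)" using x(2) by (intro \<chi>') (auto simp: fibre_product_def)
          then show ?thesis using x(1) by simp
        qed
      qed (rule H.one_closed)
      then show ?thesis by simp
    qed
    then have "in_BNS G N (\<lambda>x. - \<chi>' x)"
      unfolding in_BNS_def using finB g
      by (intro exI[of _ "snd ` g ` ?B"]) (auto simp: fibre_product_def)
    then show ?thesis ..
  qed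
qed

lemma two_int_characters:
  assumes fg: "finite S" "S \<subseteq> carrier G" "generate G S = carrier G" and rk: "co_rank G N = 2"
  shows "\<exists>(\<chi>1 :: 'a \<Rightarrow> int) (\<chi>2 :: 'a \<Rightarrow> int). add_hom G \<chi>1 \<and> add_hom G \<chi>2 \<and>
    (\<forall>n\<in>N. \<chi>1 n = 0 \<and> \<chi>2 n = 0) \<and> (\<exists>x\<in>carrier G. \<chi>1 x \<noteq> 0) \<and> (\<exists>z\<in>carrier G. \<chi>1 z = 0 \<and> \<chi>2 z \<noteq> 0)"
proof -
  interpret Q: comm_group Q by (rule comm_group_Q)
  obtain x y where xy: "x \<in> carrier G" "y \<in> carrier G"
    and ind: "\<And>(i::int) (j::int). x [^] i \<otimes> y [^] j \<in> N \<Longrightarrow> i = 0 \<and> j = 0"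
    using rank_ge_2[OF rk] by blast
  have "k = 0" if "x [^] k \<in> N" for k :: int using ind[of k 0] that xy by simp
  then obtain \<chi>1 :: "'a \<Rightarrow> int" where \<chi>1: "add_hom G \<chi>1" "\<And>n. n \<in> N \<Longrightarrow> \<chi>1 n = 0" "\<chi>1 x \<noteq> 0"
    using exists_int_hom_coset[OF fg xy(1)] by blast
  \<comment> \<open>Eliminates \<open>\<chi>1\<close>. As \<open>\<chi>1 x\<close> is not 0, no
    power of \<open>z\<close> with nonzero exponent lies in \<open>N\<close>, so some character is
    nonzero on it.\<close>
  define z where "z = y [^] (\<chi>1 x) \<otimes> x [^] (- \<chi>1 y)"
  have z: "z \<in> carrier G" using xy by (simp add: z_def)
  have z1: "\<chi>1 z = 0" using xy by (simp add: z_def add_hom_mult[OF \<chi>1(1)] add_hom_int_pow[OF \<chi>1(1)])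
  have "k = 0" if k: "z [^] k \<in> N" for k :: int
  proof -
    have "N #> (z [^] k) = (N #> z) [^]\<^bsub>Q\<^esub> k" using z by (simp add: FactGroup_int_pow)
    also have "N #> z = (N #> y) [^]\<^bsub>Q\<^esub> (\<chi>1 x) \<otimes>\<^bsub>Q\<^esub> (N #> x) [^]\<^bsub>Q\<^esub> (- \<chi>1 y)"
      using xy by (simp add: z_def FactGroup_int_pow coset_mult)
    also have "\<dots> [^]\<^bsub>Q\<^esub> k = (N #> x) [^]\<^bsub>Q\<^esub> (- \<chi>1 y * k) \<otimes>\<^bsub>Q\<^esub> (N #> y) [^]\<^bsub>Q\<^esub> (\<chi>1 x * k)"
      using xy coset_closed by (simp add: Q.int_pow_distrib Q.int_pow_pow Q.m_comm)
    also have "\<dots> = N #> (x [^] (- \<chi>1 y * k) \<otimes> y [^] (\<chi>1 x * k))"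
      using xy by (simp add: FactGroup_int_pow coset_mult)
    finally have "N #> (x [^] (- \<chi>1 y * k) \<otimes> y [^] (\<chi>1 x * k)) = \<one>\<^bsub>Q\<^esub>"
      using coset_one_iff[of "z [^] k"] k z by simp
    then have "x [^] (- \<chi>1 y * k) \<otimes> y [^] (\<chi>1 x * k) \<in> N"
      using xy by (subst (asm) coset_one_iff) auto
    then show ?thesis using ind \<chi>1(3) by fastforce
  qed
  then obtain \<chi>2 :: "'a \<Rightarrow> int" where "add_hom G \<chi>2" "\<And>n. n \<in> N \<Longrightarrow> \<chi>2 n = 0" "\<chi>2 z \<noteq> 0"
    using exists_int_hom_coset[OF fg z] by blast
  then show ?thesis using \<chi>1 xy z z1 by blast
qed

text \<open>
  If \<open>G\<close> did not split, then \<open>\<chi>\<close> and \<open>- \<chi>\<close> would never both lie in the invariant, while the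
  fibre product forces one of them to; so the circle of characters would be disconnected.
\<close>

lemma fibre_product_imp_splits:
  assumes fg: "finite S" "S \<subseteq> carrier G" "generate G S = carrier G" and rk: "co_rank G N = 2"
    and \<mu>: "\<mu> \<in> iso Q Q" and fp: "finitely_presented ((G \<times>\<times> G)\<lparr>carrier := fibre_product G N \<mu>\<rparr>)"
  shows "splits_over_cyclic G N"
proof (rule ccontr)
  assume neg: "\<not> splits_over_cyclic G N"
  interpret Q: comm_group Q by (rule comm_group_Q)
  interpret \<mu>: group_hom Q Q \<mu> using \<mu> by unfold_locales (auto simp: iso_def)
  obtain \<chi>1 \<chi>2 :: "'a \<Rightarrow> int" and x z where \<chi>12: "add_hom G \<chi>1" "add_hom G \<chi>2"
      "\<forall>n\<in>N. \<chi>1 n = 0 \<and> \<chi>2 n = 0"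
    and x: "x \<in> carrier G" "\<chi>1 x \<noteq> 0" and z: "z \<in> carrier G" "\<chi>1 z = 0" "\<chi>2 z \<noteq> 0"
    using two_int_characters[OF fg rk] by blast
  then have \<chi>1: "add_hom G \<chi>1" "\<And>n. n \<in> N \<Longrightarrow> \<chi>1 n = 0"
    and \<chi>2: "add_hom G \<chi>2" "\<And>n. n \<in> N \<Longrightarrow> \<chi>2 n = 0" by auto
  obtain \<psi>1 :: "'a \<Rightarrow> int" where \<psi>1: "add_hom G \<psi>1" "\<And>n. n \<in> N \<Longrightarrow> \<psi>1 n = 0"
    "\<And>a b. a \<in> carrier G \<Longrightarrow> b \<in> carrier G \<Longrightarrow> \<mu> (N #> a) = N #> b \<Longrightarrow> \<psi>1 b = \<chi>1 a"
    using transport_character[OF \<mu> \<chi>1] by blast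
  obtain \<psi>2 :: "'a \<Rightarrow> int" where \<psi>2: "add_hom G \<psi>2" "\<And>n. n \<in> N \<Longrightarrow> \<psi>2 n = 0"
    "\<And>a b. a \<in> carrier G \<Longrightarrow> b \<in> carrier G \<Longrightarrow> \<mu> (N #> a) = N #> b \<Longrightarrow> \<psi>2 b = \<chi>2 a"
    using transport_character[OF \<mu> \<chi>2] by blast
  have lift: "\<exists>b\<in>carrier G. \<mu> (N #> a) = N #> b" if "a \<in> carrier G" for a
    using \<mu>.hom_closed[OF coset_closed[OF that]] by (auto simp: carrier_FactGroup)
  obtain x' z' where x': "x' \<in> carrier G" "\<mu> (N #> x) = N #> x'" and z': "z' \<in> carrier G" "\<mu> (N #> z) = N #> z'"
    using lift x z by metis
  have x'1: "\<psi>1 x' \<noteq> 0" and z'1: "\<psi>1 z' = 0" "\<psi>2 z' \<noteq> 0"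
    using \<psi>1(3)[OF x(1) x'] \<psi>1(3)[OF z(1) z'] \<psi>2(3)[OF z(1) z'] x z by auto
  \<comment> \<open>\<open>c a b\<close> runs through a plane of characters and \<open>e a b\<close>
    through their transports under \<open>\<mu>\<close>; the fibre product relates
    \<open>c a b\<close> to \<open>e (- a) (- b)\<close>.\<close>
  define c where "c a b y = a * real_of_int (\<chi>1 y) + b * real_of_int (\<chi>2 y)" for a b y
  define e where "e a b y = a * real_of_int (\<psi>1 y) + b * real_of_int (\<psi>2 y)" for a b y
  have c_hom: "add_hom G (c a b)" for a b
    using \<chi>1 \<chi>2 by (auto simp: add_hom_def c_def algebra_simps)
  have c_ne: "\<exists>y\<in>carrier G. c a b y \<noteq> 0" if "a \<noteq> 0 \<or> b \<noteq> 0" for a b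
  proof (cases "b = 0")
    case True
    then show ?thesis using that x by (intro bexI[of _ x]) (auto simp: c_def)
  next
    case False
    then show ?thesis using z by (intro bexI[of _ z]) (auto simp: c_def)
  qed
  have not_both: "\<not> (in_BNS G N (c a b) \<and> in_BNS G N (c (- a) (- b)))" if "a \<noteq> 0 \<or> b \<noteq> 0" for a b
    using real_character_splits[OF \<chi>1 \<chi>2 x z that _ _ fg] neg unfolding c_def by blast
  have not_both': "\<not> (in_BNS G N (e a b) \<and> in_BNS G N (e (- a) (- b)))" if "a \<noteq> 0 \<or> b \<noteq> 0" for a b
    using real_character_splits[OF \<psi>1(1,2) \<psi>2(1,2) x'(1) x'1 z'(1) z'1 that _ _ fg] neg unfolding e_def by blast
  have fibre: "in_BNS G N (c a b) \<or> in_BNS G N (e (- a) (- b))" if "a \<noteq> 0 \<or> b \<noteq> 0" for a b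
  proof -
    have "in_BNS G N (c a b) \<or> in_BNS G N (\<lambda>y. - e a b y)"
      by (rule fibre_product_BNS[OF \<mu> fp c_hom _ c_ne[OF that]])
         (use \<chi>1 \<chi>2 \<psi>1 \<psi>2 in \<open>auto simp: c_def e_def\<close>)
    moreover have "(\<lambda>y. - e a b y) = e (- a) (- b)" by (auto simp: e_def)
    ultimately show ?thesis by simp
  qed
  \<comment> \<open>If neither \<open>c a b\<close> nor its negative belonged to the invariant, the
    fibre product would put both \<open>e a b\<close> and its negative into it, contrary to
    \<open>not_both'\<close>.\<close>
  have one_of: "in_BNS G N (c a b) \<or> in_BNS G N (c (- a) (- b))" if "a \<noteq> 0 \<or> b \<noteq> 0" for a b
    using fibre[of a b] fibre[of "- a" "- b"] not_both'[of a b] that by auto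
  \<comment> \<open>The circle is parametrised by the real line, whose connectedness suffices.
    Adding \<open>pi\<close> maps each of \<open>A\<close> and \<open>A'\<close> into the other, so
    if one is empty, both are.\<close>
  define A where "A = {\<theta>. in_BNS G N (c (cos \<theta>) (sin \<theta>))}"
  define A' where "A' = {\<theta>. in_BNS G N (c (- cos \<theta>) (- sin \<theta>))}"
  have ne0: "cos \<theta> \<noteq> 0 \<or> sin \<theta> \<noteq> 0" for \<theta> :: real
    by (metis sin_zero_abs_cos_one abs_zero zero_neq_one)
  have open_gen: "open {\<theta>. in_BNS G N (c (f \<theta>) (g \<theta>))}"
    if f: "continuous_on UNIV f" and g: "continuous_on UNIV g" and ne: "\<And>\<theta>. f \<theta> \<noteq> 0 \<or> g \<theta> \<noteq> 0"
    for f g :: "real \<Rightarrow> real"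
  proof (subst open_subopen, rule ballI)
    fix \<theta> assume "\<theta> \<in> {\<theta>. in_BNS G N (c (f \<theta>) (g \<theta>))}"
    then have "in_BNS G N (\<lambda>y. f \<theta> * real_of_int (\<chi>1 y) + g \<theta> * real_of_int (\<chi>2 y))"
      by (simp add: c_def[abs_def])
    moreover have "add_hom G (\<lambda>y. real_of_int (\<chi>1 y))" "add_hom G (\<lambda>y. real_of_int (\<chi>2 y))"
      using \<chi>1 \<chi>2 by (auto simp: add_hom_def)
    ultimately obtain \<delta> where \<delta>: "\<delta> > 0" "\<And>a b. \<bar>a - f \<theta>\<bar> < \<delta> \<Longrightarrow> \<bar>b - g \<theta>\<bar> < \<delta> \<Longrightarrow> in_BNS G N (c a b)"
      using in_BNS_open[of "\<lambda>y. real_of_int (\<chi>1 y)" "\<lambda>y. real_of_int (\<chi>2 y)" N "f \<theta>" "g \<theta>" S]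
        c_ne[OF ne[of \<theta>]] \<chi>1 \<chi>2 subset commutator_in fg unfolding c_def by auto
    have "open {t. \<bar>f t - f \<theta>\<bar> < \<delta>}" "open {t. \<bar>g t - g \<theta>\<bar> < \<delta>}"
      by (auto intro!: open_Collect_less continuous_intros f g)
    then have "open ({t. \<bar>f t - f \<theta>\<bar> < \<delta>} \<inter> {t. \<bar>g t - g \<theta>\<bar> < \<delta>})" by (rule open_Int)
    then show "\<exists>T. open T \<and> \<theta> \<in> T \<and> T \<subseteq> {\<theta>. in_BNS G N (c (f \<theta>) (g \<theta>))}"
      using \<delta> by (intro exI[of _ "{t. \<bar>f t - f \<theta>\<bar> < \<delta>} \<inter> {t. \<bar>g t - g \<theta>\<bar> < \<delta>}"]) auto
  qed
  have "open A" "open A'"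
    unfolding A_def A'_def using ne0 by (auto intro!: open_gen continuous_intros)
  moreover have "A \<inter> A' \<inter> UNIV = {}" using not_both[OF ne0] by (auto simp: A_def A'_def)
  moreover have "UNIV \<subseteq> A \<union> A'" using one_of[OF ne0] by (auto simp: A_def A'_def)
  ultimately have disj: "A = {} \<or> A' = {}" using connectedD[OF connected_UNIV, of A A'] by simp
  have "\<theta> + pi \<in> A'" if "\<theta> \<in> A" for \<theta> using that by (simp add: A_def A'_def)
  moreover have "\<theta> + pi \<in> A" if "\<theta> \<in> A'" for \<theta> using that by (simp add: A_def A'_def)
  ultimately have "A = {}" "A' = {}" using disj by blast+
  then show False using \<open>UNIV \<subseteq> A \<union> A'\<close> by simp
qed

end

section \<open>Commuting families of conjugates\<close>

context group
begin

definition conj_by :: "'a \<Rightarrow> 'a \<Rightarrow> 'a" where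
  "conj_by c z = c \<otimes> z \<otimes> inv c"

lemma conj_by_closed [simp]: "c \<in> carrier G \<Longrightarrow> z \<in> carrier G \<Longrightarrow> conj_by c z \<in> carrier G"
  by (simp add: conj_by_def)

lemma conj_by_one [simp]: "c \<in> carrier G \<Longrightarrow> conj_by c \<one> = \<one>"
  by (simp add: conj_by_def)

lemma conj_by_by_one [simp]: "z \<in> carrier G \<Longrightarrow> conj_by \<one> z = z"
  by (simp add: conj_by_def)

lemma conj_by_mult:
  "\<lbrakk>c \<in> carrier G; y \<in> carrier G; z \<in> carrier G\<rbrakk> \<Longrightarrow> conj_by c (y \<otimes> z) = conj_by c y \<otimes> conj_by c z"
  by (simp add: conj_by_def m_assoc) (simp add: m_assoc[symmetric])

lemma conj_by_inv: "\<lbrakk>c \<in> carrier G; z \<in> carrier G\<rbrakk> \<Longrightarrow> conj_by c (inv z) = inv (conj_by c z)"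
  by (simp add: conj_by_def inv_mult_group m_assoc)

lemma conj_by_conj_by:
  "\<lbrakk>c \<in> carrier G; d \<in> carrier G; z \<in> carrier G\<rbrakk> \<Longrightarrow> conj_by c (conj_by d z) = conj_by (c \<otimes> d) z"
  by (simp add: conj_by_def inv_mult_group m_assoc)

lemma conj_by_hom: "c \<in> carrier G \<Longrightarrow> group_hom G G (conj_by c)"
  by unfold_locales (auto simp: hom_def conj_by_mult)

lemma conj_by_inj: "\<lbrakk>c \<in> carrier G; y \<in> carrier G; z \<in> carrier G; conj_by c y = conj_by c z\<rbrakk> \<Longrightarrow> y = z"
  by (simp add: conj_by_def)

lemma conj_by_inverse [simp]:
  "\<lbrakk>c \<in> carrier G; z \<in> carrier G\<rbrakk> \<Longrightarrow> conj_by c (conj_by (inv c) z) = z"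
  "\<lbrakk>c \<in> carrier G; z \<in> carrier G\<rbrakk> \<Longrightarrow> conj_by (inv c) (conj_by c z) = z"
  by (simp_all add: conj_by_conj_by)

lemma conj_by_in_subgroup: "subgroup H G \<Longrightarrow> c \<in> H \<Longrightarrow> z \<in> H \<Longrightarrow> conj_by c z \<in> H"
  by (simp add: conj_by_def subgroup.m_closed subgroup.m_inv_closed)

lemma conj_by_commute:
  "\<lbrakk>c \<in> carrier G; z \<in> carrier G; c \<otimes> z = z \<otimes> c\<rbrakk> \<Longrightarrow> conj_by c z = z"
  by (simp add: conj_by_def m_assoc)

lemma commute_conj_by_iff:
  assumes "c \<in> carrier G" "y \<in> carrier G" "z \<in> carrier G"
  shows "conj_by c y \<otimes> conj_by c z = conj_by c z \<otimes> conj_by c y \<longleftrightarrow> y \<otimes> z = z \<otimes> y"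
  using assms conj_by_inj[of c "y \<otimes> z" "z \<otimes> y"] by (auto simp: conj_by_mult[symmetric])

lemma conj_by_generate:
  assumes A: "A \<subseteq> carrier G" and c: "c \<in> carrier G" and H: "subgroup H G"
    and "\<And>a. a \<in> A \<Longrightarrow> conj_by c a \<in> H" and z: "z \<in> generate G A"
  shows "conj_by c z \<in> H"
  using z
proof (induction rule: generate.induct)
  case (eng h1 h2)
  have "h1 \<in> carrier G" "h2 \<in> carrier G" using eng A generate_in_carrier by auto
  then show ?case using eng c by (simp add: conj_by_mult subgroup.m_closed[OF H])
qed (use assms in \<open>auto simp: conj_by_inv subgroup.one_closed subgroup.m_inv_closed subset_iff\<close>)

lemma commute_inv:
  assumes "x \<in> carrier G" "y \<in> carrier G" "x \<otimes> y = y \<otimes> x"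
  shows "x \<otimes> inv y = inv y \<otimes> x"
proof -
  have "x \<otimes> inv y = inv y \<otimes> (y \<otimes> x) \<otimes> inv y" using assms(1,2) by (simp add: m_assoc[symmetric])
  also have "\<dots> = inv y \<otimes> x" using assms(1,2) by (simp add: assms(3)[symmetric] m_assoc)
  finally show ?thesis .
qed

lemma generate_commute_left:
  assumes A: "A \<subseteq> carrier G" and y: "y \<in> carrier G"
    and "\<And>x. x \<in> A \<Longrightarrow> x \<otimes> y = y \<otimes> x" and x: "x \<in> generate G A"
  shows "x \<otimes> y = y \<otimes> x"
  using x
proof (induction rule: generate.induct)
  case (inv h)
  then show ?case using assms commute_inv[of y h] by (auto simp: subset_iff)
next
  case (eng h1 h2)
  have c: "h1 \<in> carrier G" "h2 \<in> carrier G" using eng A generate_in_carrier by auto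
  have "h1 \<otimes> h2 \<otimes> y = h1 \<otimes> (y \<otimes> h2)" using eng c y by (simp add: m_assoc)
  also have "\<dots> = y \<otimes> h1 \<otimes> h2" using eng c y by (simp add: m_assoc[symmetric])
  finally show ?case using c y by (simp add: m_assoc)
qed (use assms in auto)

lemma generate_commute:
  assumes "A \<subseteq> carrier G" "B \<subseteq> carrier G" "\<And>x y. x \<in> A \<Longrightarrow> y \<in> B \<Longrightarrow> x \<otimes> y = y \<otimes> x"
    and "x \<in> generate G A" "y \<in> generate G B"
  shows "x \<otimes> y = y \<otimes> x"
proof (rule generate_commute_left[OF assms(1) _ _ assms(4)])
  show y: "y \<in> carrier G" using assms generate_in_carrier by auto
  fix x assume x: "x \<in> A"
  then show "x \<otimes> y = y \<otimes> x"
    using generate_commute_left[OF assms(2) _ _ assms(5), of x] assms(1,3) by (metis subsetD)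
qed

text \<open>\<open>I = UNIV\<close> will give the whole subgroup belonging to one family; bounded
  windows \<open>I\<close> measure how far conjugation spreads its generators.\<close>

definition slab :: "'a \<Rightarrow> ('j \<Rightarrow> 'a) \<Rightarrow> 'j set \<Rightarrow> int set \<Rightarrow> 'a set" where
  "slab \<sigma> x J I = generate G {conj_by (\<sigma> [^] i) (x j) | i j. i \<in> I \<and> j \<in> J}"

context
  fixes \<sigma> :: 'a and x :: "'j \<Rightarrow> 'a"
  assumes \<sigma>: "\<sigma> \<in> carrier G" and x: "\<And>j. x j \<in> carrier G"
begin

lemma slab_generators: "{conj_by (\<sigma> [^] i) (x j) | i j. i \<in> I \<and> j \<in> J} \<subseteq> carrier G" for I :: "int set"
  using \<sigma> x by auto

lemma slab_subgroup: "subgroup (slab \<sigma> x J I) G"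
  unfolding slab_def by (rule generate_is_subgroup[OF slab_generators])

lemma slab_closed: "z \<in> slab \<sigma> x J I \<Longrightarrow> z \<in> carrier G"
  using slab_subgroup subgroup.subset by blast

lemma slab_mono: "I \<subseteq> I' \<Longrightarrow> slab \<sigma> x J I \<subseteq> slab \<sigma> x J I'"
  unfolding slab_def by (rule mono_generate) auto

lemma slab_incl: "i \<in> I \<Longrightarrow> j \<in> J \<Longrightarrow> conj_by (\<sigma> [^] i) (x j) \<in> slab \<sigma> x J I"
  unfolding slab_def by (rule generate.incl) auto

lemma slab_shift:
  assumes "z \<in> slab \<sigma> x J I" and "\<And>i. i \<in> I \<Longrightarrow> k + i \<in> I'"
  shows "conj_by (\<sigma> [^] (k::int)) z \<in> slab \<sigma> x J I'"
  using assms(1) unfolding slab_def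
proof (rule conj_by_generate[OF slab_generators, rotated 3])
  show "subgroup (generate G {conj_by (\<sigma> [^] i) (x j) | i j. i \<in> I' \<and> j \<in> J}) G"
    by (rule generate_is_subgroup[OF slab_generators])
  fix a assume "a \<in> {conj_by (\<sigma> [^] i) (x j) | i j. i \<in> I \<and> j \<in> J}"
  then obtain i j where a: "a = conj_by (\<sigma> [^] i) (x j)" "i \<in> I" "j \<in> J" by auto
  have "conj_by (\<sigma> [^] k) a = conj_by (\<sigma> [^] (k + i)) (x j)"
    using \<sigma> x by (simp add: a conj_by_conj_by int_pow_mult)
  then show "conj_by (\<sigma> [^] k) a \<in> generate G {conj_by (\<sigma> [^] i) (x j) | i j. i \<in> I' \<and> j \<in> J}"
    using slab_incl[of "k + i" I' j J] assms(2) a by (simp add: slab_def)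
qed (use \<sigma> in auto)

text \<open>Moving \<open>c\<close> past one \<open>\<sigma>\<close> costs a factor \<open>w\<close>
  from the basic window and a factor \<open>v\<close> that commutes with the windows concerned. So
  each \<open>\<sigma>\<close> merely shifts the right end of the window by one, and the spread
  \<open>b\<close> does not accumulate with \<open>i\<close>.\<close>

lemma slab_spread:
  fixes b :: int and n :: nat
  assumes c: "c \<in> carrier G" and cx: "\<And>j. j \<in> J \<Longrightarrow> conj_by c (x j) \<in> slab \<sigma> x J {- b..b}"
    and c\<sigma>: "conj_by c \<sigma> = v \<otimes> w \<otimes> \<sigma>" and w: "w \<in> slab \<sigma> x J {- b..b}" and v: "v \<in> carrier G"
    and comm: "\<And>z. z \<in> slab \<sigma> x J {- b..int n + b} \<Longrightarrow> v \<otimes> z = z \<otimes> v"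
    and i: "i \<le> n" and j: "j \<in> J"
  shows "conj_by c (conj_by (\<sigma> [^] int i) (x j)) \<in> slab \<sigma> x J {- b..int i + b}"
  using i
proof (induction i)
  case 0
  then show ?case using cx[OF j] x by simp
next
  case (Suc i)
  let ?I = "{- b..int (Suc i) + b}"
  let ?z = "conj_by c (conj_by (\<sigma> [^] int i) (x j))"
  have z: "?z \<in> slab \<sigma> x J {- b..int i + b}" using Suc by simp
  have zc: "?z \<in> carrier G" using z slab_closed by blast
  have wc: "w \<in> carrier G" using w slab_closed by blast
  have "\<sigma> [^] int (Suc i) = \<sigma> \<otimes> \<sigma> [^] int i"
    using int_pow_mult[OF \<sigma>, of 1 "int i"] \<sigma> by (simp add: int_pow_mult)
  then have "conj_by c (conj_by (\<sigma> [^] int (Suc i)) (x j)) =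
      conj_by (c \<otimes> \<sigma>) (conj_by (\<sigma> [^] int i) (x j))"
    using \<sigma> x c by (simp add: conj_by_conj_by m_assoc)
  also have "c \<otimes> \<sigma> = conj_by c \<sigma> \<otimes> c" using c \<sigma> by (simp add: conj_by_def m_assoc)
  also have "conj_by (conj_by c \<sigma> \<otimes> c) (conj_by (\<sigma> [^] int i) (x j)) = conj_by (conj_by c \<sigma>) ?z"
    using c \<sigma> x by (simp add: conj_by_conj_by m_assoc)
  also have "\<dots> = conj_by v (conj_by w (conj_by \<sigma> ?z))"
    using zc wc v \<sigma> by (simp add: c\<sigma> conj_by_conj_by m_assoc)
  finally have eq: "conj_by c (conj_by (\<sigma> [^] int (Suc i)) (x j)) =
     conj_by v (conj_by w (conj_by \<sigma> ?z))" .
  have "conj_by (\<sigma> [^] (1::int)) ?z \<in> slab \<sigma> x J ?I" by (rule slab_shift[OF z]) auto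
  then have 1: "conj_by \<sigma> ?z \<in> slab \<sigma> x J ?I" using \<sigma> by simp
  have "w \<in> slab \<sigma> x J ?I" using w slab_mono[of "{- b..b}" ?I] by auto
  then have 2: "conj_by w (conj_by \<sigma> ?z) \<in> slab \<sigma> x J ?I"
    using 1 conj_by_in_subgroup[OF slab_subgroup] by blast
  have "?I \<subseteq> {- b..int n + b}" using Suc.prems by auto
  then have "v \<otimes> conj_by w (conj_by \<sigma> ?z) = conj_by w (conj_by \<sigma> ?z) \<otimes> v"
    using 2 comm slab_mono by blast
  then have "conj_by v (conj_by w (conj_by \<sigma> ?z)) = conj_by w (conj_by \<sigma> ?z)"
    using 2 slab_closed v by (intro conj_by_commute) auto
  then show ?case using eq 2 by simp
qed

end

end

text \<open>The relations imposed on a group that is to receive the fibre product: \<open>x1\<close>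
  and \<open>x2\<close> are the two families, on which \<open>\<tau>\<close> acts as
  \<open>t\<close> and as \<open>t s^m\<close>. The factors \<open>n1\<close>, \<open>n2\<close> and
  \<open>u1\<close>, \<open>u2\<close> are what the two sides contribute when \<open>\<tau>\<close>
  or its inverse conjugates \<open>\<sigma>\<close>. The bound \<open>m > 2 * b\<close> makes the
  relative shift larger than the spreads of both families together.\<close>

locale commuting_windows = group G for G (structure) +
  fixes \<sigma> \<tau> :: 'a and x1 x2 :: "'j \<Rightarrow> 'a" and J :: "'j set" and m b \<rho> :: int and n1 n2 u1 u2 :: 'a
  assumes closed [simp]: "\<sigma> \<in> carrier G" "\<tau> \<in> carrier G" "\<And>j. x1 j \<in> carrier G" "\<And>j. x2 j \<in> carrier G"
    and sizes: "b \<ge> 0" "m > 2 * b" "\<rho> \<ge> 2 * b + m"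
    and x1_up: "\<And>j. j \<in> J \<Longrightarrow> conj_by \<tau> (x1 j) \<in> slab \<sigma> x1 J {- b..b}"
    and x1_dn: "\<And>j. j \<in> J \<Longrightarrow> conj_by (inv \<tau>) (x1 j) \<in> slab \<sigma> x1 J {- b..b}"
    and x2_up: "\<And>j. j \<in> J \<Longrightarrow> conj_by (\<tau> \<otimes> \<sigma> [^] (- m)) (x2 j) \<in> slab \<sigma> x2 J {- b..b}"
    and x2_dn: "\<And>j. j \<in> J \<Longrightarrow> conj_by (inv (\<tau> \<otimes> \<sigma> [^] (- m))) (x2 j) \<in> slab \<sigma> x2 J {- b..b}"
    and \<sigma>_up: "conj_by \<tau> \<sigma> = n1 \<otimes> n2 \<otimes> \<sigma>"
      "n1 \<in> slab \<sigma> x1 J {- b..b}" "n2 \<in> slab \<sigma> x2 J {- b..b}"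
    and \<sigma>_dn: "conj_by (inv \<tau>) \<sigma> = u1 \<otimes> conj_by (\<sigma> [^] (- m)) u2 \<otimes> \<sigma>"
      "u1 \<in> slab \<sigma> x1 J {- b..b}" "u2 \<in> slab \<sigma> x2 J {- b..b}"
    and comm_small: "\<And>k i j. \<bar>k\<bar> \<le> \<rho> \<Longrightarrow> i \<in> J \<Longrightarrow> j \<in> J \<Longrightarrow>
      x1 i \<otimes> conj_by (\<sigma> [^] k) (x2 j) = conj_by (\<sigma> [^] k) (x2 j) \<otimes> x1 i"
begin

abbreviation "slab1 \<equiv> slab \<sigma> x1 J"
abbreviation "slab2 \<equiv> slab \<sigma> x2 J"
abbreviation "\<tau>' \<equiv> \<tau> \<otimes> \<sigma> [^] (- m)"

definition comm_at :: "int \<Rightarrow> bool" where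
  "comm_at k \<longleftrightarrow> (\<forall>i\<in>J. \<forall>j\<in>J. x1 i \<otimes> conj_by (\<sigma> [^] k) (x2 j) = conj_by (\<sigma> [^] k) (x2 j) \<otimes> x1 i)"

text \<open>Conjugating by a power of \<open>\<sigma>\<close> shows that only the difference of the
  two exponents matters.\<close>

lemma slabs_commute_if:
  assumes "\<And>i l. i \<in> I \<Longrightarrow> l \<in> I' \<Longrightarrow> comm_at (l - i)" "y \<in> slab1 I" "z \<in> slab2 I'"
  shows "y \<otimes> z = z \<otimes> y"
proof (rule generate_commute[OF _ _ _ assms(2,3)[unfolded slab_def]])
  fix y z assume "y \<in> {conj_by (\<sigma> [^] i) (x1 j) | i j. i \<in> I \<and> j \<in> J}"
    "z \<in> {conj_by (\<sigma> [^] i) (x2 j) | i j. i \<in> I' \<and> j \<in> J}"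
  then obtain i j l j' where y: "y = conj_by (\<sigma> [^] i) (x1 j)" "i \<in> I" "j \<in> J"
    and z: "z = conj_by (\<sigma> [^] l) (x2 j')" "l \<in> I'" "j' \<in> J" by auto
  have "conj_by (\<sigma> [^] i) (x1 j) \<otimes> conj_by (\<sigma> [^] i) (conj_by (\<sigma> [^] (l - i)) (x2 j')) =
      conj_by (\<sigma> [^] i) (conj_by (\<sigma> [^] (l - i)) (x2 j')) \<otimes> conj_by (\<sigma> [^] i) (x1 j)"
    using assms(1)[OF y(2) z(2)] y z by (subst commute_conj_by_iff) (auto simp: comm_at_def)
  moreover have "conj_by (\<sigma> [^] i) (conj_by (\<sigma> [^] (l - i)) (x2 j')) = z"
    by (simp add: z conj_by_conj_by int_pow_mult[symmetric])
  ultimately show "y \<otimes> z = z \<otimes> y" using y by simp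
qed auto

text \<open>The same relation as seen from the second family, for which \<open>\<tau>'\<close> takes
  the place of \<open>\<tau>\<close>.\<close>

lemma \<sigma>_dn': "conj_by (inv \<tau>') \<sigma> = conj_by (\<sigma> [^] m) u1 \<otimes> u2 \<otimes> \<sigma>"
proof -
  have u: "u1 \<in> carrier G" "u2 \<in> carrier G" using slab_closed[OF _ _ \<sigma>_dn(2)] slab_closed[OF _ _ \<sigma>_dn(3)] by auto
  have "conj_by (inv \<tau>') \<sigma> = conj_by (\<sigma> [^] m) (conj_by (inv \<tau>) \<sigma>)"
    by (simp add: conj_by_conj_by inv_mult_group int_pow_neg)
  also have "\<dots> = conj_by (\<sigma> [^] m) u1 \<otimes> u2 \<otimes> conj_by (\<sigma> [^] m) \<sigma>"
    using u by (simp add: \<sigma>_dn(1) conj_by_mult conj_by_conj_by int_pow_mult[symmetric])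
  also have "conj_by (\<sigma> [^] m) \<sigma> = \<sigma>"
    using int_pow_mult[of \<sigma> m 1] int_pow_mult[of \<sigma> 1 m]
    by (intro conj_by_commute) (simp_all add: add.commute)
  finally show ?thesis .
qed

text \<open>
  Conjugation by \<open>\<tau>\<close> moves the second family by about \<open>m\<close> steps relative to the first, which
  is more than it spreads either of them; so commutation at large distances follows from
  commutation at smaller ones.
\<close>

lemma comm_at_step:
  assumes k: "int k > \<rho>" and IH: "\<And>l. \<bar>l\<bar> < int k \<Longrightarrow> comm_at l"
  shows "comm_at (int k)" "comm_at (- int k)"
proof -
  have u: "u1 \<in> carrier G" "u2 \<in> carrier G" and n: "n1 \<in> carrier G" "n2 \<in> carrier G"
    using slab_closed[OF _ _ \<sigma>_dn(2)] slab_closed[OF _ _ \<sigma>_dn(3)]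
      slab_closed[OF _ _ \<sigma>_up(2)] slab_closed[OF _ _ \<sigma>_up(3)] by auto
  show "comm_at (int k)"
    unfolding comm_at_def
  proof (intro ballI)
    fix i j assume ij: "i \<in> J" "j \<in> J"
    let ?y = "conj_by (\<sigma> [^] int k) (x2 j)"
    have "conj_by (inv \<tau>') ?y \<in> slab2 {- b..int k + b}"
    proof (rule slab_spread[where v = "conj_by (\<sigma> [^] m) u1" and w = u2 and n = k])
      show "conj_by (inv \<tau>') \<sigma> = conj_by (\<sigma> [^] m) u1 \<otimes> u2 \<otimes> \<sigma>" by (rule \<sigma>_dn')
      fix z assume z: "z \<in> slab2 {- b..int k + b}"
      have "conj_by (\<sigma> [^] m) u1 \<in> slab1 {m - b..m + b}"
        by (rule slab_shift[OF _ _ \<sigma>_dn(2)]) auto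
      then show "conj_by (\<sigma> [^] m) u1 \<otimes> z = z \<otimes> conj_by (\<sigma> [^] m) u1"
        by (rule slabs_commute_if[rotated, OF _ z]) (use sizes k in \<open>auto intro!: IH\<close>)
    qed (use x2_dn \<sigma>_dn u ij in auto)
    then have "conj_by (\<sigma> [^] (- m)) (conj_by (inv \<tau>') ?y) \<in> slab2 {- b - m..int k + b - m}"
      by (rule slab_shift[rotated 2]) auto
    moreover have "conj_by (\<sigma> [^] (- m)) (conj_by (inv \<tau>') ?y) = conj_by (inv \<tau>) ?y"
      by (simp add: conj_by_conj_by inv_mult_group int_pow_neg m_assoc[symmetric])
    ultimately have y: "conj_by (inv \<tau>) ?y \<in> slab2 {- b - m..int k + b - m}" by simp
    \<comment> \<open>Differences of exponents lie between \<open>- 2 * b - m\<close> and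
      \<open>k + 2 * b - m\<close>. The first has absolute value at most \<open>\<rho>\<close>,
      which is below \<open>k\<close>; the second is below \<open>k\<close> because
      \<open>m > 2 * b\<close>.\<close>
    have "conj_by (inv \<tau>) (x1 i) \<otimes> conj_by (inv \<tau>) ?y = conj_by (inv \<tau>) ?y \<otimes> conj_by (inv \<tau>) (x1 i)"
      by (rule slabs_commute_if[OF _ x1_dn[OF ij(1)] y]) (use sizes k in \<open>auto intro!: IH\<close>)
    then show "x1 i \<otimes> ?y = ?y \<otimes> x1 i" by (subst (asm) commute_conj_by_iff) auto
  qed
  show "comm_at (- int k)"
    unfolding comm_at_def
  proof (intro ballI)
    fix i j assume ij: "i \<in> J" "j \<in> J"
    \<comment> \<open>For the distance \<open>- k\<close> the first family is moved instead. As
      \<open>\<tau>'\<close> contains \<open>\<sigma>^-m\<close>, the exponent drops to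
      \<open>k - m\<close> before \<open>\<tau>\<close> spreads the window; it is nonnegative
      because \<open>k\<close> exceeds \<open>\<rho>\<close>.\<close>
    define l where "l = nat (int k - m)"
    have l: "int l = int k - m" using k sizes by (simp add: l_def)
    let ?y = "conj_by (\<sigma> [^] int k) (x1 i)"
    have comm_n2: "z \<otimes> n2 = n2 \<otimes> z" if z: "z \<in> slab1 {- b..int l + b}" for z
      by (rule slabs_commute_if[OF _ z \<sigma>_up(3)]) (use sizes k l in \<open>auto intro!: IH\<close>)
    have "conj_by \<tau> (conj_by (\<sigma> [^] int l) (x1 i)) \<in> slab1 {- b..int l + b}"
    proof (rule slab_spread[where v = n2 and w = n1 and n = l])
      \<comment> \<open>\<open>slab_spread\<close> expects the factor of the other family on the
        left, so \<open>n1\<close> and \<open>n2\<close> are exchanged by means of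
        \<open>comm_n2\<close>.\<close>
      have "n1 \<in> slab1 {- b..int l + b}"
        using \<sigma>_up(2) slab_mono[of \<sigma> x1 "{- b..b}" "{- b..int l + b}" J] by auto
      then show "conj_by \<tau> \<sigma> = n2 \<otimes> n1 \<otimes> \<sigma>" using comm_n2 \<sigma>_up by simp
    qed (use x1_up \<sigma>_up n ij comm_n2 in auto)
    moreover have "conj_by \<tau> (conj_by (\<sigma> [^] int l) (x1 i)) = conj_by \<tau>' ?y"
      by (simp add: conj_by_conj_by m_assoc int_pow_mult[symmetric] l)
    ultimately have y: "conj_by \<tau>' ?y \<in> slab1 {- b..int l + b}" by simp
    have "conj_by \<tau>' ?y \<otimes> conj_by \<tau>' (x2 j) = conj_by \<tau>' (x2 j) \<otimes> conj_by \<tau>' ?y"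
      by (rule slabs_commute_if[OF _ y x2_up[OF ij(2)]]) (use sizes k l in \<open>auto intro!: IH\<close>)
    then have "?y \<otimes> x2 j = x2 j \<otimes> ?y" by (subst (asm) commute_conj_by_iff) auto
    then have "conj_by (\<sigma> [^] (- int k)) ?y \<otimes> conj_by (\<sigma> [^] (- int k)) (x2 j) =
        conj_by (\<sigma> [^] (- int k)) (x2 j) \<otimes> conj_by (\<sigma> [^] (- int k)) ?y"
      by (subst commute_conj_by_iff) auto
    moreover have "conj_by (\<sigma> [^] (- int k)) ?y = x1 i"
      by (simp add: conj_by_conj_by int_pow_mult[symmetric])
    ultimately show "x1 i \<otimes> conj_by (\<sigma> [^] (- int k)) (x2 j) = conj_by (\<sigma> [^] (- int k)) (x2 j) \<otimes> x1 i"
      by simp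
  qed
qed

lemma comm_at_all: "comm_at k"
proof -
  have "comm_at (int n) \<and> comm_at (- int n)" for n
  proof (induction n rule: less_induct)
    case (less n)
    show ?case
    proof (cases "int n \<le> \<rho>")
      case True
      then show ?thesis using comm_small by (auto simp: comm_at_def)
    next
      case False
      have "comm_at l" if "\<bar>l\<bar> < int n" for l
        using less[of "nat \<bar>l\<bar>"] that by (cases "l \<ge> 0") auto
      then show ?thesis using comm_at_step[of n] False by auto
    qed
  qed
  from this[of "nat \<bar>k\<bar>"] show ?thesis by (cases "k \<ge> 0") auto
qed

lemma slabs_commute: "y \<in> slab1 I \<Longrightarrow> z \<in> slab2 I' \<Longrightarrow> y \<otimes> z = z \<otimes> y"
  by (rule slabs_commute_if[OF comm_at_all])

end

section \<open>Window words\<close>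

definition wpow :: "int \<Rightarrow> 'y \<Rightarrow> 'y letter list" where
  "wpow i y = (if i \<ge> 0 then replicate (nat i) (y, True) else replicate (nat (- i)) (y, False))"

text \<open>Window words have letters \<open>(i, j)\<close>, standing for generator \<open>j\<close>
  conjugated by the \<open>i\<close>-th power of \<open>z\<close>. They describe elements of slabs
  independently of the group in which they are evaluated, which makes it possible to compare
  \<open>G\<close> with \<open>P\<close>.\<close>

definition expand :: "'y \<Rightarrow> ('j \<Rightarrow> 'y) \<Rightarrow> (int \<times> 'j) letter list \<Rightarrow> 'y letter list" where
  "expand z f W = subst_word (\<lambda>(i, j). wpow i z @ [(f j, True)] @ wpow (- i) z) W"

definition map_word :: "('y \<Rightarrow> 'z) \<Rightarrow> 'y letter list \<Rightarrow> 'z letter list" where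
  "map_word h w = map (\<lambda>l. (h (fst l), snd l)) w"

lemma subst_word_simps [simp]:
  "subst_word f [] = []"
  "subst_word f (l # w) = subst_letter f l @ subst_word f w"
  by (simp_all add: subst_word_def)

lemma map_word_simps [simp]:
  "map_word h [] = []" "map_word h (l # w) = (h (fst l), snd l) # map_word h w"
  "map_word h (u @ v) = map_word h u @ map_word h v"
  by (simp_all add: map_word_def)

lemma map_word_wpow [simp]: "map_word h (wpow i y) = wpow i (h y)"
  by (simp add: map_word_def wpow_def)

lemma map_word_inv_word: "map_word h (inv_word w) = inv_word (map_word h w)"
  by (simp add: map_word_def inv_word_def rev_map inv_letter_def)

lemma map_word_subst_word: "map_word h (subst_word f w) = subst_word (\<lambda>y. map_word h (f y)) w"
  by (induction w) (auto simp: subst_letter_def map_word_inv_word)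

lemma map_word_expand: "map_word h (expand z f W) = expand (h z) (h \<circ> f) W"
proof -
  have "(\<lambda>y. map_word h (case y of (i, j) \<Rightarrow> wpow i z @ [(f j, True)] @ wpow (- i) z)) =
      (\<lambda>(i, j). wpow i (h z) @ [((h \<circ> f) j, True)] @ wpow (- i) (h z))"
    by (auto simp: fun_eq_iff)
  then show ?thesis by (simp add: expand_def map_word_subst_word)
qed

lemma wpow_in_words: "y \<in> B \<Longrightarrow> wpow i y \<in> words B"
  unfolding wpow_def words_def by (auto simp: in_lists_conv_set)

lemma map_word_in_words: "w \<in> words A \<Longrightarrow> (\<And>y. y \<in> A \<Longrightarrow> h y \<in> B) \<Longrightarrow> map_word h w \<in> words B"
  by (induction w) auto

lemma expand_in_words:
  assumes "z \<in> B" "\<And>j. j \<in> J \<Longrightarrow> f j \<in> B" "W \<in> words (UNIV \<times> J)"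
  shows "expand z f W \<in> words B"
  unfolding expand_def using assms
  by (intro subst_word_in_words[of "UNIV \<times> J"]) (auto intro: wpow_in_words)

context group
begin

definition win :: "'a \<Rightarrow> ('j \<Rightarrow> 'a) \<Rightarrow> (int \<times> 'j) letter list \<Rightarrow> 'a" where
  "win \<sigma> x W = eval_word G (\<lambda>(i, j). conj_by (\<sigma> [^] i) (x j)) W"

lemma eval_wpow:
  assumes g: "\<And>y. g y \<in> carrier G"
  shows "eval_word G g (wpow i y) = g y [^] i"
proof -
  have rep: "eval_word G g (replicate k (y, b)) = (if b then g y else inv (g y)) [^] k" for k b
  proof (induction k)
    case (Suc k)
    then show ?case using g nat_pow_mult[of "if b then g y else inv (g y)" 1 k]
      by (auto simp: letter_val_def)
  qed simp
  show ?thesis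
  proof (cases "i \<ge> 0")
    case True
    then show ?thesis using rep[of "nat i" True] by (simp add: wpow_def int_pow_int[symmetric])
  next
    case False
    then have "g y [^] i = inv (g y [^] nat (- i))"
      using int_pow_neg_int[of "g y" "nat (- i)"] g by simp
    also have "\<dots> = inv (g y) [^] nat (- i)" using nat_pow_inv[of "g y"] g by simp
    finally show ?thesis using False rep[of "nat (- i)" False] by (simp only: wpow_def if_False)
  qed
qed

lemma eval_expand:
  assumes g: "\<And>y. g y \<in> carrier G"
  shows "eval_word G g (expand z f W) = win (g z) (\<lambda>j. g (f j)) W"
proof -
  have "(\<lambda>y. eval_word G g (case y of (i, j) \<Rightarrow> wpow i z @ [(f j, True)] @ wpow (- i) z)) =
      (\<lambda>(i, j). conj_by (g z [^] i) (g (f j)))"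
    using g by (auto simp: fun_eq_iff eval_word_append eval_wpow letter_val_def conj_by_def
        int_pow_neg m_assoc)
  then show ?thesis using g by (simp add: expand_def eval_subst_word win_def)
qed

lemma eval_map_word: "eval_word G g (map_word h w) = eval_word G (\<lambda>y. g (h y)) w"
  unfolding map_word_def eval_word_map comp_def ..

context
  fixes \<sigma> :: 'a and x :: "'j \<Rightarrow> 'a"
  assumes \<sigma>: "\<sigma> \<in> carrier G" and x: "\<And>j. x j \<in> carrier G"
begin

lemma window_letter_closed: "(case y of (i, j) \<Rightarrow> conj_by (\<sigma> [^] (i::int)) (x j)) \<in> carrier G"
  using \<sigma> x by (cases y) auto

lemma win_closed: "win \<sigma> x W \<in> carrier G"
  unfolding win_def using window_letter_closed by (rule eval_word_closed)

lemma win_append: "win \<sigma> x (U @ V) = win \<sigma> x U \<otimes> win \<sigma> x V"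
  unfolding win_def using window_letter_closed by (rule eval_word_append)

lemma win_in_slab: "W \<in> words (I \<times> J) \<Longrightarrow> win \<sigma> x W \<in> slab \<sigma> x J I"
  unfolding win_def
  by (rule eval_word_in_subgroup[OF slab_subgroup]) (use \<sigma> x in \<open>auto intro!: slab_incl\<close>)

lemma slab_obtains_win:
  assumes "z \<in> slab \<sigma> x J I"
  shows "\<exists>W\<in>words (I \<times> J). win \<sigma> x W = z"
proof -
  have "{conj_by (\<sigma> [^] i) (x j) |i j. i \<in> I \<and> j \<in> J} = (\<lambda>(i, j). conj_by (\<sigma> [^] i) (x j)) ` (I \<times> J)"
    by auto
  then have "z \<in> generate G ((\<lambda>(i, j). conj_by (\<sigma> [^] i) (x j)) ` (I \<times> J))"
    using assms by (simp add: slab_def)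
  then show ?thesis
    unfolding win_def
    using generate_eval_word[of "\<lambda>(i, j). conj_by (\<sigma> [^] i) (x j)" z "I \<times> J"] window_letter_closed
    by (auto simp: free_group_carrier)
qed

lemma win_shift:
  "conj_by (\<sigma> [^] k) (win \<sigma> x W) = win \<sigma> x (map_word (\<lambda>(i, j). (k + i, j)) W)"
proof -
  interpret c: group_hom G G "conj_by (\<sigma> [^] k)" using \<sigma> by (intro conj_by_hom) simp
  have "conj_by (\<sigma> [^] k) (win \<sigma> x W) =
      eval_word G (conj_by (\<sigma> [^] k) \<circ> (\<lambda>(i, j). conj_by (\<sigma> [^] i) (x j))) W"
    unfolding win_def using window_letter_closed by (rule c.eval_word_hom_image)
  also have "conj_by (\<sigma> [^] k) \<circ> (\<lambda>(i, j). conj_by (\<sigma> [^] i) (x j)) =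
      (\<lambda>y. (\<lambda>(i, j). conj_by (\<sigma> [^] i) (x j)) ((\<lambda>(i, j). (k + i, j)) y))"
    using \<sigma> x by (auto simp: fun_eq_iff conj_by_conj_by int_pow_mult)
  finally show ?thesis by (simp add: win_def eval_map_word)
qed

end

end

lemma map_word_shift_in_words:
  "W \<in> words (UNIV \<times> J) \<Longrightarrow> map_word (\<lambda>(i, j). (k + i, j)) W \<in> words (UNIV \<times> J)"
  by (erule map_word_in_words) auto

section \<open>Letters acting by bijections, and moving one letter to the right\<close>

locale bijective_letters =
  fixes S :: "'s set" and f f' :: "'x \<Rightarrow> 's \<Rightarrow> 's"
  assumes f_closed: "s \<in> S \<Longrightarrow> f x s \<in> S" "s \<in> S \<Longrightarrow> f' x s \<in> S"
    and f_inverse: "s \<in> S \<Longrightarrow> f' x (f x s) = s" "s \<in> S \<Longrightarrow> f x (f' x s) = s"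
begin

abbreviation "act \<equiv> word_act f f'"

lemma act_closed: "s \<in> S \<Longrightarrow> act w s \<in> S"
  by (induction w) (auto simp: f_closed)

lemma act_append: "act (u @ v) s = act u (act v s)"
  by (induction u) auto

lemma act_inv_word: "s \<in> S \<Longrightarrow> act (inv_word w) (act w s) = s"
  by (induction w) (auto simp: inv_word_def act_append f_inverse act_closed)

lemma act_inv_word': "s \<in> S \<Longrightarrow> act w (act (inv_word w) s) = s"
  by (induction w arbitrary: s) (auto simp: inv_word_def act_append f_inverse f_closed act_closed)

lemma act_eqI:
  assumes "presents G B g R" and R: "\<And>r s. r \<in> R \<Longrightarrow> s \<in> S \<Longrightarrow> act r s = s"
    and "u \<in> words B" "v \<in> words B" "eval_word G g u = eval_word G g v" and s: "s \<in> S"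
  shows "act u s = act v s"
proof -
  interpret G: group G using assms by (simp add: presents_def)
  have g: "\<And>x. g x \<in> carrier G" using assms by (simp add: presents_def)
  have "act (inv_word v @ u) s = s"
    by (rule presents_word_act_trivial[OF assms(1) f_closed f_inverse R])
       (use assms g in \<open>auto simp: inv_word_in_words G.eval_word_append G.eval_word_inv_word\<close>)
  then have "act (inv_word v) (act u s) = s" by (simp add: act_append)
  then show ?thesis using act_inv_word'[of "act u s" v] act_closed[OF s] by simp
qed

lemma act_replicate:
  assumes "s \<in> S"
  shows "f y (act (wpow i y) s) = act (wpow (i + 1) y) s" "f' y (act (wpow i y) s) = act (wpow (i - 1) y) s"
proof -
  show "f y (act (wpow i y) s) = act (wpow (i + 1) y) s"
  proof (cases "i \<ge> 0")
    case True
    then have "nat (i + 1) = Suc (nat i)" by simp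
    then show ?thesis using True by (simp add: wpow_def)
  next
    case False
    then have "nat (- i) = Suc (nat (- (i + 1)))" by simp
    then show ?thesis using False assms
      by (cases "i = -1") (auto simp: wpow_def f_inverse act_closed)
  qed
  show "f' y (act (wpow i y) s) = act (wpow (i - 1) y) s"
  proof (cases "i \<ge> 1")
    case True
    then have "nat i = Suc (nat (i - 1))" by simp
    then show ?thesis using True assms by (simp add: wpow_def f_inverse act_closed)
  next
    case False
    then have "nat (1 - i) = Suc (nat (- i))" by simp
    then show ?thesis using False assms
      by (cases "i = 0") (auto simp: wpow_def)
  qed
qed

end

text \<open>
  Words in \<open>t\<close> (the letter \<open>None\<close>) and further letters \<open>Some k\<close>; \<open>cu k\<close> and \<open>cd k\<close> are words
  for \<open>t k t\<^sup>-\<^sup>1\<close> and \<open>t\<^sup>-\<^sup>1 k t\<close>, used to move all occurrences of \<open>t\<close> to the right.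
\<close>

fun move_right :: "('k \<Rightarrow> 'k letter list) \<Rightarrow> ('k \<Rightarrow> 'k letter list) \<Rightarrow> 'k option letter list \<Rightarrow> 'k letter list" where
  "move_right cu cd [] = []"
| "move_right cu cd (l # w) = (case fst l of
     None \<Rightarrow> subst_word (if snd l then cu else cd) (move_right cu cd w)
   | Some k \<Rightarrow> (k, snd l) # move_right cu cd w)"

text \<open>Exponent sum of \<open>None\<close>. This is \<open>t\<close> in words over all
  generators, and \<open>s\<close> in the words that remain after \<open>move_right\<close>.\<close>

fun none_exp :: "'k option letter list \<Rightarrow> int" where
  "none_exp [] = 0"
| "none_exp (l # w) = (case fst l of None \<Rightarrow> if snd l then 1 else - 1 | Some _ \<Rightarrow> 0) + none_exp w"

lemma (in bijective_letters) act_subst_word: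
  assumes h: "\<And>k s. s \<in> S \<Longrightarrow> h (f (g k) s) = act (map_word g (v k)) (h s)" and hS: "\<And>s. s \<in> S \<Longrightarrow> h s \<in> S"
    and s: "s \<in> S"
  shows "h (act (map_word g w) s) = act (map_word g (subst_word v w)) (h s)"
proof (induction w)
  case (Cons l w)
  let ?a = "act (map_word g w) s"
  have a: "?a \<in> S" using s act_closed by blast
  show ?case
  proof (cases "snd l")
    case True
    then show ?thesis using Cons h[OF a, of "fst l"] by (simp add: subst_letter_def act_append)
  next
    case False
    let ?b = "f' (g (fst l)) ?a"
    have b: "?b \<in> S" using a f_closed by blast
    have "h ?a = act (map_word g (v (fst l))) (h ?b)"
      using h[OF b, of "fst l"] a by (simp add: f_inverse)
    then have "h ?b = act (inv_word (map_word g (v (fst l)))) (h ?a)"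
      using act_inv_word[OF hS[OF b]] by simp
    then show ?thesis using Cons False by (simp add: subst_letter_def act_append map_word_inv_word)
  qed
qed simp

text \<open>The rewriting takes place inside an arbitrary action: it is enough that the two
  conjugation rules hold for the action, whether or not it comes from a group with the relations of
  \<open>G\<close>.\<close>

lemma act_move_right:
  fixes f f' :: "'k option \<Rightarrow> 's \<Rightarrow> 's"
  assumes "bijective_letters S f f'"
    and cu: "\<And>k s. s \<in> S \<Longrightarrow> f None (f (Some k) s) = word_act f f' (map_word Some (cu k)) (f None s)"
    and cd: "\<And>k s. s \<in> S \<Longrightarrow> f' None (f (Some k) s) = word_act f f' (map_word Some (cd k)) (f' None s)"
    and s: "s \<in> S"
  shows "word_act f f' w s =
    word_act f f' (map_word Some (move_right cu cd w)) (word_act f f' (wpow (none_exp w) None) s)"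
proof -
  interpret bijective_letters S f f' by fact
  show ?thesis
  proof (induction w)
    case Nil
    show ?case by (simp add: wpow_def)
  next
    case (Cons l w)
    have a: "act (wpow (none_exp w) None) s \<in> S" using s act_closed by blast
    show ?case
    proof (cases "fst l")
      case None
      show ?thesis
      proof (cases "snd l")
        case True
        then show ?thesis
          using None Cons act_subst_word[where h = "f None" and g = Some and v = cu, OF cu f_closed(1) a]
            act_replicate(1)[OF s, of None "none_exp w"]
          by (simp add: add.commute)
      next
        case False
        then show ?thesis
          using None Cons act_subst_word[where h = "f' None" and g = Some and v = cd, OF cd f_closed(2) a]
            act_replicate(2)[OF s, of None "none_exp w"]
          by simp
      qed
    qed (use Cons in simp)
  qed
qed

text \<open>Here \<open>None\<close> is \<open>s\<close>. Its conjugate by \<open>t\<close> differs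
  from \<open>s\<close> by an element of the common kernel of the two characters, whence the window
  word \<open>n\<close> in front.\<close>

definition conj_words :: "(int \<times> 'j) letter list \<Rightarrow> ('j \<Rightarrow> (int \<times> 'j) letter list) \<Rightarrow>
    'j option \<Rightarrow> 'j option letter list" where
  "conj_words n V k = (case k of None \<Rightarrow> expand None Some n @ [(None, True)] | Some j \<Rightarrow> expand None Some (V j))"

text \<open>Two layers of options: the outer \<open>None\<close> is the letter moved by
  \<open>move_right\<close>, and stripping one \<open>Some\<close> leaves the letters of
  \<open>gen2\<close>.\<close>

definition gen3 :: "'a \<Rightarrow> 'a \<Rightarrow> ('j \<Rightarrow> 'a) \<Rightarrow> 'j option option \<Rightarrow> 'a" where
  "gen3 t s x z = (case z of None \<Rightarrow> t | Some None \<Rightarrow> s | Some (Some j) \<Rightarrow> x j)"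

lemma gen3_simps [simp]:
  "gen3 t s x None = t" "gen3 t s x (Some None) = s" "gen3 t s x (Some (Some j)) = x j"
  by (simp_all add: gen3_def)

definition gen2 :: "'a \<Rightarrow> ('j \<Rightarrow> 'a) \<Rightarrow> 'j option \<Rightarrow> 'a" where
  "gen2 s x z = (case z of None \<Rightarrow> s | Some j \<Rightarrow> x j)"

lemma gen2_simps [simp]: "gen2 s x None = s" "gen2 s x (Some j) = x j"
  by (simp_all add: gen2_def)

lemma gen3_Some: "gen3 t s x (Some k) = gen2 s x k"
  by (cases k) auto

text \<open>This is \<open>act_move_right\<close> for left multiplication of \<open>G\<close> on
  itself, applied to the unit.\<close>

lemma (in group) eval_move_right:
  assumes c: "t \<in> carrier G" "s \<in> carrier G" "\<And>j. x j \<in> carrier G"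
    and cu: "\<And>j. win s x (Wp j) = conj_by t (x j)" "win s x np \<otimes> s = conj_by t s"
    and cd: "\<And>j. win s x (Wm j) = conj_by (inv t) (x j)" "win s x nm \<otimes> s = conj_by (inv t) s"
  shows "eval_word G (gen3 t s x) w =
    eval_word G (gen2 s x) (move_right (conj_words np Wp) (conj_words nm Wm) w) \<otimes> t [^] none_exp w"
proof -
  let ?g = "gen3 t s x"
  have g: "?g z \<in> carrier G" for z using c by (auto simp: gen3_def split: option.splits)
  have g2: "gen2 s x z \<in> carrier G" for z using c by (auto simp: gen2_def split: option.splits)
  let ?f = "\<lambda>z h. ?g z \<otimes> h" and ?f' = "\<lambda>z h. inv (?g z) \<otimes> h"
  have act: "word_act ?f ?f' w h = eval_word G ?g w \<otimes> h" if "h \<in> carrier G" for w h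
    using that g by (induction w) (auto simp: letter_val_def m_assoc)
  have bl: "bijective_letters (carrier G) ?f ?f'"
    using g by unfold_locales (auto simp: m_assoc[symmetric])
  have ev: "eval_word G ?g (map_word Some w) = eval_word G (gen2 s x) w" for w
    by (simp add: eval_map_word gen3_Some)
  have upw: "eval_word G (gen2 s x) (conj_words np Wp k) = conj_by t (gen2 s x k)"
    and dnw: "eval_word G (gen2 s x) (conj_words nm Wm k) = conj_by (inv t) (gen2 s x k)" for k
    using cu cd g2 c
    by (auto simp: conj_words_def eval_word_append eval_expand letter_val_def win_closed split: option.split)
  have "word_act ?f ?f' w \<one> = word_act ?f ?f' (map_word Some (move_right (conj_words np Wp) (conj_words nm Wm) w))
     (word_act ?f ?f' (wpow (none_exp w) None) \<one>)"
  proof (rule act_move_right[OF bl])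
    fix k h assume h: "h \<in> carrier G"
    show "?f None (?f (Some k) h) = word_act ?f ?f' (map_word Some (conj_words np Wp k)) (?f None h)"
      using h c g g2 by (simp add: act ev upw gen3_Some conj_by_def m_assoc) (simp add: m_assoc[symmetric])
    show "?f' None (?f (Some k) h) = word_act ?f ?f' (map_word Some (conj_words nm Wm k)) (?f' None h)"
      using h c g g2 by (simp add: act ev dnw gen3_Some conj_by_def m_assoc) (simp add: m_assoc[symmetric])
  qed simp
  then show ?thesis using c g g2 by (simp add: act ev eval_wpow)
qed

text \<open>
  One of the two families \<open>y\<close> generating the kernel of a fibre product, with the operators \<open>\<sigma>\<close>
  and \<open>\<tau>\<close>; the contribution of the other family is hidden in \<open>v\<close> and \<open>v'\<close>.
\<close>

locale one_side = group P for P (structure) +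
  fixes \<sigma> \<tau> v v' :: 'a and y :: "'j \<Rightarrow> 'a" and Wp Wm :: "'j \<Rightarrow> (int \<times> 'j) letter list"
    and np nm :: "(int \<times> 'j) letter list"
  assumes closed [simp]: "\<sigma> \<in> carrier P" "\<tau> \<in> carrier P" "v \<in> carrier P" "v' \<in> carrier P" "\<And>j. y j \<in> carrier P"
    and y_up: "\<And>j. conj_by \<tau> (y j) = win \<sigma> y (Wp j)"
    and y_dn: "\<And>j. conj_by (inv \<tau>) (y j) = win \<sigma> y (Wm j)"
    and \<sigma>_up: "conj_by \<tau> \<sigma> = win \<sigma> y np \<otimes> v \<otimes> \<sigma>"
    and \<sigma>_dn: "conj_by (inv \<tau>) \<sigma> = win \<sigma> y nm \<otimes> v' \<otimes> \<sigma>"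
    and v_comm: "\<And>z. z \<in> slab \<sigma> y UNIV UNIV \<Longrightarrow> v \<otimes> z = z \<otimes> v"
      "\<And>z. z \<in> slab \<sigma> y UNIV UNIV \<Longrightarrow> v' \<otimes> z = z \<otimes> v'"
    and cancel: "conj_by \<tau> (win \<sigma> y nm) \<otimes> win \<sigma> y np = \<one>"
begin

abbreviation "M \<equiv> slab \<sigma> y UNIV UNIV"
abbreviation "wn \<equiv> win \<sigma> y"

lemma M_closed: "z \<in> M \<Longrightarrow> z \<in> carrier P"
  by (rule slab_closed[of \<sigma> y z UNIV UNIV]) auto

lemma M_subgroup: "subgroup M P"
  by (rule slab_subgroup) auto

lemma wn_in_M: "wn W \<in> M"
proof -
  have "W \<in> words (UNIV \<times> UNIV)" by (simp add: words_def)
  then show ?thesis by (intro win_in_slab) auto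
qed

lemma wn_closed [simp]: "wn W \<in> carrier P"
  by (rule win_closed) auto

lemma conj_\<sigma>_M: "z \<in> M \<Longrightarrow> conj_by (\<sigma> [^] (k::int)) z \<in> M"
  by (rule slab_shift) auto

text \<open>Both inclusions are demanded, since elements that merely conjugate \<open>M\<close> into
  itself need not form a subgroup.\<close>

definition normaliser :: "'a set" where
  "normaliser = {c \<in> carrier P. \<forall>z\<in>M. conj_by c z \<in> M \<and> conj_by (inv c) z \<in> M}"

lemma normaliser_subgroup: "subgroup normaliser P"
proof (rule subgroupI)
  have "\<one> \<in> normaliser" by (auto simp: normaliser_def M_closed)
  then show "normaliser \<noteq> {}" by blast
  fix a b assume a: "a \<in> normaliser"
  then show "inv a \<in> normaliser" by (auto simp: normaliser_def)
  assume b: "b \<in> normaliser"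
  have ab: "a \<in> carrier P" "b \<in> carrier P" using a b by (auto simp: normaliser_def)
  have "conj_by (a \<otimes> b) z = conj_by a (conj_by b z)"
    "conj_by (inv (a \<otimes> b)) z = conj_by (inv b) (conj_by (inv a) z)" if "z \<in> M" for z
    using ab M_closed[OF that] by (simp_all add: conj_by_conj_by inv_mult_group)
  then show "a \<otimes> b \<in> normaliser" using a b by (auto simp: normaliser_def)
qed (auto simp: normaliser_def)

lemma M_in_normaliser: "c \<in> M \<Longrightarrow> c \<in> normaliser"
  using M_closed conj_by_in_subgroup[OF M_subgroup] subgroup.m_inv_closed[OF M_subgroup]
  by (auto simp: normaliser_def)

lemma \<sigma>_in_normaliser: "\<sigma> \<in> normaliser"
  using conj_\<sigma>_M[of _ 1] conj_\<sigma>_M[of _ "-1"] by (auto simp: normaliser_def int_pow_neg)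

lemma centraliser_in_normaliser:
  assumes "c \<in> carrier P" "\<And>z. z \<in> M \<Longrightarrow> c \<otimes> z = z \<otimes> c"
  shows "c \<in> normaliser"
proof -
  have 1: "conj_by c z = z" if "z \<in> M" for z
    using assms that M_closed by (intro conj_by_commute) auto
  moreover have "conj_by (inv c) z = z" if "z \<in> M" for z
    using assms(1) M_closed[OF that] 1[OF that] conj_by_inverse(2)[of c z] by simp
  ultimately show ?thesis using assms by (auto simp: normaliser_def)
qed

text \<open>Conjugation by \<open>\<tau>\<close> turns the conjugate of \<open>y j\<close> by
  \<open>\<sigma> [^] i\<close> into the conjugate of \<open>conj_by \<tau> (y j)\<close> by the
  \<open>i\<close>-th power of \<open>conj_by \<tau> \<sigma>\<close>. The latter is a product of an
  element of \<open>M\<close>, an element centralising \<open>M\<close>, and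
  \<open>\<sigma>\<close>, so it normalises \<open>M\<close>. The same holds for the inverse of
  \<open>\<tau>\<close>.\<close>

lemma conj_\<tau>_M:
  assumes z: "z \<in> M"
  shows "conj_by \<tau> z \<in> M" "conj_by (inv \<tau>) z \<in> M"
proof -
  have key: "conj_by c z \<in> M"
    if c: "c \<in> carrier P" and cy: "\<And>j. conj_by c (y j) \<in> M" and c\<sigma>: "conj_by c \<sigma> \<in> normaliser" for c
    using z unfolding slab_def
  proof (rule conj_by_generate[OF slab_generators[OF closed(1,5)] c, rotated 2])
    interpret h: group_hom P P "conj_by c" using c by (rule conj_by_hom)
    fix a assume "a \<in> {conj_by (\<sigma> [^] i) (y j) | (i::int) j. i \<in> UNIV \<and> j \<in> UNIV}"
    then obtain i :: int and j where a: "a = conj_by (\<sigma> [^] i) (y j)" by auto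
    have "conj_by c a = conj_by (conj_by c \<sigma> [^] i) (conj_by c (y j))"
      using c h.hom_int_pow[of \<sigma> i] by (simp add: a conj_by_def[of "\<sigma> [^] i"] h.hom_mult conj_by_def[of "conj_by c \<sigma> [^] i"])
    moreover have "conj_by c \<sigma> [^] i \<in> normaliser"
      by (rule subgroup_int_pow_closed[OF normaliser_subgroup c\<sigma>])
    ultimately have "conj_by c a \<in> M" using cy by (auto simp: normaliser_def)
    then show "conj_by c a \<in> generate P {conj_by (\<sigma> [^] i) (y j) | (i::int) j. i \<in> UNIV \<and> j \<in> UNIV}"
      by (simp add: slab_def)
  qed (use M_subgroup in \<open>simp add: slab_def\<close>)
  have n: "wn W \<otimes> c \<otimes> \<sigma> \<in> normaliser" if "c \<in> normaliser" for W c
    using subgroup.m_closed[OF normaliser_subgroup] M_in_normaliser[OF wn_in_M] \<sigma>_in_normaliser that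
    by blast
  have vn: "v \<in> normaliser" "v' \<in> normaliser"
    using v_comm by (auto intro: centraliser_in_normaliser)
  show "conj_by \<tau> z \<in> M"
    by (rule key) (use n[OF vn(1)] in \<open>auto simp: y_up \<sigma>_up wn_in_M\<close>)
  show "conj_by (inv \<tau>) z \<in> M"
    by (rule key) (use n[OF vn(2)] in \<open>auto simp: y_dn \<sigma>_dn wn_in_M\<close>)
qed

text \<open>A substitute in \<open>M\<close> for \<open>t s^i t^-1 s^-i\<close>: conjugating
  \<open>\<sigma>\<close> by \<open>\<tau>\<close> gives
  \<open>wn np \<otimes> v \<otimes> \<sigma>\<close>, and the factor \<open>v\<close> of the other
  family is left out.\<close>

definition \<kappa> :: "int \<Rightarrow> 'a" where
  "\<kappa> i = (wn np \<otimes> \<sigma>) [^] i \<otimes> \<sigma> [^] (- i)"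

lemma \<kappa>_0 [simp]: "\<kappa> 0 = \<one>"
  by (simp add: \<kappa>_def)

lemma \<kappa>_closed [simp]: "\<kappa> i \<in> carrier P"
  by (simp add: \<kappa>_def)

lemma \<kappa>_Suc: "\<kappa> (i + 1) = wn np \<otimes> conj_by \<sigma> (\<kappa> i)"
proof -
  have "(wn np \<otimes> \<sigma>) [^] (i + 1) = wn np \<otimes> \<sigma> \<otimes> (wn np \<otimes> \<sigma>) [^] i"
    using int_pow_mult[of "wn np \<otimes> \<sigma>" 1 i] by (simp add: add.commute)
  moreover have "\<sigma> [^] (- (i + 1)) = \<sigma> [^] (- i) \<otimes> inv \<sigma>"
    using int_pow_mult[of \<sigma> "- i" "- 1"] by (simp add: int_pow_neg)
  ultimately show ?thesis by (simp add: \<kappa>_def conj_by_def m_assoc)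
qed

lemma \<kappa>_in_M: "\<kappa> i \<in> M"
proof (induction i rule: int_induct[where k = 0])
  case base
  then show ?case using subgroup.one_closed[OF M_subgroup] by simp
next
  case (step1 i)
  then show ?case using conj_\<sigma>_M[of "\<kappa> i" 1] wn_in_M subgroup.m_closed[OF M_subgroup] by (simp add: \<kappa>_Suc)
next
  case (step2 i)
  have "inv (wn np) \<otimes> \<kappa> i = conj_by \<sigma> (\<kappa> (i - 1))"
    using \<kappa>_Suc[of "i - 1"] by (simp add: m_assoc[symmetric])
  then have "\<kappa> (i - 1) = conj_by (\<sigma> [^] (-1::int)) (inv (wn np) \<otimes> \<kappa> i)"
    by (simp add: int_pow_neg)
  moreover have "inv (wn np) \<otimes> \<kappa> i \<in> M"
    using step2 wn_in_M subgroup.m_closed[OF M_subgroup] subgroup.m_inv_closed[OF M_subgroup] by blast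
  ultimately show ?case using conj_\<sigma>_M by presburger
qed

text \<open>
  The pair \<open>(n, i)\<close> stands for the coset-free normal form \<open>n \<otimes> \<sigma> [^] i\<close>. The letter for \<open>t\<close> acts
  by conjugation with \<open>\<tau>\<close>, corrected by the factor \<open>v\<close> that centralises \<open>M\<close>.
\<close>

definition fw :: "'j option option \<Rightarrow> 'a \<times> int \<Rightarrow> 'a \<times> int" where
  "fw z = (\<lambda>(n, i). case z of None \<Rightarrow> (conj_by \<tau> n \<otimes> \<kappa> i, i)
     | Some None \<Rightarrow> (conj_by \<sigma> n, i + 1) | Some (Some j) \<Rightarrow> (y j \<otimes> n, i))"

definition bw :: "'j option option \<Rightarrow> 'a \<times> int \<Rightarrow> 'a \<times> int" where
  "bw z = (\<lambda>(n, i). case z of None \<Rightarrow> (conj_by (inv \<tau>) (n \<otimes> inv (\<kappa> i)), i)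
     | Some None \<Rightarrow> (conj_by (inv \<sigma>) n, i - 1) | Some (Some j) \<Rightarrow> (inv (y j) \<otimes> n, i))"

lemma fw_simps:
  "fw None (n, i) = (conj_by \<tau> n \<otimes> \<kappa> i, i)"
  "fw (Some None) (n, i) = (conj_by \<sigma> n, i + 1)"
  "fw (Some (Some j)) (n, i) = (y j \<otimes> n, i)"
  by (simp_all add: fw_def)

lemma bw_simps:
  "bw None (n, i) = (conj_by (inv \<tau>) (n \<otimes> inv (\<kappa> i)), i)"
  "bw (Some None) (n, i) = (conj_by (inv \<sigma>) n, i - 1)"
  "bw (Some (Some j)) (n, i) = (inv (y j) \<otimes> n, i)"
  by (simp_all add: bw_def)

lemma y_in_M: "y j \<in> M"
  using slab_incl[of \<sigma> y 0 UNIV j UNIV] by simp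

lemma letters: "bijective_letters (M \<times> UNIV) fw bw"
proof
  fix p :: "'a \<times> int" and z assume p: "p \<in> M \<times> UNIV"
  then obtain n i where n: "p = (n, i)" "n \<in> M" by auto
  have nc: "n \<in> carrier P" using n M_closed by blast
  note sg = subgroup.m_closed[OF M_subgroup] subgroup.m_inv_closed[OF M_subgroup]
  show "fw z p \<in> M \<times> UNIV" using n conj_\<tau>_M conj_\<sigma>_M[of n 1] \<kappa>_in_M y_in_M sg
    by (auto simp: fw_def split: option.split)
  show "bw z p \<in> M \<times> UNIV" using n conj_\<tau>_M conj_\<sigma>_M[of n "-1"] \<kappa>_in_M y_in_M sg
    by (auto simp: bw_def int_pow_neg split: option.split)
  show "bw z (fw z p) = p" "fw z (bw z p) = p"
    using n nc by (auto simp: fw_def bw_def m_assoc m_assoc[symmetric, of "y _"]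
        m_assoc[symmetric, of "inv (y _)"] split: option.split)
qed

interpretation L: bijective_letters "M \<times> UNIV" fw bw
  by (rule letters)

lemma act_wpow_s: "n \<in> M \<Longrightarrow> L.act (wpow k (Some None)) (n, i) = (conj_by (\<sigma> [^] k) n, i + k)"
proof (induction k rule: int_induct[where k = 0])
  case base
  then show ?case by (simp add: wpow_def M_closed)
next
  case (step1 k)
  have nc: "n \<in> carrier P" using step1 M_closed by blast
  have "L.act (wpow (k + 1) (Some None)) (n, i) = fw (Some None) (conj_by (\<sigma> [^] k) n, i + k)"
    using L.act_replicate(1)[of "(n, i)" "Some None" k] step1 by simp
  then show ?case using nc int_pow_mult[of \<sigma> 1 k] by (simp add: fw_simps conj_by_conj_by add.commute)
next
  case (step2 k)
  have nc: "n \<in> carrier P" using step2 M_closed by blast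
  have "L.act (wpow (k - 1) (Some None)) (n, i) = bw (Some None) (conj_by (\<sigma> [^] k) n, i + k)"
    using L.act_replicate(2)[of "(n, i)" "Some None" k] step2 by simp
  then show ?case using nc int_pow_mult[of \<sigma> "- 1" k] by (simp add: bw_simps conj_by_conj_by int_pow_neg add.commute)
qed

text \<open>This is how values in \<open>M\<close> are read off from the action: applied to the pair
  of the unit and 0, a window word returns its own value.\<close>

lemma act_expand:
  assumes "n \<in> M"
  shows "L.act (expand (Some None) (Some \<circ> Some) W) (n, i) = (wn W \<otimes> n, i)"
proof (induction W)
  case Nil
  show ?case using M_closed[OF assms] by (simp add: expand_def win_def)
next
  case (Cons l W)
  let ?u = "\<lambda>(k, j). wpow k (Some None) @ [(Some (Some j), True)] @ wpow (- k) (Some None)"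
  obtain k j b where l: "l = ((k, j), b)" by (cases l) auto
  let ?c = "conj_by (\<sigma> [^] k) (y j)"
  have cM: "?c \<in> M" using conj_\<sigma>_M y_in_M by blast
  have one: "L.act (?u (k, j)) (n', i) = (?c \<otimes> n', i)" if n': "n' \<in> M" for n' i
  proof -
    have c: "conj_by (\<sigma> [^] (- k)) n' \<in> M" using conj_\<sigma>_M n' by blast
    then have "y j \<otimes> conj_by (\<sigma> [^] (- k)) n' \<in> M" using y_in_M subgroup.m_closed[OF M_subgroup] by blast
    then have "L.act (?u (k, j)) (n', i) = (conj_by (\<sigma> [^] k) (y j \<otimes> conj_by (\<sigma> [^] (- k)) n'), i)"
      using n' by (simp add: L.act_append act_wpow_s fw_simps)
    also have "\<dots> = (?c \<otimes> n', i)"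
      using M_closed[OF n'] M_closed[OF c] by (simp add: conj_by_mult int_pow_neg)
    finally show ?thesis .
  qed
  let ?n = "wn W \<otimes> n"
  have nM: "?n \<in> M" using assms wn_in_M subgroup.m_closed[OF M_subgroup] by blast
  have exp: "expand (Some None) (Some \<circ> Some) (l # W) =
      (if b then ?u (k, j) else inv_word (?u (k, j))) @ expand (Some None) (Some \<circ> Some) W"
    by (simp add: expand_def subst_letter_def l)
  have wl: "wn (l # W) = (if b then ?c else inv ?c) \<otimes> wn W"
    by (simp add: win_def letter_val_def l)
  show ?case
  proof (cases b)
    case True
    then show ?thesis using Cons one[OF nM] M_closed[OF assms] M_closed[OF cM]
      by (simp only: exp wl L.act_append if_True m_assoc wn_closed)
  next
    case False
    have iM: "inv ?c \<otimes> ?n \<in> M"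
      using cM nM subgroup.m_closed[OF M_subgroup] subgroup.m_inv_closed[OF M_subgroup] by blast
    have "L.act (?u (k, j)) (inv ?c \<otimes> ?n, i) = (?n, i)"
      using one[OF iM] M_closed[OF nM] M_closed[OF cM] by (simp add: m_assoc[symmetric])
    then have "L.act (inv_word (?u (k, j))) (?n, i) = (inv ?c \<otimes> ?n, i)"
      using L.act_inv_word[of "(inv ?c \<otimes> ?n, i)" "?u (k, j)"] iM by simp
    then show ?thesis using Cons False M_closed[OF assms] M_closed[OF cM]
      by (simp only: exp wl L.act_append if_False m_assoc wn_closed inv_closed)
  qed
qed

text \<open>Without the letter for \<open>t\<close>, the action becomes left multiplication under
  the map from \<open>(n, i)\<close> to \<open>n \<otimes> \<sigma> [^] i\<close>. A power of
  \<open>\<sigma>\<close> may lie in \<open>M\<close>, so this map need not be injective and the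
  exponent is tracked separately.\<close>

lemma act_gen2:
  assumes "n \<in> M"
  shows "\<exists>n'\<in>M. L.act (map_word Some w) (n, i) = (n', i + none_exp w) \<and>
    n' \<otimes> \<sigma> [^] (i + none_exp w) = eval_word P (gen2 \<sigma> y) w \<otimes> (n \<otimes> \<sigma> [^] i)"
proof (induction w)
  case Nil
  then show ?case using assms M_closed by auto
next
  case (Cons l w)
  then obtain n' where n': "n' \<in> M" "L.act (map_word Some w) (n, i) = (n', i + none_exp w)"
    "n' \<otimes> \<sigma> [^] (i + none_exp w) = eval_word P (gen2 \<sigma> y) w \<otimes> (n \<otimes> \<sigma> [^] i)" by blast
  have nc: "n' \<in> carrier P" "n \<in> carrier P" using n' assms M_closed by auto
  have g2: "gen2 \<sigma> y k \<in> carrier P" for k by (cases k) auto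
  let ?i = "i + none_exp w"
  have e: "eval_word P (gen2 \<sigma> y) (l # w) \<otimes> (n \<otimes> \<sigma> [^] i) = letter_val P (gen2 \<sigma> y) l \<otimes> (n' \<otimes> \<sigma> [^] ?i)"
    using nc g2 by (simp add: n'(3) m_assoc)
  show ?case
  proof (cases "fst l")
    case None
    show ?thesis
    proof (cases "snd l")
      case True
      have "conj_by \<sigma> n' \<otimes> \<sigma> [^] (?i + 1) = \<sigma> \<otimes> (n' \<otimes> \<sigma> [^] ?i)"
        using nc int_pow_mult[of \<sigma> 1 ?i] by (simp add: conj_by_def m_assoc add.commute)
         (simp add: m_assoc[symmetric])
      moreover have "conj_by \<sigma> n' \<in> M" using conj_\<sigma>_M[OF n'(1), of 1] by simp
      ultimately show ?thesis using None True n'(2) e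
        by (intro bexI[of _ "conj_by \<sigma> n'"]) (auto simp: fw_simps letter_val_def algebra_simps)
    next
      case False
      have "conj_by (inv \<sigma>) n' \<otimes> \<sigma> [^] (?i - 1) = inv \<sigma> \<otimes> (n' \<otimes> \<sigma> [^] ?i)"
        using nc int_pow_mult[of \<sigma> 1 "?i - 1"] by (simp add: conj_by_def m_assoc)
      moreover have "conj_by (inv \<sigma>) n' \<in> M" using conj_\<sigma>_M[OF n'(1), of "-1"] by (simp add: int_pow_neg)
      ultimately show ?thesis using None False n'(2) e
        by (intro bexI[of _ "conj_by (inv \<sigma>) n'"]) (auto simp: bw_simps letter_val_def algebra_simps)
    qed
  next
    case (Some j)
    have "letter_val P (gen2 \<sigma> y) l \<otimes> n' \<in> M"
      using Some n' y_in_M subgroup.m_closed[OF M_subgroup] subgroup.m_inv_closed[OF M_subgroup]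
      by (auto simp: letter_val_def)
    then show ?thesis using Some n'(2) e nc
      by (intro bexI[of _ "letter_val P (gen2 \<sigma> y) l \<otimes> n'"])
         (auto simp: fw_simps bw_simps letter_val_def m_assoc)
  qed
qed

abbreviation "mv \<equiv> move_right (conj_words np Wp) (conj_words nm Wm)"

text \<open>The letter for \<open>t\<close> obeys the conjugation rules of \<open>G\<close>, because
  \<open>v\<close> disappears when it conjugates an element of \<open>M\<close>. The rule for the
  inverse letter is stated after multiplication by \<open>t\<close>; \<open>cancel\<close> expresses
  that the words \<open>nm\<close> and \<open>np\<close> belong to mutually inverse
  conjugations.\<close>

lemma fw_None_conj:
  assumes p: "p \<in> M \<times> UNIV"
  shows "fw None (fw (Some k) p) = L.act (map_word Some (conj_words np Wp k)) (fw None p)"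
    and "fw None (L.act (map_word Some (conj_words nm Wm k)) p) = fw (Some k) (fw None p)"
proof -
  obtain n i where n: "p = (n, i)" "n \<in> M" using p by auto
  have nc: "n \<in> carrier P" using n M_closed by blast
  note sg = subgroup.m_closed[OF M_subgroup]
  have mw: "map_word Some (expand None Some W) = expand (Some None) (Some \<circ> Some) W" for W :: "(int \<times> 'j) letter list"
    by (rule map_word_expand)
  let ?n = "conj_by \<tau> n"
  have tn: "?n \<in> M" "?n \<otimes> \<kappa> i \<in> M" "conj_by \<sigma> (?n \<otimes> \<kappa> i) \<in> M" "conj_by \<sigma> n \<in> M"
    using conj_\<tau>_M n sg \<kappa>_in_M conj_\<sigma>_M[of _ 1] by auto
  have tc: "?n \<in> carrier P" using tn M_closed by blast
  have vn: "conj_by v (conj_by \<sigma> ?n) = conj_by \<sigma> ?n"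
    using v_comm(1) conj_\<sigma>_M[OF tn(1), of 1] tc by (intro conj_by_commute) auto
  \<comment> \<open>The rule for \<open>s\<close>. The recursion \<open>\<kappa>_Suc\<close>
    supplies exactly the factor \<open>wn np\<close> that conjugation produces.\<close>
  have key: "conj_by \<tau> (conj_by \<sigma> n) \<otimes> \<kappa> (i + 1) = wn np \<otimes> conj_by \<sigma> (?n \<otimes> \<kappa> i)"
  proof -
    have "conj_by \<tau> (conj_by \<sigma> n) = conj_by (conj_by \<tau> \<sigma>) ?n"
      using nc by (simp add: conj_by_conj_by) (simp add: conj_by_def m_assoc)
    also have "\<dots> = conj_by (wn np) (conj_by v (conj_by \<sigma> ?n))"
      using tc by (simp add: \<sigma>_up conj_by_conj_by m_assoc)
    also have "\<dots> = conj_by (wn np) (conj_by \<sigma> ?n)" by (simp add: vn)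
    finally have "conj_by \<tau> (conj_by \<sigma> n) \<otimes> \<kappa> (i + 1) =
        conj_by (wn np) (conj_by \<sigma> ?n) \<otimes> (wn np \<otimes> conj_by \<sigma> (\<kappa> i))" by (simp add: \<kappa>_Suc)
    also have "\<dots> = wn np \<otimes> (conj_by \<sigma> ?n \<otimes> conj_by \<sigma> (\<kappa> i))"
      using tc by (simp add: conj_by_def[of "wn np"] m_assoc) (simp add: m_assoc[symmetric])
    finally show ?thesis using tc by (simp add: conj_by_mult)
  qed
  show "fw None (fw (Some k) p) = L.act (map_word Some (conj_words np Wp k)) (fw None p)"
  proof (cases k)
    case None
    then show ?thesis using n tn key by (simp add: fw_simps conj_words_def mw L.act_append act_expand)
  next
    case (Some j)
    then show ?thesis using n tn nc tc
      by (simp add: fw_simps conj_words_def mw act_expand conj_by_mult y_up m_assoc)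
  qed
  show "fw None (L.act (map_word Some (conj_words nm Wm k)) p) = fw (Some k) (fw None p)"
  proof (cases k)
    case None
    have "conj_by \<tau> (wn nm \<otimes> conj_by \<sigma> n) \<otimes> \<kappa> (i + 1) =
        conj_by \<tau> (wn nm) \<otimes> (conj_by \<tau> (conj_by \<sigma> n) \<otimes> \<kappa> (i + 1))"
      using nc by (simp add: conj_by_mult m_assoc)
    also have "\<dots> = conj_by \<tau> (wn nm) \<otimes> wn np \<otimes> conj_by \<sigma> (?n \<otimes> \<kappa> i)"
      using tc by (simp add: key m_assoc)
    also have "\<dots> = conj_by \<sigma> (?n \<otimes> \<kappa> i)" using tc by (simp add: cancel)
    finally show ?thesis using None n tn
      by (simp add: fw_simps conj_words_def mw L.act_append act_expand)
  next
    case (Some j)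
    have "conj_by \<tau> (wn (Wm j)) = y j" by (simp add: y_dn[symmetric])
    then show ?thesis using Some n tn nc tc
      by (simp add: fw_simps conj_words_def mw act_expand conj_by_mult m_assoc)
  qed
qed

text \<open>The first exponent condition removes the power of \<open>t\<close> moved to the right.
  The remaining word has value the unit, so it preserves \<open>n \<otimes> \<sigma> [^] i\<close>;
  by the second exponent condition it preserves \<open>i\<close>, hence also
  \<open>n\<close>.\<close>

lemma act_relator:
  assumes r: "none_exp r = 0" "none_exp (mv r) = 0" "eval_word P (gen2 \<sigma> y) (mv r) = \<one>"
    and p: "p \<in> M \<times> UNIV"
  shows "L.act r p = p"
proof -
  have "L.act r p = L.act (map_word Some (mv r)) (L.act (wpow (none_exp r) None) p)"
  proof (rule act_move_right[OF letters _ _ p])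
    fix k q assume q: "q \<in> M \<times> (UNIV :: int set)"
    show "fw None (fw (Some k) q) = L.act (map_word Some (conj_words np Wp k)) (fw None q)"
      by (rule fw_None_conj(1)[OF q])
    have b: "bw None q \<in> M \<times> UNIV" by (rule L.f_closed(2)[OF q])
    have "fw None (L.act (map_word Some (conj_words nm Wm k)) (bw None q)) = fw (Some k) q"
      using fw_None_conj(2)[OF b] L.f_inverse(2)[OF q] by simp
    then show "bw None (fw (Some k) q) = L.act (map_word Some (conj_words nm Wm k)) (bw None q)"
      using L.f_inverse(1)[OF L.act_closed[OF b], of None] by metis
  qed
  also have "\<dots> = L.act (map_word Some (mv r)) p" by (simp add: r wpow_def)
  finally have eq: "L.act r p = L.act (map_word Some (mv r)) p" .
  obtain n i where n: "p = (n, i)" "n \<in> M" using p by auto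
  obtain n' where n': "n' \<in> M" "L.act (map_word Some (mv r)) (n, i) = (n', i + none_exp (mv r))"
    "n' \<otimes> \<sigma> [^] (i + none_exp (mv r)) = eval_word P (gen2 \<sigma> y) (mv r) \<otimes> (n \<otimes> \<sigma> [^] i)"
    using act_gen2[OF n(2)] by blast
  have "n' = n" using n'(3) r M_closed[OF n'(1)] M_closed[OF n(2)] by simp
  then show ?thesis using eq n n' r by simp
qed

text \<open>Words with equal values in \<open>G\<close> act equally on the base point, and
  \<open>act_expand\<close> reads off their values in \<open>M\<close>. Identities of
  \<open>G\<close> between window words thus pass to \<open>P\<close>, although \<open>P\<close>
  need not satisfy the relations of \<open>G\<close>.\<close>

lemma window_transfer:
  assumes pres: "presents G B (gen3 t s x) R"
    and B: "{None, Some None} \<union> Some ` Some ` J \<subseteq> B"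
    and R: "\<And>r. r \<in> R \<Longrightarrow> none_exp r = 0 \<and> none_exp (mv r) = 0 \<and> eval_word P (gen2 \<sigma> y) (mv r) = \<one>"
    and W: "W \<in> words (UNIV \<times> J)" "W' \<in> words (UNIV \<times> J)"
  shows "group.win G s x W = group.win G s x W' \<Longrightarrow> wn W = wn W'"
    and "group.conj_by G t (group.win G s x W) = group.win G s x W' \<Longrightarrow> conj_by \<tau> (wn W) = wn W'"
proof -
  interpret G: group G using pres by (simp add: presents_def)
  have g: "\<And>z. gen3 t s x z \<in> carrier G" using pres by (simp add: presents_def)
  have t: "t \<in> carrier G" and s: "s \<in> carrier G" and x: "\<And>j. x j \<in> carrier G"
    using g[of None] g[of "Some None"] g[of "Some (Some _)"] by auto
  let ?e = "expand (Some None) (Some \<circ> Some) :: (int \<times> 'j) letter list \<Rightarrow> _"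
  have ew: "?e W \<in> words B" "?e W' \<in> words B"
    using B W by (auto intro!: expand_in_words[where J = J])
  have ev: "eval_word G (gen3 t s x) (?e V) = G.win s x V" for V
    using G.eval_expand[of "gen3 t s x" "Some None" "Some \<circ> Some" V] g by simp
  have Rt: "L.act r p = p" if "r \<in> R" "p \<in> M \<times> UNIV" for r p
    using R[OF that(1)] that(2) by (intro act_relator) auto
  have one: "(\<one>, 0) \<in> M \<times> (UNIV :: int set)" "\<one> \<in> M" using subgroup.one_closed[OF M_subgroup] by auto
  show "wn W = wn W'" if "G.win s x W = G.win s x W'"
  proof -
    have "L.act (?e W) (\<one>, 0) = L.act (?e W') (\<one>, 0)"
      by (rule L.act_eqI[OF pres Rt ew _ one(1)]) (simp_all add: ev that)
    then show ?thesis using act_expand[OF one(2)] by simp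
  qed
  show "conj_by \<tau> (wn W) = wn W'" if h: "G.conj_by t (G.win s x W) = G.win s x W'"
  proof -
    have wc: "G.win s x V \<in> carrier G" for V using s x by (rule G.win_closed)
    have "L.act ((None, True) # ?e W) (\<one>, 0) = L.act (?e W' @ [(None, True)]) (\<one>, 0)"
    proof (rule L.act_eqI[OF pres Rt _ _ _ one(1)])
      show "eval_word G (gen3 t s x) ((None, True) # ?e W) = eval_word G (gen3 t s x) (?e W' @ [(None, True)])"
        using g t wc[of W] by (simp add: G.eval_word_append ev h[symmetric] letter_val_def G.conj_by_def G.m_assoc)
    qed (use ew B in auto)
    then show ?thesis using act_expand[OF one(2)] by (simp add: L.act_append fw_simps)
  qed
qed

end

section \<open>The twisted fibre product\<close>

text \<open>Choose a window word for each element and evaluate it in \<open>P\<close>; by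
  \<open>window_transfer\<close> the choice is immaterial. The value on \<open>np\<close> is
  recorded because \<open>np\<close> measures how \<open>t\<close> conjugates
  \<open>s\<close>.\<close>

lemma (in one_side) window_hom:
  assumes pres: "presents G B (gen3 t s x) R"
    and B: "{None, Some None} \<union> Some ` Some ` J \<subseteq> B"
    and R: "\<And>r. r \<in> R \<Longrightarrow> none_exp r = 0 \<and> none_exp (mv r) = 0 \<and> eval_word P (gen2 \<sigma> y) (mv r) = \<one>"
    and N0: "N0 = group.slab G s x J UNIV"
    and N0t: "\<And>n. n \<in> N0 \<Longrightarrow> group.conj_by G t n \<in> N0"
    and np: "np \<in> words (UNIV \<times> J)"
  obtains \<theta> where "\<And>n. n \<in> N0 \<Longrightarrow> \<theta> n \<in> M"
    "\<And>n n'. n \<in> N0 \<Longrightarrow> n' \<in> N0 \<Longrightarrow> \<theta> (n \<otimes>\<^bsub>G\<^esub> n') = \<theta> n \<otimes> \<theta> n'"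
    "\<And>j. j \<in> J \<Longrightarrow> \<theta> (x j) = y j"
    "\<And>n k. n \<in> N0 \<Longrightarrow> \<theta> (group.conj_by G (s [^]\<^bsub>G\<^esub> (k::int)) n) = conj_by (\<sigma> [^] k) (\<theta> n)"
    "\<And>n. n \<in> N0 \<Longrightarrow> \<theta> (group.conj_by G t n) = conj_by \<tau> (\<theta> n)"
    "\<theta> (group.win G s x np) = wn np"
proof -
  interpret G: group G using pres by (simp add: presents_def)
  have g: "\<And>z. gen3 t s x z \<in> carrier G" using pres by (simp add: presents_def)
  have t: "t \<in> carrier G" and s: "s \<in> carrier G" and x: "\<And>j. x j \<in> carrier G"
    using g[of None] g[of "Some None"] g[of "Some (Some _)"] by auto
  note T = window_transfer[OF pres B R]
  define W where "W n = (SOME w. w \<in> words (UNIV \<times> J) \<and> G.win s x w = n)" for n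
  have W: "W n \<in> words (UNIV \<times> J) \<and> G.win s x (W n) = n" if n: "n \<in> N0" for n
  proof -
    have "\<exists>w. w \<in> words (UNIV \<times> J) \<and> G.win s x w = n"
      using G.slab_obtains_win[of s x n J UNIV] s x n N0 by auto
    then show ?thesis unfolding W_def by (rule someI_ex)
  qed
  have inN: "G.win s x w \<in> N0" if "w \<in> words (UNIV \<times> J)" for w
    using G.win_in_slab[OF s x that] N0 by simp
  let ?\<theta> = "\<lambda>n. wn (W n)"
  have eq: "?\<theta> (G.win s x w) = wn w" if w: "w \<in> words (UNIV \<times> J)" for w
    using T(1)[of "W (G.win s x w)" w] W[OF inN[OF w]] w by simp
  have hom: "?\<theta> (n \<otimes>\<^bsub>G\<^esub> n') = ?\<theta> n \<otimes> ?\<theta> n'" if n: "n \<in> N0" "n' \<in> N0" for n n'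
  proof -
    have "?\<theta> (G.win s x (W n @ W n')) = wn (W n @ W n')" using W n by (intro eq) auto
    then show ?thesis using W[OF n(1)] W[OF n(2)] by (simp add: G.win_append[OF s x] win_append)
  qed
  have gen: "?\<theta> (x j) = y j" if j: "j \<in> J" for j
  proof -
    have "?\<theta> (G.win s x [((0, j), True)]) = wn [((0, j), True)]" using j by (intro eq) auto
    then show ?thesis using x s by (simp add: G.win_def win_def letter_val_def)
  qed
  have shift: "?\<theta> (G.conj_by (s [^]\<^bsub>G\<^esub> k) n) = conj_by (\<sigma> [^] k) (?\<theta> n)" if n: "n \<in> N0" for n and k :: int
  proof -
    let ?V = "map_word (\<lambda>(i, j). (k + i, j)) (W n)"
    have "?\<theta> (G.win s x ?V) = wn ?V" using W[OF n] by (intro eq map_word_shift_in_words) auto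
    then show ?thesis using W[OF n] G.win_shift[of s x k "W n"] s x win_shift[of \<sigma> y k "W n"] by simp
  qed
  have tt: "?\<theta> (G.conj_by t n) = conj_by \<tau> (?\<theta> n)" if n: "n \<in> N0" for n
    using T(2)[of "W n" "W (G.conj_by t n)"] W[OF n] W[OF N0t[OF n]] by simp
  show ?thesis
    by (rule that[of ?\<theta>, OF wn_in_M hom gen shift tt eq[OF np]])
qed

text \<open>
  Relations between \<open>\<sigma> = (s, s)\<close>, \<open>\<tau> = (t, t s\<^sup>m)\<close>, \<open>y1 j = (x j, 1)\<close> and \<open>y2 j = (1, x j)\<close>, so that
  \<open>\<tau> \<otimes> \<sigma> [^] (- m)\<close> has second component \<open>t\<close>. Only the commutators of the two families at
  distance at most \<open>\<rho>\<close> are imposed.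
\<close>

context group
begin

definition twisted_relations ::
    "int \<Rightarrow> int \<Rightarrow> ('j \<Rightarrow> (int \<times> 'j) letter list) \<Rightarrow> ('j \<Rightarrow> (int \<times> 'j) letter list) \<Rightarrow> (int \<times> 'j) letter list \<Rightarrow>
     (int \<times> 'j) letter list \<Rightarrow> 'j set \<Rightarrow> 'j option letter list set \<Rightarrow> 'a \<Rightarrow> 'a \<Rightarrow> ('j \<Rightarrow> 'a) \<Rightarrow> ('j \<Rightarrow> 'a) \<Rightarrow> bool" where
  "twisted_relations m \<rho> Wp Wm np nm J K \<sigma> \<tau> y1 y2 \<longleftrightarrow>
    (\<forall>j\<in>J. conj_by \<tau> (y1 j) = win \<sigma> y1 (Wp j)) \<and>
    (\<forall>j\<in>J. conj_by (inv \<tau>) (y1 j) = win \<sigma> y1 (Wm j)) \<and>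
    (\<forall>j\<in>J. conj_by (\<tau> \<otimes> \<sigma> [^] (- m)) (y2 j) = win \<sigma> y2 (Wp j)) \<and>
    (\<forall>j\<in>J. conj_by (inv (\<tau> \<otimes> \<sigma> [^] (- m))) (y2 j) = win \<sigma> y2 (Wm j)) \<and>
    conj_by \<tau> \<sigma> = win \<sigma> y1 np \<otimes> win \<sigma> y2 np \<otimes> \<sigma> \<and>
    conj_by (inv \<tau>) \<sigma> = win \<sigma> y1 nm \<otimes> conj_by (\<sigma> [^] (- m)) (win \<sigma> y2 nm) \<otimes> \<sigma> \<and>
    (\<forall>k\<in>{- \<rho>..\<rho>}. \<forall>i\<in>J. \<forall>j\<in>J.
       y1 i \<otimes> conj_by (\<sigma> [^] k) (y2 j) = conj_by (\<sigma> [^] k) (y2 j) \<otimes> y1 i) \<and>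
    conj_by \<tau> (win \<sigma> y1 nm) \<otimes> win \<sigma> y1 np = \<one> \<and>
    conj_by (\<tau> \<otimes> \<sigma> [^] (- m)) (win \<sigma> y2 nm) \<otimes> win \<sigma> y2 np = \<one> \<and>
    (\<forall>q\<in>K. eval_word G (gen2 \<sigma> y1) q = \<one>) \<and> (\<forall>q\<in>K. eval_word G (gen2 \<sigma> y2) q = \<one>)"

end

section \<open>The relators of the twisted fibre product\<close>

datatype 'j twisted_gen = Tau | Sig | Fst 'j | Snd 'j

text \<open>The clauses of \<open>twisted_relations\<close> as words; an equation is kept as the
  pair of its two sides, which a group satisfies if both have the same value.\<close>

definition twisted_relators ::
    "int \<Rightarrow> int \<Rightarrow> ('j \<Rightarrow> (int \<times> 'j) letter list) \<Rightarrow> ('j \<Rightarrow> (int \<times> 'j) letter list) \<Rightarrow> (int \<times> 'j) letter list \<Rightarrow>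
     (int \<times> 'j) letter list \<Rightarrow> 'j set \<Rightarrow> 'j option letter list set \<Rightarrow>
     ('j twisted_gen letter list \<times> 'j twisted_gen letter list) set" where
  "twisted_relators m \<rho> Wp Wm np nm J K = (let
      T = [(Tau, True)]; T' = T @ wpow (- m) Sig; e1 = expand Sig Fst; e2 = expand Sig Snd;
      cj = (\<lambda>u w. u @ w @ inv_word u) in
    (\<lambda>j. (cj T [(Fst j, True)], e1 (Wp j))) ` J \<union>
    (\<lambda>j. (cj (inv_word T) [(Fst j, True)], e1 (Wm j))) ` J \<union>
    (\<lambda>j. (cj T' [(Snd j, True)], e2 (Wp j))) ` J \<union>
    (\<lambda>j. (cj (inv_word T') [(Snd j, True)], e2 (Wm j))) ` J \<union>
    {(cj T [(Sig, True)], e1 np @ e2 np @ [(Sig, True)]),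
     (cj (inv_word T) [(Sig, True)], e1 nm @ cj (wpow (- m) Sig) (e2 nm) @ [(Sig, True)])} \<union>
    (\<Union>k\<in>{- \<rho>..\<rho>}. \<Union>i\<in>J. (\<lambda>j. ([(Fst i, True)] @ cj (wpow k Sig) [(Snd j, True)],
        cj (wpow k Sig) [(Snd j, True)] @ [(Fst i, True)])) ` J) \<union>
    {(cj T (e1 nm) @ e1 np, []), (cj T' (e2 nm) @ e2 np, [])} \<union>
    (\<lambda>q. (map_word (case_option Sig Fst) q, [])) ` K \<union>
    (\<lambda>q. (map_word (case_option Sig Snd) q, [])) ` K)"

lemma (in group) twisted_relators_iff:
  assumes p: "\<And>z. p z \<in> carrier G"
  shows "(\<forall>(u, v)\<in>twisted_relators m \<rho> Wp Wm np nm J K. eval_word G p u = eval_word G p v) \<longleftrightarrow>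
    twisted_relations m \<rho> Wp Wm np nm J K (p Sig) (p Tau) (\<lambda>j. p (Fst j)) (\<lambda>j. p (Snd j))"
proof -
  have cj: "eval_word G p (u @ w @ inv_word u) = conj_by (eval_word G p u) (eval_word G p w)" for u w
    using p by (simp add: eval_word_append eval_word_inv_word conj_by_def m_assoc)
  have sing: "eval_word G p [(z, True)] = p z" for z using p by (simp add: letter_val_def)
  have T': "eval_word G p ([(Tau, True)] @ wpow (- m) Sig) = p Tau \<otimes> p Sig [^] (- m)"
    using p by (simp only: eval_word_append sing eval_wpow)
  have co: "(\<lambda>y. p (case_option Sig h y)) = gen2 (p Sig) (\<lambda>j. p (h j))" for h :: "'c \<Rightarrow> 'c twisted_gen"
    by (auto simp: fun_eq_iff gen2_def split: option.split)
  have c3: "eval_word G p (u @ v @ w) = eval_word G p u \<otimes> eval_word G p v \<otimes> eval_word G p w" for u v w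
    using p by (simp add: eval_word_append m_assoc)
  note ev = cj sing T' eval_expand[of p, OF p] eval_wpow[of p, OF p] eval_word_inv_word[of p, OF p]
  let ?E = "eval_word G p" and ?T = "[(Tau, True)]" and ?T' = "[(Tau, True)] @ wpow (- m) Sig"
  let ?\<sigma> = "p Sig" and ?\<tau> = "p Tau" and ?y1 = "\<lambda>j. p (Fst j)" and ?y2 = "\<lambda>j. p (Snd j)"
  have 1: "?E (?T @ [(Fst j, True)] @ inv_word ?T) = ?E (expand Sig Fst W) \<longleftrightarrow>
      conj_by ?\<tau> (p (Fst j)) = win ?\<sigma> ?y1 W" for j W
    by (simp only: ev)
  have 2: "?E (inv_word ?T @ [(Fst j, True)] @ inv_word (inv_word ?T)) = ?E (expand Sig Fst W) \<longleftrightarrow>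
      conj_by (inv ?\<tau>) (p (Fst j)) = win ?\<sigma> ?y1 W" for j W
    by (simp only: ev)
  have 3: "?E (?T' @ [(Snd j, True)] @ inv_word ?T') = ?E (expand Sig Snd W) \<longleftrightarrow>
      conj_by (?\<tau> \<otimes> ?\<sigma> [^] (- m)) (p (Snd j)) = win ?\<sigma> ?y2 W" for j W
    by (simp only: ev)
  have 4: "?E (inv_word ?T' @ [(Snd j, True)] @ inv_word (inv_word ?T')) = ?E (expand Sig Snd W) \<longleftrightarrow>
      conj_by (inv (?\<tau> \<otimes> ?\<sigma> [^] (- m))) (p (Snd j)) = win ?\<sigma> ?y2 W" for j W
    by (simp only: ev)
  have 5: "?E (?T @ [(Sig, True)] @ inv_word ?T) = ?E (expand Sig Fst V @ expand Sig Snd W @ [(Sig, True)]) \<longleftrightarrow>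
      conj_by ?\<tau> ?\<sigma> = win ?\<sigma> ?y1 V \<otimes> win ?\<sigma> ?y2 W \<otimes> ?\<sigma>" for V W
    by (simp only: ev c3[of "expand Sig Fst V"])
  have 6: "?E (inv_word ?T @ [(Sig, True)] @ inv_word (inv_word ?T)) =
      ?E (expand Sig Fst V @ (wpow (- m) Sig @ expand Sig Snd W @ inv_word (wpow (- m) Sig)) @ [(Sig, True)]) \<longleftrightarrow>
      conj_by (inv ?\<tau>) ?\<sigma> = win ?\<sigma> ?y1 V \<otimes> conj_by (?\<sigma> [^] (- m)) (win ?\<sigma> ?y2 W) \<otimes> ?\<sigma>" for V W
    by (simp only: ev c3[of "expand Sig Fst V"])
  have 7: "?E ([(Fst i, True)] @ wpow k Sig @ [(Snd j, True)] @ inv_word (wpow k Sig)) =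
      ?E ((wpow k Sig @ [(Snd j, True)] @ inv_word (wpow k Sig)) @ [(Fst i, True)]) \<longleftrightarrow>
      p (Fst i) \<otimes> conj_by (?\<sigma> [^] k) (p (Snd j)) = conj_by (?\<sigma> [^] k) (p (Snd j)) \<otimes> p (Fst i)" for k i j
    using eval_word_append[of p "[(Fst i, True)]" "wpow k Sig @ [(Snd j, True)] @ inv_word (wpow k Sig)", OF p]
      eval_word_append[of p "wpow k Sig @ [(Snd j, True)] @ inv_word (wpow k Sig)" "[(Fst i, True)]", OF p]
    by (simp only: ev)
  have 8: "?E ((?T @ expand Sig Fst V @ inv_word ?T) @ expand Sig Fst W) = ?E [] \<longleftrightarrow>
      conj_by ?\<tau> (win ?\<sigma> ?y1 V) \<otimes> win ?\<sigma> ?y1 W = \<one>" for V W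
    using eval_word_append[of p "?T @ expand Sig Fst V @ inv_word ?T" "expand Sig Fst W", OF p]
    by (simp only: ev eval_word.simps(1))
  have 9: "?E ((?T' @ expand Sig Snd V @ inv_word ?T') @ expand Sig Snd W) = ?E [] \<longleftrightarrow>
      conj_by (?\<tau> \<otimes> ?\<sigma> [^] (- m)) (win ?\<sigma> ?y2 V) \<otimes> win ?\<sigma> ?y2 W = \<one>" for V W
    using eval_word_append[of p "?T' @ expand Sig Snd V @ inv_word ?T'" "expand Sig Snd W", OF p]
    by (simp only: ev eval_word.simps(1))
  have 10: "?E (map_word (case_option Sig h) q) = ?E [] \<longleftrightarrow>
      eval_word G (gen2 ?\<sigma> (\<lambda>j. p (h j))) q = \<one>" for h :: "'c \<Rightarrow> 'c twisted_gen" and q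
    by (simp only: eval_map_word co eval_word.simps(1))
  show ?thesis
    unfolding twisted_relators_def twisted_relations_def Let_def
    by (simp only: ball_Un ball_simps UN_ball_bex_simps prod.case 1 2 3 4 5 6 7 8 9 10 conj_assoc simp_thms)
qed

lemma words_mono: "w \<in> words A \<Longrightarrow> A \<subseteq> B \<Longrightarrow> w \<in> words B"
  by (induction w) auto

lemma window_word_bounded:
  "W \<in> words (UNIV \<times> J) \<Longrightarrow> \<exists>b::nat. W \<in> words ({- int b..int b} \<times> J)"
proof (induction W)
  case (Cons l W)
  then obtain b :: nat where b: "W \<in> words ({- int b..int b} \<times> J)" by auto
  let ?b = "max b (nat \<bar>fst (fst l)\<bar>)"
  have "W \<in> words ({- int ?b..int ?b} \<times> J)" using b by (rule words_mono) auto
  then show ?case using Cons by (intro exI[of _ ?b]) auto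
qed simp

lemma window_words_bounded:
  assumes "finite F" "F \<subseteq> words (UNIV \<times> J)"
  shows "\<exists>b::nat. F \<subseteq> words ({- int b..int b} \<times> J)"
  using assms
proof (induction F)
  case (insert W F)
  then obtain b c :: nat where b: "F \<subseteq> words ({- int b..int b} \<times> J)" and c: "W \<in> words ({- int c..int c} \<times> J)"
    using window_word_bounded by (metis insert_subset)
  have "V \<in> words ({- int (max b c)..int (max b c)} \<times> J)" if "V \<in> insert W F" for V
  proof (cases "V = W")
    case True
    show ?thesis unfolding True using c by (rule words_mono) auto
  next
    case False
    then have "V \<in> words ({- int b..int b} \<times> J)" using that b by auto
    then show ?thesis by (rule words_mono) auto
  qed
  then show ?case by blast
qed simp

text \<open>Used in the coordinate of the direct product in which the family in question is
  trivial.\<close>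

lemma (in group) eval_gen2_trivial:
  assumes "s \<in> carrier G"
  shows "eval_word G (gen2 s (\<lambda>_. \<one>)) w = s [^] none_exp w"
proof (induction w)
  case (Cons l w)
  then show ?case
    using assms int_pow_mult[of s 1 "none_exp w"] int_pow_mult[of s "- 1" "none_exp w"]
    by (cases "fst l") (auto simp: letter_val_def int_pow_neg)
qed simp

lemma (in group) win_trivial:
  assumes "s \<in> carrier G"
  shows "win s (\<lambda>_. \<one>) w = \<one>"
proof (induction w)
  case (Cons l w)
  then show ?case using assms by (cases "fst l") (auto simp: win_def letter_val_def)
qed (simp add: win_def)

lemma eval_word_DirProd:
  assumes "group G" "group H" "\<And>z. p z \<in> carrier (G \<times>\<times> H)"
  shows "eval_word (G \<times>\<times> H) p w = (eval_word G (fst \<circ> p) w, eval_word H (snd \<circ> p) w)"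
proof (induction w)
  case (Cons l w)
  have pz: "p (fst l) = (fst (p (fst l)), snd (p (fst l)))" by simp
  have "letter_val (G \<times>\<times> H) p l = (letter_val G (fst \<circ> p) l, letter_val H (snd \<circ> p) l)"
  proof (cases "snd l")
    case False
    have "inv\<^bsub>G \<times>\<times> H\<^esub> (p (fst l)) = (inv\<^bsub>G\<^esub> fst (p (fst l)), inv\<^bsub>H\<^esub> snd (p (fst l)))"
      using assms(3)[of "fst l"] by (subst pz) (rule inv_DirProd[OF assms(1,2)], auto simp: mem_Times_iff)
    then show ?thesis using False by (simp add: letter_val_def)
  qed (simp add: letter_val_def)
  then show ?case using Cons by (simp only: eval_word.simps mult_DirProd)
qed simp

lemma (in group) int_pow_unique:
  assumes "a \<in> carrier G" "\<And>i::int. f i \<in> carrier G" "f 0 = \<one>" "\<And>i::int. f (i + 1) = a \<otimes> f i"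
  shows "f i = a [^] i"
proof (induction i rule: int_induct[where k = 0])
  case (step1 i)
  have "a [^] (i + 1) = a \<otimes> a [^] i" using assms(1) int_pow_mult[of a 1 i] by (simp add: add.commute)
  then show ?case using step1 assms(4)[of i] by simp
next
  case (step2 i)
  have "a \<otimes> f (i - 1) = a \<otimes> a [^] (i - 1)"
    using assms(4)[of "i - 1"] step2 assms(1) int_pow_mult[of a 1 "i - 1"] by simp
  then show ?case using assms by simp
qed (simp add: assms)

lemma move_right_in_words:
  assumes "\<And>k. k \<in> A \<Longrightarrow> cu k \<in> words A" "\<And>k. k \<in> A \<Longrightarrow> cd k \<in> words A"
    and "w \<in> words (insert None (Some ` A))"
  shows "move_right cu cd w \<in> words A"
  using assms(3)
proof (induction w)
  case (Cons l w)
  then show ?case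
    using subst_word_in_words[of A cu A] subst_word_in_words[of A cd A] assms(1,2)
    by (cases "fst l") auto
qed simp

lemma conj_words_in_words:
  assumes "n \<in> words (UNIV \<times> J)" "\<And>j. V j \<in> words (UNIV \<times> J)"
  shows "conj_words n V k \<in> words (insert None (Some ` J))"
  using assms by (auto simp: conj_words_def split: option.split intro!: expand_in_words[where J = J])

lemma twisted_relators_finite: "finite J \<Longrightarrow> finite K \<Longrightarrow> finite (twisted_relators m \<rho> Wp Wm np nm J K)"
  by (simp add: twisted_relators_def Let_def)

lemma twisted_relators_in_words:
  assumes W: "\<And>j. Wp j \<in> words (UNIV \<times> J)" "\<And>j. Wm j \<in> words (UNIV \<times> J)"
    "np \<in> words (UNIV \<times> J)" "nm \<in> words (UNIV \<times> J)"
    and K: "K \<subseteq> words (insert None (Some ` J))"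
    and uv: "(u, v) \<in> twisted_relators m \<rho> Wp Wm np nm J K"
  defines "C \<equiv> {Tau, Sig} \<union> Fst ` J \<union> Snd ` J"
  shows "u \<in> words C \<and> v \<in> words C"
proof -
  have e: "expand Sig Fst V \<in> words C" "expand Sig Snd V \<in> words C" if "V \<in> words (UNIV \<times> J)" for V
    using that by (auto intro!: expand_in_words[where J = J] simp: C_def)
  have w: "wpow k Sig \<in> words C" for k by (auto intro!: wpow_in_words simp: C_def)
  have k: "map_word (case_option Sig Fst) q \<in> words C" "map_word (case_option Sig Snd) q \<in> words C"
    if "q \<in> K" for q
    using that K by (auto intro!: map_word_in_words[of q "insert None (Some ` J)"] simp: C_def)
  have l: "Tau \<in> C" "Sig \<in> C" "\<And>j. j \<in> J \<Longrightarrow> Fst j \<in> C \<and> Snd j \<in> C" by (auto simp: C_def)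
  show ?thesis
    using uv W e w k l by (auto simp: twisted_relators_def Let_def inv_word_in_words)
qed

text \<open>
  The group in question is the fibre product \<open>{(g\<^sub>1, g\<^sub>2). \<mu> (N g\<^sub>1) = N g\<^sub>2}\<close> for
  \<open>N = ker \<chi> \<inter> ker a\<close> and the automorphism \<open>\<mu>\<close> of \<open>G/N\<close> that fixes \<open>s\<close> and
  maps \<open>t\<close> to \<open>t s\<^sup>m\<close>.
\<close>

lemma twisted_fibre_product_finitely_presented:
  fixes G :: "('a, 'b) monoid_scheme" and x :: "nat \<Rightarrow> 'a" and \<chi> a :: "'a \<Rightarrow> int"
  assumes fp: "finitely_presented G" and t: "t \<in> carrier G" and s: "s \<in> carrier G"
    and x: "\<And>j. x j \<in> carrier G" "\<And>j. j \<ge> r \<Longrightarrow> x j = \<one>\<^bsub>G\<^esub>"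
    and \<chi>: "add_hom G \<chi>" "\<chi> t = 1" "\<chi> s = 0" "\<And>j. \<chi> (x j) = 0"
    and a: "add_hom G a" "a t = 0" "a s = 1" "\<And>j. a (x j) = 0"
    and gen: "generate G ({t, s} \<union> x ` {..<r}) = carrier G"
    and N0: "{g \<in> carrier G. \<chi> g = 0 \<and> a g = 0} \<subseteq> group.slab G s x {..<r} UNIV"
  shows "\<exists>m::int. finitely_presented ((G \<times>\<times> G)\<lparr>carrier :=
    {(g1, g2). g1 \<in> carrier G \<and> g2 \<in> carrier G \<and> \<chi> g1 = \<chi> g2 \<and> a g2 = a g1 + m * \<chi> g1}\<rparr>)"
proof -
  obtain n0 :: nat and g0 R0 where pres0: "presents G {..<n0} g0 R0"
    using finitely_presented_imp_presents[OF fp] by blast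
  interpret G: group G using pres0 by (simp add: presents_def)
  let ?J = "{..<r}" and ?g = "gen3 t s x"
  let ?B = "{None, Some None} \<union> Some ` Some ` ?J"
  have g: "?g z \<in> carrier G" for z using t s x by (auto simp: gen3_def split: option.splits)
  have "?g ` ?B = {t, s} \<union> x ` ?J" by (auto simp: image_iff)
  then obtain R where pres: "presents G ?B ?g R"
    using presents_change_generators[OF pres0, of ?B ?g] g gen by auto
  note \<chi>m = G.add_hom_mult[OF \<chi>(1)] and \<chi>i = G.add_hom_inv[OF \<chi>(1)] and \<chi>p = G.add_hom_int_pow[OF \<chi>(1)]
  note am = G.add_hom_mult[OF a(1)] and ai = G.add_hom_inv[OF a(1)] and ap = G.add_hom_int_pow[OF a(1)]
  \<comment> \<open>This plays the part of \<open>L\<close>: by \<open>N_eq\<close> it is the common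
    kernel of both characters.\<close>
  define N where "N = G.slab s x ?J UNIV"
  have N_eq: "N = {g \<in> carrier G. \<chi> g = 0 \<and> a g = 0}"
  proof
    show "N \<subseteq> {g \<in> carrier G. \<chi> g = 0 \<and> a g = 0}"
    proof
      fix n assume n: "n \<in> N"
      have nc: "n \<in> carrier G" using n G.slab_closed[OF s x(1)] by (simp add: N_def)
      have "\<chi> n = 0" using n unfolding N_def G.slab_def
        by (rule G.add_hom_eq_0_on_generate[OF \<chi>(1) G.slab_generators[OF s x(1)], rotated])
           (use s x \<chi> in \<open>auto simp: G.conj_by_def \<chi>m \<chi>i\<close>)
      moreover have "a n = 0" using n unfolding N_def G.slab_def
        by (rule G.add_hom_eq_0_on_generate[OF a(1) G.slab_generators[OF s x(1)], rotated])
           (use s x a in \<open>auto simp: G.conj_by_def am ai\<close>)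
      ultimately show "n \<in> {g \<in> carrier G. \<chi> g = 0 \<and> a g = 0}" using nc by simp
    qed
  qed (use N0 in \<open>simp add: N_def\<close>)
  have N_conj: "G.conj_by c n \<in> N" if "n \<in> N" "c \<in> carrier G" for c n
    using that by (simp add: N_eq G.conj_by_def \<chi>m \<chi>i am ai)
  have win_ex: "\<exists>W. W \<in> words (UNIV \<times> ?J) \<and> G.win s x W = n" if "n \<in> N" for n
    using G.slab_obtains_win[of s x n ?J UNIV] s x that by (auto simp: N_def)
  have "\<exists>W. (W \<in> words (UNIV \<times> ?J)) \<and> G.win s x W = G.conj_by t (x j)" for j
    using x t \<chi> a by (intro win_ex N_conj) (auto simp: N_eq)
  then obtain Wp where Wp: "\<And>j. Wp j \<in> words (UNIV \<times> ?J)" "\<And>j. G.win s x (Wp j) = G.conj_by t (x j)"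
    by metis
  have "\<exists>W. (W \<in> words (UNIV \<times> ?J)) \<and> G.win s x W = G.conj_by (inv\<^bsub>G\<^esub> t) (x j)" for j
    using x t \<chi> a by (intro win_ex N_conj) (auto simp: N_eq)
  then obtain Wm where Wm: "\<And>j. Wm j \<in> words (UNIV \<times> ?J)" "\<And>j. G.win s x (Wm j) = G.conj_by (inv\<^bsub>G\<^esub> t) (x j)"
    by metis
  obtain np where np: "np \<in> words (UNIV \<times> ?J)" "G.win s x np = G.conj_by t s \<otimes>\<^bsub>G\<^esub> inv\<^bsub>G\<^esub> s"
    using win_ex[of "G.conj_by t s \<otimes>\<^bsub>G\<^esub> inv\<^bsub>G\<^esub> s"] t s \<chi> a
    by (auto simp: N_eq G.conj_by_def \<chi>m \<chi>i am ai)
  obtain nm where nm: "nm \<in> words (UNIV \<times> ?J)" "G.win s x nm = G.conj_by (inv\<^bsub>G\<^esub> t) s \<otimes>\<^bsub>G\<^esub> inv\<^bsub>G\<^esub> s"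
    using win_ex[of "G.conj_by (inv\<^bsub>G\<^esub> t) s \<otimes>\<^bsub>G\<^esub> inv\<^bsub>G\<^esub> s"] t s \<chi> a
    by (auto simp: N_eq G.conj_by_def \<chi>m \<chi>i am ai)
  \<comment> \<open>From \<open>r\<close> on the generators are trivial and receive the empty word,
    so one bound \<open>b\<close> serves all indices.\<close>
  define Wp' where "Wp' j = (if j < r then Wp j else [])" for j
  define Wm' where "Wm' j = (if j < r then Wm j else [])" for j
  have Wp': "Wp' j \<in> words (UNIV \<times> ?J)" "G.win s x (Wp' j) = G.conj_by t (x j)" for j
    using Wp t x(2)[of j] by (auto simp: Wp'_def G.win_def)
  have Wm': "Wm' j \<in> words (UNIV \<times> ?J)" "G.win s x (Wm' j) = G.conj_by (inv\<^bsub>G\<^esub> t) (x j)" for j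
    using Wm t x(2)[of j] by (auto simp: Wm'_def G.win_def)
  have "\<exists>b::nat. {np, nm} \<union> Wp ` ?J \<union> Wm ` ?J \<subseteq> words ({- int b..int b} \<times> ?J)"
    using np nm Wp Wm by (intro window_words_bounded) auto
  then obtain b :: nat where "{np, nm} \<union> Wp ` ?J \<union> Wm ` ?J \<subseteq> words ({- int b..int b} \<times> ?J)" ..
  then have b: "np \<in> words ({- int b..int b} \<times> ?J)" "nm \<in> words ({- int b..int b} \<times> ?J)"
    "\<And>j. Wp' j \<in> words ({- int b..int b} \<times> ?J)" "\<And>j. Wm' j \<in> words ({- int b..int b} \<times> ?J)"
    by (auto simp: Wp'_def Wm'_def image_subset_iff)
  \<comment> \<open>\<open>b\<close> bounds the windows needed for conjugating the generators and
    \<open>s\<close> by \<open>t\<close> and its inverse. The shift is the least integer above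
    \<open>2 * b\<close>, and \<open>\<rho>\<close> the least radius that
    \<open>commuting_windows\<close> accepts.\<close>
  define m :: int where "m = 2 * int b + 1"
  define \<rho> :: int where "\<rho> = 2 * int b + m"
  let ?mv = "move_right (conj_words np Wp') (conj_words nm Wm')"
  have sc: "G.win s x np \<otimes>\<^bsub>G\<^esub> s = G.conj_by t s" "G.win s x nm \<otimes>\<^bsub>G\<^esub> s = G.conj_by (inv\<^bsub>G\<^esub> t) s"
    using np nm s t by (auto simp: G.m_assoc)
  have g2: "gen2 s x k \<in> carrier G" for k using s x by (auto simp: gen2_def split: option.split)
  have finR: "finite R" using pres by (simp add: presents_def)
  \<comment> \<open>\<open>\<chi>\<close> counts occurrences of \<open>t\<close>, and
    \<open>a\<close> counts those of \<open>s\<close> once \<open>t\<close> has been moved away;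
    both vanish on the unit.\<close>
  have R: "none_exp q = 0 \<and> none_exp (?mv q) = 0 \<and> eval_word G (gen2 s x) (?mv q) = \<one>\<^bsub>G\<^esub>"
    if "q \<in> R" for q
  proof -
    have q: "eval_word G ?g q = \<one>\<^bsub>G\<^esub>" using that pres by (simp add: presents_def)
    have e: "eval_word G ?g q = eval_word G (gen2 s x) (?mv q) \<otimes>\<^bsub>G\<^esub> t [^]\<^bsub>G\<^esub> none_exp q"
      by (rule G.eval_move_right[OF t s x(1) Wp'(2) sc(1) Wm'(2) sc(2)])
    have \<chi>g: "\<chi> (eval_word G (gen2 s x) w) = 0" for w
    proof (induction w)
      case (Cons l w)
      then show ?case using g2 \<chi> by (cases "fst l") (auto simp: letter_val_def \<chi>m \<chi>i s x)
    qed (simp add: G.add_hom_one[OF \<chi>(1)])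
    have ag: "a (eval_word G (gen2 s x) w) = none_exp w" for w
    proof (induction w)
      case (Cons l w)
      then show ?case using g2 a by (cases "fst l") (auto simp: letter_val_def am ai s x)
    qed (simp add: G.add_hom_one[OF a(1)])
    have "\<chi> (eval_word G ?g q) = none_exp q"
      unfolding e using g2 t \<chi>g \<chi>(2) by (simp add: \<chi>m \<chi>p)
    then have 1: "none_exp q = 0" using q G.add_hom_one[OF \<chi>(1)] by simp
    then have 2: "eval_word G (gen2 s x) (?mv q) = \<one>\<^bsub>G\<^esub>" using e q g2 by simp
    then have "none_exp (?mv q) = 0" using ag[of "?mv q"] G.add_hom_one[OF a(1)] by simp
    then show ?thesis using 1 2 by simp
  qed
  let ?H = "{(g1, g2). g1 \<in> carrier G \<and> g2 \<in> carrier G \<and> \<chi> g1 = \<chi> g2 \<and> a g2 = a g1 + m * \<chi> g1}"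
  let ?GG = "G \<times>\<times> G"
  let ?HG = "?GG\<lparr>carrier := ?H\<rparr>"
  interpret GG: group ?GG by (rule DirProd_group[OF G.group_axioms G.group_axioms])
  have Hsub: "subgroup ?H ?GG"
  proof (rule GG.subgroupI)
    show "?H \<noteq> {}" using G.add_hom_one[OF \<chi>(1)] G.add_hom_one[OF a(1)] by (auto intro!: exI[of _ "\<one>\<^bsub>G\<^esub>"])
    show "inv\<^bsub>?GG\<^esub> h \<in> ?H" if "h \<in> ?H" for h
      using that G.group_axioms by (auto simp: \<chi>i ai)
    show "h \<otimes>\<^bsub>?GG\<^esub> k \<in> ?H" if "h \<in> ?H" "k \<in> ?H" for h k
      using that by (auto simp: \<chi>m am algebra_simps)
  qed auto
  interpret H: group ?HG by (rule GG.subgroup_imp_group[OF Hsub])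
  let ?t2 = "t \<otimes>\<^bsub>G\<^esub> s [^]\<^bsub>G\<^esub> m"
  have t2: "?t2 \<in> carrier G" using t s by simp
  define h where "h z = (case z of Tau \<Rightarrow> (t, ?t2) | Sig \<Rightarrow> (s, s) | Fst j \<Rightarrow> (x j, \<one>\<^bsub>G\<^esub>) | Snd j \<Rightarrow> (\<one>\<^bsub>G\<^esub>, x j))" for z
  have hH: "h z \<in> ?H" for z
    using t s x \<chi> a G.add_hom_one[OF \<chi>(1)] G.add_hom_one[OF a(1)]
    by (cases z) (auto simp: h_def \<chi>m \<chi>p am ap)
  have hGG: "h z \<in> carrier ?GG" for z using hH[of z] by auto
  have hc: "h z \<in> carrier ?HG" for z using hH[of z] by simp
  have hsub: "h ` A \<subseteq> carrier ?HG" for A by (rule image_subsetI) (rule hc)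
  let ?C = "{Tau, Sig} \<union> Fst ` ?J \<union> Snd ` ?J"
  let ?K = "?mv ` R"
  let ?E = "twisted_relators m \<rho> Wp' Wm' np nm ?J ?K"
  let ?R = "(\<lambda>(u, v). u @ inv_word v) ` ?E"
  have c1: "\<And>z. (fst \<circ> h) z \<in> carrier G" and c2: "\<And>z. (snd \<circ> h) z \<in> carrier G"
    using hGG by (auto simp: mem_Times_iff)
  have evH: "eval_word ?HG h w = (eval_word G (fst \<circ> h) w, eval_word G (snd \<circ> h) w)" for w
    using GG.eval_word_subgroup[of ?H h w, OF Hsub hH]
      eval_word_DirProd[of G G h w, OF G.group_axioms G.group_axioms hGG] by simp
  \<comment> \<open>Conjugating by \<open>t\<close> undoes conjugating by its inverse; in
    \<open>P\<close> this has to be imposed, and it becomes the assumption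
    \<open>cancel\<close>.\<close>
  have nmnp: "G.conj_by t (G.win s x nm) \<otimes>\<^bsub>G\<^esub> G.win s x np = \<one>\<^bsub>G\<^esub>"
  proof -
    have "G.conj_by t (G.win s x nm) = s \<otimes>\<^bsub>G\<^esub> inv\<^bsub>G\<^esub> G.conj_by t s"
      using t s by (simp add: nm G.conj_by_mult G.conj_by_inv)
    then show ?thesis using t s by (simp add: np G.m_assoc) (simp add: G.m_assoc[symmetric])
  qed
  have t2s: "?t2 \<otimes>\<^bsub>G\<^esub> s [^]\<^bsub>G\<^esub> (- m) = t"
    using t s by (simp add: G.m_assoc G.int_pow_mult[symmetric])
  have smm: "G.conj_by (s [^]\<^bsub>G\<^esub> (k::int)) s = s" for k
    using s G.int_pow_mult[of s k 1] G.int_pow_mult[of s 1 k]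
    by (intro G.conj_by_commute) (simp_all add: add.commute)
  have wcl: "G.win s x V \<in> carrier G" for V using s x by (intro G.win_closed)
  \<comment> \<open>The relations are checked in each coordinate separately. In the first the second
    family is trivial; in the second the first family is, and there
    \<open>\<tau> \<sigma>^-m\<close> is \<open>t\<close>.\<close>
  have rel1: "G.twisted_relations m \<rho> Wp' Wm' np nm ?J ?K s t x (\<lambda>_. \<one>\<^bsub>G\<^esub>)"
    unfolding G.twisted_relations_def
    using t s x Wp' Wm' R nmnp sc wcl
    by (auto simp: G.win_trivial G.eval_gen2_trivial)
  have rel2: "G.twisted_relations m \<rho> Wp' Wm' np nm ?J ?K s ?t2 (\<lambda>_. \<one>\<^bsub>G\<^esub>) x"
  proof -
    have 1: "G.conj_by ?t2 s = G.win s x np \<otimes>\<^bsub>G\<^esub> s"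
      using t s smm by (simp add: sc G.conj_by_conj_by[symmetric])
    have "G.conj_by (inv\<^bsub>G\<^esub> ?t2) s = G.conj_by (s [^]\<^bsub>G\<^esub> (- m)) (G.conj_by (inv\<^bsub>G\<^esub> t) s)"
      using t s by (simp add: G.inv_mult_group G.conj_by_conj_by G.int_pow_neg)
    also have "\<dots> = G.conj_by (s [^]\<^bsub>G\<^esub> (- m)) (G.win s x nm) \<otimes>\<^bsub>G\<^esub> s"
      using t s smm[of "- m"] by (simp add: sc(2)[symmetric] G.conj_by_mult wcl)
    finally show ?thesis
      unfolding G.twisted_relations_def t2s
      using t s x t2 Wp' Wm' R nmnp 1 wcl by (auto simp: G.win_trivial G.eval_gen2_trivial)
  qed
  have relH: "eval_word ?HG h u = eval_word ?HG h v" if "(u, v) \<in> ?E" for u v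
  proof -
    have "\<forall>(u, v)\<in>?E. eval_word G (fst \<circ> h) u = eval_word G (fst \<circ> h) v"
      using rel1 by (subst G.twisted_relators_iff[OF c1]) (simp add: h_def)
    moreover have "\<forall>(u, v)\<in>?E. eval_word G (snd \<circ> h) u = eval_word G (snd \<circ> h) v"
      using rel2 by (subst G.twisted_relators_iff[OF c2]) (simp add: h_def)
    ultimately show ?thesis using that by (auto simp: evH)
  qed
  define \<kappa> where "\<kappa> i = G.conj_by t (s [^]\<^bsub>G\<^esub> i) \<otimes>\<^bsub>G\<^esub> s [^]\<^bsub>G\<^esub> (- i)" for i :: int
  have \<kappa>N: "\<kappa> i \<in> N" for i
    using t s \<chi> a by (simp add: N_eq \<kappa>_def G.conj_by_def \<chi>m \<chi>i am ai \<chi>p ap)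
  have Nc: "n \<in> carrier G" if "n \<in> N" for n using that by (simp add: N_eq)
  \<comment> \<open>A normal form with the same exponents in both coordinates. They agree because
    \<open>a\<close> has the value \<open>m\<close> on \<open>?t2\<close>, which is what the
    condition on \<open>a g2\<close> compensates.\<close>
  have nf_obtain: "\<exists>n1\<in>N. \<exists>n2\<in>N. \<exists>(i::int) (j::int). k = (n1 \<otimes>\<^bsub>G\<^esub> s [^]\<^bsub>G\<^esub> i \<otimes>\<^bsub>G\<^esub> t [^]\<^bsub>G\<^esub> j, n2 \<otimes>\<^bsub>G\<^esub> s [^]\<^bsub>G\<^esub> i \<otimes>\<^bsub>G\<^esub> ?t2 [^]\<^bsub>G\<^esub> j)"
    if k: "k \<in> ?H" for k
  proof -
    obtain g1 g2 where gg: "k = (g1, g2)" "g1 \<in> carrier G" "g2 \<in> carrier G" "\<chi> g1 = \<chi> g2" "a g2 = a g1 + m * \<chi> g1"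
      using k by auto
    define i where "i = a g1"
    define j where "j = \<chi> g1"
    define n1 where "n1 = g1 \<otimes>\<^bsub>G\<^esub> t [^]\<^bsub>G\<^esub> (- j) \<otimes>\<^bsub>G\<^esub> s [^]\<^bsub>G\<^esub> (- i)"
    define n2 where "n2 = g2 \<otimes>\<^bsub>G\<^esub> ?t2 [^]\<^bsub>G\<^esub> (- j) \<otimes>\<^bsub>G\<^esub> s [^]\<^bsub>G\<^esub> (- i)"
    have "n1 \<in> N" using gg t s \<chi> a by (simp add: N_eq n1_def i_def j_def \<chi>m am \<chi>p ap)
    moreover have "n2 \<in> N"
      using gg t s \<chi> a t2 by (simp add: N_eq n2_def i_def j_def \<chi>m am \<chi>p ap)
    moreover have cancel: "g = g \<otimes>\<^bsub>G\<^esub> c [^]\<^bsub>G\<^esub> (- j) \<otimes>\<^bsub>G\<^esub> s [^]\<^bsub>G\<^esub> (- i) \<otimes>\<^bsub>G\<^esub> s [^]\<^bsub>G\<^esub> i \<otimes>\<^bsub>G\<^esub> c [^]\<^bsub>G\<^esub> j"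
      if "g \<in> carrier G" "c \<in> carrier G" for g c
      using that s by (simp add: G.m_assoc G.int_pow_neg)
    have "g1 = n1 \<otimes>\<^bsub>G\<^esub> s [^]\<^bsub>G\<^esub> i \<otimes>\<^bsub>G\<^esub> t [^]\<^bsub>G\<^esub> j"
      using gg t unfolding n1_def by (intro cancel) auto
    moreover have "g2 = n2 \<otimes>\<^bsub>G\<^esub> s [^]\<^bsub>G\<^esub> i \<otimes>\<^bsub>G\<^esub> ?t2 [^]\<^bsub>G\<^esub> j"
      using gg t2 unfolding n2_def by (intro cancel) auto
    ultimately show ?thesis using gg(1) by blast
  qed
  have nf1: "\<chi> (n \<otimes>\<^bsub>G\<^esub> s [^]\<^bsub>G\<^esub> i \<otimes>\<^bsub>G\<^esub> t [^]\<^bsub>G\<^esub> j) = j" "a (n \<otimes>\<^bsub>G\<^esub> s [^]\<^bsub>G\<^esub> i \<otimes>\<^bsub>G\<^esub> t [^]\<^bsub>G\<^esub> j) = i"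
    if "n \<in> N" for n and i j :: int
    using that t s \<chi> a by (auto simp: N_eq \<chi>m am \<chi>p ap)
  have genH: "generate ?HG (h ` ?C) = carrier ?HG"
  proof
    show "generate ?HG (h ` ?C) \<subseteq> carrier ?HG"
      by (rule H.generate_incl[OF hsub])
    show "carrier ?HG \<subseteq> generate ?HG (h ` ?C)"
    proof
      fix k assume "k \<in> carrier ?HG"
      then obtain n1 n2 and i j :: int where n: "n1 \<in> N" "n2 \<in> N"
        and k: "k = (n1 \<otimes>\<^bsub>G\<^esub> s [^]\<^bsub>G\<^esub> i \<otimes>\<^bsub>G\<^esub> t [^]\<^bsub>G\<^esub> j, n2 \<otimes>\<^bsub>G\<^esub> s [^]\<^bsub>G\<^esub> i \<otimes>\<^bsub>G\<^esub> ?t2 [^]\<^bsub>G\<^esub> j)"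
        using nf_obtain[of k] by auto
      obtain W1 W2 where W1: "W1 \<in> words (UNIV \<times> ?J)" "G.win s x W1 = n1"
        and W2: "W2 \<in> words (UNIV \<times> ?J)" "G.win s x W2 = n2" using win_ex n by meson
      \<comment> \<open>The normal form written as a word; each of the two window words is trivial
        in the other coordinate.\<close>
      let ?w = "expand Sig Fst W1 @ expand Sig Snd W2 @ wpow i Sig @ wpow j Tau"
      have w: "?w \<in> words ?C"
        using W1 W2 by (auto intro!: expand_in_words[where J = ?J] wpow_in_words)
      have ex1: "eval_word G (fst \<circ> h) (expand Sig Fst W1) = n1" "eval_word G (snd \<circ> h) (expand Sig Snd W2) = n2"
        "eval_word G (fst \<circ> h) (expand Sig Snd W2) = \<one>\<^bsub>G\<^esub>" "eval_word G (snd \<circ> h) (expand Sig Fst W1) = \<one>\<^bsub>G\<^esub>"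
        using G.eval_expand[of "fst \<circ> h" Sig Fst W1] G.eval_expand[of "snd \<circ> h" Sig Snd W2]
          G.eval_expand[of "fst \<circ> h" Sig Snd W2] G.eval_expand[of "snd \<circ> h" Sig Fst W1] c1 c2 W1 W2 s
        by (simp_all add: h_def G.win_trivial)
      have ex2: "eval_word G (fst \<circ> h) (wpow i Sig) = s [^]\<^bsub>G\<^esub> i" "eval_word G (snd \<circ> h) (wpow i Sig) = s [^]\<^bsub>G\<^esub> i"
        "eval_word G (fst \<circ> h) (wpow j Tau) = t [^]\<^bsub>G\<^esub> j" "eval_word G (snd \<circ> h) (wpow j Tau) = ?t2 [^]\<^bsub>G\<^esub> j"
        using G.eval_wpow[of "fst \<circ> h" i Sig] G.eval_wpow[of "snd \<circ> h" i Sig]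
          G.eval_wpow[of "fst \<circ> h" j Tau] G.eval_wpow[of "snd \<circ> h" j Tau] c1 c2 by (simp_all add: h_def)
      have "eval_word G (fst \<circ> h) ?w = n1 \<otimes>\<^bsub>G\<^esub> (\<one>\<^bsub>G\<^esub> \<otimes>\<^bsub>G\<^esub> (s [^]\<^bsub>G\<^esub> i \<otimes>\<^bsub>G\<^esub> t [^]\<^bsub>G\<^esub> j))"
        by (simp only: G.eval_word_append[of "fst \<circ> h", OF c1] ex1 ex2)
      moreover have "eval_word G (snd \<circ> h) ?w = \<one>\<^bsub>G\<^esub> \<otimes>\<^bsub>G\<^esub> (n2 \<otimes>\<^bsub>G\<^esub> (s [^]\<^bsub>G\<^esub> i \<otimes>\<^bsub>G\<^esub> ?t2 [^]\<^bsub>G\<^esub> j))"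
        by (simp only: G.eval_word_append[of "snd \<circ> h", OF c2] ex1 ex2)
      ultimately have "eval_word ?HG h ?w = k"
        using n Nc t s t2 G.int_pow_closed[OF t2] by (simp add: evH k G.m_assoc)
      moreover have "eval_word ?HG h ?w \<in> generate ?HG (h ` ?C)"
      proof (rule H.eval_word_in_subgroup[OF _ _ w])
        show "subgroup (generate ?HG (h ` ?C)) ?HG" by (rule H.generate_is_subgroup[OF hsub])
        show "h z \<in> generate ?HG (h ` ?C)" if "z \<in> ?C" for z using that by (intro generate.incl) blast
      qed
      ultimately show "k \<in> generate ?HG (h ` ?C)" by simp
    qed
  qed
  have Kw: "?K \<subseteq> words (insert None (Some ` ?J))"
  proof -
    have "R \<subseteq> words ?B" using pres by (auto simp: presents_def free_group_carrier)
    moreover have "?B = insert None (Some ` insert None (Some ` ?J))" by auto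
    ultimately show ?thesis
      using np nm Wp' Wm' by (auto intro!: move_right_in_words conj_words_in_words)
  qed
  have Ew: "u \<in> words ?C \<and> v \<in> words ?C" if "(u, v) \<in> ?E" for u v
    using twisted_relators_in_words[OF Wp'(1) Wm'(1) np(1) nm(1) Kw that] .
  have "presents ?HG ?C h (reduce_word ` ?R)"
  proof (rule presentsI[OF H.group_axioms _ _ genH])
    show "finite ?R" using finR by (intro finite_imageI twisted_relators_finite) auto
    show "?R \<subseteq> words ?C" using Ew inv_word_in_words by fastforce
    show "eval_word ?HG h q = \<one>\<^bsub>?HG\<^esub>" if q: "q \<in> ?R" for q
    proof -
      obtain u v where uv: "(u, v) \<in> ?E" "q = u @ inv_word v" using q by auto
      show ?thesis using relH[OF uv(1)] H.eval_word_append[of h u "inv_word v", OF hc]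
          H.eval_word_inv_word[of h v, OF hc] H.r_inv[OF H.eval_word_closed[of h v, OF hc]] uv(2)
        by simp
    qed
  next
    fix P :: "nat twisted_gen letter list set monoid" and p
    assume P: "group P" and p: "\<And>z. p z \<in> carrier P" and p1: "\<And>z. z \<notin> ?C \<Longrightarrow> p z = \<one>\<^bsub>P\<^esub>"
      and rel: "\<And>q. q \<in> ?R \<Longrightarrow> eval_word P p q = \<one>\<^bsub>P\<^esub>"
    interpret P: group P by fact
    let ?\<sigma> = "p Sig" and ?\<tau> = "p Tau" and ?y1 = "\<lambda>j. p (Fst j)" and ?y2 = "\<lambda>j. p (Snd j)"
    have "eval_word P p u = eval_word P p v" if "(u, v) \<in> ?E" for u v
    proof -
      have "eval_word P p (u @ inv_word v) = \<one>\<^bsub>P\<^esub>" using that by (intro rel) force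
      then have "eval_word P p u \<otimes>\<^bsub>P\<^esub> inv\<^bsub>P\<^esub> eval_word P p v = \<one>\<^bsub>P\<^esub>"
        using p by (simp add: P.eval_word_append P.eval_word_inv_word)
      then show ?thesis using p P.inv_equality[of "eval_word P p u" "inv\<^bsub>P\<^esub> eval_word P p v"] by simp
    qed
    then have "\<forall>(u, v)\<in>?E. eval_word P p u = eval_word P p v" by auto
    then have tw: "P.twisted_relations m \<rho> Wp' Wm' np nm ?J ?K ?\<sigma> ?\<tau> ?y1 ?y2"
      by (subst (asm) P.twisted_relators_iff[OF p])
    note tw = tw[unfolded P.twisted_relations_def]
    have y_triv: "p (Fst j) = \<one>\<^bsub>P\<^esub>" "p (Snd j) = \<one>\<^bsub>P\<^esub>" if "j \<notin> ?J" for j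
      using that by (auto intro!: p1)
    have Wtriv: "Wp' j = []" "Wm' j = []" if "j \<notin> ?J" for j using that by (auto simp: Wp'_def Wm'_def)
    let ?\<tau>' = "?\<tau> \<otimes>\<^bsub>P\<^esub> ?\<sigma> [^]\<^bsub>P\<^esub> (- m)"
    have \<tau>': "?\<tau>' \<in> carrier P" using p by simp
    have e1: "P.conj_by ?\<tau> (p (Fst j)) = P.win ?\<sigma> ?y1 (Wp' j)"
      and e2: "P.conj_by (inv\<^bsub>P\<^esub> ?\<tau>) (p (Fst j)) = P.win ?\<sigma> ?y1 (Wm' j)"
      and e3: "P.conj_by ?\<tau>' (p (Snd j)) = P.win ?\<sigma> ?y2 (Wp' j)"
      and e4: "P.conj_by (inv\<^bsub>P\<^esub> ?\<tau>') (p (Snd j)) = P.win ?\<sigma> ?y2 (Wm' j)" for j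
      using tw y_triv[of j] Wtriv[of j] p \<tau>'
      by (cases "j \<in> ?J"; simp add: P.win_def)+
    have sl1: "P.win ?\<sigma> ?y1 V \<in> P.slab ?\<sigma> ?y1 UNIV {- int b..int b}"
      and sl2: "P.win ?\<sigma> ?y2 V \<in> P.slab ?\<sigma> ?y2 UNIV {- int b..int b}"
      if "V \<in> words ({- int b..int b} \<times> ?J)" for V
      using words_mono[OF that, of "{- int b..int b} \<times> UNIV"] p by (auto intro!: P.win_in_slab)
    have comm_small: "p (Fst i) \<otimes>\<^bsub>P\<^esub> P.conj_by (?\<sigma> [^]\<^bsub>P\<^esub> k) (p (Snd j)) = P.conj_by (?\<sigma> [^]\<^bsub>P\<^esub> k) (p (Snd j)) \<otimes>\<^bsub>P\<^esub> p (Fst i)"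
      if "\<bar>k\<bar> \<le> \<rho>" for k i j
    proof (cases "i \<in> ?J \<and> j \<in> ?J")
      case True
      moreover have "k \<in> {- \<rho>..\<rho>}" using that by auto
      ultimately show ?thesis using tw by blast
    next
      case False
      then show ?thesis using y_triv[of i] y_triv[of j] p by (cases "i \<in> ?J") simp_all
    qed
    \<comment> \<open>The family runs over all indices. This is harmless, since outside
      \<open>?J\<close> the generators are mapped to the unit of \<open>P\<close> and the words are
      empty.\<close>
    interpret cw: commuting_windows P ?\<sigma> ?\<tau> ?y1 ?y2 UNIV m "int b" \<rho>
      "P.win ?\<sigma> ?y1 np" "P.win ?\<sigma> ?y2 np" "P.win ?\<sigma> ?y1 nm" "P.win ?\<sigma> ?y2 nm"
      by (intro commuting_windows.intro commuting_windows_axioms.intro P)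
         (use p e1 e2 e3 e4 sl1 sl2 b tw comm_small in \<open>auto simp: m_def \<rho>_def\<close>)
    let ?M1 = "P.slab ?\<sigma> ?y1 UNIV UNIV" and ?M2 = "P.slab ?\<sigma> ?y2 UNIV UNIV"
    have w1: "P.win ?\<sigma> ?y1 V \<in> ?M1" and w2: "P.win ?\<sigma> ?y2 V \<in> ?M2" for V :: "(int \<times> nat) letter list"
      using p by (auto intro!: P.win_in_slab simp: words_def)
    have w1c: "P.win ?\<sigma> ?y1 V \<in> carrier P" and w2c: "P.win ?\<sigma> ?y2 V \<in> carrier P" for V :: "(int \<times> nat) letter list"
      using p by (auto intro!: P.win_closed)
    have sh1: "P.conj_by (?\<sigma> [^]\<^bsub>P\<^esub> k) z \<in> ?M1" if "z \<in> ?M1" for z and k :: int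
      using p that by (intro P.slab_shift[OF _ _ that]) auto
    have sh2: "P.conj_by (?\<sigma> [^]\<^bsub>P\<^esub> k) z \<in> ?M2" if "z \<in> ?M2" for z and k :: int
      using p that by (intro P.slab_shift[OF _ _ that]) auto
    \<comment> \<open>Each family is treated on its own. The other one enters through factors that
      centralise it, which rests on commutation at all distances. For the second family
      \<open>?\<tau>'\<close> replaces \<open>?\<tau>\<close>.\<close>
    interpret s1: one_side P ?\<sigma> ?\<tau> "P.win ?\<sigma> ?y2 np" "P.conj_by (?\<sigma> [^]\<^bsub>P\<^esub> (- m)) (P.win ?\<sigma> ?y2 nm)"
      ?y1 Wp' Wm' np nm
    proof (intro one_side.intro one_side_axioms.intro P)
      show "P.win ?\<sigma> ?y2 np \<otimes>\<^bsub>P\<^esub> z = z \<otimes>\<^bsub>P\<^esub> P.win ?\<sigma> ?y2 np" if "z \<in> ?M1" for z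
        by (rule cw.slabs_commute[OF that w2, symmetric])
      show "P.conj_by (?\<sigma> [^]\<^bsub>P\<^esub> (- m)) (P.win ?\<sigma> ?y2 nm) \<otimes>\<^bsub>P\<^esub> z =
          z \<otimes>\<^bsub>P\<^esub> P.conj_by (?\<sigma> [^]\<^bsub>P\<^esub> (- m)) (P.win ?\<sigma> ?y2 nm)" if "z \<in> ?M1" for z
        by (rule cw.slabs_commute[OF that sh2[OF w2], symmetric])
    qed (use p e1 e2 tw w2c in simp_all)
    interpret s2: one_side P ?\<sigma> ?\<tau>' "P.win ?\<sigma> ?y1 np" "P.conj_by (?\<sigma> [^]\<^bsub>P\<^esub> m) (P.win ?\<sigma> ?y1 nm)"
      ?y2 Wp' Wm' np nm
    proof (intro one_side.intro one_side_axioms.intro P)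
      have "P.conj_by ?\<tau>' ?\<sigma> = P.conj_by ?\<tau> (P.conj_by (?\<sigma> [^]\<^bsub>P\<^esub> (- m)) ?\<sigma>)"
        using p by (simp add: P.conj_by_conj_by)
      also have "P.conj_by (?\<sigma> [^]\<^bsub>P\<^esub> (- m)) ?\<sigma> = ?\<sigma>"
        using p P.int_pow_mult[of ?\<sigma> "- m" 1] P.int_pow_mult[of ?\<sigma> 1 "- m"]
        by (intro P.conj_by_commute) (simp_all add: add.commute)
      finally show "P.conj_by ?\<tau>' ?\<sigma> = P.win ?\<sigma> ?y2 np \<otimes>\<^bsub>P\<^esub> P.win ?\<sigma> ?y1 np \<otimes>\<^bsub>P\<^esub> ?\<sigma>"
        using tw cw.slabs_commute[OF w1 w2] by simp
      show "P.conj_by (inv\<^bsub>P\<^esub> ?\<tau>') ?\<sigma> =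
          P.win ?\<sigma> ?y2 nm \<otimes>\<^bsub>P\<^esub> P.conj_by (?\<sigma> [^]\<^bsub>P\<^esub> m) (P.win ?\<sigma> ?y1 nm) \<otimes>\<^bsub>P\<^esub> ?\<sigma>"
        using cw.\<sigma>_dn' cw.slabs_commute[OF sh1[OF w1] w2] by simp
      show "P.win ?\<sigma> ?y1 np \<otimes>\<^bsub>P\<^esub> z = z \<otimes>\<^bsub>P\<^esub> P.win ?\<sigma> ?y1 np" if "z \<in> ?M2" for z
        by (rule cw.slabs_commute[OF w1 that])
      show "P.conj_by (?\<sigma> [^]\<^bsub>P\<^esub> m) (P.win ?\<sigma> ?y1 nm) \<otimes>\<^bsub>P\<^esub> z =
          z \<otimes>\<^bsub>P\<^esub> P.conj_by (?\<sigma> [^]\<^bsub>P\<^esub> m) (P.win ?\<sigma> ?y1 nm)" if "z \<in> ?M2" for z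
        by (rule cw.slabs_commute[OF sh1[OF w1] that])
    qed (use p e3 e4 tw w1c in simp_all)
    have RP: "none_exp q = 0 \<and> none_exp (?mv q) = 0 \<and> eval_word P (gen2 ?\<sigma> ?y1) (?mv q) = \<one>\<^bsub>P\<^esub>"
      "none_exp q = 0 \<and> none_exp (?mv q) = 0 \<and> eval_word P (gen2 ?\<sigma> ?y2) (?mv q) = \<one>\<^bsub>P\<^esub>" if "q \<in> R" for q
      using R[OF that] tw that by auto
    have Nt: "G.conj_by t n \<in> N" if "n \<in> N" for n using that t by (rule N_conj)
    obtain \<theta>1 where \<theta>1: "\<And>n. n \<in> N \<Longrightarrow> \<theta>1 n \<in> ?M1"
      "\<And>n n'. n \<in> N \<Longrightarrow> n' \<in> N \<Longrightarrow> \<theta>1 (n \<otimes>\<^bsub>G\<^esub> n') = \<theta>1 n \<otimes>\<^bsub>P\<^esub> \<theta>1 n'"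
      "\<And>j. j \<in> ?J \<Longrightarrow> \<theta>1 (x j) = p (Fst j)"
      "\<And>n k. n \<in> N \<Longrightarrow> \<theta>1 (G.conj_by (s [^]\<^bsub>G\<^esub> (k::int)) n) = P.conj_by (?\<sigma> [^]\<^bsub>P\<^esub> k) (\<theta>1 n)"
      "\<And>n. n \<in> N \<Longrightarrow> \<theta>1 (G.conj_by t n) = P.conj_by ?\<tau> (\<theta>1 n)" "\<theta>1 (G.win s x np) = P.win ?\<sigma> ?y1 np"
      by (rule s1.window_hom[OF pres subset_refl RP(1) N_def Nt np(1)]; (assumption | rule that))
    obtain \<theta>2 where \<theta>2: "\<And>n. n \<in> N \<Longrightarrow> \<theta>2 n \<in> ?M2"
      "\<And>n n'. n \<in> N \<Longrightarrow> n' \<in> N \<Longrightarrow> \<theta>2 (n \<otimes>\<^bsub>G\<^esub> n') = \<theta>2 n \<otimes>\<^bsub>P\<^esub> \<theta>2 n'"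
      "\<And>j. j \<in> ?J \<Longrightarrow> \<theta>2 (x j) = p (Snd j)"
      "\<And>n k. n \<in> N \<Longrightarrow> \<theta>2 (G.conj_by (s [^]\<^bsub>G\<^esub> (k::int)) n) = P.conj_by (?\<sigma> [^]\<^bsub>P\<^esub> k) (\<theta>2 n)"
      "\<And>n. n \<in> N \<Longrightarrow> \<theta>2 (G.conj_by t n) = P.conj_by ?\<tau>' (\<theta>2 n)" "\<theta>2 (G.win s x np) = P.win ?\<sigma> ?y2 np"
      by (rule s2.window_hom[OF pres subset_refl RP(2) N_def Nt np(1)]; (assumption | rule that))
    have \<theta>c: "\<theta>1 n \<in> carrier P" "\<theta>2 n \<in> carrier P" if "n \<in> N" for n
      using \<theta>1(1)[OF that] \<theta>2(1)[OF that] s1.M_closed s2.M_closed by auto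
    have Nm: "n \<otimes>\<^bsub>G\<^esub> n' \<in> N" if "n \<in> N" "n' \<in> N" for n n' using that by (simp add: N_eq \<chi>m am)
    have xN: "x j \<in> N" for j using x \<chi> a by (simp add: N_eq)
    have oneN: "\<one>\<^bsub>G\<^esub> \<in> N" using G.add_hom_one[OF \<chi>(1)] G.add_hom_one[OF a(1)] by (simp add: N_eq)
    have \<theta>one: "\<theta>1 \<one>\<^bsub>G\<^esub> = \<one>\<^bsub>P\<^esub>" "\<theta>2 \<one>\<^bsub>G\<^esub> = \<one>\<^bsub>P\<^esub>"
      using \<theta>1(2)[OF oneN oneN] \<theta>2(2)[OF oneN oneN] \<theta>c[OF oneN] by simp_all
    have \<theta>comm: "\<theta>1 n \<otimes>\<^bsub>P\<^esub> \<theta>2 n' = \<theta>2 n' \<otimes>\<^bsub>P\<^esub> \<theta>1 n" if "n \<in> N" "n' \<in> N" for n n'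
      by (rule cw.slabs_commute[OF \<theta>1(1)[OF that(1)] \<theta>2(1)[OF that(2)]])
    have \<theta>s: "\<theta>1 (G.conj_by s n) = P.conj_by ?\<sigma> (\<theta>1 n)" "\<theta>2 (G.conj_by s n) = P.conj_by ?\<sigma> (\<theta>2 n)"
      if "n \<in> N" for n
      using \<theta>1(4)[OF that, of 1] \<theta>2(4)[OF that, of 1] s p by simp_all
    \<comment> \<open>\<open>\<theta>2\<close> matches conjugation by \<open>t\<close> with that by
      \<open>?\<tau>'\<close>. Multiplying by the \<open>m\<close>-th powers of \<open>s\<close> and
      \<open>?\<sigma>\<close> matches \<open>?t2\<close> with \<open>?\<tau>\<close>.\<close>
    have \<theta>2t: "\<theta>2 (G.conj_by ?t2 n) = P.conj_by ?\<tau> (\<theta>2 n)" if n: "n \<in> N" for n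
    proof -
      have "G.conj_by ?t2 n = G.conj_by t (G.conj_by (s [^]\<^bsub>G\<^esub> m) n)"
        using t s Nc[OF n] by (simp add: G.conj_by_conj_by)
      moreover have "G.conj_by (s [^]\<^bsub>G\<^esub> m) n \<in> N" using n s by (intro N_conj) auto
      ultimately have "\<theta>2 (G.conj_by ?t2 n) = P.conj_by ?\<tau>' (P.conj_by (?\<sigma> [^]\<^bsub>P\<^esub> m) (\<theta>2 n))"
        using \<theta>2(5) \<theta>2(4)[OF n] by simp
      also have "\<dots> = P.conj_by (?\<tau>' \<otimes>\<^bsub>P\<^esub> ?\<sigma> [^]\<^bsub>P\<^esub> m) (\<theta>2 n)"
        using p \<theta>c(2)[OF n] \<tau>' by (intro P.conj_by_conj_by) auto
      also have "?\<tau>' \<otimes>\<^bsub>P\<^esub> ?\<sigma> [^]\<^bsub>P\<^esub> m = ?\<tau>"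
        using p by (simp add: P.m_assoc P.int_pow_mult[symmetric])
      finally show ?thesis .
    qed
    have \<kappa>1: "\<kappa> 1 = G.win s x np" using s t by (simp add: \<kappa>_def np G.int_pow_neg)
    have \<kappa>Suc: "\<kappa> (i + 1) = \<kappa> 1 \<otimes>\<^bsub>G\<^esub> G.conj_by s (\<kappa> i)" for i
    proof -
      have "s [^]\<^bsub>G\<^esub> (i + 1) = s \<otimes>\<^bsub>G\<^esub> s [^]\<^bsub>G\<^esub> i" using G.int_pow_mult[of s 1 i] s by (simp add: add.commute)
      moreover have "s [^]\<^bsub>G\<^esub> (- (i + 1)) = s [^]\<^bsub>G\<^esub> (- i) \<otimes>\<^bsub>G\<^esub> inv\<^bsub>G\<^esub> s"
        using G.int_pow_mult[of s "- i" "- 1"] s by (simp add: G.int_pow_neg)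
      ultimately have "\<kappa> (i + 1) = G.conj_by t s \<otimes>\<^bsub>G\<^esub> (G.conj_by t (s [^]\<^bsub>G\<^esub> i) \<otimes>\<^bsub>G\<^esub> s [^]\<^bsub>G\<^esub> (- i)) \<otimes>\<^bsub>G\<^esub> inv\<^bsub>G\<^esub> s"
        using s t by (simp add: \<kappa>_def G.conj_by_mult G.m_assoc)
      also have "G.conj_by t (s [^]\<^bsub>G\<^esub> i) \<otimes>\<^bsub>G\<^esub> s [^]\<^bsub>G\<^esub> (- i) = \<kappa> i" by (simp only: \<kappa>_def)
      also have "G.conj_by t s \<otimes>\<^bsub>G\<^esub> \<kappa> i \<otimes>\<^bsub>G\<^esub> inv\<^bsub>G\<^esub> s = (G.conj_by t s \<otimes>\<^bsub>G\<^esub> inv\<^bsub>G\<^esub> s) \<otimes>\<^bsub>G\<^esub> (s \<otimes>\<^bsub>G\<^esub> \<kappa> i \<otimes>\<^bsub>G\<^esub> inv\<^bsub>G\<^esub> s)"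
        using s t Nc[OF \<kappa>N[of i]] by (simp add: G.m_assoc) (simp add: G.m_assoc[symmetric])
      also have "\<dots> = \<kappa> 1 \<otimes>\<^bsub>G\<^esub> G.conj_by s (\<kappa> i)"
        using s by (simp add: \<kappa>1 np G.conj_by_def[of s])
      finally show ?thesis .
    qed
    \<comment> \<open>The expected conjugate of the \<open>i\<close>-th power of
      \<open>?\<sigma>\<close> by \<open>?\<tau>\<close>. It satisfies the recursion of the powers
      of \<open>P.conj_by ?\<tau> ?\<sigma>\<close>, and \<open>int_pow_unique\<close> identifies
      the two.\<close>
    define \<Phi> where "\<Phi> i = \<theta>1 (\<kappa> i) \<otimes>\<^bsub>P\<^esub> \<theta>2 (\<kappa> i) \<otimes>\<^bsub>P\<^esub> ?\<sigma> [^]\<^bsub>P\<^esub> i" for i :: int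
    have \<Phi>c: "\<Phi> i \<in> carrier P" for i using \<theta>c[OF \<kappa>N] p by (simp add: \<Phi>_def)
    have \<Phi>0: "\<Phi> 0 = \<one>\<^bsub>P\<^esub>" using t by (simp add: \<Phi>_def \<kappa>_def \<theta>one)
    have \<tau>\<sigma>: "P.conj_by ?\<tau> ?\<sigma> = \<theta>1 (\<kappa> 1) \<otimes>\<^bsub>P\<^esub> \<theta>2 (\<kappa> 1) \<otimes>\<^bsub>P\<^esub> ?\<sigma>"
      using tw by (simp add: \<kappa>1 \<theta>1(6) \<theta>2(6))
    have \<Phi>Suc: "\<Phi> (i + 1) = P.conj_by ?\<tau> ?\<sigma> \<otimes>\<^bsub>P\<^esub> \<Phi> i" for i
    proof -
      let ?a1 = "\<theta>1 (\<kappa> 1)" and ?a2 = "\<theta>2 (\<kappa> 1)" and ?b1 = "P.conj_by ?\<sigma> (\<theta>1 (\<kappa> i))" and ?b2 = "P.conj_by ?\<sigma> (\<theta>2 (\<kappa> i))"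
      have sN: "G.conj_by s (\<kappa> i) \<in> N" using \<kappa>N s by (intro N_conj)
      have b: "?b1 = \<theta>1 (G.conj_by s (\<kappa> i))" "?b2 = \<theta>2 (G.conj_by s (\<kappa> i))" using \<theta>s[OF \<kappa>N] by auto
      have c: "?a1 \<in> carrier P" "?a2 \<in> carrier P" "?b1 \<in> carrier P" "?b2 \<in> carrier P"
        "\<theta>1 (\<kappa> i) \<in> carrier P" "\<theta>2 (\<kappa> i) \<in> carrier P" using \<theta>c \<kappa>N p by auto
      have "\<Phi> (i + 1) = (?a1 \<otimes>\<^bsub>P\<^esub> ?b1) \<otimes>\<^bsub>P\<^esub> (?a2 \<otimes>\<^bsub>P\<^esub> ?b2) \<otimes>\<^bsub>P\<^esub> (?\<sigma> \<otimes>\<^bsub>P\<^esub> ?\<sigma> [^]\<^bsub>P\<^esub> i)"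
        using \<kappa>N sN p P.int_pow_mult[of ?\<sigma> 1 i] unfolding \<Phi>_def \<kappa>Suc
        by (simp add: \<theta>1(2) \<theta>2(2) \<theta>s add.commute)
      also have "\<dots> = ?a1 \<otimes>\<^bsub>P\<^esub> (?b1 \<otimes>\<^bsub>P\<^esub> ?a2) \<otimes>\<^bsub>P\<^esub> ?b2 \<otimes>\<^bsub>P\<^esub> (?\<sigma> \<otimes>\<^bsub>P\<^esub> ?\<sigma> [^]\<^bsub>P\<^esub> i)"
        using c p by (simp add: P.m_assoc)
      also have "?b1 \<otimes>\<^bsub>P\<^esub> ?a2 = ?a2 \<otimes>\<^bsub>P\<^esub> ?b1" unfolding b by (rule \<theta>comm[OF sN \<kappa>N])
      also have "?a1 \<otimes>\<^bsub>P\<^esub> (?a2 \<otimes>\<^bsub>P\<^esub> ?b1) \<otimes>\<^bsub>P\<^esub> ?b2 \<otimes>\<^bsub>P\<^esub> (?\<sigma> \<otimes>\<^bsub>P\<^esub> ?\<sigma> [^]\<^bsub>P\<^esub> i) = P.conj_by ?\<tau> ?\<sigma> \<otimes>\<^bsub>P\<^esub> \<Phi> i"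
        unfolding \<tau>\<sigma> \<Phi>_def P.conj_by_def[of ?\<sigma>] using c p
        by (simp add: P.m_assoc) (simp add: P.m_assoc[symmetric])
      finally show ?thesis .
    qed
    have \<tau>\<sigma>pow: "P.conj_by ?\<tau> (?\<sigma> [^]\<^bsub>P\<^esub> i) = \<theta>1 (\<kappa> i) \<otimes>\<^bsub>P\<^esub> \<theta>2 (\<kappa> i) \<otimes>\<^bsub>P\<^esub> ?\<sigma> [^]\<^bsub>P\<^esub> i" for i :: int
    proof -
      interpret ch: group_hom P P "P.conj_by ?\<tau>" using p by (intro P.conj_by_hom)
      have "\<Phi> i = (P.conj_by ?\<tau> ?\<sigma>) [^]\<^bsub>P\<^esub> i"
        using p \<Phi>c \<Phi>0 \<Phi>Suc by (intro P.int_pow_unique) auto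
      also have "\<dots> = P.conj_by ?\<tau> (?\<sigma> [^]\<^bsub>P\<^esub> i)" using ch.hom_int_pow[of ?\<sigma> i] p by simp
      finally show ?thesis by (simp add: \<Phi>_def)
    qed
    \<comment> \<open>The map dictated by the normal form: both exponents are read off from the
      first coordinate, and the remaining parts in \<open>N\<close> are mapped by
      \<open>\<theta>1\<close> and \<open>\<theta>2\<close>.\<close>
    define \<theta> where "\<theta> = (\<lambda>(g1, g2). let j = \<chi> g1; i = a g1 in
      \<theta>1 (g1 \<otimes>\<^bsub>G\<^esub> t [^]\<^bsub>G\<^esub> (- j) \<otimes>\<^bsub>G\<^esub> s [^]\<^bsub>G\<^esub> (- i)) \<otimes>\<^bsub>P\<^esub> \<theta>2 (g2 \<otimes>\<^bsub>G\<^esub> ?t2 [^]\<^bsub>G\<^esub> (- j) \<otimes>\<^bsub>G\<^esub> s [^]\<^bsub>G\<^esub> (- i))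
        \<otimes>\<^bsub>P\<^esub> ?\<sigma> [^]\<^bsub>P\<^esub> i \<otimes>\<^bsub>P\<^esub> ?\<tau> [^]\<^bsub>P\<^esub> j)"
    let ?nf = "\<lambda>n1 n2 (i::int) (j::int). (n1 \<otimes>\<^bsub>G\<^esub> s [^]\<^bsub>G\<^esub> i \<otimes>\<^bsub>G\<^esub> t [^]\<^bsub>G\<^esub> j, n2 \<otimes>\<^bsub>G\<^esub> s [^]\<^bsub>G\<^esub> i \<otimes>\<^bsub>G\<^esub> ?t2 [^]\<^bsub>G\<^esub> j)"
    have \<theta>_nf: "\<theta> (?nf n1 n2 i j) = \<theta>1 n1 \<otimes>\<^bsub>P\<^esub> \<theta>2 n2 \<otimes>\<^bsub>P\<^esub> ?\<sigma> [^]\<^bsub>P\<^esub> i \<otimes>\<^bsub>P\<^esub> ?\<tau> [^]\<^bsub>P\<^esub> j"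
      if n: "n1 \<in> N" "n2 \<in> N" for n1 n2 i j
    proof -
      have "n \<otimes>\<^bsub>G\<^esub> s [^]\<^bsub>G\<^esub> i \<otimes>\<^bsub>G\<^esub> c [^]\<^bsub>G\<^esub> j \<otimes>\<^bsub>G\<^esub> c [^]\<^bsub>G\<^esub> (- j) \<otimes>\<^bsub>G\<^esub> s [^]\<^bsub>G\<^esub> (- i) = n"
        if "n \<in> carrier G" "c \<in> carrier G" for n c
        using that s by (simp add: G.m_assoc G.int_pow_neg)
      then show ?thesis using n Nc t t2 by (simp add: \<theta>_def nf1)
    qed
    \<comment> \<open>For \<open>Tau\<close>, moving past the power of \<open>s\<close> produces
      \<open>\<kappa> i\<close> in both coordinates, and by \<open>\<tau>\<sigma>pow\<close> the
      element \<open>?\<tau>\<close> does the same to the power of \<open>?\<sigma>\<close> in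
      \<open>P\<close>; commutation of the families then sorts the factors.\<close>
    have equi: "\<theta> (h z \<otimes>\<^bsub>?HG\<^esub> k) = p z \<otimes>\<^bsub>P\<^esub> \<theta> k" if z: "z \<in> ?C" and k: "k \<in> ?H" for z k
    proof -
      obtain n1 n2 and i j :: int where n: "n1 \<in> N" "n2 \<in> N" and k: "k = ?nf n1 n2 i j"
        using nf_obtain[OF k] by blast
      note nc = Nc[OF n(1)] Nc[OF n(2)]
      note tc = \<theta>c(1)[OF n(1)] \<theta>c(2)[OF n(2)]
      consider "z = Tau" | "z = Sig" | j' where "z = Fst j'" "j' \<in> ?J" | j' where "z = Snd j'" "j' \<in> ?J"
        using z by auto
      then show ?thesis
      proof cases
        case 1
        have key: "c \<otimes>\<^bsub>G\<^esub> (n \<otimes>\<^bsub>G\<^esub> s [^]\<^bsub>G\<^esub> i \<otimes>\<^bsub>G\<^esub> c [^]\<^bsub>G\<^esub> j) = G.conj_by c n \<otimes>\<^bsub>G\<^esub> \<kappa> i \<otimes>\<^bsub>G\<^esub> s [^]\<^bsub>G\<^esub> i \<otimes>\<^bsub>G\<^esub> c [^]\<^bsub>G\<^esub> (1 + j)"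
          if "n \<in> carrier G" "c \<in> carrier G" "G.conj_by c (s [^]\<^bsub>G\<^esub> i) = G.conj_by t (s [^]\<^bsub>G\<^esub> i)" for n c
        proof -
          have "G.conj_by c n \<otimes>\<^bsub>G\<^esub> \<kappa> i \<otimes>\<^bsub>G\<^esub> s [^]\<^bsub>G\<^esub> i = G.conj_by c n \<otimes>\<^bsub>G\<^esub> G.conj_by c (s [^]\<^bsub>G\<^esub> i)"
            using that s t by (simp add: \<kappa>_def G.m_assoc G.int_pow_neg)
          also have "\<dots> = G.conj_by c (n \<otimes>\<^bsub>G\<^esub> s [^]\<^bsub>G\<^esub> i)" using that s by (simp add: G.conj_by_mult)
          finally show ?thesis using that s by (simp add: G.conj_by_def G.int_pow_mult G.m_assoc)
             (simp add: G.m_assoc[symmetric])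
        qed
        have smk: "G.conj_by (s [^]\<^bsub>G\<^esub> m) (s [^]\<^bsub>G\<^esub> i) = s [^]\<^bsub>G\<^esub> i"
          using s by (intro G.conj_by_commute) (simp_all add: G.int_pow_mult[symmetric] add.commute)
        have "G.conj_by ?t2 (s [^]\<^bsub>G\<^esub> i) = G.conj_by t (s [^]\<^bsub>G\<^esub> i)"
          using s t smk by (simp add: G.conj_by_conj_by[symmetric])
        then have "h z \<otimes>\<^bsub>?HG\<^esub> k = ?nf (G.conj_by t n1 \<otimes>\<^bsub>G\<^esub> \<kappa> i) (G.conj_by ?t2 n2 \<otimes>\<^bsub>G\<^esub> \<kappa> i) i (1 + j)"
          using key[of n1 t] key[of n2 ?t2] nc t t2 1 k by (simp add: h_def)
        moreover have N12: "G.conj_by t n1 \<in> N" "G.conj_by ?t2 n2 \<in> N" using n t t2 N_conj by auto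
        ultimately have "\<theta> (h z \<otimes>\<^bsub>?HG\<^esub> k) = \<theta>1 (G.conj_by t n1 \<otimes>\<^bsub>G\<^esub> \<kappa> i) \<otimes>\<^bsub>P\<^esub> \<theta>2 (G.conj_by ?t2 n2 \<otimes>\<^bsub>G\<^esub> \<kappa> i)
            \<otimes>\<^bsub>P\<^esub> ?\<sigma> [^]\<^bsub>P\<^esub> i \<otimes>\<^bsub>P\<^esub> ?\<tau> [^]\<^bsub>P\<^esub> (1 + j)"
          using \<kappa>N Nm by (simp only: \<theta>_nf)
        also have "\<dots> = \<theta>1 (G.conj_by t n1) \<otimes>\<^bsub>P\<^esub> (\<theta>1 (\<kappa> i) \<otimes>\<^bsub>P\<^esub> \<theta>2 (G.conj_by ?t2 n2)) \<otimes>\<^bsub>P\<^esub> \<theta>2 (\<kappa> i)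
            \<otimes>\<^bsub>P\<^esub> ?\<sigma> [^]\<^bsub>P\<^esub> i \<otimes>\<^bsub>P\<^esub> ?\<tau> [^]\<^bsub>P\<^esub> (1 + j)"
          using \<theta>c[OF N12(1)] \<theta>c[OF N12(2)] \<theta>c[OF \<kappa>N] p
          by (simp add: \<theta>1(2)[OF N12(1) \<kappa>N] \<theta>2(2)[OF N12(2) \<kappa>N] P.m_assoc)
        also have "\<theta>1 (\<kappa> i) \<otimes>\<^bsub>P\<^esub> \<theta>2 (G.conj_by ?t2 n2) = \<theta>2 (G.conj_by ?t2 n2) \<otimes>\<^bsub>P\<^esub> \<theta>1 (\<kappa> i)"
          by (rule \<theta>comm[OF \<kappa>N N12(2)])
        also have "\<theta>1 (G.conj_by t n1) = P.conj_by ?\<tau> (\<theta>1 n1)" by (rule \<theta>1(5)[OF n(1)])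
        also have "\<theta>2 (G.conj_by ?t2 n2) = P.conj_by ?\<tau> (\<theta>2 n2)" by (rule \<theta>2t[OF n(2)])
        also have "P.conj_by ?\<tau> (\<theta>1 n1) \<otimes>\<^bsub>P\<^esub> (P.conj_by ?\<tau> (\<theta>2 n2) \<otimes>\<^bsub>P\<^esub> \<theta>1 (\<kappa> i)) \<otimes>\<^bsub>P\<^esub> \<theta>2 (\<kappa> i)
            \<otimes>\<^bsub>P\<^esub> ?\<sigma> [^]\<^bsub>P\<^esub> i \<otimes>\<^bsub>P\<^esub> ?\<tau> [^]\<^bsub>P\<^esub> (1 + j) =
            P.conj_by ?\<tau> (\<theta>1 n1) \<otimes>\<^bsub>P\<^esub> P.conj_by ?\<tau> (\<theta>2 n2) \<otimes>\<^bsub>P\<^esub> P.conj_by ?\<tau> (?\<sigma> [^]\<^bsub>P\<^esub> i) \<otimes>\<^bsub>P\<^esub> ?\<tau> [^]\<^bsub>P\<^esub> (1 + j)"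
          using tc \<theta>c[OF \<kappa>N] p by (simp add: \<tau>\<sigma>pow P.m_assoc)
        also have "\<dots> = P.conj_by ?\<tau> (\<theta>1 n1 \<otimes>\<^bsub>P\<^esub> \<theta>2 n2 \<otimes>\<^bsub>P\<^esub> ?\<sigma> [^]\<^bsub>P\<^esub> i) \<otimes>\<^bsub>P\<^esub> (?\<tau> \<otimes>\<^bsub>P\<^esub> ?\<tau> [^]\<^bsub>P\<^esub> j)"
          using tc p by (simp add: P.conj_by_mult P.int_pow_mult)
        also have "\<dots> = ?\<tau> \<otimes>\<^bsub>P\<^esub> (\<theta>1 n1 \<otimes>\<^bsub>P\<^esub> \<theta>2 n2 \<otimes>\<^bsub>P\<^esub> ?\<sigma> [^]\<^bsub>P\<^esub> i \<otimes>\<^bsub>P\<^esub> ?\<tau> [^]\<^bsub>P\<^esub> j)"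
          using tc p by (simp add: P.conj_by_def P.m_assoc) (simp add: P.m_assoc[symmetric])
        finally show ?thesis using 1 n by (simp add: \<theta>_nf k)
      next
        case 2
        have key: "s \<otimes>\<^bsub>G\<^esub> (n \<otimes>\<^bsub>G\<^esub> s [^]\<^bsub>G\<^esub> i \<otimes>\<^bsub>G\<^esub> c) = G.conj_by s n \<otimes>\<^bsub>G\<^esub> s [^]\<^bsub>G\<^esub> (1 + i) \<otimes>\<^bsub>G\<^esub> c"
          if "n \<in> carrier G" "c \<in> carrier G" for n c
          using that s by (simp add: G.conj_by_def G.int_pow_mult G.m_assoc) (simp add: G.m_assoc[symmetric])
        have "h z \<otimes>\<^bsub>?HG\<^esub> k = ?nf (G.conj_by s n1) (G.conj_by s n2) (1 + i) j"
          using key nc t t2 2 k by (simp add: h_def)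
        moreover have "G.conj_by s n1 \<in> N" "G.conj_by s n2 \<in> N" using n s N_conj by auto
        ultimately have "\<theta> (h z \<otimes>\<^bsub>?HG\<^esub> k) = P.conj_by ?\<sigma> (\<theta>1 n1) \<otimes>\<^bsub>P\<^esub> P.conj_by ?\<sigma> (\<theta>2 n2)
            \<otimes>\<^bsub>P\<^esub> ?\<sigma> [^]\<^bsub>P\<^esub> (1 + i) \<otimes>\<^bsub>P\<^esub> ?\<tau> [^]\<^bsub>P\<^esub> j"
          by (simp only: \<theta>_nf \<theta>s[OF n(1)] \<theta>s[OF n(2)])
        also have "\<dots> = ?\<sigma> \<otimes>\<^bsub>P\<^esub> (\<theta>1 n1 \<otimes>\<^bsub>P\<^esub> \<theta>2 n2 \<otimes>\<^bsub>P\<^esub> ?\<sigma> [^]\<^bsub>P\<^esub> i \<otimes>\<^bsub>P\<^esub> ?\<tau> [^]\<^bsub>P\<^esub> j)"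
          using tc p by (simp add: P.conj_by_mult[symmetric] P.int_pow_mult P.conj_by_def P.m_assoc)
            (simp add: P.m_assoc[symmetric])
        finally show ?thesis using 2 n by (simp add: \<theta>_nf k)
      next
        case 3
        have "h z \<otimes>\<^bsub>?HG\<^esub> k = ?nf (x j' \<otimes>\<^bsub>G\<^esub> n1) n2 i j"
          using nc t t2 s x 3 k by (simp add: h_def G.m_assoc)
        then have "\<theta> (h z \<otimes>\<^bsub>?HG\<^esub> k) = p z \<otimes>\<^bsub>P\<^esub> \<theta>1 n1 \<otimes>\<^bsub>P\<^esub> \<theta>2 n2 \<otimes>\<^bsub>P\<^esub> ?\<sigma> [^]\<^bsub>P\<^esub> i \<otimes>\<^bsub>P\<^esub> ?\<tau> [^]\<^bsub>P\<^esub> j"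
          using 3 n Nm[OF xN n(1)] by (simp only: \<theta>_nf \<theta>1(2)[OF xN n(1)] \<theta>1(3))
        then show ?thesis using tc p n by (simp add: \<theta>_nf k P.m_assoc)
      next
        case 4
        have "h z \<otimes>\<^bsub>?HG\<^esub> k = ?nf n1 (x j' \<otimes>\<^bsub>G\<^esub> n2) i j"
          using nc t t2 s x 4 k by (simp add: h_def G.m_assoc)
        then have "\<theta> (h z \<otimes>\<^bsub>?HG\<^esub> k) = \<theta>1 n1 \<otimes>\<^bsub>P\<^esub> \<theta>2 (x j' \<otimes>\<^bsub>G\<^esub> n2) \<otimes>\<^bsub>P\<^esub> ?\<sigma> [^]\<^bsub>P\<^esub> i \<otimes>\<^bsub>P\<^esub> ?\<tau> [^]\<^bsub>P\<^esub> j"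
          using n Nm[OF xN n(2)] by (simp only: \<theta>_nf)
        also have "\<theta>1 n1 \<otimes>\<^bsub>P\<^esub> \<theta>2 (x j' \<otimes>\<^bsub>G\<^esub> n2) = \<theta>2 (x j') \<otimes>\<^bsub>P\<^esub> \<theta>1 n1 \<otimes>\<^bsub>P\<^esub> \<theta>2 n2"
          using \<theta>c[OF xN] tc \<theta>comm[OF n(1) xN] by (simp add: \<theta>2(2)[OF xN n(2)] P.m_assoc[symmetric])
        also have "\<theta>2 (x j') = p z" using 4 \<theta>2(3) by simp
        finally show ?thesis using tc p n by (simp add: \<theta>_nf k P.m_assoc)
      qed
    qed
    have "?nf \<one>\<^bsub>G\<^esub> \<one>\<^bsub>G\<^esub> 0 0 = \<one>\<^bsub>?HG\<^esub>" by simp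
    then have "\<theta> \<one>\<^bsub>?HG\<^esub> = \<one>\<^bsub>P\<^esub>" using \<theta>_nf[OF oneN oneN, of 0 0] by (simp add: \<theta>one)
    moreover have "\<theta> k \<in> carrier P" if "k \<in> ?H" for k
    proof -
      obtain n1 n2 and i j :: int where n: "n1 \<in> N" "n2 \<in> N" and k: "k = ?nf n1 n2 i j"
        using nf_obtain[OF \<open>k \<in> ?H\<close>] by blast
      show ?thesis unfolding k \<theta>_nf[OF n] using \<theta>c(1)[OF n(1)] \<theta>c(2)[OF n(2)] p by simp
    qed
    moreover have "carrier ?HG = ?H" by simp
    ultimately show "\<exists>\<theta>. \<theta> \<one>\<^bsub>?HG\<^esub> = \<one>\<^bsub>P\<^esub> \<and>
        (\<forall>z\<in>?C. \<forall>k\<in>carrier ?HG. \<theta> (h z \<otimes>\<^bsub>?HG\<^esub> k) = p z \<otimes>\<^bsub>P\<^esub> \<theta> k) \<and> (\<forall>k\<in>carrier ?HG. \<theta> k \<in> carrier P)"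
      using equi by (intro exI[of _ \<theta>]) (simp only: simp_thms, blast)
  qed (rule hc | simp)+
  then show ?thesis
    using presents_imp_finitely_presented by blast
qed

section \<open>Splittings yield finitely presented fibre products\<close>

lemma (in comm_group) finite_generate_torsion:
  assumes "finite S" "S \<subseteq> carrier G" "\<And>s. s \<in> S \<Longrightarrow> \<exists>n::nat. n > 0 \<and> s [^] n = \<one>"
  shows "finite (generate G S)"
  using assms
proof (induction S)
  case empty
  then show ?case by (simp add: generate_empty)
next
  case (insert s S)
  have s: "s \<in> carrier G" and S: "S \<subseteq> carrier G" using insert by auto
  obtain n :: nat where n: "n > 0" "s [^] n = \<one>" using insert.prems(2)[of s] by auto
  have "generate G {s} \<subseteq> (\<lambda>i::int. s [^] i) ` {0..<int n}"
  proof
    fix y assume "y \<in> generate G {s}"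
    then obtain k :: int where y: "y = s [^] k" using generate_pow[OF s] by auto
    have "s [^] (int n * (k div int n)) = \<one>"
      using s n by (simp add: int_pow_pow[symmetric] int_pow_int)
    then have "s [^] k = s [^] (k mod int n)"
      using s int_pow_mult[of s "int n * (k div int n)" "k mod int n"] by simp
    then show "y \<in> (\<lambda>i::int. s [^] i) ` {0..<int n}" using y n by auto
  qed
  then have fin: "finite (generate G {s})" by (rule finite_subset) simp
  have sub: "subgroup (generate G {s}) G" "subgroup (generate G S) G"
    using s S by (auto intro!: generate_is_subgroup)
  have "generate G (insert s S) \<subseteq> generate G {s} <#> generate G S"
  proof (rule generate_subgroup_incl[OF _ mult_subgroups[OF sub]])
    have "s \<otimes> \<one> \<in> generate G {s} <#> generate G S" unfolding set_mult_def
      using generate.incl[of s "{s}" G] generate.one[of G S] by blast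
    moreover have "y \<in> generate G {s} <#> generate G S" if y: "y \<in> S" for y
    proof -
      have "\<one> \<otimes> y \<in> generate G {s} <#> generate G S" unfolding set_mult_def
        using generate.incl[OF y] generate.one[of G "{s}"] by blast
      then show ?thesis using y S by auto
    qed
    ultimately show "insert s S \<subseteq> generate G {s} <#> generate G S" using s by auto
  qed
  moreover have "finite (generate G {s} <#> generate G S)"
    using fin insert.IH[OF S] insert.prems(2) by (simp add: set_mult_def)
  ultimately show ?case by (rule finite_subset)
qed

text \<open>\<open>\<chi> y\<close> is the exponent \<open>k\<close> for which \<open>y t^-k\<close>
  lies in \<open>K\<close>. It is unique because \<open>t\<close> has infinite order and its powers
  meet \<open>K\<close> trivially.\<close>

lemma (in group) semidirect_int_character:
  assumes t: "t \<in> carrier G" "infinite (generate G {t})" and sd: "internal_semidirect G (generate G {t}) K"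
  shows "\<exists>\<chi> :: 'a \<Rightarrow> int. add_hom G \<chi> \<and> \<chi> t = 1 \<and> K = {y \<in> carrier G. \<chi> y = 0}"
proof -
  have K: "K \<lhd> G" "generate G {t} \<inter> K = {\<one>}" "generate G {t} <#> K = carrier G"
    using sd by (auto simp: internal_semidirect_def)
  interpret K: normal K G by (rule K(1))
  have gen: "generate G {t} = {t [^] (k::int) | k. k \<in> UNIV}" using generate_pow t by simp
  have pow: "k = 0" if "t [^] k \<in> K" for k :: int
  proof -
    have "t [^] k \<in> generate G {t}" by (auto simp: gen)
    then have "t [^] k = \<one>" using that K(2) by blast
    then have "int (ord t) dvd k" using int_pow_eq_id[OF t(1)] by simp
    moreover have "ord t = 0" using generate_pow_card[OF t(1)] t(2) by simp
    ultimately show ?thesis by simp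
  qed
  define \<chi> where "\<chi> y = (THE k::int. y \<otimes> t [^] (- k) \<in> K)" for y
  have uniq: "k = l" if "y \<in> carrier G" "y \<otimes> t [^] (- k) \<in> K" "y \<otimes> t [^] (- l) \<in> K" for y and k l :: int
  proof -
    have "inv (y \<otimes> t [^] (- k)) \<otimes> (y \<otimes> t [^] (- l)) \<in> K" using that by simp
    also have "inv (y \<otimes> t [^] (- k)) \<otimes> (y \<otimes> t [^] (- l)) = t [^] k \<otimes> t [^] (- l)"
      using that t by (simp add: inv_mult_group int_pow_neg m_assoc) (simp add: m_assoc[symmetric])
    finally have "t [^] (k - l) \<in> K" using t by (simp add: int_pow_diff int_pow_neg)
    then show ?thesis using pow[of "k - l"] by simp
  qed
  have \<chi>_eq: "\<chi> y = k" if "y \<in> carrier G" "y \<otimes> t [^] (- k) \<in> K" for y k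
    unfolding \<chi>_def using that uniq by (intro the_equality) auto
  have \<chi>K: "y \<otimes> t [^] (- \<chi> y) \<in> K" if y: "y \<in> carrier G" for y
  proof -
    obtain k :: int and b where b: "b \<in> K" "y = t [^] k \<otimes> b"
      using y unfolding K(3)[symmetric] set_mult_def gen by auto
    have "t [^] k \<otimes> b \<otimes> inv (t [^] k) \<in> K" using t b by (intro K.inv_op_closed2) auto
    then have "y \<otimes> t [^] (- k) \<in> K" using b t by (simp add: int_pow_neg)
    then show ?thesis using \<chi>_eq[OF y] by simp
  qed
  have "add_hom G \<chi>"
    unfolding add_hom_def
  proof (intro ballI)
    fix x y assume xy: "x \<in> carrier G" "y \<in> carrier G"
    have "(x \<otimes> t [^] (- \<chi> x)) \<otimes> (t [^] \<chi> x \<otimes> (y \<otimes> t [^] (- \<chi> y)) \<otimes> inv (t [^] \<chi> x)) \<in> K"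
      using t by (intro K.m_closed[OF \<chi>K[OF xy(1)] K.inv_op_closed2[OF _ \<chi>K[OF xy(2)]]]) simp
    also have "(x \<otimes> t [^] (- \<chi> x)) \<otimes> (t [^] \<chi> x \<otimes> (y \<otimes> t [^] (- \<chi> y)) \<otimes> inv (t [^] \<chi> x)) =
        x \<otimes> y \<otimes> (t [^] (- \<chi> y) \<otimes> t [^] (- \<chi> x))"
      using xy t by (simp add: m_assoc int_pow_neg) (simp add: m_assoc[symmetric])
    also have "t [^] (- \<chi> y) \<otimes> t [^] (- \<chi> x) = t [^] (- (\<chi> x + \<chi> y))"
      using t int_pow_mult[of t "- \<chi> y" "- \<chi> x"] by (simp add: algebra_simps)
    finally show "\<chi> (x \<otimes> y) = \<chi> x + \<chi> y" using xy by (intro \<chi>_eq) auto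
  qed
  moreover have "\<chi> t = 1" using t by (intro \<chi>_eq) (simp_all add: int_pow_neg)
  moreover have "K = {y \<in> carrier G. \<chi> y = 0}"
  proof (intro subset_antisym subsetI)
    fix y assume y: "y \<in> K"
    then have "\<chi> y = 0" by (intro \<chi>_eq) auto
    then show "y \<in> {y \<in> carrier G. \<chi> y = 0}" using y by simp
  next
    fix y assume "y \<in> {y \<in> carrier G. \<chi> y = 0}"
    then show "y \<in> K" using \<chi>K[of y] by simp
  qed
  ultimately show ?thesis by blast
qed

section \<open>Complementary characters and shear automorphisms\<close>

context coabelian
begin

lemma coset_conj_by: "c \<in> carrier G \<Longrightarrow> y \<in> carrier G \<Longrightarrow> N #> conj_by c y = N #> y"
  using commutator_in[of c y] by (simp add: conj_by_def coset_eq_iff)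

text \<open>From each of two independent characters subtract the multiple of \<open>\<chi>\<close>
  that makes it vanish on \<open>t\<close>. Not both results are zero. A nonzero one is made
  primitive, and an element of value 1 is moved into the kernel of \<open>\<chi>\<close> by a power
  of \<open>t\<close>.\<close>

lemma complementary_int_character:
  assumes fg: "finite S" "S \<subseteq> carrier G" "generate G S = carrier G" and rk: "co_rank G N = 2"
    and \<chi>: "add_hom G (\<chi> :: 'a \<Rightarrow> int)" "\<And>n. n \<in> N \<Longrightarrow> \<chi> n = 0" and t: "t \<in> carrier G" "\<chi> t = 1"
  shows "\<exists>(a :: 'a \<Rightarrow> int) s. add_hom G a \<and> (\<forall>n\<in>N. a n = 0) \<and> a t = 0 \<and> s \<in> carrier G \<and> \<chi> s = 0 \<and> a s = 1"
proof -
  note \<chi>m = add_hom_mult[OF \<chi>(1)] and \<chi>p = add_hom_int_pow[OF \<chi>(1)]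
  obtain \<chi>1 \<chi>2 :: "'a \<Rightarrow> int" and x z where \<chi>12: "add_hom G \<chi>1" "add_hom G \<chi>2"
      "\<forall>n\<in>N. \<chi>1 n = 0 \<and> \<chi>2 n = 0"
    and x: "x \<in> carrier G" "\<chi>1 x \<noteq> 0" and z: "z \<in> carrier G" "\<chi>1 z = 0" "\<chi>2 z \<noteq> 0"
    using two_int_characters[OF fg rk] by blast
  then have \<chi>1: "add_hom G \<chi>1" "\<And>n. n \<in> N \<Longrightarrow> \<chi>1 n = 0"
    and \<chi>2: "add_hom G \<chi>2" "\<And>n. n \<in> N \<Longrightarrow> \<chi>2 n = 0" by auto
  have hom: "add_hom G (\<lambda>y. f y - f t * \<chi> y)" if "add_hom G f" for f :: "'a \<Rightarrow> int"
    unfolding add_hom_def by (intro ballI) (simp add: add_hom_mult[OF that] \<chi>m distrib_left)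
  have "(\<exists>y\<in>carrier G. \<chi>1 y - \<chi>1 t * \<chi> y \<noteq> 0) \<or> (\<exists>y\<in>carrier G. \<chi>2 y - \<chi>2 t * \<chi> y \<noteq> 0)"
  proof (rule ccontr)
    \<comment> \<open>Both characters would be multiples of \<open>\<chi>\<close>; the first then
      forces \<open>\<chi> z = 0\<close>, which contradicts the second.\<close>
    assume "\<not> ?thesis"
    then have "\<chi>1 x = \<chi>1 t * \<chi> x" "\<chi>1 z = \<chi>1 t * \<chi> z" "\<chi>2 z = \<chi>2 t * \<chi> z" using x z by auto
    then show False using x z by auto
  qed
  then obtain a0 :: "'a \<Rightarrow> int" and y where a0: "add_hom G a0" "\<And>n. n \<in> N \<Longrightarrow> a0 n = 0" "a0 t = 0"
    and y: "y \<in> carrier G" "a0 y \<noteq> 0"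
  proof (elim disjE bexE)
    fix y assume "y \<in> carrier G" "\<chi>1 y - \<chi>1 t * \<chi> y \<noteq> 0"
    then show ?thesis using that[OF hom[OF \<chi>1(1)]] \<chi>1 \<chi> t by simp
  next
    fix y assume "y \<in> carrier G" "\<chi>2 y - \<chi>2 t * \<chi> y \<noteq> 0"
    then show ?thesis using that[OF hom[OF \<chi>2(1)]] \<chi>2 \<chi> t by simp
  qed
  obtain n :: int and a :: "'a \<Rightarrow> int" and u where n: "n > 0" and a: "add_hom G a"
    and u: "u \<in> carrier G" "a u = 1" and na: "\<And>y. y \<in> carrier G \<Longrightarrow> a0 y = n * a y"
    using int_hom_primitive[OF a0(1) y] by metis
  have at: "a t = 0" using na[OF t(1)] a0 n by simp
  have "a k = 0" if "k \<in> N" for k using na[of k] a0(2)[OF that] n that by simp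
  moreover have "\<chi> (u \<otimes> t [^] (- \<chi> u)) = 0" "a (u \<otimes> t [^] (- \<chi> u)) = 1"
    using t u at by (simp_all add: \<chi>m \<chi>p add_hom_mult[OF a] add_hom_int_pow[OF a])
  moreover have "u \<otimes> t [^] (- \<chi> u) \<in> carrier G" using t u by simp
  ultimately show ?thesis using a at by blast
qed

text \<open>A unipotent map: as \<open>\<chi>\<close> vanishes on \<open>z\<close>, the map
  preserves \<open>\<chi>\<close>, and its inverse is the same map with \<open>z\<close>
  inverted.\<close>

lemma shear_iso:
  assumes \<chi>: "add_hom G (\<chi> :: 'a \<Rightarrow> int)" "\<And>n. n \<in> N \<Longrightarrow> \<chi> n = 0" and z: "z \<in> carrier G" "\<chi> z = 0"
  shows "\<exists>\<mu>\<in>iso Q Q. \<forall>g\<in>carrier G. \<mu> (N #> g) = N #> (g \<otimes> z [^] \<chi> g)"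
proof -
  interpret Q: comm_group Q by (rule comm_group_Q)
  note \<chi>m = add_hom_mult[OF \<chi>(1)] and \<chi>p = add_hom_int_pow[OF \<chi>(1)] and \<chi>i = add_hom_inv[OF \<chi>(1)]
  have \<chi>_coset: "\<chi> g = \<chi> h" if "g \<in> carrier G" "h \<in> carrier G" "N #> g = N #> h" for g h
    using that \<chi>(2)[of "g \<otimes> inv h"] by (simp add: coset_eq_iff \<chi>m \<chi>i)
  define \<mu> where "\<mu> q = q \<otimes>\<^bsub>Q\<^esub> (N #> z) [^]\<^bsub>Q\<^esub> \<chi> (SOME g. g \<in> carrier G \<and> q = N #> g)" for q
  have \<mu>: "\<mu> (N #> g) = N #> (g \<otimes> z [^] \<chi> g)" if g: "g \<in> carrier G" for g
  proof -
    let ?g = "SOME h. h \<in> carrier G \<and> N #> g = N #> h"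
    have "?g \<in> carrier G \<and> N #> g = N #> ?g" by (rule someI[of _ g]) (use g in simp)
    then have "\<chi> ?g = \<chi> g" using \<chi>_coset[of ?g g] g by simp
    then show ?thesis using g z by (simp add: \<mu>_def FactGroup_int_pow coset_mult)
  qed
  have mem: "g \<otimes> z [^] \<chi> g \<in> carrier G" if "g \<in> carrier G" for g using that z by simp
  have "\<mu> \<in> hom Q Q"
  proof (rule homI)
    fix p q assume "p \<in> carrier Q" "q \<in> carrier Q"
    then obtain g h where gh: "g \<in> carrier G" "p = N #> g" "h \<in> carrier G" "q = N #> h"
      by (auto simp: carrier_FactGroup)
    have cl: "N #> g \<in> carrier Q" "N #> h \<in> carrier Q" "N #> z \<in> carrier Q" "N #> (z [^] \<chi> g) \<in> carrier Q"
      "N #> (z [^] \<chi> h) \<in> carrier Q" using gh z by (auto intro!: coset_closed)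
    show "\<mu> p \<in> carrier Q" using gh \<mu> mem coset_closed by simp
    have "\<mu> (p \<otimes>\<^bsub>Q\<^esub> q) = N #> (g \<otimes> h \<otimes> (z [^] \<chi> g \<otimes> z [^] \<chi> h))"
      using gh z \<mu>[of "g \<otimes> h"] by (simp add: coset_mult \<chi>m int_pow_mult)
    also have "\<dots> = \<mu> p \<otimes>\<^bsub>Q\<^esub> \<mu> q"
      using gh z cl by (simp add: \<mu> coset_mult[symmetric] Q.m_ac)
    finally show "\<mu> (p \<otimes>\<^bsub>Q\<^esub> q) = \<mu> p \<otimes>\<^bsub>Q\<^esub> \<mu> q" .
  qed
  moreover have "inj_on \<mu> (carrier Q)"
  proof (rule inj_onI)
    fix p q assume "p \<in> carrier Q" "q \<in> carrier Q" and eq: "\<mu> p = \<mu> q"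
    then obtain g h where gh: "g \<in> carrier G" "p = N #> g" "h \<in> carrier G" "q = N #> h"
      by (auto simp: carrier_FactGroup)
    have e: "N #> (g \<otimes> z [^] \<chi> g) = N #> (h \<otimes> z [^] \<chi> h)" using eq gh \<mu> by simp
    have "\<chi> (g \<otimes> z [^] \<chi> g) = \<chi> (h \<otimes> z [^] \<chi> h)"
      by (rule \<chi>_coset[OF mem[OF gh(1)] mem[OF gh(3)] e])
    then have "\<chi> g = \<chi> h" using gh z by (simp add: \<chi>m \<chi>p)
    then have "(N #> g) \<otimes>\<^bsub>Q\<^esub> (N #> (z [^] \<chi> g)) = (N #> h) \<otimes>\<^bsub>Q\<^esub> (N #> (z [^] \<chi> g))"
      using e gh z by (simp add: coset_mult)
    moreover have "N #> g \<in> carrier Q" "N #> h \<in> carrier Q" "N #> (z [^] \<chi> g) \<in> carrier Q"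
      using gh z by (auto intro!: coset_closed)
    ultimately show "p = q" using gh Q.r_cancel by metis
  qed
  moreover have "\<mu> ` carrier Q = carrier Q"
  proof (intro subset_antisym subsetI)
    fix q assume "q \<in> carrier Q"
    then obtain h where h: "h \<in> carrier G" "q = N #> h" by (auto simp: carrier_FactGroup)
    define g where "g = h \<otimes> z [^] (- \<chi> h)"
    have g: "g \<in> carrier G" "\<chi> g = \<chi> h" using h z by (auto simp: g_def \<chi>m \<chi>p)
    have "g \<otimes> z [^] \<chi> g = h" unfolding g(2) using h z by (simp add: g_def m_assoc int_pow_neg)
    then have "\<mu> (N #> g) = q" using \<mu>[OF g(1)] h by simp
    then show "q \<in> \<mu> ` carrier Q" using coset_closed[OF g(1)] by blast
  qed (use \<open>\<mu> \<in> hom Q Q\<close> in \<open>auto dest: hom_in_carrier\<close>)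
  ultimately have "\<mu> \<in> iso Q Q" by (simp add: iso_def bij_betw_def)
  then show ?thesis using \<mu> by blast
qed

text \<open>By the rank, \<open>t\<close>, \<open>s\<close> and \<open>n\<close> satisfy a
  nontrivial relation modulo \<open>N\<close>; the two characters show that the exponents of
  \<open>t\<close> and \<open>s\<close> in it are 0.\<close>

lemma torsion_modulo:
  assumes rk: "co_rank G N = 2" and N0: "\<And>n. n \<in> N \<Longrightarrow> \<chi> n = 0 \<and> a n = 0"
    and \<chi>: "add_hom G (\<chi> :: 'a \<Rightarrow> int)" and a: "add_hom G (a :: 'a \<Rightarrow> int)"
    and t: "t \<in> carrier G" "\<chi> t = 1" "a t = 0" and s: "s \<in> carrier G" "\<chi> s = 0" "a s = 1"
    and n: "n \<in> carrier G" "\<chi> n = 0" "a n = 0"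
  shows "\<exists>k::nat. k > 0 \<and> n [^] k \<in> N"
proof -
  obtain i j k :: int where ijk: "t [^] i \<otimes> s [^] j \<otimes> n [^] k \<in> N" "(i, j, k) \<noteq> (0, 0, 0)"
    using rank_le_2[OF rk t(1) s(1) n(1)] by blast
  have "i = 0" "j = 0"
    using N0[OF ijk(1)] t s n
    by (simp_all add: add_hom_mult[OF \<chi>] add_hom_mult[OF a] add_hom_int_pow[OF \<chi>] add_hom_int_pow[OF a])
  then have k: "k \<noteq> 0" "n [^] k \<in> N" using ijk t s n by auto
  show ?thesis
  proof (cases "k > 0")
    case True
    then show ?thesis using k n int_pow_int[of G n "nat k"] by (intro exI[of _ "nat k"]) auto
  next
    case False
    have "inv (n [^] k) \<in> N" using k(2) by simp
    then have "n [^] (- k) \<in> N" using n by (simp add: int_pow_neg)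
    then show ?thesis using False k(1) int_pow_int[of G n "nat (- k)"] by (intro exI[of _ "nat (- k)"]) auto
  qed
qed

text \<open>As \<open>K\<close> is finitely generated, the common kernel of \<open>\<chi>\<close>
  and a complementary character is generated by the conjugates of finitely many elements under
  powers of \<open>s\<close>, so its twisted fibre product is finitely presented. The
  \<open>N\<close>-fibre product is the kernel of a homomorphism from this group with finite
  image.\<close>

lemma split_imp_fibre_product:
  assumes fp: "finitely_presented G" and fg: "finite S" "S \<subseteq> carrier G" "generate G S = carrier G"
    and rk: "co_rank G N = 2" and t: "t \<in> carrier G" "infinite (generate G {t})"
    and sd: "internal_semidirect G (generate G {t}) K" and K: "finitely_generated (G\<lparr>carrier := K\<rparr>)" "N \<subseteq> K"
  shows "\<exists>\<mu>\<in>iso Q Q. finitely_presented ((G \<times>\<times> G)\<lparr>carrier := fibre_product G N \<mu>\<rparr>)"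
proof -
  interpret Q: comm_group Q by (rule comm_group_Q)
  interpret GG: group "G \<times>\<times> G" by (rule DirProd_group[OF is_group is_group])
  obtain \<chi> :: "'a \<Rightarrow> int" where \<chi>: "add_hom G \<chi>" "\<chi> t = 1" and K_eq: "K = {y \<in> carrier G. \<chi> y = 0}"
    using semidirect_int_character[OF t sd] by blast
  have \<chi>N: "\<chi> n = 0" if "n \<in> N" for n using that K(2) K_eq by auto
  obtain a :: "'a \<Rightarrow> int" and s where a: "add_hom G a" "\<And>n. n \<in> N \<Longrightarrow> a n = 0" "a t = 0"
    and s: "s \<in> carrier G" "\<chi> s = 0" "a s = 1"
    using complementary_int_character[OF fg rk \<chi>(1) \<chi>N t(1) \<chi>(2)] by metis
  note \<chi>m = add_hom_mult[OF \<chi>(1)] and \<chi>p = add_hom_int_pow[OF \<chi>(1)] and \<chi>i = add_hom_inv[OF \<chi>(1)]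
    and am = add_hom_mult[OF a(1)] and ap = add_hom_int_pow[OF a(1)] and ai = add_hom_inv[OF a(1)]
    and \<chi>1 = add_hom_one[OF \<chi>(1)] and a1 = add_hom_one[OF a(1)]
  have subK: "subgroup K G" using sd normal_imp_subgroup by (auto simp: internal_semidirect_def)
  obtain F where F: "finite F" "F \<subseteq> K" "generate (G\<lparr>carrier := K\<rparr>) F = K"
    using K(1) by (auto simp: finitely_generated_def)
  have genF: "generate G F = K" using generate_consistent[OF F(2) subK] F(3) by simp
  obtain r and k :: "nat \<Rightarrow> 'a" where k: "F = k ` {..<r}"
    using finite_imp_nat_seg_image_inj_on[OF F(1)] by (auto simp: lessThan_def)
  \<comment> \<open>Powers of \<open>s\<close> bring the generators of \<open>K\<close> into the
    kernel of \<open>a\<close>.\<close>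
  define x where "x j = (if j < r then k j \<otimes> s [^] (- a (k j)) else \<one>)" for j
  have kj: "k j \<in> carrier G" "\<chi> (k j) = 0" if "j < r" for j
  proof -
    have "k j \<in> K" using that F(2) k by blast
    then show "k j \<in> carrier G" "\<chi> (k j) = 0" by (auto simp: K_eq)
  qed
  have x: "x j \<in> carrier G" "\<chi> (x j) = 0" "a (x j) = 0" for j
    using s kj by (auto simp: x_def \<chi>m \<chi>p am ap \<chi>1 a1)
  let ?M = "slab s x {..<r} UNIV" and ?N0 = "{g \<in> carrier G. \<chi> g = 0 \<and> a g = 0}"
  interpret M: subgroup ?M G using s x by (intro slab_subgroup)
  have shift: "conj_by (s [^] (i::int)) z \<in> ?M" if "z \<in> ?M" for i z
    using s x by (intro slab_shift[OF _ _ that]) auto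
  \<comment> \<open>This subgroup contains \<open>F\<close> and therefore \<open>K\<close>, so every
    element of \<open>K\<close> is an element of \<open>?M\<close> times a power of
    \<open>s\<close>. On the kernel of \<open>a\<close> that power is trivial, which gives
    \<open>N0M\<close>.\<close>
  have "subgroup {g \<in> carrier G. g \<otimes> s [^] (- a g) \<in> ?M} G"
  proof (rule subgroupI)
    have "\<one> \<in> {g \<in> carrier G. g \<otimes> s [^] (- a g) \<in> ?M}" using M.one_closed by (simp add: a1)
    then show "{g \<in> carrier G. g \<otimes> s [^] (- a g) \<in> ?M} \<noteq> {}" by blast
    fix g assume "g \<in> {g \<in> carrier G. g \<otimes> s [^] (- a g) \<in> ?M}"
    then have g: "g \<in> carrier G" "g \<otimes> s [^] (- a g) \<in> ?M" by auto
    have "conj_by (s [^] (- a g)) (inv (g \<otimes> s [^] (- a g))) \<in> ?M"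
      using M.m_inv_closed[OF g(2)] by (rule shift)
    also have "conj_by (s [^] (- a g)) (inv (g \<otimes> s [^] (- a g))) = inv g \<otimes> s [^] (a g)"
      using g s by (simp add: conj_by_def inv_mult_group int_pow_neg m_assoc) (simp add: m_assoc[symmetric])
    finally show "inv g \<in> {g \<in> carrier G. g \<otimes> s [^] (- a g) \<in> ?M}" using g by (simp add: ai)
    fix h assume "h \<in> {g \<in> carrier G. g \<otimes> s [^] (- a g) \<in> ?M}"
    then have h: "h \<in> carrier G" "h \<otimes> s [^] (- a h) \<in> ?M" by auto
    have "(g \<otimes> s [^] (- a g)) \<otimes> conj_by (s [^] a g) (h \<otimes> s [^] (- a h)) \<in> ?M"
      by (rule M.m_closed[OF g(2) shift[OF h(2)]])
    also have "(g \<otimes> s [^] (- a g)) \<otimes> conj_by (s [^] a g) (h \<otimes> s [^] (- a h)) =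
        g \<otimes> h \<otimes> (s [^] (- a h) \<otimes> s [^] (- a g))"
      using g(1) h(1) s by (simp add: conj_by_def int_pow_neg m_assoc) (simp add: m_assoc[symmetric])
    also have "s [^] (- a h) \<otimes> s [^] (- a g) = s [^] (- a (g \<otimes> h))"
      using g(1) h(1) s int_pow_mult[of s "- a h" "- a g"] by (simp add: am algebra_simps)
    finally show "g \<otimes> h \<in> {g \<in> carrier G. g \<otimes> s [^] (- a g) \<in> ?M}" using g h by simp
  qed auto
  moreover have "F \<subseteq> {g \<in> carrier G. g \<otimes> s [^] (- a g) \<in> ?M}"
  proof
    fix g assume "g \<in> F"
    then obtain j where j: "j < r" "g = k j" using k by auto
    then have "g \<otimes> s [^] (- a g) = conj_by (s [^] (0::int)) (x j)" using x(1)[of j] s by (simp add: x_def)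
    also have "\<dots> \<in> ?M" using s x j by (intro slab_incl) auto
    finally show "g \<in> {g \<in> carrier G. g \<otimes> s [^] (- a g) \<in> ?M}" using kj j by simp
  qed
  ultimately have "K \<subseteq> {g \<in> carrier G. g \<otimes> s [^] (- a g) \<in> ?M}"
    using generate_subgroup_incl genF by metis
  then have N0M: "?N0 \<subseteq> ?M" by (force simp: K_eq)
  let ?U = "generate G ({t, s} \<union> x ` {..<r})"
  have Uc: "{t, s} \<union> x ` {..<r} \<subseteq> carrier G" using t s x by auto
  interpret U: subgroup ?U G by (rule generate_is_subgroup[OF Uc])
  have tU: "t \<in> ?U" "s \<in> ?U" "\<And>j. j < r \<Longrightarrow> x j \<in> ?U" by (auto intro: generate.incl)
  have powU: "y [^] (i::int) \<in> ?U" if "y \<in> ?U" for y i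
    using subgroup_int_pow_closed[OF U.is_subgroup that] .
  have "F \<subseteq> ?U"
  proof
    fix g assume "g \<in> F"
    then obtain j where j: "j < r" "g = k j" using k by auto
    have "g = x j \<otimes> s [^] a g" using j kj[OF j(1)] s by (simp add: x_def m_assoc int_pow_neg)
    then show "g \<in> ?U" using U.m_closed[OF tU(3)[OF j(1)] powU[OF tU(2)]] by metis
  qed
  then have KU: "K \<subseteq> ?U" using generate_subgroup_incl[OF _ U.is_subgroup] genF by metis
  have gen: "?U = carrier G"
  proof (intro subset_antisym subsetI)
    fix g assume g: "g \<in> carrier G"
    have "g \<otimes> t [^] (- \<chi> g) \<in> K" using g t \<chi>(2) by (simp add: K_eq \<chi>m \<chi>p)
    then have "(g \<otimes> t [^] (- \<chi> g)) \<otimes> t [^] \<chi> g \<in> ?U" using KU U.m_closed[OF _ powU[OF tU(1)]] by blast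
    then show "g \<in> ?U" using g t by (simp add: m_assoc int_pow_neg)
  qed (use U.subset in blast)
  have x_triv: "x j = \<one>" if "j \<ge> r" for j using that by (simp add: x_def)
  obtain m :: int where m: "finitely_presented ((G \<times>\<times> G)\<lparr>carrier :=
      {(g1, g2). g1 \<in> carrier G \<and> g2 \<in> carrier G \<and> \<chi> g1 = \<chi> g2 \<and> a g2 = a g1 + m * \<chi> g1}\<rparr>)"
    using twisted_fibre_product_finitely_presented[OF fp t(1) s(1) x(1) x_triv \<chi> s(2) x(2) a(1,3) s(3) x(3) gen N0M]
    by blast
  let ?H = "{(g1, g2). g1 \<in> carrier G \<and> g2 \<in> carrier G \<and> \<chi> g1 = \<chi> g2 \<and> a g2 = a g1 + m * \<chi> g1}"
  let ?HG = "(G \<times>\<times> G)\<lparr>carrier := ?H\<rparr>"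
  have sm: "s [^] m \<in> carrier G" "\<chi> (s [^] m) = 0" using s by (auto simp: \<chi>p)
  \<comment> \<open>The automorphism belonging to the twist: a coset is multiplied by the
    \<open>m\<close>-th power of \<open>s\<close> as often as \<open>\<chi>\<close> counts
    \<open>t\<close> in it.\<close>
  obtain \<mu> where \<mu>: "\<mu> \<in> iso Q Q" "\<And>g. g \<in> carrier G \<Longrightarrow> \<mu> (N #> g) = N #> (g \<otimes> (s [^] m) [^] \<chi> g)"
    using shear_iso[OF \<chi>(1) \<chi>N sm] by metis
  define \<phi> where "\<phi> = (\<lambda>(g1, g2). \<mu> (N #> g1) \<otimes>\<^bsub>Q\<^esub> inv\<^bsub>Q\<^esub> (N #> g2))"
  interpret \<phi>: group_hom "G \<times>\<times> G" Q \<phi> unfolding \<phi>_def by (rule fibre_product_kernel(1)[OF \<mu>(1)])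
  \<comment> \<open>A representative in \<open>G\<close> of the value of \<open>\<phi>\<close>. For
    pairs in \<open>?H\<close> both characters vanish on it, so it lies in
    \<open>?M\<close>.\<close>
  define d where "d = (\<lambda>(g1, g2). g1 \<otimes> (s [^] m) [^] \<chi> g1 \<otimes> inv g2)"
  have \<phi>d: "\<phi> (g1, g2) = N #> d (g1, g2)" "d (g1, g2) \<in> carrier G" if "g1 \<in> carrier G" "g2 \<in> carrier G" for g1 g2
    using that sm \<mu>(2) coset_hom group_hom.hom_inv[OF coset_hom, of g2] by (simp_all add: \<phi>_def d_def coset_mult[symmetric])
  have d_char: "\<chi> (d (g1, g2)) = \<chi> g1 - \<chi> g2" "a (d (g1, g2)) = a g1 + m * \<chi> g1 - a g2"
    if "g1 \<in> carrier G" "g2 \<in> carrier G" for g1 g2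
    using that s by (simp_all add: d_def \<chi>m \<chi>p \<chi>i am ap ai int_pow_pow)
  have sub: "fibre_product G N \<mu> \<subseteq> ?H"
  proof
    fix p assume p: "p \<in> fibre_product G N \<mu>"
    then obtain g1 g2 where g: "p = (g1, g2)" "g1 \<in> carrier G" "g2 \<in> carrier G" by (auto simp: fibre_product_def)
    have "\<phi> p = \<one>\<^bsub>Q\<^esub>"
      using p fibre_product_kernel(2)[OF \<mu>(1)] by (simp add: kernel_def \<phi>_def)
    then have "d p \<in> N" using \<phi>d[of g1 g2] coset_one_iff[of "d p"] g by simp
    then have "\<chi> (d p) = 0" "a (d p) = 0" using \<chi>N a by auto
    then show "p \<in> ?H" using g d_char by simp
  qed
  have "subgroup ?H (G \<times>\<times> G)"
  proof (rule GG.subgroupI)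
    show "?H \<noteq> {}" using \<chi>1 a1 by (auto intro!: exI[of _ \<one>])
    show "inv\<^bsub>G \<times>\<times> G\<^esub> h \<in> ?H" if "h \<in> ?H" for h using that is_group by (auto simp: \<chi>i ai)
    show "h \<otimes>\<^bsub>G \<times>\<times> G\<^esub> l \<in> ?H" if "h \<in> ?H" "l \<in> ?H" for h l
      using that by (auto simp: \<chi>m am algebra_simps)
  qed auto
  then have "group ?HG" by (rule GG.subgroup_imp_group)
  then have \<phi>H: "group_hom ?HG Q \<phi>"
    using \<phi>.homh by (intro group_hom.intro group_hom_axioms.intro Q.is_group) (auto simp: hom_def)
  have ker: "kernel ?HG Q \<phi> = fibre_product G N \<mu>"
    using sub fibre_product_kernel(2)[OF \<mu>(1)] unfolding \<phi>_def[symmetric] by (auto simp: kernel_def)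
  \<comment> \<open>Modulo \<open>N\<close> conjugates coincide, so the cosets of the finitely many
    \<open>x j\<close> already generate the image of \<open>?M\<close> in \<open>Q\<close>. They are
    torsion because of the rank, hence \<open>?T\<close> is finite.\<close>
  let ?T = "generate Q ((\<lambda>j. N #> x j) ` {..<r})"
  have "finite ?T"
  proof (rule Q.finite_generate_torsion)
    fix q assume "q \<in> (\<lambda>j. N #> x j) ` {..<r}"
    then obtain j where j: "q = N #> x j" by auto
    obtain l :: nat where l: "l > 0" "x j [^] l \<in> N"
      using torsion_modulo[OF rk _ \<chi>(1) a(1) t(1) \<chi>(2) a(3) s x[of j]] \<chi>N a(2) by blast
    have "q [^]\<^bsub>Q\<^esub> l = N #> (x j [^] l)" using group_hom.hom_nat_pow[OF coset_hom x(1)] j by simp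
    then have "q [^]\<^bsub>Q\<^esub> l = \<one>\<^bsub>Q\<^esub>" using coset_one_iff[of "x j [^] l"] l x by simp
    then show "\<exists>n::nat. n > 0 \<and> q [^]\<^bsub>Q\<^esub> n = \<one>\<^bsub>Q\<^esub>" using l by blast
  qed (use x coset_closed in auto)
  moreover have "\<phi> ` carrier ?HG \<subseteq> ?T"
  proof
    fix q assume "q \<in> \<phi> ` carrier ?HG"
    then obtain g1 g2 where g: "q = \<phi> (g1, g2)" "g1 \<in> carrier G" "g2 \<in> carrier G"
      "\<chi> g1 = \<chi> g2" "a g2 = a g1 + m * \<chi> g1" by auto
    have "d (g1, g2) \<in> ?M" using g \<phi>d d_char N0M by auto
    then have "N #> d (g1, g2) \<in> (\<lambda>g. N #> g) ` ?M" by blast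
    also have "(\<lambda>g. N #> g) ` ?M = generate Q ((\<lambda>g. N #> g) ` {conj_by (s [^] i) (x j) | i j. i \<in> (UNIV :: int set) \<and> j \<in> {..<r}})"
      unfolding slab_def by (rule group_hom.generate_img[OF coset_hom slab_generators, symmetric]) (use s x in auto)
    also have "\<dots> \<subseteq> ?T"
    proof (rule Q.mono_generate, rule image_subsetI)
      fix g assume "g \<in> {conj_by (s [^] i) (x j) | i j. i \<in> (UNIV :: int set) \<and> j \<in> {..<r}}"
      then obtain i :: int and j where "g = conj_by (s [^] i) (x j)" "j < r" by auto
      then show "N #> g \<in> (\<lambda>j. N #> x j) ` {..<r}" using s x by (auto simp: coset_conj_by)
    qed
    finally show "q \<in> ?T" using g \<phi>d by simp
  qed
  ultimately have "finite (\<phi> ` carrier ?HG)" by (rule finite_subset[rotated])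
  then have "finitely_presented (?HG\<lparr>carrier := kernel ?HG Q \<phi>\<rparr>)"
    by (rule finitely_presented_finite_index_kernel[OF m \<phi>H])
  then show ?thesis using \<mu>(1) unfolding ker by auto
qed

end

lemma (in group) coabelianI:
  assumes "subgroup N G" "derived G (carrier G) \<subseteq> N"
  shows "coabelian N G"
proof -
  have comm: "x \<otimes> y \<otimes> inv x \<otimes> inv y \<in> N" if "x \<in> carrier G" "y \<in> carrier G" for x y
    using assms(2) that generate.incl[of "x \<otimes> y \<otimes> inv x \<otimes> inv y" "derived_set G (carrier G)" G]
    by (auto simp: derived_def)
  interpret N: subgroup N G by fact
  have "x \<otimes> n \<otimes> inv x \<in> N" if "x \<in> carrier G" "n \<in> N" for x n
  proof -
    have "x \<otimes> n \<otimes> inv x = (x \<otimes> n \<otimes> inv x \<otimes> inv n) \<otimes> n" using that by (simp add: m_assoc)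
    then show ?thesis using comm[of x n] that by (metis N.m_closed N.mem_carrier)
  qed
  then have "N \<lhd> G" using assms(1) by (simp add: normal_inv_iff)
  then show ?thesis using comm by (intro coabelian.intro coabelian_axioms.intro)
qed

theorem theorem5p1:
  fixes G :: "('a, 'b) monoid_scheme" and N :: "'a set"
  assumes "group G"
    and "finitely_presented G"
    and "subgroup N G"
    and "derived G (carrier G) \<subseteq> N"
    and "co_rank G N = 2"
  shows "(\<exists>H. is_fibre_product G N H \<and> H \<lhd> (G \<times>\<times> G)
             \<and> finitely_presented ((G \<times>\<times> G)\<lparr>carrier := H\<rparr>))
     \<longleftrightarrow> (\<exists>t K. t \<in> carrier G \<and> infinite (generate G {t})
             \<and> internal_semidirect G (generate G {t}) K
             \<and> finitely_generated (G\<lparr>carrier := K\<rparr>) \<and> N \<subseteq> K)"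
proof -
  interpret coabelian N G using assms by (intro group.coabelianI)
  obtain n g R where "presents G {..<n::nat} g R" using finitely_presented_imp_presents[OF assms(2)] by blast
  then have fg: "finite (g ` {..<n})" "g ` {..<n} \<subseteq> carrier G" "generate G (g ` {..<n}) = carrier G"
    by (auto simp: presents_def)
  show ?thesis
  proof
    assume "\<exists>H. is_fibre_product G N H \<and> H \<lhd> (G \<times>\<times> G) \<and> finitely_presented ((G \<times>\<times> G)\<lparr>carrier := H\<rparr>)"
    then obtain \<mu> where "\<mu> \<in> iso Q Q" "finitely_presented ((G \<times>\<times> G)\<lparr>carrier := fibre_product G N \<mu>\<rparr>)"
      by (auto simp: is_fibre_product_def)
    then show "\<exists>t K. t \<in> carrier G \<and> infinite (generate G {t}) \<and> internal_semidirect G (generate G {t}) K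
        \<and> finitely_generated (G\<lparr>carrier := K\<rparr>) \<and> N \<subseteq> K"
      using fibre_product_imp_splits[OF fg assms(5)] by (simp add: splits_over_cyclic_def)
  next
    assume "\<exists>t K. t \<in> carrier G \<and> infinite (generate G {t}) \<and> internal_semidirect G (generate G {t}) K
        \<and> finitely_generated (G\<lparr>carrier := K\<rparr>) \<and> N \<subseteq> K"
    then obtain \<mu> where "\<mu> \<in> iso Q Q" "finitely_presented ((G \<times>\<times> G)\<lparr>carrier := fibre_product G N \<mu>\<rparr>)"
      using split_imp_fibre_product[OF assms(2) fg assms(5)] by blast
    then show "\<exists>H. is_fibre_product G N H \<and> H \<lhd> (G \<times>\<times> G) \<and> finitely_presented ((G \<times>\<times> G)\<lparr>carrier := H\<rparr>)"
      using fibre_product_normal by (auto simp: is_fibre_product_def)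
  qed
qed

end
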